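(* Let $m,n\geq 1$ be fixed integers. There is a polynomial time algorithm which, given an integer $a\ge 1$, polynomial data $\varphi=(\varphi_1,\dots,\varphi_n)$ with $\varphi_j\in\mathbb{Q}[x_1,\dots,x_m]$ and $f=(f_1,\dots,f_n)$ with $f_j\in\mathbb{Q}[t,x_1,\dots,x_m]$, and symmetric matrices $A,B_1,\dots,B_m\in M_n(\mathbb{A})$ with $A$ positive definite and $\mu^{(i)}_{\min}<0<\mu^{(i)}_{\max}$ for all $i=1,\dots,m$, computes a space grid step $h=1/2^N$ and a time grid step $\tau$ (dividing a rational $T>0$ with $H\subseteq[0,T]\times Q$) such that the grid function $v$ on $G_N^\tau$ produced by the Godunov difference scheme on the corresponding grid satisfies $$\|\mathbf{u}-\widetilde{v|_H}\|_{sL_2}<\frac1a,$$ where $\mathbf{u}$ is the solution on $H$ of the Cauchy problem $$A\frac{\partial \mathbf{u}}{\partial t}+\sum_{i=1}^m B_i\frac{\partial \mathbf{u}}{\partial x_i}=f(t,x_1,\dots,x_m),\ t\ge 0,\qquad \mathbf{u}|_{t=0}=\varphi(x_1,\dots,x_m).$$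
   Context: **Encodings.** $\mathbb{A}$ is the field of real algebraic numbers and $M_n(\mathbb{A})$ the $n\times n$ matrices over it. Integers are coded in binary (with a sign bit); a rational $p/q$ in lowest terms, $q\ge1$, by the codes of $p$ and $q$; a polynomial in one variable by the list of codes of all its coefficients; polynomials in several variables by iterating this. A nonzero $\alpha\in\mathbb{A}$ is coded by the pair $(p_\alpha,k)$, where $p_\alpha\in\mathbb{Q}[x]$ is the monic minimal polynomial of $\alpha$ over $\mathbb{Q}$ and $\alpha$ is the $k$-th element in the increasing list of the real roots of $p_\alpha$. Matrices are coded by the list of codes of their entries. "Polynomial time" means: on a Turing machine, in time polynomial in the length of the input code. **Domain.** $Q=[0,1]^m$; $\mu^{(i)}_{\min},\mu^{(i)}_{\max}$ are the minimal and maximal eigenvalues of $A^{-1}B_i$; the domain of existence and uniqueness of the Cauchy problem is $$H=\{(t,x)\in\mathbb{R}^{m+1}: t\ge 0,\ x_i-\mu^{(i)}_{\max}t\ge 0,\ x_i-1-\mu^{(i)}_{\min}t\le 0\ (i=1,\dots,m)\}.$$ **Grids, interpolation, norm.** For $h=1/2^N$, $G_N$ is the set of points $\left(\frac{i_1-1/2}{2^N},\dots,\frac{i_m-1/2}{2^N}\right)$, $1\le i_1,\dots,i_m\le 2^N$. For a time step $\tau$ with $L=T/\tau$ an integer, $G_N^\tau=G_N\times\{l\tau\}_{l=1}^L$. For a vector-valued grid function $v$ on $G_N^\tau$, $\tilde v$ is its multilinear interpolation (linear in each coordinate on every grid cell, equal to $v$ at grid points; at points whose coordinates lie outside the range of the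 grid, each such coordinate is replaced by the nearest one in the range); $\widetilde{v|_H}$ denotes this interpolation considered on $H$. For $\mathbf{w}$ on $H$, $\|\mathbf{w}\|_{sL_2}=\sup_t\big(\int_{\{x\in Q:(t,x)\in H\}}|\mathbf{w}(t,x)|^2dx\big)^{1/2}$, the supremum being over all $t$ for which the slice is nonempty. **Matrices used in the scheme.** Let $\lambda_1\le\dots\le\lambda_n$ be the eigenvalues of $A$ and $L_A$ the matrix whose columns form a corresponding orthonormal basis of eigenvectors; $D=\mathrm{diag}(\lambda_1^{-1/2},\dots,\lambda_n^{-1/2})$. For each $i$ let $\mu^{(i)}_1\le\dots\le\mu^{(i)}_n$ be the eigenvalues of the symmetric matrix $D^*L_A^*B_iL_AD$ (equivalently, of $A^{-1}B_i$), $K_i$ the matrix whose columns form a corresponding orthonormal eigenbasis, and $T_i=L_ADK_i$. **Godunov scheme.** Identify each $P\in G_N$ with the center of a grid cell of side $h$; $e_i$ is the $i$-th coordinate vector. At time level $0$ set $\mathbf{u}^{(0)}_P=\varphi(P)$. For $l=0,\dots,L-1$, from $\mathbf{u}^{(l)}$ compute $\mathbf{v}^{(i)}_P=T_i^{-1}\mathbf{u}^{(l)}_P$ for all $P\in G_N$, $i=1,\dots,m$. For each cell face orthogonal to the $i$-th axis, with center $F=P+\frac h2e_i$ between the cells centered at $P$ and $P+he_i$, define the vector $\mathcal{V}_F$ with components $$(\mathcal{V}_F)_k=(\mathbf{v}^{(i)}_{P})_k \text{ if } \mu^{(i)}_k\ge 0,\qquad (\mathcal{V}_F)_k=(\mathbf{v}^{(i)}_{P+he_i})_k\text{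 if }\mu^{(i)}_k<0,$$ where, for faces on the boundary of $Q$, the missing values outside $Q$ are taken by periodicity ($P$ with $i$-th coordinate $-h/2$ is replaced by that with $i$-th coordinate $1-h/2$, and $1+h/2$ by $h/2$). Put $\mathcal{U}_F=T_i\mathcal{V}_F$ and $$\mathbf{u}^{(l+1)}_P=\mathbf{u}^{(l)}_P-\frac{\tau}{h}A^{-1}\sum_{i=1}^mB_i\big(\mathcal{U}_{P+\frac h2e_i}-\mathcal{U}_{P-\frac h2e_i}\big)+\tau A^{-1}f(l\tau,P).$$ The resulting grid function is $v(l\tau,P)=\mathbf{u}^{(l)}_P$, $l=1,\dots,L$, $P\in G_N$. *)

theory Defs
  imports
    "HOL-Analysis.Analysis"
    "HOL-Computational_Algebra.Polynomial"
    "HOL-Library.Poly_Mapping"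
begin

text \<open>
  The fixed dimensions \<open>m\<close> and \<open>n\<close> are the cardinalities of the index types \<open>'m\<close> and \<open>'n\<close>; their
  linear orders say in which order coordinates are listed in codes and eigenvalues are numbered.
  A point \<open>(t, x)\<close> of space-time is an element of \<^typ>\<open>real \<times> (real ^ 'm)\<close>.
  The synonym below is \<open>real ^ 'n ^ 'n\<close>, but leaves the sort of \<open>'n\<close> open.
\<close>

type_synonym 'n sqmat = "((real, 'n) vec, 'n) vec"


section \<open>Turing machines and polynomial time\<close>

datatype letter = Digit0 | Digit1 | LBrack | RBrack | Sep

datatype direction = Go_Left | Stay | Go_Right

text \<open>
  A deterministic multi-tape machine: states are the numbers below \<open>num_states\<close> (\<open>0\<close> is initial), tape
  symbols the numbers below \<open>num_symbols\<close> (\<open>0\<close> is the blank). The machine halts when \<open>delta\<close>, applied to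
  the state and the list of scanned symbols, is \<^const>\<open>None\<close>. Only the finitely many values of \<open>delta\<close>
  constrained in \<open>turing_machine\<close> below are ever used in a run.
\<close>

record tm =
  num_tapes :: nat
  num_states :: nat
  num_symbols :: nat
  delta :: "nat \<Rightarrow> nat list \<Rightarrow> (nat \<times> (nat \<times> direction) list) option"

definition turing_machine :: "tm \<Rightarrow> bool" where
  "turing_machine M \<longleftrightarrow>
     num_tapes M \<ge> 1 \<and> num_states M \<ge> 1 \<and> num_symbols M \<ge> 6 \<and>
     (\<forall>q ss q' acts.
        q < num_states M \<longrightarrow> length ss = num_tapes M \<longrightarrow> set ss \<subseteq> {..<num_symbols M} \<longrightarrow>
        delta M q ss = Some (q', acts) \<longrightarrow>
          q' < num_states M \<and> length acts = num_tapes M \<and> fst ` set acts \<subseteq> {..<num_symbols M})"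

text \<open>A tape together with its head position, and a configuration (state and tapes).\<close>

type_synonym tape = "(int \<Rightarrow> nat) \<times> int"
type_synonym config = "nat \<times> tape list"

fun shift :: "direction \<Rightarrow> int" where
  "shift Go_Left = -1"
| "shift Stay = 0"
| "shift Go_Right = 1"

fun act :: "nat \<times> direction \<Rightarrow> tape \<Rightarrow> tape" where
  "act (s, d) (c, p) = (c(p := s), p + shift d)"

definition scanned :: "tape list \<Rightarrow> nat list" where
  "scanned ts = map (\<lambda>(c, p). c p) ts"

fun step :: "tm \<Rightarrow> config \<Rightarrow> config" where
  "step M (q, ts) =
     (case delta M q (scanned ts) of
        None \<Rightarrow> (q, ts)
      | Some (q', acts) \<Rightarrow> (q', map2 act acts ts))"

fun halted :: "tm \<Rightarrow> config \<Rightarrow> bool" where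
  "halted M (q, ts) \<longleftrightarrow> delta M q (scanned ts) = None"

fun letter_symbol :: "letter \<Rightarrow> nat" where
  "letter_symbol Digit0 = 1"
| "letter_symbol Digit1 = 2"
| "letter_symbol LBrack = 3"
| "letter_symbol RBrack = 4"
| "letter_symbol Sep = 5"

definition tape_of :: "letter list \<Rightarrow> int \<Rightarrow> nat" where
  "tape_of w = (\<lambda>i. if 0 \<le> i \<and> i < int (length w) then letter_symbol (w ! nat i) else 0)"

definition initial_config :: "tm \<Rightarrow> letter list \<Rightarrow> config" where
  "initial_config M w = (0, (tape_of w, 0) # replicate (num_tapes M - 1) (\<lambda>_. 0, 0))"

text \<open>The input is written on the first tape and the output on the last one.\<close>

definition computes_within :: "tm \<Rightarrow> nat \<Rightarrow> letter list \<Rightarrow> letter list \<Rightarrow> bool" where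
  "computes_within M b w w' \<longleftrightarrow>
     (\<exists>k\<le>b. let c = (step M ^^ k) (initial_config M w)
             in halted M c \<and> fst (last (snd c)) = tape_of w')"


section \<open>Codes\<close>

datatype code = Num int | Seq "code list"

text \<open>Binary digits, most significant first; the code of an integer starts with a sign bit.\<close>

fun bits :: "nat \<Rightarrow> letter list" where
  "bits k = (if k < 2 then [if k = 0 then Digit0 else Digit1]
             else bits (k div 2) @ [if even k then Digit0 else Digit1])"

declare bits.simps [simp del]

fun word :: "code \<Rightarrow> letter list" where
  "word (Num z) = (if z < 0 then Digit1 else Digit0) # bits (nat \<bar>z\<bar>)"
| "word (Seq cs) = LBrack # concat (map (\<lambda>c. word c @ [Sep]) cs) @ [RBrack]"

definition code_rat :: "rat \<Rightarrow> code" where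
  "code_rat r = (let (p, q) = quotient_of r in Seq [Num p, Num q])"

definition code_poly :: "rat poly \<Rightarrow> code" where
  "code_poly p = Seq (map code_rat (coeffs p))"

definition index_list :: "'a::{finite,linorder} list" where
  "index_list = sorted_list_of_set UNIV"


subsection \<open>Real algebraic numbers\<close>

definition min_poly :: "real \<Rightarrow> rat poly" where
  "min_poly \<alpha> = (THE p. lead_coeff p = 1 \<and> poly (map_poly of_rat p) \<alpha> = 0 \<and>
      (\<forall>q. q \<noteq> 0 \<longrightarrow> poly (map_poly of_rat q) \<alpha> = 0 \<longrightarrow> degree p \<le> degree q))"

definition root_index :: "real \<Rightarrow> nat" where
  "root_index \<alpha> = card {x. poly (map_poly of_rat (min_poly \<alpha>)) x = 0 \<and> x \<le> \<alpha>}"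

text \<open>Zero is coded by the same rule, with minimal polynomial \<open>x\<close>.\<close>

definition code_alg :: "real \<Rightarrow> code" where
  "code_alg \<alpha> = Seq [code_poly (min_poly \<alpha>), Num (int (root_index \<alpha>))]"

definition code_matrix :: "'n::{finite,linorder} sqmat \<Rightarrow> code" where
  "code_matrix A = Seq [code_alg (A $ i $ j). i \<leftarrow> index_list, j \<leftarrow> index_list]"

definition algebraic_matrix :: "real ^ 'n ^ 'n \<Rightarrow> bool" where
  "algebraic_matrix A \<longleftrightarrow> (\<forall>i j. algebraic (A $ i $ j))"


subsection \<open>Polynomials in several variables\<close>

text \<open>Rational polynomials in the variables \<open>'v\<close>, as finitely supported functions on monomials.\<close>

type_synonym 'v qpoly = "('v \<Rightarrow>\<^sub>0 nat) \<Rightarrow>\<^sub>0 rat"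

definition eval_qpoly :: "'v::finite qpoly \<Rightarrow> ('v \<Rightarrow> real) \<Rightarrow> real" where
  "eval_qpoly p x = (\<Sum>e\<in>Poly_Mapping.keys p.
     of_rat (Poly_Mapping.lookup p e) * (\<Prod>v\<in>UNIV. x v ^ Poly_Mapping.lookup e v))"

text \<open>
  If \<open>c\<close> gives the coefficients of a polynomial, \<open>coeff_in v k c\<close> gives those of the coefficient of
  \<open>v ^ k\<close>, a polynomial in the variables other than \<open>v\<close>. A polynomial in the variables \<open>v # vs\<close> is coded
  as a polynomial in \<open>v\<close>, i.e. by the list of the codes of its coefficients (up to the degree in \<open>v\<close>),
  which are polynomials in \<open>vs\<close>.
\<close>

definition coeff_in :: "'v \<Rightarrow> nat \<Rightarrow> (('v \<Rightarrow>\<^sub>0 nat) \<Rightarrow> rat) \<Rightarrow> ('v \<Rightarrow>\<^sub>0 nat) \<Rightarrow> rat" where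
  "coeff_in v k c = (\<lambda>e. if Poly_Mapping.lookup e v = 0 then c (Poly_Mapping.update v k e) else 0)"

fun code_coeffs :: "'v list \<Rightarrow> (('v \<Rightarrow>\<^sub>0 nat) \<Rightarrow> rat) \<Rightarrow> code" where
  "code_coeffs [] c = code_rat (c 0)"
| "code_coeffs (v # vs) c =
     Seq (map (\<lambda>k. code_coeffs vs (coeff_in v k c))
            [0..<(LEAST d. \<forall>k\<ge>d. coeff_in v k c = (\<lambda>_. 0))])"

definition code_qpoly :: "'v list \<Rightarrow> 'v qpoly \<Rightarrow> code" where
  "code_qpoly vs p = code_coeffs vs (Poly_Mapping.lookup p)"

text \<open>
  Polynomials in \<open>t, x\<^sub>1, \<dots>, x\<^sub>m\<close> have the variables \<^typ>\<open>'m option\<close>, where \<^const>\<open>None\<close> stands for \<open>t\<close>.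
\<close>

definition space_field :: "('n::finite \<Rightarrow> 'm::finite qpoly) \<Rightarrow> real ^ 'm \<Rightarrow> real ^ 'n" where
  "space_field \<phi> x = (\<chi> j. eval_qpoly (\<phi> j) (\<lambda>i. x $ i))"

definition spacetime_field ::
    "('n::finite \<Rightarrow> 'm::finite option qpoly) \<Rightarrow> real \<times> (real ^ 'm) \<Rightarrow> real ^ 'n" where
  "spacetime_field f = (\<lambda>(t, x). \<chi> j. eval_qpoly (f j) (case_option t (\<lambda>i. x $ i)))"

definition input_word ::
    "int \<Rightarrow> ('n::{finite,linorder} \<Rightarrow> 'm::{finite,linorder} qpoly) \<Rightarrow> ('n \<Rightarrow> 'm option qpoly) \<Rightarrow>
     'n sqmat \<Rightarrow> ('m \<Rightarrow> 'n sqmat) \<Rightarrow> letter list" where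
  "input_word a \<phi> f A B = word (Seq
     [Num a,
      Seq (map (\<lambda>j. code_qpoly index_list (\<phi> j)) index_list),
      Seq (map (\<lambda>j. code_qpoly (None # map Some index_list) (f j)) index_list),
      code_matrix A,
      Seq (map (\<lambda>i. code_matrix (B i)) index_list)])"

definition output_word :: "rat \<Rightarrow> rat \<Rightarrow> letter list" where
  "output_word h \<tau> = word (Seq [code_rat h, code_rat \<tau>])"


section \<open>The Cauchy problem\<close>

definition symmetric_matrix :: "real ^ 'n ^ 'n \<Rightarrow> bool" where
  "symmetric_matrix A \<longleftrightarrow> transpose A = A"

definition positive_definite :: "real ^ 'n ^ 'n \<Rightarrow> bool" where
  "positive_definite A \<longleftrightarrow> symmetric_matrix A \<and> (\<forall>x. x \<noteq> 0 \<longrightarrow> x \<bullet> (A *v x) > 0)"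

definition eigenvalues :: "real ^ 'n ^ 'n \<Rightarrow> real set" where
  "eigenvalues M = {\<mu>. \<exists>v. v \<noteq> 0 \<and> M *v v = \<mu> *\<^sub>R v}"

text \<open>
  For \<open>A\<close> positive definite and \<open>B\<close> symmetric the set of eigenvalues of \<open>A\<^sup>-\<^sup>1 B\<close> is finite and nonempty,
  so that its minimum and maximum are meaningful.
\<close>

definition mu_min :: "real ^ 'n ^ 'n \<Rightarrow> real ^ 'n ^ 'n \<Rightarrow> real" where
  "mu_min A B = Min (eigenvalues (matrix_inv A ** B))"

definition mu_max :: "real ^ 'n ^ 'n \<Rightarrow> real ^ 'n ^ 'n \<Rightarrow> real" where
  "mu_max A B = Max (eigenvalues (matrix_inv A ** B))"

definition unit_cube :: "(real ^ 'm) set" where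
  "unit_cube = {x. \<forall>i. 0 \<le> x $ i \<and> x $ i \<le> 1}"

definition domain_H :: "real ^ 'n ^ 'n \<Rightarrow> ('m::finite \<Rightarrow> real ^ 'n ^ 'n) \<Rightarrow> (real \<times> (real ^ 'm)) set" where
  "domain_H A B = {(t, x). t \<ge> 0 \<and>
     (\<forall>i. x $ i - mu_max A (B i) * t \<ge> 0 \<and> x $ i - 1 - mu_min A (B i) * t \<le> 0)}"

text \<open>
  Classical solutions: continuously differentiable on \<open>H\<close> up to the boundary. \<open>H\<close> is convex with
  nonempty interior, so the derivative within \<open>H\<close> is unique at every point of \<open>H\<close>.
\<close>

definition cauchy_solution ::
    "real ^ 'n ^ 'n \<Rightarrow> ('m::finite \<Rightarrow> real ^ 'n ^ 'n) \<Rightarrow> (real \<times> (real ^ 'm) \<Rightarrow> real ^ 'n) \<Rightarrow>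
     (real ^ 'm \<Rightarrow> real ^ 'n) \<Rightarrow> (real \<times> (real ^ 'm) \<Rightarrow> real ^ 'n) \<Rightarrow> bool" where
  "cauchy_solution A B f \<phi> u \<longleftrightarrow>
     (\<exists>u'. (\<forall>z\<in>domain_H A B. (u has_derivative u' z) (at z within domain_H A B)) \<and>
           (\<forall>d. continuous_on (domain_H A B) (\<lambda>z. u' z d)) \<and>
           (\<forall>z\<in>domain_H A B.
              A *v u' z (1, 0) + (\<Sum>i\<in>UNIV. B i *v u' z (0, axis i 1)) = f z)) \<and>
     (\<forall>x\<in>unit_cube. u (0, x) = \<phi> x)"

definition esqrt :: "ennreal \<Rightarrow> ennreal" where
  "esqrt x = (if x = \<infinity> then \<infinity> else ennreal (sqrt (enn2real x)))"

definition slice :: "(real \<times> (real ^ 'm)) set \<Rightarrow> real \<Rightarrow> (real ^ 'm) set" where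
  "slice H t = {x \<in> unit_cube. (t, x) \<in> H}"

definition sL2_norm ::
    "(real \<times> (real ^ 'm::finite)) set \<Rightarrow> (real \<times> (real ^ 'm) \<Rightarrow> real ^ 'n) \<Rightarrow> ennreal" where
  "sL2_norm H w =
     (SUP t \<in> {t. slice H t \<noteq> {}}.
        esqrt (\<integral>\<^sup>+x \<in> slice H t. ennreal ((norm (w (t, x)))\<^sup>2) \<partial>lborel))"


section \<open>The Godunov scheme\<close>

definition diag_matrix :: "('n \<Rightarrow> real) \<Rightarrow> real ^ 'n ^ 'n" where
  "diag_matrix d = (\<chi> i j. if i = j then d i else 0)"

text \<open>
  The columns of \<open>L\<close> form an orthonormal basis of eigenvectors of \<open>S\<close> for the eigenvalues \<open>\<lambda>\<close>, listed
  with multiplicity in increasing order.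
\<close>

definition orthonormal_eigenbasis ::
    "'n::{finite,linorder} sqmat \<Rightarrow> ('n \<Rightarrow> real) \<Rightarrow> 'n sqmat \<Rightarrow> bool" where
  "orthonormal_eigenbasis S lam L \<longleftrightarrow>
     mono lam \<and> orthogonal_matrix L \<and> (\<forall>j. S *v column j L = lam j *\<^sub>R column j L)"

text \<open>
  Eigenbases are not unique, so the possible eigenvalues and matrices \<open>T\<^sub>i\<close> of the scheme are described by
  a predicate.
\<close>

definition scheme_matrices ::
    "'n::{finite,linorder} sqmat \<Rightarrow> ('m \<Rightarrow> 'n sqmat) \<Rightarrow>
     ('m \<Rightarrow> 'n \<Rightarrow> real) \<Rightarrow> ('m \<Rightarrow> 'n sqmat) \<Rightarrow> bool" where
  "scheme_matrices A B \<mu> Tm \<longleftrightarrow>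
     (\<exists>lam L K. orthonormal_eigenbasis A lam L \<and>
        (let D = diag_matrix (\<lambda>j. 1 / sqrt (lam j))
         in \<forall>i. orthonormal_eigenbasis
                  (transpose D ** transpose L ** B i ** L ** D) (\<mu> i) (K i) \<and>
                Tm i = L ** D ** K i))"

text \<open>
  A cell of the grid \<open>G\<^sub>N\<close> is given by its multi-index, with all components in \<open>{1..2 ^ N}\<close>. A face
  orthogonal to the axis \<open>i\<close> is given by the multi-index of the cell on its lower side, whose \<open>i\<close>-th
  component may be \<open>0\<close>. The neighbours \<open>0\<close> and \<open>2 ^ N + 1\<close> outside the cube are replaced by periodicity.
\<close>

definition grid_point :: "nat \<Rightarrow> ('m \<Rightarrow> int) \<Rightarrow> real ^ 'm" where
  "grid_point N j = (\<chi> i. (of_int (j i) - 1/2) / 2 ^ N)"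

definition grid_indices :: "nat \<Rightarrow> ('m \<Rightarrow> int) set" where
  "grid_indices N = {j. \<forall>i. j i \<in> {1..2 ^ N}}"

definition wrap :: "nat \<Rightarrow> int \<Rightarrow> int" where
  "wrap N k = (if k = 0 then 2 ^ N else if k = 2 ^ N + 1 then 1 else k)"

definition face_value ::
    "nat \<Rightarrow> ('m \<Rightarrow> 'n::finite \<Rightarrow> real) \<Rightarrow> ('m \<Rightarrow> real ^ 'n ^ 'n) \<Rightarrow>
     (('m \<Rightarrow> int) \<Rightarrow> real ^ 'n) \<Rightarrow> 'm \<Rightarrow> ('m \<Rightarrow> int) \<Rightarrow> real ^ 'n" where
  "face_value N \<mu> Tm U i j =
     (let vl = matrix_inv (Tm i) *v U (j(i := wrap N (j i)));
          vr = matrix_inv (Tm i) *v U (j(i := wrap N (j i + 1)))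
      in Tm i *v (\<chi> k. if \<mu> i k \<ge> 0 then vl $ k else vr $ k))"

primrec godunov ::
    "real ^ 'n ^ 'n \<Rightarrow> ('m::finite \<Rightarrow> real ^ 'n ^ 'n) \<Rightarrow>
     ('m \<Rightarrow> 'n::finite \<Rightarrow> real) \<Rightarrow> ('m \<Rightarrow> real ^ 'n ^ 'n) \<Rightarrow>
     (real \<times> (real ^ 'm) \<Rightarrow> real ^ 'n) \<Rightarrow> (real ^ 'm \<Rightarrow> real ^ 'n) \<Rightarrow> nat \<Rightarrow> real \<Rightarrow>
     nat \<Rightarrow> ('m \<Rightarrow> int) \<Rightarrow> real ^ 'n" where
  "godunov A B \<mu> Tm f \<phi> N \<tau> 0 = (\<lambda>j. \<phi> (grid_point N j))"
| "godunov A B \<mu> Tm f \<phi> N \<tau> (Suc l) =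
     (let h = 1 / 2 ^ N; U = godunov A B \<mu> Tm f \<phi> N \<tau> l
      in (\<lambda>j. U j
           - (\<tau> / h) *\<^sub>R (matrix_inv A *v
               (\<Sum>i\<in>UNIV. B i *v
                  (face_value N \<mu> Tm U i j - face_value N \<mu> Tm U i (j(i := j i - 1)))))
           + \<tau> *\<^sub>R (matrix_inv A *v f (real l * \<tau>, grid_point N j))))"

text \<open>
  Multilinear interpolation on \<open>G\<^sub>N\<^sup>\<tau>\<close>. Coordinates are first rescaled so that the grid has the integer
  coordinates \<open>1..L\<close> and \<open>1..2 ^ N\<close>, and clamped to these ranges. The functions \<open>s \<mapsto> hat (s - k)\<close> with \<open>k\<close>
  an integer are affine between consecutive integers and equal to \<open>1\<close> at \<open>k\<close> and \<open>0\<close> at the other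
  integers, so the sum is affine in each coordinate on every grid cell and has the values \<open>v\<close> at the
  grid points.
\<close>

definition hat :: "real \<Rightarrow> real" where
  "hat s = max 0 (1 - \<bar>s\<bar>)"

definition clamp_range :: "real \<Rightarrow> real \<Rightarrow> real" where
  "clamp_range K s = max 1 (min K s)"

definition interpolate ::
    "nat \<Rightarrow> real \<Rightarrow> nat \<Rightarrow> (nat \<Rightarrow> ('m::finite \<Rightarrow> int) \<Rightarrow> real ^ 'n) \<Rightarrow>
     real \<times> (real ^ 'm) \<Rightarrow> real ^ 'n" where
  "interpolate N \<tau> L v = (\<lambda>(t, x).
     \<Sum>l\<in>{1..L}. \<Sum>j\<in>grid_indices N.
       (hat (clamp_range (real L) (t / \<tau>) - real l) *
        (\<Prod>i\<in>UNIV. hat (clamp_range (2 ^ N) (x $ i * 2 ^ N + 1/2) - of_int (j i)))) *\<^sub>R v l j)"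

end

theory Submission
  imports Defs
begin

text \<open>
  The machine reads only the length \<open>l\<close> of its input and prints \<open>h = 2\<^sup>-\<^sup>N\<close>, \<open>\<tau> = h\<^sup>2\<close> with \<open>N = (l + 1)\<^sup>k - 1\<close>.
  It suffices that every constant in the error estimate is at most \<open>2\<close> to the power of a polynomial in
  \<open>l\<close>, while the error itself is at most such a constant times a fixed power of \<open>h\<close>.

  Constants: an algebraic number with a code of length \<open>l\<close> satisfies an integral relation with
  coefficients at most exponential in a polynomial of \<open>l\<close>. The determinant of \<open>A\<close> acts on the lattice
  spanned by the monomials in its entries, so it is a root of an integer polynomial of bounded size and
  cannot be too small. Hence \<open>A\<^sup>-\<^sup>1\<close>, the speeds of propagation and the height of \<open>H\<close> are bounded. Since
  each space derivative lowers the degree, the solution is a polynomial in \<open>t, x\<close>, with bounded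
  coefficients.

  Error: the scheme is a convex combination with matrix weights and does not increase the energy. It is
  consistent away from the boundary of the cube; on the boundary the periodic continuation spoils
  consistency. Weighting the energy of the error with the squared distances to the lateral faces of \<open>H\<close>
  removes the boundary, as the faces move with the extremal speeds, and controls the error at a distance
  \<open>d\<close> from these faces. In the remaining layer, smallness follows from cutting off the data near the
  boundary of the cube, which changes the values of the scheme little in energy and makes the differences
  of its values small, and from a discrete trace inequality. The same weighted estimate proves uniqueness of
  \<open>u\<close>.
\<close>

section \<open>Printing long words on a Turing machine\<close>

text \<open>The machine may ignore the meaning of its input because every sufficiently fine grid
  will do; only a bound for all constants in terms of the length is needed. Taking
  \<open>\<tau> = h\<^sup>2\<close> rather than a multiple of \<open>h\<close> settles stability
  without knowing the speeds, since the Courant number is then a speed bound times \<open>h\<close>;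
  moreover this \<open>\<tau>\<close> divides every integer \<open>T\<close>. The obstacle is the
  lateral boundary of \<open>H\<close>: the error is measured up to it, but there the weight
  degenerates. Three lengths are balanced, so that each contribution to the mean square error is of
  order \<open>d = 1 / 2 ^ r\<close>. Cutting off the data at width \<open>d\<close> changes the
  values by order \<open>d\<close> in mean square. Cut off values have differences of order
  \<open>h / d\<close>, so the trace inequality bounds one layer by order
  \<open>1 / d\<^sup>2\<close>, and layers of thickness \<open>d ^ 3\<close> contribute order
  \<open>d\<close>. Off these layers the weight is at least
  \<open>(d ^ 3) ^ (4 m) = d ^ (12 m)\<close>, so that a weighted error of order \<open>h\<close> is
  harmless once \<open>h \<le> d ^ (12 m + 1)\<close>. This is the origin of the condition
  \<open>(12 m + 1) r \<le> N\<close>.\<close>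

datatype instr = Emit letter | Zeros

text \<open>A base \<open>n + 1\<close> counter, least significant digit first. Decrementing the
  zero counter wraps around to the largest value, so a loop that starts and ends at zero needs no
  separate initialization.\<close>

fun decr :: "nat \<Rightarrow> nat list \<Rightarrow> nat list" where
  "decr n [] = []"
| "decr n (r # rs) = (if r = 0 then n # decr n rs else (r - 1) # rs)"

fun digits_value :: "nat \<Rightarrow> nat list \<Rightarrow> nat" where
  "digits_value n [] = 0"
| "digits_value n (r # rs) = r + (n + 1) * digits_value n rs"

lemma length_decr [simp]: "length (decr n rs) = length rs"
  by (induction rs) auto

lemma digits_value_zero: "set rs \<subseteq> {0} \<Longrightarrow> digits_value n rs = 0"
  by (induction rs) auto

lemma digits_value_eq_0_iff: "digits_value n rs = 0 \<longleftrightarrow> set rs \<subseteq> {0}"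
  by (induction rs) auto

text \<open>The successor on the left makes the wrap-around uniform with the ordinary case: from
  zero the next value is \<open>(n + 1) ^ length rs - 1\<close>, the number of zeros printed by one
  \<open>Zeros\<close>.\<close>

lemma digits_value_decr:
  "Suc (digits_value n (decr n rs)) =
     (if set rs \<subseteq> {0} then (n + 1) ^ length rs else digits_value n rs)"
proof (induction rs)
  case (Cons r rs)
  show ?case
  proof (cases "r = 0")
    case True
    have "Suc (digits_value n (decr n (r # rs))) = (n + 1) * Suc (digits_value n (decr n rs))"
      using True by simp
    also have "\<dots> = (if set (r # rs) \<subseteq> {0} then (n + 1) ^ length (r # rs)
        else digits_value n (r # rs))"
      unfolding Cons.IH using True by auto
    finally show ?thesis .
  qed auto
qed auto

lemma decr_le: "set rs \<subseteq> {..n} \<Longrightarrow> set (decr n rs) \<subseteq> {..n}"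
  by (induction rs) auto

fun dir :: "bool \<Rightarrow> direction" where
  "dir d = (if d then Go_Right else Go_Left)"

text \<open>\<open>decr\<close> as the machine can perform it: of each digit it only sees whether it
  is zero (a blank). A blank passes the borrow on to the next tape and reverses the direction of its
  own; the first mark absorbs the borrow.\<close>

fun decr_acts :: "bool list \<Rightarrow> nat list \<Rightarrow> bool list \<times> (nat \<times> direction) list" where
  "decr_acts (d # ds) (c # cs) =
     (if c = 0 then (case decr_acts ds cs of (ds', as) \<Rightarrow> ((\<not> d) # ds', (0, dir (\<not> d)) # as))
      else (d # ds, (c, dir d) # map (\<lambda>c. (c, Stay)) cs))"
| "decr_acts ds cs = ([], [])"

lemma decr_acts_length:
  assumes "length ds = length cs"
  shows "length (fst (decr_acts ds cs)) = length cs \<and> length (snd (decr_acts ds cs)) = length cs"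
  using assms by (induction ds cs rule: decr_acts.induct) (auto split: prod.splits)

lemma decr_acts_symbols:
  "fst ` set (snd (decr_acts ds cs)) \<subseteq> insert 0 (set cs)"
proof (induction ds cs rule: decr_acts.induct)
  case (1 d ds c cs)
  then show ?case by (cases "decr_acts ds cs") (auto simp: subset_iff)
qed auto

text \<open>
  A digit \<open>r \<le> n\<close> is stored as the distance of a head to the blank at the end, in the current direction
  \<open>d\<close>, of a block of \<open>n\<close> marks. Resetting the digit from \<open>0\<close> to \<open>n\<close> is then a single move in the
  opposite direction.
\<close>

definition marks :: "nat \<Rightarrow> int \<Rightarrow> nat" where
  "marks n = (\<lambda>i. if 0 \<le> i \<and> i < int n then 1 else 0)"

definition digit_tape :: "nat \<Rightarrow> bool \<Rightarrow> nat \<Rightarrow> tape" where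
  "digit_tape n d r = (marks n, if d then int n - int r else int r - 1)"

lemma scanned_digit_tape:
  "r \<le> n \<Longrightarrow> (case digit_tape n d r of (c, p) \<Rightarrow> c p) = (if r = 0 then 0 else 1)"
  by (auto simp: digit_tape_def marks_def)

lemma scanned_digit_tapes:
  "length ds = length rs \<Longrightarrow> set rs \<subseteq> {..n} \<Longrightarrow>
   scanned (map2 (digit_tape n) ds rs) = map (\<lambda>r. if r = 0 then 0 else 1) rs"
proof (induction ds rs rule: list_induct2)
  case (Cons d ds r rs)
  then show ?case using scanned_digit_tape[of r n d] by (simp add: scanned_def)
qed (simp add: scanned_def)

lemma acts_stay: "map2 act (map (\<lambda>c. (c, Stay)) (scanned ts)) ts = ts"
  by (induction ts) (auto simp: scanned_def)

lemma decr_acts_digit_tapes: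
  assumes "length ds = length rs" "set rs \<subseteq> {..n}"
  shows "map2 act (snd (decr_acts ds (map (\<lambda>r. if r = 0 then 0 else 1) rs)))
           (map2 (digit_tape n) ds rs) =
         map2 (digit_tape n) (fst (decr_acts ds (map (\<lambda>r. if r = 0 then 0 else 1) rs))) (decr n rs)"
  using assms
proof (induction ds rs rule: list_induct2)
  case (Cons d ds r rs)
  show ?case
  proof (cases "r = 0")
    case True
    \<comment> \<open>The head stands on a blank next to the block. One step back puts it on the
      last mark, at distance \<open>n\<close> from the blank at the other end, which is the digit
      \<open>n\<close> in the reversed direction.\<close>
    have "act (0, dir (\<not> d)) (digit_tape n d 0) = digit_tape n (\<not> d) n"
      by (auto simp: digit_tape_def marks_def fun_eq_iff)
    then show ?thesis using True Cons by (auto split: prod.splits)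
  next
    case False
    have "act (1, dir d) (digit_tape n d r) = digit_tape n d (r - 1)"
      using False Cons.prems by (auto simp: digit_tape_def marks_def fun_eq_iff)
    moreover have "map2 act (map (\<lambda>c. (c, Stay)) (map (\<lambda>r. if r = 0 then 0 else 1) rs))
        (map2 (digit_tape n) ds rs) = map2 (digit_tape n) ds rs"
      using acts_stay[of "map2 (digit_tape n) ds rs"] scanned_digit_tapes[of ds rs n] Cons
      by (simp add: comp_def)
    ultimately show ?thesis using False Cons by (simp add: comp_def)
  qed
qed auto

lemma tape_of_snoc:
  "act (letter_symbol x, Go_Right) (tape_of w, int (length w)) =
   (tape_of (w @ [x]), int (length (w @ [x])))"
  by (auto simp: tape_of_def fun_eq_iff nth_append)

type_synonym printer_state = "nat \<times> bool \<times> bool list"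

text \<open>
  The flag of a state tells whether the counter has been started by the current instruction. Program
  counter \<open>0\<close> is the initial phase, which marks blocks of the length of the input on the counter tapes.
\<close>

fun printer_delta :: "nat \<Rightarrow> instr list \<Rightarrow> printer_state \<Rightarrow> nat list \<Rightarrow>
    (printer_state \<times> (nat \<times> direction) list) option" where
  "printer_delta k prog (pc, b, ds) ss =
    (let cs = butlast (tl ss); stay = map (\<lambda>c. (c, Stay)) in
     if pc > length prog then None
     else if pc = 0 then
       (if hd ss = 0 then Some ((1, b, ds), stay ss)
        else Some ((0, b, ds), (hd ss, Go_Right) # replicate k (1, Go_Right) @ [(last ss, Stay)]))
     else case prog ! (pc - 1) of
       Emit x \<Rightarrow> Some ((pc + 1, b, ds), stay (hd ss # cs) @ [(letter_symbol x, Go_Right)])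
     | Zeros \<Rightarrow>
         (case decr_acts ds cs of (ds', as) \<Rightarrow>
            if \<not> b then Some ((pc, True, ds'), (hd ss, Stay) # as @ [(last ss, Stay)])
            else if set cs \<subseteq> {0} then Some ((pc + 1, False, ds), stay ss)
            else Some ((pc, True, ds'), (hd ss, Stay) # as @ [(letter_symbol Digit0, Go_Right)])))"

declare printer_delta.simps [simp del]

definition printer_states :: "nat \<Rightarrow> instr list \<Rightarrow> printer_state set" where
  "printer_states k prog = {..Suc (length prog)} \<times> UNIV \<times> {ds. length ds = k}"

lemma finite_printer_states: "finite (printer_states k prog)"
proof -
  have "finite {ds :: bool list. set ds \<subseteq> UNIV \<and> length ds = k}"
    by (rule finite_lists_length_eq) simp
  then show ?thesis by (auto simp: printer_states_def)
qed

lemma printer_delta_wf: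
  assumes "s \<in> printer_states k prog" "length ss = k + 2" "set ss \<subseteq> {..<6}"
    and "printer_delta k prog s ss = Some (s', acts)"
  shows "s' \<in> printer_states k prog \<and> length acts = k + 2 \<and> fst ` set acts \<subseteq> {..<6}"
proof -
  obtain pc b ds where s: "s = (pc, b, ds)" by (cases s)
  have ds: "length ds = k" using assms(1) s by (simp add: printer_states_def)
  obtain s0 ss' where ss': "ss = s0 # ss'" "length ss' = Suc k" using assms(2) by (cases ss) auto
  then obtain cs so where "ss' = cs @ [so]" by (cases ss' rule: rev_cases) auto
  with ss' have ss: "ss = s0 # cs @ [so]" and cs: "length cs = k" by auto
  have sym: "s0 < 6" "set cs \<subseteq> {..<6}" "so < 6" using assms(3) ss by auto
  have sym2: "letter_symbol x < 6" for x by (cases x) auto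
  obtain ds' as where da: "decr_acts ds cs = (ds', as)" by fastforce
  have len: "length ds' = k" "length as = k"
    using decr_acts_length[of ds cs] ds cs da by auto
  have as: "\<forall>(x, d) \<in> set as. x < 6"
    using decr_acts_symbols[of ds cs] sym da by (auto simp: subset_iff image_iff)
  have stay: "fst ` set (map (\<lambda>c. (c, Stay)) cs) \<subseteq> {..<6}"
    using sym(2) by auto
  have rep: "fst ` set (replicate k (1, Go_Right)) \<subseteq> {..<6::nat}" by auto
  have bl: "butlast (tl ss) = cs" "hd ss = s0" "last ss = so" using ss by auto
  have pc: "pc \<le> length prog"
    using assms(4) by (simp add: s printer_delta.simps Let_def split: if_splits)
  consider (A) "pc = 0" | (B) x where "pc \<noteq> 0" "prog ! (pc - 1) = Emit x"
    | (C) "pc \<noteq> 0" "prog ! (pc - 1) = Zeros"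
    by (cases "prog ! (pc - 1)") auto
  then show ?thesis
  proof cases
    case A
    then show ?thesis using assms(4) ds cs sym stay rep
      unfolding s printer_delta.simps bl Let_def by (auto simp: printer_states_def ss split: if_splits)
  next
    case B
    then show ?thesis using assms(4) ds cs sym sym2[of x] stay pc
      unfolding s printer_delta.simps bl Let_def by (auto simp: printer_states_def)
  next
    case C
    then show ?thesis using assms(4) ds cs sym as len stay pc
      unfolding s printer_delta.simps bl Let_def da
      by (auto simp: printer_states_def ss split: if_splits)
  qed
qed

text \<open>Machines have numbered states, so the structured states are transported along a
  numbering \<open>enc\<close>, which is inverted on the finite set of reachable state
  triples.\<close>

definition printer_tm :: "(printer_state \<Rightarrow> nat) \<Rightarrow> nat \<Rightarrow> instr list \<Rightarrow> tm" where
  "printer_tm enc k prog = \<lparr>num_tapes = k + 2, num_states = card (printer_states k prog), num_symbols = 6,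
     delta = (\<lambda>q ss. map_option (\<lambda>(s, acts). (enc s, acts))
        (printer_delta k prog (the_inv_into (printer_states k prog) enc q) ss))\<rparr>"

locale printer =
  fixes enc :: "printer_state \<Rightarrow> nat" and k :: nat and prog :: "instr list"
  assumes enc: "bij_betw enc (printer_states k prog) {..<card (printer_states k prog)}"
    and enc_init: "enc (0, False, replicate k True) = 0"
begin

abbreviation "M \<equiv> printer_tm enc k prog"

lemma the_inv_enc: "s \<in> printer_states k prog \<Longrightarrow> the_inv_into (printer_states k prog) enc (enc s) = s"
  using enc by (meson bij_betw_def the_inv_into_f_f)

lemma turing_machine_printer: "turing_machine M"
  unfolding turing_machine_def
proof (intro conjI allI impI)
  have "(0, False, replicate k True) \<in> printer_states k prog" by (simp add: printer_states_def)
  then show "1 \<le> num_states M"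
    using finite_printer_states[of k prog] by (auto simp: printer_tm_def Suc_le_eq card_gt_0_iff)
next
  fix q ss q' acts
  assume q: "q < num_states M" and ss: "length ss = num_tapes M" "set ss \<subseteq> {..<num_symbols M}"
    and d: "delta M q ss = Some (q', acts)"
  define s where "s = the_inv_into (printer_states k prog) enc q"
  have s: "s \<in> printer_states k prog"
    unfolding s_def using enc q
    by (metis (no_types, lifting) bij_betw_def bij_betw_the_inv_into imageI lessThan_iff printer_tm_def
        tm.select_convs(2))
  obtain s' where s': "printer_delta k prog s ss = Some (s', acts)" "q' = enc s'"
    using d by (auto simp: printer_tm_def s_def)
  have wf: "s' \<in> printer_states k prog \<and> length acts = k + 2 \<and> fst ` set acts \<subseteq> {..<6}"
    by (rule printer_delta_wf[OF s _ _ s'(1)]) (use ss in \<open>auto simp: printer_tm_def\<close>)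
  then have "q' < card (printer_states k prog)"
    using enc s'(2) by (auto simp: bij_betw_def)
  then show "q' < num_states M" "length acts = num_tapes M" "fst ` set acts \<subseteq> {..<num_symbols M}"
    using wf by (auto simp: printer_tm_def)
qed (auto simp: printer_tm_def)

definition conf :: "tape \<Rightarrow> nat \<Rightarrow> nat \<Rightarrow> bool \<Rightarrow> bool list \<Rightarrow> nat list \<Rightarrow> letter list \<Rightarrow> config" where
  "conf inp n pc b ds rs w =
     (enc (pc, b, ds), inp # map2 (digit_tape n) ds rs @ [(tape_of w, int (length w))])"

definition ready :: "nat \<Rightarrow> bool list \<Rightarrow> nat list \<Rightarrow> bool" where
  "ready n ds rs \<longleftrightarrow> length ds = k \<and> length rs = k \<and> set rs \<subseteq> {..n}"

lemma step_conf:
  assumes "pc \<le> Suc (length prog)" "length ds = k"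
  shows "step M (enc (pc, b, ds), ts) =
    (case printer_delta k prog (pc, b, ds) (scanned ts) of None \<Rightarrow> (enc (pc, b, ds), ts)
     | Some (s', acts) \<Rightarrow> (enc s', map2 act acts ts))"
proof -
  have "(pc, b, ds) \<in> printer_states k prog" using assms by (simp add: printer_states_def)
  from the_inv_enc[OF this] show ?thesis
    by (auto simp: printer_tm_def split: option.splits)
qed

lemma scanned_conf:
  assumes "ready n ds rs"
  shows "scanned (inp # map2 (digit_tape n) ds rs @ [(tape_of w, int (length w))]) =
    (fst inp (snd inp)) # map (\<lambda>r. if r = 0 then 0 else 1) rs @ [0]"
  using scanned_digit_tapes[of ds rs n] assms
  by (auto simp: scanned_def ready_def tape_of_def split: prod.splits)

text \<open>A step decomposes over the tapes: the input tape stays, \<open>as\<close> acts on the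
  counter tapes and \<open>a\<close> on the output tape. All instructions are instances.\<close>

lemma step_confI:
  assumes r: "ready n ds rs" and pc: "pc \<le> Suc (length prog)"
    and d: "printer_delta k prog (pc, b, ds)
      (fst inp (snd inp) # map (\<lambda>r. if r = 0 then 0 else 1) rs @ [0]) =
      Some ((pc', b', ds'), (fst inp (snd inp), Stay) # as @ [a])"
    and as: "length as = k" "map2 act as (map2 (digit_tape n) ds rs) = map2 (digit_tape n) ds' rs'"
    and a: "act a (tape_of w, int (length w)) = (tape_of w', int (length w'))"
  shows "step M (conf inp n pc b ds rs w) = conf inp n pc' b' ds' rs' w'"
proof -
  have ds: "length ds = k" "length rs = k" using r by (auto simp: ready_def)
  have inp: "act (fst inp (snd inp), Stay) inp = inp" by (cases inp) auto
  have "map2 act (as @ [a]) (map2 (digit_tape n) ds rs @ [(tape_of w, int (length w))]) =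
      map2 (digit_tape n) ds' rs' @ [(tape_of w', int (length w'))]"
    using as a ds by (simp only: zip_append length_map length_zip map_append) simp
  then show ?thesis
    unfolding conf_def step_conf[OF pc ds(1)] scanned_conf[OF r] d using inp by simp
qed

lemma stay_tapes:
  assumes "ready n ds rs"
  shows "map2 act (map (\<lambda>c. (c, Stay)) (map (\<lambda>r. if r = 0 then 0 else 1) rs))
        (map2 (digit_tape n) ds rs) = map2 (digit_tape n) ds rs"
  using acts_stay[of "map2 (digit_tape n) ds rs"] scanned_digit_tapes[of ds rs n] assms
  unfolding ready_def by metis

lemma act_out: "act (0, Stay) (tape_of w, int (length w)) = (tape_of w, int (length w))"
  by (auto simp: tape_of_def fun_eq_iff)

lemma step_emit:
  assumes "ready n ds rs" "i < length prog" "prog ! i = Emit x"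
  shows "step M (conf inp n (Suc i) b ds rs w) = conf inp n (Suc (Suc i)) b ds rs (w @ [x])"
proof (rule step_confI[OF assms(1) _ _ _ stay_tapes[OF assms(1)] tape_of_snoc])
  show "printer_delta k prog (Suc i, b, ds)
      (fst inp (snd inp) # map (\<lambda>r. if r = 0 then 0 else 1) rs @ [0]) =
      Some ((Suc (Suc i), b, ds), (fst inp (snd inp), Stay) #
        map (\<lambda>c. (c, Stay)) (map (\<lambda>r. if r = 0 then 0 else 1) rs) @ [(letter_symbol x, Go_Right)])"
    using assms by (simp add: printer_delta.simps Let_def)
qed (use assms in \<open>auto simp: ready_def\<close>)

text \<open>The first decrement, with the flag off, prints nothing and only performs the
  wrap-around; every later one prints a digit, until the zero counter is seen again. The same
  \<open>ds'\<close> serves both cases because it depends only on the scanned counter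
  symbols.\<close>

lemma step_zeros:
  assumes r: "ready n ds rs" and i: "i < length prog" "prog ! i = Zeros"
  shows "\<exists>ds'. ready n ds' (decr n rs) \<and>
      step M (conf inp n (Suc i) False ds rs w) = conf inp n (Suc i) True ds' (decr n rs) w \<and>
      (\<not> set rs \<subseteq> {0} \<longrightarrow> step M (conf inp n (Suc i) True ds rs w) =
         conf inp n (Suc i) True ds' (decr n rs) (w @ [Digit0]))"
    and "set rs \<subseteq> {0} \<Longrightarrow>
      step M (conf inp n (Suc i) True ds rs w) = conf inp n (Suc (Suc i)) False ds rs w"
proof -
  have ds: "length ds = k" "length rs = k" "set rs \<subseteq> {..n}" using r by (auto simp: ready_def)
  define cs where "cs = map (\<lambda>r. if r = 0 then 0 else 1 :: nat) rs"
  define ds' where "ds' = fst (decr_acts ds cs)"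
  define as where "as = snd (decr_acts ds cs)"
  have da: "decr_acts ds cs = (ds', as)" by (simp add: ds'_def as_def)
  have len: "length ds' = k" "length as = k"
    using decr_acts_length[of ds cs] da ds by (auto simp: cs_def)
  have tapes: "map2 act as (map2 (digit_tape n) ds rs) = map2 (digit_tape n) ds' (decr n rs)"
    unfolding as_def ds'_def cs_def by (rule decr_acts_digit_tapes) (use ds in auto)
  have cs0: "set cs \<subseteq> {0} \<longleftrightarrow> set rs \<subseteq> {0}" by (auto simp: cs_def)
  have i': "Suc i \<le> Suc (length prog)" using i by simp
  have "ready n ds' (decr n rs)"
    using len ds decr_le[of rs n] by (simp add: ready_def)
  moreover have "step M (conf inp n (Suc i) False ds rs w) = conf inp n (Suc i) True ds' (decr n rs) w"
    by (rule step_confI[OF r i' _ len(2) tapes act_out], fold cs_def)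
      (use i in \<open>simp only: printer_delta.simps Let_def da list.sel butlast_snoc, simp\<close>)
  moreover have "step M (conf inp n (Suc i) True ds rs w) =
         conf inp n (Suc i) True ds' (decr n rs) (w @ [Digit0])" if "\<not> set rs \<subseteq> {0}"
    by (rule step_confI[OF r i' _ len(2) tapes tape_of_snoc], fold cs_def)
      (use i that in \<open>simp only: printer_delta.simps Let_def da list.sel butlast_snoc cs0, simp\<close>)
  ultimately show "\<exists>ds'. ready n ds' (decr n rs) \<and>
      step M (conf inp n (Suc i) False ds rs w) = conf inp n (Suc i) True ds' (decr n rs) w \<and>
      (\<not> set rs \<subseteq> {0} \<longrightarrow> step M (conf inp n (Suc i) True ds rs w) =
         conf inp n (Suc i) True ds' (decr n rs) (w @ [Digit0]))"
    by (intro exI[of _ ds'] conjI impI)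
  show "step M (conf inp n (Suc i) True ds rs w) = conf inp n (Suc (Suc i)) False ds rs w"
    if z: "set rs \<subseteq> {0}"
  proof (rule step_confI[OF r i' _ _ stay_tapes[OF r] act_out], fold cs_def)
    have "set cs \<subseteq> {0}" using z cs0 by simp
    then show "printer_delta k prog (Suc i, True, ds) (fst inp (snd inp) # cs @ [0]) =
        Some ((Suc (Suc i), False, ds), (fst inp (snd inp), Stay) # map (\<lambda>c. (c, Stay)) cs @ [(0, Stay)])"
      using i by (simp only: printer_delta.simps Let_def da list.sel butlast_snoc) simp
  qed (simp add: cs_def ds)
qed

lemma run_zeros_started:
  assumes "ready n ds rs" "i < length prog" "prog ! i = Zeros"
  shows "\<exists>ds' rs'. ready n ds' rs' \<and> set rs' \<subseteq> {0} \<and>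
      (step M ^^ Suc (digits_value n rs)) (conf inp n (Suc i) True ds rs w) =
        conf inp n (Suc (Suc i)) False ds' rs' (w @ replicate (digits_value n rs) Digit0)"
  using assms
proof (induction "digits_value n rs" arbitrary: ds rs w)
  case 0
  then have z: "set rs \<subseteq> {0}" by (metis digits_value_eq_0_iff)
  have "(step M ^^ Suc (digits_value n rs)) (conf inp n (Suc i) True ds rs w) =
      step M (conf inp n (Suc i) True ds rs w)"
    unfolding 0(1)[symmetric] by (simp only: funpow.simps comp_apply id_apply)
  also have "\<dots> = conf inp n (Suc (Suc i)) False ds rs w"
    by (rule step_zeros(2)[OF 0(2-4) z])
  also have "\<dots> = conf inp n (Suc (Suc i)) False ds rs (w @ replicate (digits_value n rs) Digit0)"
    unfolding 0(1)[symmetric] by simp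
  finally show ?case using 0(2) z by blast
next
  case (Suc v)
  have nz: "\<not> set rs \<subseteq> {0}" using Suc.hyps(2) digits_value_zero by force
  obtain ds' where ds': "ready n ds' (decr n rs)"
    "step M (conf inp n (Suc i) True ds rs w) = conf inp n (Suc i) True ds' (decr n rs) (w @ [Digit0])"
    using step_zeros(1)[OF Suc.prems, of inp w] nz by metis
  have v: "v = digits_value n (decr n rs)"
    using digits_value_decr[of n rs] nz Suc.hyps(2) by simp
  obtain ds'' rs'' where *: "ready n ds'' rs''" "set rs'' \<subseteq> {0}"
      "(step M ^^ Suc v) (conf inp n (Suc i) True ds' (decr n rs) (w @ [Digit0])) =
        conf inp n (Suc (Suc i)) False ds'' rs'' ((w @ [Digit0]) @ replicate v Digit0)"
    using Suc.hyps(1)[OF v ds'(1) Suc.prems(2,3), of "w @ [Digit0]"] unfolding v[symmetric] by metis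
  have "(step M ^^ Suc (Suc v)) (conf inp n (Suc i) True ds rs w) =
      conf inp n (Suc (Suc i)) False ds'' rs'' ((w @ [Digit0]) @ replicate v Digit0)"
    unfolding funpow_Suc_right[of "Suc v"] comp_apply ds'(2) *(3) ..
  also have "(w @ [Digit0]) @ replicate v Digit0 = w @ replicate (Suc v) Digit0" by simp
  finally show ?case using *(1,2) unfolding Suc.hyps(2)[symmetric] by blast
qed

fun printed :: "nat \<Rightarrow> instr \<Rightarrow> letter list" where
  "printed n (Emit x) = [x]"
| "printed n Zeros = replicate ((n + 1) ^ k - 1) Digit0"

text \<open>The invariant between instructions is a zero counter with arbitrary directions; every
  instruction restores it, so that \<open>Zeros\<close> can be used repeatedly.\<close>

lemma run_instr:
  assumes "ready n ds rs" "set rs \<subseteq> {0}" "i < length prog"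
  shows "\<exists>ds' rs' j. ready n ds' rs' \<and> set rs' \<subseteq> {0} \<and> j \<le> (n + 1) ^ k + 1 \<and>
      (step M ^^ j) (conf inp n (Suc i) False ds rs w) =
        conf inp n (Suc (Suc i)) False ds' rs' (w @ printed n (prog ! i))"
proof (cases "prog ! i")
  case (Emit x)
  have "(step M ^^ 1) (conf inp n (Suc i) False ds rs w) =
        conf inp n (Suc (Suc i)) False ds rs (w @ printed n (prog ! i))"
    using step_emit[OF assms(1,3) Emit, of inp False w] unfolding Emit printed.simps
    by (simp only: One_nat_def funpow.simps comp_apply id_apply)
  then show ?thesis using assms(1,2) by (metis le_add2)
next
  case Zeros
  obtain ds1 where ds1: "ready n ds1 (decr n rs)"
    "step M (conf inp n (Suc i) False ds rs w) = conf inp n (Suc i) True ds1 (decr n rs) w"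
    using step_zeros(1)[OF assms(1,3) Zeros, of inp w] by metis
  define v where "v = digits_value n (decr n rs)"
  have v: "Suc v = (n + 1) ^ k"
    using digits_value_decr[of n rs] assms(1,2) by (simp add: v_def ready_def)
  obtain ds' rs' where *: "ready n ds' rs'" "set rs' \<subseteq> {0}"
      "(step M ^^ Suc v) (conf inp n (Suc i) True ds1 (decr n rs) w) =
        conf inp n (Suc (Suc i)) False ds' rs' (w @ replicate v Digit0)"
    using run_zeros_started[OF ds1(1) assms(3) Zeros, of inp w] unfolding v_def by metis
  have v': "v = (n + 1) ^ k - 1" "Suc (Suc v) \<le> (n + 1) ^ k + 1" using v by auto
  have "(step M ^^ Suc (Suc v)) (conf inp n (Suc i) False ds rs w) =
        conf inp n (Suc (Suc i)) False ds' rs' (w @ printed n (prog ! i))"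
    unfolding funpow_Suc_right[of "Suc v"] comp_apply ds1(2) *(3) Zeros printed.simps v'(1)[symmetric] ..
  then show ?thesis using *(1,2) v'(2) by metis
qed

lemma run_prog:
  assumes "ready n ds rs" "set rs \<subseteq> {0}" "i \<le> length prog"
  shows "\<exists>ds' rs' j. ready n ds' rs' \<and> set rs' \<subseteq> {0} \<and> j \<le> i * ((n + 1) ^ k + 1) \<and>
      (step M ^^ j) (conf inp n 1 False ds rs w) =
        conf inp n (Suc i) False ds' rs' (w @ concat (map (printed n) (take i prog)))"
  using assms(3)
proof (induction i)
  case 0
  have "(step M ^^ 0) (conf inp n 1 False ds rs w) =
        conf inp n (Suc 0) False ds rs (w @ concat (map (printed n) (take 0 prog)))"
    by (simp only: funpow.simps id_apply One_nat_def take_0 list.map concat.simps append_Nil2)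
  then show ?case using assms(1,2) by (metis le0)
next
  case (Suc i)
  then have i: "i \<le> length prog" "i < length prog" by auto
  obtain ds1 rs1 j1 where 1: "ready n ds1 rs1" "set rs1 \<subseteq> {0}" "j1 \<le> i * ((n + 1) ^ k + 1)"
    "(step M ^^ j1) (conf inp n 1 False ds rs w) =
        conf inp n (Suc i) False ds1 rs1 (w @ concat (map (printed n) (take i prog)))"
    using Suc.IH[OF i(1)] by metis
  obtain ds2 rs2 j2 where 2: "ready n ds2 rs2" "set rs2 \<subseteq> {0}" "j2 \<le> (n + 1) ^ k + 1"
    "(step M ^^ j2) (conf inp n (Suc i) False ds1 rs1 (w @ concat (map (printed n) (take i prog)))) =
      conf inp n (Suc (Suc i)) False ds2 rs2 ((w @ concat (map (printed n) (take i prog))) @ printed n (prog ! i))"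
    using run_instr[OF 1(1,2) i(2)] by metis
  have "(w @ concat (map (printed n) (take i prog))) @ printed n (prog ! i) =
      w @ concat (map (printed n) (take (Suc i) prog))"
    using i(2) by (simp add: take_Suc_conv_app_nth)
  then have "(step M ^^ (j2 + j1)) (conf inp n 1 False ds rs w) =
      conf inp n (Suc (Suc i)) False ds2 rs2 (w @ concat (map (printed n) (take (Suc i) prog)))"
    unfolding funpow_add comp_apply 1(4) 2(4) by simp
  moreover have "j2 + j1 \<le> Suc i * ((n + 1) ^ k + 1)" using 1(3) 2(3) by simp
  ultimately show ?case using 2(1,2) by blast
qed

lemma copy_run:
  fixes u :: "letter list"
  defines "C \<equiv> \<lambda>i. (enc (0, False, replicate k True),
      (tape_of u, int i) # replicate k (marks i, int i) @ [(tape_of [], 0)])"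
  assumes "i \<le> length u"
  shows "(step M ^^ i) (C 0) = C i"
  using assms(2)
proof (induction i)
  case (Suc i)
  have rep: "map2 act (replicate k (1, Go_Right)) (replicate k (marks i, int i)) =
      replicate k (marks (Suc i), int (Suc i))"
    by (auto simp: marks_def fun_eq_iff)
  have nz: "tape_of u (int i) \<noteq> 0"
    using Suc.prems by (cases "u ! i") (auto simp: tape_of_def)
  have "step M (C i) = C (Suc i)"
    using rep nz
    by (auto simp: C_def step_conf printer_delta.simps Let_def scanned_def tape_of_def zip_append
        fun_eq_iff simp del: step.simps)
  then show ?case using Suc by (simp del: step.simps)
qed simp

lemma run_printer:
  "\<exists>j \<le> length u + 1 + length prog * ((length u + 1) ^ k + 1).
     let c = (step M ^^ j) (initial_config M u)
     in halted M c \<and> fst (last (snd c)) = tape_of (concat (map (printed (length u)) prog))"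
proof -
  define n where "n = length u"
  define ds where "ds = replicate k True"
  define rs where "rs = replicate k (0::nat)"
  define inp where "inp = (tape_of u, int n)"
  have rd: "ready n ds rs" "set rs \<subseteq> {0}" by (auto simp: ready_def ds_def rs_def)
  have t0: "tape_of [] = (\<lambda>_. 0)" "marks 0 = (\<lambda>_. 0)" by (auto simp: tape_of_def marks_def)
  have init: "initial_config M u = (enc (0, False, replicate k True),
      (tape_of u, int 0) # replicate k (marks 0, int 0) @ [(tape_of [], 0)])"
    unfolding initial_config_def t0 enc_init by (simp add: printer_tm_def replicate_append_same)
  \<comment> \<open>After copying, the counter heads stand on the blank right of their blocks: this
    is the digit \<open>0\<close> in the direction right, so the invariant holds at the
    start.\<close>
  have digs: "replicate k (marks n, int n) = map2 (digit_tape n) ds rs"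
    by (simp add: ds_def rs_def digit_tape_def)
  have c0: "(step M ^^ n) (initial_config M u) = conf inp n 0 False ds rs []"
    unfolding init using copy_run[of n u] by (simp add: n_def conf_def digs inp_def ds_def
        digs[unfolded ds_def n_def])
  have b: "tape_of u (int n) = 0" by (simp add: tape_of_def n_def)
  have "step M (conf inp n 0 False ds rs []) = conf inp n 1 False ds rs []"
    by (rule step_confI[OF rd(1) _ _ _ stay_tapes[OF rd(1)] act_out])
      (auto simp: printer_delta.simps Let_def b inp_def rs_def)
  then have c1: "(step M ^^ Suc n) (initial_config M u) = conf inp n 1 False ds rs []"
    unfolding funpow.simps comp_apply c0 .
  obtain ds' rs' j where j: "ready n ds' rs'" "j \<le> length prog * ((n + 1) ^ k + 1)"
      "(step M ^^ j) (conf inp n 1 False ds rs []) =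
        conf inp n (Suc (length prog)) False ds' rs' ([] @ concat (map (printed n) (take (length prog) prog)))"
    using run_prog[OF rd order_refl, of inp "[]"] by metis
  have "(step M ^^ (j + Suc n)) (initial_config M u) =
      conf inp n (Suc (length prog)) False ds' rs' (concat (map (printed n) prog))"
    unfolding funpow_add comp_apply c1 j(3) by simp
  moreover have "halted M (conf inp n (Suc (length prog)) False ds' rs' w)" for w
  proof -
    have "(Suc (length prog), False, ds') \<in> printer_states k prog"
      using j(1) by (simp add: printer_states_def ready_def)
    from the_inv_enc[OF this] show ?thesis
      by (simp add: conf_def printer_tm_def printer_delta.simps Let_def)
  qed
  moreover have "j + Suc n \<le> length u + 1 + length prog * ((length u + 1) ^ k + 1)"
    using j(2) by (simp add: n_def)
  ultimately show ?thesis
    by (intro exI[of _ "j + Suc n"]) (simp add: conf_def n_def)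
qed

end

lemma ex_printer: "\<exists>enc. printer enc k prog"
proof -
  let ?S = "printer_states k prog" and ?s = "(0, False, replicate k True) :: printer_state"
  have s: "?s \<in> ?S" by (simp add: printer_states_def)
  obtain f where f: "bij_betw f ?S {0..<card ?S}"
    using ex_bij_betw_finite_nat[OF finite_printer_states] by blast
  \<comment> \<open>Any numbering of the states, followed by the transposition that sends the
    initial state to \<open>0\<close>.\<close>
  define g where "g = Transposition.transpose (f ?s) 0 \<circ> f"
  have fs: "f ?s \<in> {..<card ?S}" using f s by (auto simp: bij_betw_def)
  then have "bij_betw (Transposition.transpose (f ?s) 0) {..<card ?S} {..<card ?S}"
    using s f by (intro bij_betw_transpose_iff) (auto simp: bij_betw_def)
  then have "bij_betw g ?S {..<card ?S}"
    unfolding g_def using f by (auto intro: bij_betw_trans simp: atLeast0LessThan)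
  moreover have "g ?s = 0" by (simp add: g_def)
  ultimately show ?thesis by (auto simp: printer_def)
qed

section \<open>The words of dyadic rationals and the program that prints the grid\<close>

lemma bits_power2: "bits (2 ^ N) = Digit1 # replicate N Digit0"
proof (induction N)
  case 0 then show ?case by (simp add: bits.simps)
next
  case (Suc N)
  have "\<not> (2::nat) ^ Suc N < 2" using one_le_power[of "2::nat" N] by simp
  then have "bits (2 ^ Suc N) = bits (2 ^ N) @ [Digit0]"
    by (subst bits.simps) simp
  then show ?case using Suc by (simp add: replicate_append_same)
qed

lemma word_dyadic:
  "word (code_rat (1 / 2 ^ N)) =
     [LBrack, Digit0, Digit1, Sep, Digit0, Digit1] @ replicate N Digit0 @ [Sep, RBrack]"
proof -
  have "(1::rat) / 2 ^ N = Fract 1 (2 ^ N)" by (simp add: Fract_of_int_quotient)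
  then have "quotient_of (1 / 2 ^ N :: rat) = (1, 2 ^ N)"
    by (simp add: quotient_of_Fract Rat.normalize_def)
  then show ?thesis
    by (simp add: code_rat_def bits_power2 nat_power_eq bits_power2[of 0, simplified])
qed

text \<open>Only the numbers of trailing zeros in the denominators depend on the input:
  \<open>N\<close> for \<open>h\<close> and \<open>2 * N\<close> for \<open>\<tau>\<close>, hence
  one \<open>Zeros\<close> and then two in a row.\<close>

definition grid_program :: "instr list" where
  "grid_program =
     map Emit [LBrack, LBrack, Digit0, Digit1, Sep, Digit0, Digit1] @ [Zeros] @
     map Emit [Sep, RBrack, Sep, LBrack, Digit0, Digit1, Sep, Digit0, Digit1] @ [Zeros, Zeros] @
     map Emit [Sep, RBrack, Sep, RBrack]"

lemma polynomial_time_grid: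
  "\<exists>(M :: tm) (p :: nat poly). turing_machine M \<and>
     (\<forall>w. let N = (length w + 1) ^ k - 1 in
        computes_within M (poly p (length w)) w (output_word (1 / 2 ^ N) (1 / 2 ^ (2 * N))))"
proof -
  obtain enc where "printer enc k grid_program" using ex_printer by blast
  then interpret printer enc k grid_program .
  define p :: "nat poly" where
    "p = [:1, 1:] + smult (length grid_program) ([:1, 1:] ^ k + 1)"
  have "computes_within M (poly p (length w)) w
      (output_word (1 / 2 ^ ((length w + 1) ^ k - 1)) (1 / 2 ^ (2 * ((length w + 1) ^ k - 1))))" for w
  proof -
    define N where "N = (length w + 1) ^ k - 1"
    have printed: "printed (length w) Zeros = replicate N Digit0" by (simp add: N_def)
    have "concat (map (printed (length w)) grid_program) =
      output_word (1 / 2 ^ N) (1 / 2 ^ (2 * N))"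
      unfolding grid_program_def output_word_def mult_2 map_append list.map printed word.simps
        concat.simps word_dyadic replicate_add
      by simp
    moreover have "poly p (length w) = length w + 1 + length grid_program * ((length w + 1) ^ k + 1)"
      by (simp add: p_def algebra_simps)
    ultimately show ?thesis using run_printer[of w] by (auto simp: computes_within_def Let_def N_def)
  qed
  then show ?thesis using turing_machine_printer by (auto simp: Let_def)
qed

section \<open>Codes and the size of algebraic numbers\<close>

lemma lt_power_length_bits: "k < 2 ^ length (bits k)"
proof (induction k rule: bits.induct)
  case (1 k)
  show ?case
  proof (cases "k < 2")
    case True then show ?thesis by (subst bits.simps) auto
  next
    case False
    then have "k div 2 < 2 ^ length (bits (k div 2))" using 1 by simp
    then have "k < 2 * 2 ^ length (bits (k div 2))" by simp
    then show ?thesis using False by (subst bits.simps) simp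
  qed
qed

lemma abs_lt_power_length_word: "\<bar>z\<bar> < 2 ^ length (word (Num z))"
proof -
  have "\<bar>z\<bar> < 2 ^ length (bits (nat \<bar>z\<bar>))"
    using lt_power_length_bits[of "nat \<bar>z\<bar>"] by (simp add: nat_less_iff)
  also have "\<dots> \<le> 2 ^ length (word (Num z))" by (intro power_increasing) auto
  finally show ?thesis .
qed

lemma length_word_mem: "c \<in> set cs \<Longrightarrow> length (word c) \<le> length (word (Seq cs))"
  by (induction cs) auto

lemma length_le_length_word_Seq: "length cs + 2 \<le> length (word (Seq cs))"
  by (induction cs) auto

lemma code_rat_bounds:
  assumes "quotient_of r = (p, q)" "length (word (code_rat r)) \<le> n"
  shows "\<bar>p\<bar> \<le> 2 ^ n" "\<bar>q\<bar> \<le> 2 ^ n" "\<bar>r\<bar> \<le> 2 ^ n"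
proof -
  have c: "code_rat r = Seq [Num p, Num q]" using assms(1) by (simp add: code_rat_def)
  have *: "\<bar>z\<bar> \<le> 2 ^ n" if "Num z \<in> set [Num p, Num q]" for z
  proof -
    have "\<bar>z\<bar> \<le> 2 ^ length (word (Num z))" using abs_lt_power_length_word[of z] by linarith
    also have "\<dots> \<le> 2 ^ n"
      using length_word_mem[OF that] assms(2) c by (intro power_increasing) auto
    finally show ?thesis .
  qed
  show p: "\<bar>p\<bar> \<le> 2 ^ n" and "\<bar>q\<bar> \<le> 2 ^ n" using * by auto
  have q: "q > 0" using quotient_of_denom_pos[OF assms(1)] .
  have "r = of_int p / of_int q" using quotient_of_div[OF assms(1)] .
  then have "\<bar>r\<bar> = of_int \<bar>p\<bar> / of_int q" using q by simp
  also have "\<dots> \<le> of_int \<bar>p\<bar> / 1" using q by (intro divide_left_mono) auto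
  also have "\<dots> \<le> of_int (2 ^ n)" using p by (simp del: of_int_power)
  finally show "\<bar>r\<bar> \<le> 2 ^ n" by simp
qed

lemma lookup_update': "Poly_Mapping.lookup (Poly_Mapping.update v k e) = (Poly_Mapping.lookup e)(v := k)"
  by transfer auto

lemma update_update': "Poly_Mapping.update v k (Poly_Mapping.update v l e) = Poly_Mapping.update v k e"
  by (intro poly_mapping_eqI) (simp add: lookup_update')

lemma update_same': "Poly_Mapping.lookup e v = k \<Longrightarrow> Poly_Mapping.update v k e = e"
  by (intro poly_mapping_eqI) (auto simp add: lookup_update')

text \<open>Induction on the variables. If \<open>v\<close> has exponent \<open>k\<close> in
  \<open>e\<close>, the coefficient at \<open>e\<close> sits in the entry number \<open>k\<close> of
  the list coded for \<open>v\<close>: the code of this entry is no longer than the whole, and the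
  list has more than \<open>k\<close> entries, so that \<open>k \<le> n\<close>.\<close>

lemma code_coeffs_bounds:
  assumes "finite {e. c e \<noteq> 0}" "\<And>e v. c e \<noteq> 0 \<Longrightarrow> v \<notin> set vs \<Longrightarrow> Poly_Mapping.lookup e v = 0"
    and "c e \<noteq> 0" "length (word (code_coeffs vs c)) \<le> n"
  shows "\<bar>c e\<bar> \<le> 2 ^ n \<and> (\<forall>v. Poly_Mapping.lookup e v \<le> n)"
  using assms
proof (induction vs arbitrary: c e)
  case Nil
  have e0: "e = 0" by (intro poly_mapping_eqI) (use Nil in auto)
  obtain p q where "quotient_of (c 0) = (p, q)" by fastforce
  from code_rat_bounds(3)[OF this] Nil(4) show ?case by (simp add: e0)
next
  case (Cons v vs)
  define k where "k = Poly_Mapping.lookup e v"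
  define c' where "c' = coeff_in v k c"
  define e' where "e' = Poly_Mapping.update v 0 e"
  define d where "d = (LEAST d. \<forall>k\<ge>d. coeff_in v k c = (\<lambda>_. 0))"
  have c'e': "c' e' = c e"
    by (simp add: c'_def coeff_in_def e'_def lookup_update' update_update' update_same' k_def)
  have nz: "coeff_in v j c f \<noteq> 0 \<Longrightarrow> Poly_Mapping.lookup f v = 0 \<and> c (Poly_Mapping.update v j f) \<noteq> 0" for j f
    by (auto simp: coeff_in_def split: if_splits)
  define b where "b = Suc (Max ((\<lambda>e. Poly_Mapping.lookup e v) ` {e. c e \<noteq> 0}))"
  \<comment> \<open>Only finitely many monomials occur, so the \<open>LEAST\<close> in the code is
    attained.\<close>
  have "\<forall>k\<ge>b. coeff_in v k c = (\<lambda>_. 0)"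
  proof (intro allI impI ext, rule ccontr)
    fix j f assume "j \<ge> b" and f: "coeff_in v j c f \<noteq> 0"
    have "j = Poly_Mapping.lookup (Poly_Mapping.update v j f) v" by (simp add: lookup_update')
    also have "\<dots> \<le> Max ((\<lambda>e. Poly_Mapping.lookup e v) ` {e. c e \<noteq> 0})"
      using nz[OF f] Cons.prems(1) by (intro Max_ge) auto
    finally show False using \<open>j \<ge> b\<close> by (simp add: b_def)
  qed
  then have d: "\<forall>k\<ge>d. coeff_in v k c = (\<lambda>_. 0)" unfolding d_def by (rule LeastI)
  have kd: "k < d"
  proof (rule ccontr)
    assume "\<not> k < d"
    then have "c' = (\<lambda>_. 0)" using d by (simp add: c'_def)
    then show False using c'e' Cons.prems(3) by simp
  qed
  define cs where "cs = map (\<lambda>k. code_coeffs vs (coeff_in v k c)) [0..<d]"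
  have code: "code_coeffs (v # vs) c = Seq cs" by (simp add: cs_def d_def)
  have "length cs \<le> n" using length_le_length_word_Seq[of cs] Cons.prems(4)[unfolded code] by linarith
  then have kn: "k \<le> n" using kd by (simp add: cs_def)
  have "code_coeffs vs c' \<in> set cs" using kd by (auto simp: cs_def c'_def)
  then have len: "length (word (code_coeffs vs c')) \<le> n"
    using length_word_mem[of _ cs] Cons.prems(4)[unfolded code] by fastforce
  have "\<bar>c' e'\<bar> \<le> 2 ^ n \<and> (\<forall>u. Poly_Mapping.lookup e' u \<le> n)"
  proof (rule Cons.IH[OF _ _ _ len])
    have "{f. c' f \<noteq> 0} \<subseteq> (\<lambda>e. Poly_Mapping.update v 0 e) ` {e. c e \<noteq> 0}"
    proof
      fix f assume "f \<in> {f. c' f \<noteq> 0}"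
      then have "Poly_Mapping.lookup f v = 0" "c (Poly_Mapping.update v k f) \<noteq> 0"
        using nz by (auto simp: c'_def)
      moreover have "f = Poly_Mapping.update v 0 (Poly_Mapping.update v k f)"
        using calculation(1) by (simp add: update_update' update_same')
      ultimately show "f \<in> (\<lambda>e. Poly_Mapping.update v 0 e) ` {e. c e \<noteq> 0}" by blast
    qed
    then show "finite {f. c' f \<noteq> 0}" using Cons.prems(1) finite_surj by blast
    show "Poly_Mapping.lookup f u = 0" if "c' f \<noteq> 0" "u \<notin> set vs" for f u
    proof (cases "u = v")
      case True then show ?thesis using nz that by (auto simp: c'_def)
    next
      case False
      then have "Poly_Mapping.lookup (Poly_Mapping.update v k f) u = 0"
        using Cons.prems(2)[of "Poly_Mapping.update v k f" u] nz[of k f] that by (auto simp: c'_def)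
      then show ?thesis using False by (simp add: lookup_update')
    qed
    show "c' e' \<noteq> 0" using c'e' Cons.prems(3) by simp
  qed
  moreover have "Poly_Mapping.lookup e u \<le> n" if "\<forall>u. Poly_Mapping.lookup e' u \<le> n" for u
    using that[rule_format, of u] kn by (cases "u = v") (auto simp: e'_def lookup_update' k_def)
  ultimately show ?case using c'e' by auto
qed

lemma code_qpoly_bounds:
  assumes "set vs = UNIV" "e \<in> Poly_Mapping.keys p" "length (word (code_qpoly vs p)) \<le> n"
  shows "\<bar>Poly_Mapping.lookup p e\<bar> \<le> 2 ^ n \<and> (\<forall>v. Poly_Mapping.lookup e v \<le> n)"
  using assms code_coeffs_bounds[of "Poly_Mapping.lookup p" vs e n]
  by (auto simp: code_qpoly_def in_keys_iff)

text \<open>The definite description is justified by normalizing an annihilating polynomial of least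
  degree; the difference of two such monic polynomials would annihilate \<alpha> with a smaller
  degree.\<close>

lemma min_poly_props:
  assumes "algebraic \<alpha>"
  shows "lead_coeff (min_poly \<alpha>) = 1" "poly (map_poly of_rat (min_poly \<alpha>)) \<alpha> = 0"
proof -
  define Z where "Z = {q :: rat poly. q \<noteq> 0 \<and> poly (map_poly of_rat q) \<alpha> = 0}"
  obtain p :: "real poly" where p: "\<And>i. coeff p i \<in> \<int>" "p \<noteq> 0" "poly p \<alpha> = 0"
    using assms by (auto simp: algebraic_def)
  define p' where "p' = map_poly (\<lambda>x. of_int \<lfloor>x\<rfloor> :: rat) p"
  have pp': "map_poly of_rat p' = p"
    by (intro poly_eqI) (use p(1) in \<open>auto simp: p'_def coeff_map_poly elim!: Ints_cases\<close>)
  then have "p' \<in> Z" using p by (auto simp: Z_def)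
  then have "\<exists>q. q \<in> Z \<and> (\<forall>r. r \<in> Z \<longrightarrow> degree q \<le> degree r)"
    by (rule ex_has_least_nat[where m = degree])
  then obtain q where q: "q \<in> Z" "\<And>r. r \<in> Z \<Longrightarrow> degree q \<le> degree r" by blast
  have ev_smult: "poly (map_poly of_rat (smult c r)) \<alpha> = of_rat c * poly (map_poly of_rat r) \<alpha>"
    for c :: rat and r
    by (simp add: poly_altdef coeff_map_poly degree_map_poly of_rat_mult sum_distrib_left mult.assoc)
  have ev_diff: "poly (map_poly of_rat (r - s)) \<alpha> =
      poly (map_poly of_rat r) \<alpha> - poly (map_poly of_rat s) \<alpha>" for r s :: "rat poly"
  proof -
    have "(map_poly of_rat (r - s) :: real poly) = map_poly of_rat r - map_poly of_rat s"
      by (intro poly_eqI) (simp add: coeff_map_poly of_rat_diff)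
    then show ?thesis by simp
  qed
  define q1 where "q1 = smult (inverse (lead_coeff q)) q"
  have q1: "lead_coeff q1 = 1" "poly (map_poly of_rat q1) \<alpha> = 0" "degree q1 = degree q"
    using q(1) by (auto simp: q1_def ev_smult Z_def)
  have "\<exists>!p. lead_coeff p = 1 \<and> poly (map_poly of_rat p) \<alpha> = 0 \<and>
      (\<forall>q. q \<noteq> 0 \<longrightarrow> poly (map_poly of_rat q) \<alpha> = 0 \<longrightarrow> degree p \<le> degree q)"
  proof (intro ex1I[of _ q1] conjI allI impI)
    fix r assume "r \<noteq> 0" "poly (map_poly of_rat r) \<alpha> = 0"
    then show "degree q1 \<le> degree r" using q(2)[of r] q1(3) by (simp add: Z_def)
  next
    fix r assume r: "lead_coeff r = 1 \<and> poly (map_poly of_rat r) \<alpha> = 0 \<and>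
      (\<forall>q. q \<noteq> 0 \<longrightarrow> poly (map_poly of_rat q) \<alpha> = 0 \<longrightarrow> degree r \<le> degree q)"
    have "r \<in> Z" using r by (auto simp: Z_def)
    then have dr: "degree r = degree q1"
      using r q q1(3) by (metis (mono_tags, lifting) Z_def le_antisym mem_Collect_eq)
    show "r = q1"
    proof (rule ccontr)
      assume ne: "r \<noteq> q1"
      then have "r - q1 \<in> Z" using r q1 by (auto simp: Z_def ev_diff)
      then have "degree q1 \<le> degree (r - q1)" using q(2) q1(3) by simp
      moreover have "degree (r - q1) \<le> degree q1" using degree_diff_le_max[of r q1] dr by simp
      moreover have "coeff (r - q1) (degree q1) = 0" using r q1 dr by simp
      ultimately show False using ne by (metis eq_iff_diff_eq_0 leading_coeff_0_iff le_antisym)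
    qed
  qed (use q1 in auto)
  from theI'[OF this] show "lead_coeff (min_poly \<alpha>) = 1"
    "poly (map_poly of_rat (min_poly \<alpha>)) \<alpha> = 0"
    unfolding min_poly_def by auto
qed

text \<open>
  Clearing denominators in the minimal polynomial: an integral relation whose size is bounded in terms of
  the length of the code.
\<close>

definition algebraic_bound :: "nat \<Rightarrow> nat" where
  "algebraic_bound n = 2 ^ (n * n + n)"

text \<open>The leading coefficient \<open>c\<close> stays because \<alpha> need not be an algebraic
  integer; it is \<open>c * \<alpha>\<close> that acts on a lattice of monomials.\<close>

definition integral_relation :: "nat \<Rightarrow> nat \<Rightarrow> real \<Rightarrow> nat \<Rightarrow> int \<Rightarrow> (nat \<Rightarrow> int) \<Rightarrow> bool" where
  "integral_relation n H \<alpha> d c a \<longleftrightarrow>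
     1 \<le> d \<and> d \<le> n \<and> 1 \<le> c \<and> c \<le> int H \<and> (\<forall>j. \<bar>a j\<bar> \<le> int H) \<and>
     of_int c * \<alpha> ^ d = (\<Sum>j<d. of_int (a j) * \<alpha> ^ j)"

lemma ex_integral_relation:
  assumes "algebraic \<alpha>" "length (word (code_alg \<alpha>)) \<le> n"
  shows "\<exists>d c a. integral_relation n (algebraic_bound n) \<alpha> d c a"
proof -
  define p where "p = min_poly \<alpha>"
  note mp = min_poly_props[OF assms(1), folded p_def]
  define d where "d = degree p"
  have p0: "p \<noteq> 0" using mp(1) by auto
  have d1: "d \<ge> 1"
  proof (rule ccontr)
    assume "\<not> d \<ge> 1"
    then have d0: "degree p = 0" by (simp add: d_def)
    then have "p = [:1:]" using mp(1) by (metis degree_eq_zeroE lead_coeff_pCons(2))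
    then show False using mp(2) by (simp add: map_poly_pCons)
  qed
  have len: "length (word (code_poly p)) \<le> n"
    using length_word_mem[of "code_poly p" "[code_poly (min_poly \<alpha>), Num (int (root_index \<alpha>))]"] assms(2)
    by (simp add: code_alg_def p_def)
  have lc: "length (coeffs p) = Suc d" using p0 by (simp add: length_coeffs_degree d_def)
  have dn: "Suc d \<le> n" using length_le_length_word_Seq[of "map code_rat (coeffs p)"] len lc
    by (simp add: code_poly_def)
  have coeff_len: "length (word (code_rat (coeff p j))) \<le> n" if "j \<le> d" for j
  proof -
    have "coeff p j \<in> set (coeffs p)"
      using that lc p0 by (metis coeffs_nth d_def le_imp_less_Suc nth_mem)
    then show ?thesis using length_word_mem[of "code_rat (coeff p j)" "map code_rat (coeffs p)"] len
      by (simp add: code_poly_def)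
  qed
  define q where "q j = snd (quotient_of (coeff p j))" for j
  define num where "num j = fst (quotient_of (coeff p j))" for j
  have q: "q j > 0" for j using quotient_of_denom_pos'[of "coeff p j"] by (simp add: q_def)
  have qn: "q j \<le> 2 ^ n" "\<bar>num j\<bar> \<le> 2 ^ n" if "j \<le> d" for j
    using code_rat_bounds(1,2)[of "coeff p j" "num j" "q j" n] coeff_len[OF that]
    by (auto simp: q_def num_def)
  have coef: "coeff p j = of_int (num j) / of_int (q j)" for j
    using quotient_of_div[of "coeff p j" "num j" "q j"] by (simp add: q_def num_def)
  \<comment> \<open>The product of all denominators is a crude common one: there are
    \<open>d + 1 \<le> n\<close> of them, each at most \<open>2 ^ n\<close>. The remaining factor
    \<open>2 ^ n\<close> in \<open>algebraic_bound\<close> is for a numerator.\<close>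
  define c where "c = (\<Prod>j\<le>d. q j)"
  define a where "a j = (if j < d then - (num j * (\<Prod>i\<in>{..d} - {j}. q i)) else 0)" for j
  have ca: "of_int c * coeff p j = - of_int (a j)" if "j < d" for j
  proof -
    have "c = q j * (\<Prod>i\<in>{..d} - {j}. q i)"
      unfolding c_def using that by (intro prod.remove) auto
    then show ?thesis using that q[of j] by (simp add: a_def coef)
  qed
  have "(\<Prod>j\<le>d. q j) \<le> (\<Prod>j\<le>d. 2 ^ n)"
    by (intro prod_mono) (use q qn in \<open>auto intro: less_imp_le\<close>)
  also have "\<dots> = 2 ^ (n * Suc d)" by (simp add: power_mult power_add)
  also have "\<dots> \<le> 2 ^ (n * n)" using dn by (intro power_increasing mult_le_mono) auto
  finally have c_le: "c \<le> 2 ^ (n * n)" by (simp add: c_def)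
  have "c > 0" unfolding c_def using q by (intro prod_pos) auto
  then have c1: "1 \<le> c" by simp
  have H: "int (algebraic_bound n) = 2 ^ (n * n) * 2 ^ n" by (simp add: algebraic_bound_def power_add)
  have "c \<le> 2 ^ (n * n) * 2 ^ n"
    using c_le by (meson mult_left_le one_le_power order_trans mult_le_cancel_left1 zero_le_power
        one_le_numeral zero_le_numeral le_less_trans not_less linorder_not_le mult_mono')
  then have cH: "c \<le> int (algebraic_bound n)" using H by simp
  have aH: "\<bar>a j\<bar> \<le> int (algebraic_bound n)" for j
  proof (cases "j < d")
    case True
    have "(\<Prod>i\<in>{..d} - {j}. q i) \<le> (\<Prod>i\<in>{..d} - {j}. 2 ^ n)"
      by (intro prod_mono) (use q qn in \<open>auto intro: less_imp_le\<close>)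
    also have "\<dots> = 2 ^ (n * d)" using True by (simp add: power_mult card_Diff_singleton)
    also have "\<dots> \<le> 2 ^ (n * n)" using dn by (intro power_increasing mult_le_mono) auto
    finally have *: "(\<Prod>i\<in>{..d} - {j}. q i) \<le> 2 ^ (n * n)" .
    have "0 \<le> (\<Prod>i\<in>{..d} - {j}. q i)" using q by (intro prod_nonneg) (auto intro: less_imp_le)
    then have "\<bar>a j\<bar> = \<bar>num j\<bar> * (\<Prod>i\<in>{..d} - {j}. q i)" using True by (simp add: a_def abs_mult)
    also have "\<dots> \<le> 2 ^ n * 2 ^ (n * n)"
      using qn(2)[of j] True * by (intro mult_mono) (auto intro!: prod_nonneg less_imp_le[OF q])
    finally show ?thesis using H by (simp add: mult.commute)
  qed (simp add: a_def)
  have "0 = (\<Sum>j\<le>d. of_rat (coeff p j) * \<alpha> ^ j)"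
    using mp(2) by (simp add: poly_altdef coeff_map_poly degree_map_poly d_def)
  also have "\<dots> = \<alpha> ^ d + (\<Sum>j<d. of_rat (coeff p j) * \<alpha> ^ j)"
    using mp(1) by (simp add: lessThan_Suc_atMost[symmetric] d_def)
  finally have "of_int c * (\<alpha> ^ d + (\<Sum>j<d. of_rat (coeff p j) * \<alpha> ^ j)) = 0" by simp
  moreover have "of_int c * (\<Sum>j<d. of_rat (coeff p j) * \<alpha> ^ j) = - (\<Sum>j<d. of_int (a j) * \<alpha> ^ j)"
  proof -
    have "of_int c * (of_rat (coeff p j) * \<alpha> ^ j) = - (of_int (a j) * \<alpha> ^ j)" if "j < d" for j
    proof -
      have "(of_int c * of_rat (coeff p j) :: real) = of_rat (of_int c * coeff p j)"
        by (simp add: of_rat_mult)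
      also have "\<dots> = - of_int (a j)" using ca[OF that] by (simp add: of_rat_minus)
      finally show ?thesis by (simp add: mult.assoc[symmetric])
    qed
    then show ?thesis by (simp add: sum_distrib_left sum_negf[symmetric])
  qed
  ultimately have "of_int c * \<alpha> ^ d = (\<Sum>j<d. of_int (a j) * \<alpha> ^ j)"
    by (simp add: algebra_simps)
  then have "integral_relation n (algebraic_bound n) \<alpha> d c a"
    using d1 dn c1 cH aH by (auto simp: integral_relation_def)
  then show ?thesis by blast
qed

text \<open>Cauchy's bound for roots: for \<open>\<bar>\<alpha>\<bar> \<ge> 1\<close> every lower
  term is at most \<open>H * \<bar>\<alpha>\<bar> ^ (d - 1)\<close>, and there are at most
  \<open>n\<close> of them.\<close>

lemma integral_relation_abs_le:
  assumes "integral_relation n H \<alpha> d c a"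
  shows "\<bar>\<alpha>\<bar> \<le> real n * real H + 1"
proof (rule ccontr)
  assume "\<not> ?thesis"
  then have big: "\<bar>\<alpha>\<bar> > real n * real H + 1" by simp
  then have one: "\<bar>\<alpha>\<bar> \<ge> 1" by (smt (verit) mult_nonneg_nonneg of_nat_0_le_iff)
  have d: "1 \<le> d" "d \<le> n" "1 \<le> c" "\<And>j. \<bar>a j\<bar> \<le> int H"
    and eq: "of_int c * \<alpha> ^ d = (\<Sum>j<d. of_int (a j) * \<alpha> ^ j)"
    using assms by (auto simp: integral_relation_def)
  have aH: "\<bar>real_of_int (a j)\<bar> \<le> real H" for j using d(4)[of j] by linarith
  have "\<bar>\<alpha>\<bar> * \<bar>\<alpha>\<bar> ^ (d - 1) = \<bar>\<alpha>\<bar> ^ d" using d(1) by (cases d) auto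
  also have "\<dots> \<le> \<bar>of_int c * \<alpha> ^ d\<bar>"
  proof -
    have "\<bar>\<alpha>\<bar> ^ d * 1 \<le> \<bar>\<alpha>\<bar> ^ d * of_int c" using d(3) by (intro mult_left_mono) auto
    then show ?thesis using d(3) by (simp add: abs_mult power_abs mult.commute)
  qed
  also have "\<dots> \<le> (\<Sum>j<d. \<bar>of_int (a j) * \<alpha> ^ j\<bar>)" unfolding eq by (rule sum_abs)
  also have "\<dots> \<le> (\<Sum>j<d. real H * \<bar>\<alpha>\<bar> ^ (d - 1))"
    using one aH by (intro sum_mono) (auto simp: abs_mult power_abs intro!: mult_mono power_increasing)
  also have "\<dots> = real d * real H * \<bar>\<alpha>\<bar> ^ (d - 1)" by simp
  also have "\<dots> \<le> real n * real H * \<bar>\<alpha>\<bar> ^ (d - 1)"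
    using d(2) by (intro mult_right_mono) auto
  finally have "\<bar>\<alpha>\<bar> \<le> real n * real H"
    using one by (simp add: mult_le_cancel_right split: if_splits) (smt (verit))
  then show False using big by simp
qed

text \<open>Divide the relation by the lowest power of \<delta> that occurs: its coefficient is a
  nonzero integer, while all other terms still contain a factor \<delta>, which is harmless to
  estimate when \<open>\<bar>\<delta>\<bar> < 1\<close>.\<close>

lemma integer_relation_abs_ge:
  fixes \<delta> :: real and c :: "nat \<Rightarrow> int"
  assumes rel: "(\<Sum>j\<le>D. of_int (c j) * \<delta> ^ j) = 0" and nz: "\<exists>j\<le>D. c j \<noteq> 0"
    and bd: "\<And>j. \<bar>c j\<bar> \<le> int Q" and "\<delta> \<noteq> 0"
  shows "1 \<le> \<bar>\<delta>\<bar> * (real (D * Q) + 1)"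
proof (cases "\<bar>\<delta>\<bar> \<ge> 1")
  case True
  then show ?thesis using mult_mono[of 1 "\<bar>\<delta>\<bar>" 1 "real (D * Q) + 1"] by simp
next
  case False
  define m where "m = (LEAST j. c j \<noteq> 0)"
  obtain j0 where j0: "j0 \<le> D" "c j0 \<noteq> 0" using nz by blast
  have m: "c m \<noteq> 0" "m \<le> D"
    using LeastI[of "\<lambda>j. c j \<noteq> 0", OF j0(2)] Least_le[of "\<lambda>j. c j \<noteq> 0", OF j0(2)] j0(1)
    by (auto simp: m_def)
  have below: "c j = 0" if "j < m" for j using not_less_Least[OF that[unfolded m_def]] by simp
  have cQ: "\<bar>real_of_int (c j)\<bar> \<le> real Q" for j using bd[of j] by linarith
  have "0 = of_int (c m) * \<delta> ^ m + (\<Sum>j\<in>{..D} - {m}. of_int (c j) * \<delta> ^ j)"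
    using rel m(2) by (simp add: sum.remove[of "{..D}" m])
  then have "\<bar>of_int (c m) * \<delta> ^ m\<bar> = \<bar>\<Sum>j\<in>{..D} - {m}. of_int (c j) * \<delta> ^ j\<bar>" by simp
  also have "\<dots> \<le> (\<Sum>j\<in>{..D} - {m}. \<bar>of_int (c j) * \<delta> ^ j\<bar>)" by (rule sum_abs)
  also have "\<dots> \<le> (\<Sum>j\<in>{..D} - {m}. real Q * \<bar>\<delta>\<bar> ^ Suc m)"
  proof (rule sum_mono)
    fix j assume j: "j \<in> {..D} - {m}"
    show "\<bar>of_int (c j) * \<delta> ^ j\<bar> \<le> real Q * \<bar>\<delta>\<bar> ^ Suc m"
    proof (cases "j < m")
      case True
      then show ?thesis by (simp add: below)
    next
      case False
      then have "Suc m \<le> j" using j by auto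
      then have "\<bar>\<delta>\<bar> ^ j \<le> \<bar>\<delta>\<bar> ^ Suc m" using \<open>\<not> \<bar>\<delta>\<bar> \<ge> 1\<close> by (intro power_decreasing) auto
      then show ?thesis using cQ[of j] by (auto simp: abs_mult power_abs intro!: mult_mono)
    qed
  qed
  also have "\<dots> = real (D * Q) * \<bar>\<delta>\<bar> * \<bar>\<delta>\<bar> ^ m" using m(2) by (simp add: card_Diff_singleton)
  finally have "\<bar>of_int (c m)\<bar> * \<bar>\<delta>\<bar> ^ m \<le> (real (D * Q) * \<bar>\<delta>\<bar>) * \<bar>\<delta>\<bar> ^ m"
    by (simp add: abs_mult power_abs)
  then have "\<bar>real_of_int (c m)\<bar> \<le> real (D * Q) * \<bar>\<delta>\<bar>"
    using assms(4) by (simp only: mult_le_cancel_right) auto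
  moreover have "1 \<le> \<bar>real_of_int (c m)\<bar>" using m(1) by linarith
  ultimately show ?thesis by (simp add: algebra_simps)
qed

text \<open>This keeps nonzero entries of the \<open>B i\<close> away from zero, which later bounds
  the height of the domain.\<close>

lemma integral_relation_abs_ge:
  assumes "integral_relation n H \<alpha> d c a" "\<alpha> \<noteq> 0"
  shows "1 \<le> \<bar>\<alpha>\<bar> * (real (n * H) + 1)"
proof -
  define c' where "c' j = (if j = d then c else - a j)" for j
  have *: "1 \<le> d" "d \<le> n" "1 \<le> c" "c \<le> int H" "\<And>j. \<bar>a j\<bar> \<le> int H"
    and eq: "of_int c * \<alpha> ^ d = (\<Sum>j<d. of_int (a j) * \<alpha> ^ j)"
    using assms(1) by (auto simp: integral_relation_def)
  have "(\<Sum>j\<le>d. of_int (c' j) * \<alpha> ^ j) = of_int c * \<alpha> ^ d - (\<Sum>j<d. of_int (a j) * \<alpha> ^ j)"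
    by (simp add: lessThan_Suc_atMost[symmetric] c'_def sum_negf)
  then have "(\<Sum>j\<le>d. of_int (c' j) * \<alpha> ^ j) = 0" using eq by simp
  moreover have "\<exists>j\<le>d. c' j \<noteq> 0" using *(3) by (intro exI[of _ d]) (auto simp: c'_def)
  moreover have "\<bar>c' j\<bar> \<le> int H" for j using *(3,4,5) by (auto simp: c'_def)
  ultimately have "1 \<le> \<bar>\<alpha>\<bar> * (real (d * H) + 1)"
    using assms(2) by (rule integer_relation_abs_ge)
  also have "\<dots> \<le> \<bar>\<alpha>\<bar> * (real (n * H) + 1)"
    using *(2) by (intro mult_left_mono add_right_mono) (auto simp: mult_right_mono)
  finally show ?thesis .
qed

section \<open>Determinants of algebraic matrices\<close>

text \<open>
  Multiplication by \<open>\<beta>\<close> maps the integral combinations of the \<open>v e\<close>, \<open>e \<in> E\<close>, into themselves and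
  enlarges the coefficients at most by the factor \<open>r\<close>.
\<close>

definition acts_integrally :: "'e set \<Rightarrow> ('e \<Rightarrow> real) \<Rightarrow> real \<Rightarrow> nat \<Rightarrow> bool" where
  "acts_integrally E v \<beta> r \<longleftrightarrow>
     (\<forall>(a :: 'e \<Rightarrow> int) R. (\<forall>e\<in>E. \<bar>a e\<bar> \<le> int R) \<longrightarrow>
        (\<exists>b :: 'e \<Rightarrow> int. (\<forall>e\<in>E. \<bar>b e\<bar> \<le> int (r * R)) \<and>
          \<beta> * (\<Sum>e\<in>E. of_int (a e) * v e) = (\<Sum>e\<in>E. of_int (b e) * v e)))"

lemma acts_integrallyE:
  fixes a :: "'e \<Rightarrow> int"
  assumes "acts_integrally E v \<beta> r" "\<forall>e\<in>E. \<bar>a e\<bar> \<le> int R"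
  obtains b :: "'e \<Rightarrow> int" where "\<forall>e\<in>E. \<bar>b e\<bar> \<le> int (r * R)"
    "\<beta> * (\<Sum>e\<in>E. of_int (a e) * v e) = (\<Sum>e\<in>E. of_int (b e) * v e)"
  using assms unfolding acts_integrally_def by blast

lemma acts_integrally_mono:
  assumes "acts_integrally E v \<beta> r" "r \<le> s"
  shows "acts_integrally E v \<beta> s"
  unfolding acts_integrally_def
proof (intro allI impI)
  fix a :: "'a \<Rightarrow> int" and R assume "\<forall>e\<in>E. \<bar>a e\<bar> \<le> int R"
  from acts_integrallyE[OF assms(1) this] obtain b :: "'a \<Rightarrow> int" where
    b: "\<forall>e\<in>E. \<bar>b e\<bar> \<le> int (r * R)" "\<beta> * (\<Sum>e\<in>E. of_int (a e) * v e) = (\<Sum>e\<in>E. of_int (b e) * v e)" .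
  have "int (r * R) \<le> int (s * R)" using assms(2) by (simp add: mult_right_mono)
  then show "\<exists>b. (\<forall>e\<in>E. \<bar>b e\<bar> \<le> int (s * R)) \<and>
      \<beta> * (\<Sum>e\<in>E. of_int (a e) * v e) = (\<Sum>e\<in>E. of_int (b e) * v e)"
    using b by (meson order_trans)
qed

lemma acts_integrally_of_int:
  assumes "\<bar>c\<bar> \<le> int r"
  shows "acts_integrally E v (of_int c) r"
  unfolding acts_integrally_def
proof (intro allI impI)
  fix a :: "'a \<Rightarrow> int" and R assume a: "\<forall>e\<in>E. \<bar>a e\<bar> \<le> int R"
  show "\<exists>b. (\<forall>e\<in>E. \<bar>b e\<bar> \<le> int (r * R)) \<and>
      of_int c * (\<Sum>e\<in>E. of_int (a e) * v e) = (\<Sum>e\<in>E. of_int (b e) * v e)"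
    using a assms
    by (intro exI[of _ "\<lambda>e. c * a e"])
      (auto simp: abs_mult sum_distrib_left mult.assoc intro!: mult_mono)
qed

lemma acts_integrally_mult:
  assumes "acts_integrally E v \<beta> r" "acts_integrally E v \<gamma> s"
  shows "acts_integrally E v (\<beta> * \<gamma>) (r * s)"
  unfolding acts_integrally_def
proof (intro allI impI)
  fix a :: "'a \<Rightarrow> int" and R assume a: "\<forall>e\<in>E. \<bar>a e\<bar> \<le> int R"
  from acts_integrallyE[OF assms(2) a] obtain b :: "'a \<Rightarrow> int" where
    b: "\<forall>e\<in>E. \<bar>b e\<bar> \<le> int (s * R)" "\<gamma> * (\<Sum>e\<in>E. of_int (a e) * v e) = (\<Sum>e\<in>E. of_int (b e) * v e)" .
  from acts_integrallyE[OF assms(1) b(1)] obtain c :: "'a \<Rightarrow> int" where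
    c: "\<forall>e\<in>E. \<bar>c e\<bar> \<le> int (r * (s * R))" "\<beta> * (\<Sum>e\<in>E. of_int (b e) * v e) = (\<Sum>e\<in>E. of_int (c e) * v e)" .
  show "\<exists>c. (\<forall>e\<in>E. \<bar>c e\<bar> \<le> int (r * s * R)) \<and>
      \<beta> * \<gamma> * (\<Sum>e\<in>E. of_int (a e) * v e) = (\<Sum>e\<in>E. of_int (c e) * v e)"
    using b(2) c by (intro exI[of _ c]) (simp add: mult.assoc)
qed

lemma acts_integrally_add:
  assumes "acts_integrally E v \<beta> r" "acts_integrally E v \<gamma> s"
  shows "acts_integrally E v (\<beta> + \<gamma>) (r + s)"
  unfolding acts_integrally_def
proof (intro allI impI)
  fix a :: "'a \<Rightarrow> int" and R assume a: "\<forall>e\<in>E. \<bar>a e\<bar> \<le> int R"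
  from acts_integrallyE[OF assms(1) a] obtain b :: "'a \<Rightarrow> int" where
    b: "\<forall>e\<in>E. \<bar>b e\<bar> \<le> int (r * R)" "\<beta> * (\<Sum>e\<in>E. of_int (a e) * v e) = (\<Sum>e\<in>E. of_int (b e) * v e)" .
  from acts_integrallyE[OF assms(2) a] obtain c :: "'a \<Rightarrow> int" where
    c: "\<forall>e\<in>E. \<bar>c e\<bar> \<le> int (s * R)" "\<gamma> * (\<Sum>e\<in>E. of_int (a e) * v e) = (\<Sum>e\<in>E. of_int (c e) * v e)" .
  have "\<bar>b e + c e\<bar> \<le> int ((r + s) * R)" if "e \<in> E" for e
  proof -
    have "\<bar>b e + c e\<bar> \<le> int (r * R) + int (s * R)"
      using b(1) c(1) that abs_triangle_ineq[of "b e" "c e"] by fastforce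
    then show ?thesis by (simp add: algebra_simps)
  qed
  moreover have "(\<beta> + \<gamma>) * (\<Sum>e\<in>E. of_int (a e) * v e) = (\<Sum>e\<in>E. of_int (b e + c e) * v e)"
    unfolding distrib_right b(2) c(2) by (simp add: sum.distrib distrib_right)
  ultimately show "\<exists>c. (\<forall>e\<in>E. \<bar>c e\<bar> \<le> int ((r + s) * R)) \<and>
      (\<beta> + \<gamma>) * (\<Sum>e\<in>E. of_int (a e) * v e) = (\<Sum>e\<in>E. of_int (c e) * v e)"
    by (intro exI[of _ "\<lambda>e. b e + c e"]) blast
qed

lemma acts_integrally_prod:
  assumes "finite I" "\<And>i. i \<in> I \<Longrightarrow> acts_integrally E v (\<beta> i) r"
  shows "acts_integrally E v (\<Prod>i\<in>I. \<beta> i) (r ^ card I)"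
  using assms
proof (induction I)
  case empty
  then show ?case using acts_integrally_of_int[of 1 1 E v] by simp
next
  case (insert i I)
  then show ?case using acts_integrally_mult[of E v "\<beta> i" r] by simp
qed

lemma acts_integrally_sum:
  assumes "finite I" "\<And>i. i \<in> I \<Longrightarrow> acts_integrally E v (\<beta> i) r"
  shows "acts_integrally E v (\<Sum>i\<in>I. \<beta> i) (card I * r)"
  using assms
proof (induction I)
  case empty
  then show ?case using acts_integrally_of_int[of 0 0 E v] by simp
next
  case (insert i I)
  then show ?case using acts_integrally_add[of E v "\<beta> i" r] by simp
qed

lemma acts_integrally_power:
  assumes "acts_integrally E v \<beta> r"
  shows "acts_integrally E v (\<beta> ^ k) (r ^ k)"
  using acts_integrally_prod[of "{..<k}" E v "\<lambda>_. \<beta>" r] assms by simp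

text \<open>The action on generators extends linearly; each new coefficient collects one
  contribution from every generator, hence the factor \<open>card E\<close>.\<close>

lemma acts_integrally_basis:
  assumes "finite E"
    and "\<And>e. e \<in> E \<Longrightarrow> \<exists>m :: 'e \<Rightarrow> int. (\<forall>e'\<in>E. \<bar>m e'\<bar> \<le> int s) \<and>
            \<beta> * v e = (\<Sum>e'\<in>E. of_int (m e') * v e')"
  shows "acts_integrally E v \<beta> (card E * s)"
proof -
  have "\<forall>e\<in>E. \<exists>m :: 'e \<Rightarrow> int. (\<forall>e'\<in>E. \<bar>m e'\<bar> \<le> int s) \<and> \<beta> * v e = (\<Sum>e'\<in>E. of_int (m e') * v e')"
    using assms(2) by blast
  then obtain m :: "'e \<Rightarrow> 'e \<Rightarrow> int" where
    m: "\<And>e e'. e \<in> E \<Longrightarrow> e' \<in> E \<Longrightarrow> \<bar>m e e'\<bar> \<le> int s"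
      "\<And>e. e \<in> E \<Longrightarrow> \<beta> * v e = (\<Sum>e'\<in>E. of_int (m e e') * v e')"
    by metis
  show ?thesis unfolding acts_integrally_def
  proof (intro allI impI)
    fix a :: "'e \<Rightarrow> int" and R assume a: "\<forall>e\<in>E. \<bar>a e\<bar> \<le> int R"
    define b where "b e' = (\<Sum>e\<in>E. a e * m e e')" for e'
    have "\<bar>b e'\<bar> \<le> int (card E * s * R)" if "e' \<in> E" for e'
    proof -
      have "\<bar>b e'\<bar> \<le> (\<Sum>e\<in>E. \<bar>a e * m e e'\<bar>)" unfolding b_def by (rule sum_abs)
      also have "\<dots> \<le> (\<Sum>e\<in>E. int R * int s)"
        using a m(1) that by (intro sum_mono) (auto simp: abs_mult intro!: mult_mono)
      finally show ?thesis by (simp add: algebra_simps)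
    qed
    moreover have "\<beta> * (\<Sum>e\<in>E. of_int (a e) * v e) = (\<Sum>e\<in>E. of_int (b e) * v e)"
    proof -
      have "\<beta> * (\<Sum>e\<in>E. of_int (a e) * v e) = (\<Sum>e\<in>E. of_int (a e) * (\<beta> * v e))"
        by (simp add: sum_distrib_left algebra_simps)
      also have "\<dots> = (\<Sum>e\<in>E. \<Sum>e'\<in>E. of_int (a e) * (of_int (m e e') * v e'))"
        by (intro sum.cong) (simp_all add: m(2) sum_distrib_left)
      also have "\<dots> = (\<Sum>e'\<in>E. \<Sum>e\<in>E. of_int (a e) * (of_int (m e e') * v e'))"
        by (rule sum.swap)
      finally show ?thesis by (simp add: b_def sum_distrib_right mult.assoc)
    qed
    ultimately show "\<exists>b. (\<forall>e\<in>E. \<bar>b e\<bar> \<le> int (card E * s * R)) \<and>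
        \<beta> * (\<Sum>e\<in>E. of_int (a e) * v e) = (\<Sum>e\<in>E. of_int (b e) * v e)" by blast
  qed
qed

text \<open>
  A real number acting on a lattice of rank \<open>D\<close> is a root of an integer polynomial of degree at most
  \<open>D\<close>; the pigeonhole principle (Siegel's lemma) bounds its coefficients.
\<close>

lemma acts_integrally_abs_ge:
  fixes \<delta> :: real
  assumes "finite E" "e0 \<in> E" "v e0 \<noteq> 0" "acts_integrally E v \<delta> r" "r \<ge> 1" "\<delta> \<noteq> 0"
  defines "D \<equiv> card E"
  shows "1 \<le> \<bar>\<delta>\<bar> * (real (D * (2 * (D + 1) * r ^ D + 1) ^ D) + 1)"
proof -
  define X where "X = r ^ D"
  \<comment> \<open>Chosen for the count below: there are \<open>(Q + 1) ^ (D + 1)\<close>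
    coefficient vectors, but at most
    \<open>(2 * (D + 1) * X + 1) ^ D * (Q + 1) ^ D = Q * (Q + 1) ^ D\<close> values of the map
    \<open>F\<close>.\<close>
  define Q where "Q = (2 * (D + 1) * X + 1) ^ D"
  have "\<exists>b :: 'a \<Rightarrow> int. (\<forall>e\<in>E. \<bar>b e\<bar> \<le> int X) \<and> \<delta> ^ j * v e0 = (\<Sum>e\<in>E. of_int (b e) * v e)"
    if "j \<le> D" for j
  proof -
    define u :: "'a \<Rightarrow> int" where "u e = (if e = e0 then 1 else 0)" for e
    have "\<forall>e\<in>E. \<bar>u e\<bar> \<le> int 1" by (simp add: u_def)
    from acts_integrallyE[OF acts_integrally_power[OF assms(4), of j] this]
    obtain b :: "'a \<Rightarrow> int" where b: "\<forall>e\<in>E. \<bar>b e\<bar> \<le> int (r ^ j * 1)"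
      "\<delta> ^ j * (\<Sum>e\<in>E. of_int (u e) * v e) = (\<Sum>e\<in>E. of_int (b e) * v e)" .
    have "(\<Sum>e\<in>E. of_int (u e) * v e) = (\<Sum>e\<in>E. if e = e0 then v e else 0)"
      by (intro sum.cong) (auto simp: u_def)
    also have "\<dots> = v e0" using assms(1,2) by simp
    finally have "\<delta> ^ j * v e0 = (\<Sum>e\<in>E. of_int (b e) * v e)" using b(2) by simp
    moreover have "int (r ^ j * 1) \<le> int X"
      unfolding X_def using power_increasing[OF that assms(5)] by (simp del: of_nat_power)
    ultimately show ?thesis using b(1) by (meson order_trans)
  qed
  then obtain b :: "nat \<Rightarrow> 'a \<Rightarrow> int" where
    b: "\<And>j e. j \<le> D \<Longrightarrow> e \<in> E \<Longrightarrow> \<bar>b j e\<bar> \<le> int X"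
      "\<And>j. j \<le> D \<Longrightarrow> \<delta> ^ j * v e0 = (\<Sum>e\<in>E. of_int (b j e) * v e)"
    by metis
  define S :: "(nat \<Rightarrow> int) set" where "S = (\<Pi>\<^sub>E j\<in>{..D}. {0..int Q})"
  define Y where "Y = int ((D + 1) * Q * X)"
  define T :: "('a \<Rightarrow> int) set" where "T = (\<Pi>\<^sub>E e\<in>E. {-Y..Y})"
  define F where "F c = (\<lambda>e\<in>E. \<Sum>j\<le>D. c j * b j e)" for c :: "nat \<Rightarrow> int"
  have FT: "F ` S \<subseteq> T"
  proof
    fix g assume "g \<in> F ` S"
    then obtain c where c: "c \<in> S" "g = F c" by blast
    have "\<bar>\<Sum>j\<le>D. c j * b j e\<bar> \<le> Y" if e: "e \<in> E" for e
    proof -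
      have "\<bar>\<Sum>j\<le>D. c j * b j e\<bar> \<le> (\<Sum>j\<le>D. \<bar>c j * b j e\<bar>)" by (rule sum_abs)
      also have "\<dots> \<le> (\<Sum>j\<le>D. int Q * int X)"
        using c(1) b(1) e by (intro sum_mono) (auto simp: S_def abs_mult PiE_iff intro!: mult_mono)
      finally show ?thesis by (simp add: Y_def algebra_simps)
    qed
    then show "g \<in> T" using c(2) by (auto simp: T_def F_def abs_le_iff minus_le_iff)
  qed
  have cardS: "card S = (Q + 1) ^ (D + 1)" by (simp add: S_def card_PiE nat_add_distrib)
  have "card T = (2 * (D + 1) * Q * X + 1) ^ D"
  proof -
    have "Y - - Y + 1 = int (2 * (D + 1) * Q * X + 1)" by (simp add: Y_def algebra_simps)
    then have "nat (Y - - Y + 1) = 2 * (D + 1) * Q * X + 1" by (simp only: nat_int)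
    then show ?thesis using assms(1) by (simp add: T_def card_PiE D_def)
  qed
  also have "\<dots> \<le> ((2 * (D + 1) * X + 1) * (Q + 1)) ^ D"
    by (intro power_mono) (auto simp: algebra_simps)
  also have "\<dots> = Q * (Q + 1) ^ D" unfolding power_mult_distrib by (simp only: Q_def[symmetric])
  also have "\<dots> < card S" unfolding cardS by simp
  finally have "card (F ` S) < card S"
    using card_mono[OF _ FT] assms(1) by (auto simp: T_def finite_PiE)
  then have "\<not> inj_on F S" by (rule pigeonhole)
  then obtain c c' where cc: "c \<in> S" "c' \<in> S" "F c = F c'" "c \<noteq> c'" by (auto simp: inj_on_def)
  \<comment> \<open>Two colliding vectors have entries in \<open>{0..Q}\<close>, so their difference
    is a nontrivial relation between the powers of \<delta> with entries at most
    \<open>Q\<close>.\<close>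
  define q where "q j = (if j \<le> D then c j - c' j else 0)" for j
  have "(\<Sum>j\<le>D. of_int (q j) * \<delta> ^ j) * v e0 = (\<Sum>j\<le>D. of_int (q j) * (\<delta> ^ j * v e0))"
    by (simp add: sum_distrib_right mult.assoc)
  also have "\<dots> = (\<Sum>j\<le>D. \<Sum>e\<in>E. of_int (q j) * (of_int (b j e) * v e))"
    by (intro sum.cong) (simp_all add: b(2) sum_distrib_left)
  also have "\<dots> = (\<Sum>e\<in>E. \<Sum>j\<le>D. of_int (q j) * (of_int (b j e) * v e))" by (rule sum.swap)
  also have "\<dots> = (\<Sum>e\<in>E. of_int (F c e - F c' e) * v e)"
  proof (rule sum.cong[OF refl])
    fix e assume "e \<in> E"
    then have "F c e - F c' e = (\<Sum>j\<le>D. q j * b j e)"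
      by (simp add: F_def q_def sum_subtractf[symmetric] left_diff_distrib)
    then show "(\<Sum>j\<le>D. of_int (q j) * (of_int (b j e) * v e)) = of_int (F c e - F c' e) * v e"
      by (simp add: sum_distrib_right mult.assoc)
  qed
  also have "\<dots> = 0" using cc(3) by simp
  finally have "(\<Sum>j\<le>D. of_int (q j) * \<delta> ^ j) = 0" using assms(3) by simp
  moreover have "\<exists>j\<le>D. q j \<noteq> 0"
  proof (rule ccontr)
    assume "\<not> (\<exists>j\<le>D. q j \<noteq> 0)"
    then have "c = c'" using cc(1,2) by (intro PiE_ext[of c "{..D}"]) (auto simp: S_def q_def)
    then show False using cc(4) by simp
  qed
  moreover have "\<bar>q j\<bar> \<le> int Q" for j
    using cc(1,2) by (auto simp: q_def S_def PiE_iff abs_le_iff) (smt (verit) atMost_iff)+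
  ultimately have "1 \<le> \<bar>\<delta>\<bar> * (real (D * Q) + 1)"
    using assms(6) by (rule integer_relation_abs_ge)
  then show ?thesis by (simp add: Q_def X_def)
qed

text \<open>The lattice is spanned by the monomials with exponents \<open>e k < d k\<close>.
  Multiplication by \<open>\<alpha> i\<close> raises one exponent; only from the top exponent does
  it leave the range, and there the relation for \<open>\<alpha> i\<close> brings it back. The
  factor \<open>c i\<close> is what that relation costs.\<close>

lemma acts_integrally_generator:
  fixes \<alpha> :: "'k::finite \<Rightarrow> real"
  assumes rel: "\<And>k. integral_relation n H (\<alpha> k) (d k) (c k) (a k)"
  defines "E \<equiv> \<Pi>\<^sub>E k\<in>UNIV. {..<d k}"
  defines "v \<equiv> \<lambda>e. \<Prod>k\<in>UNIV. \<alpha> k ^ e k"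
  shows "acts_integrally E v (of_int (c i) * \<alpha> i) (card E * H)"
proof (rule acts_integrally_basis)
  show "finite E" by (simp add: E_def finite_PiE)
  fix e assume e: "e \<in> E"
  have d: "1 \<le> d k" "1 \<le> c k" "c k \<le> int H" "\<bar>a k j\<bar> \<le> int H"
    and eq: "of_int (c k) * \<alpha> k ^ d k = (\<Sum>j<d k. of_int (a k j) * \<alpha> k ^ j)" for k j
    using rel[of k] by (auto simp: integral_relation_def)
  have upd: "v (e(i := j)) = \<alpha> i ^ j * (\<Prod>k\<in>UNIV - {i}. \<alpha> k ^ e k)" for j
  proof -
    have "v (e(i := j)) = \<alpha> i ^ (e(i := j)) i * (\<Prod>k\<in>UNIV - {i}. \<alpha> k ^ (e(i := j)) k)"
      unfolding v_def by (intro prod.remove) auto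
    then show ?thesis by simp
  qed
  have ei: "v e = \<alpha> i ^ e i * (\<Prod>k\<in>UNIV - {i}. \<alpha> k ^ e k)" using upd[of "e i"] by simp
  show "\<exists>m :: ('k \<Rightarrow> nat) \<Rightarrow> int. (\<forall>e'\<in>E. \<bar>m e'\<bar> \<le> int H) \<and>
      of_int (c i) * \<alpha> i * v e = (\<Sum>e'\<in>E. of_int (m e') * v e')"
  proof (cases "Suc (e i) < d i")
    case True
    define e1 where "e1 = e(i := Suc (e i))"
    have e1: "e1 \<in> E" using e True by (auto simp: E_def e1_def PiE_iff)
    have "(\<Sum>e'\<in>E. of_int (if e' = e1 then c i else 0) * v e') = (\<Sum>e'\<in>E. if e' = e1 then of_int (c i) * v e' else 0)"
      by (intro sum.cong) auto
    also have "\<dots> = of_int (c i) * v e1" using e1 by (simp add: E_def finite_PiE)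
    finally have "of_int (c i) * \<alpha> i * v e = (\<Sum>e'\<in>E. of_int (if e' = e1 then c i else 0) * v e')"
      by (simp add: e1_def upd ei)
    moreover have "\<bar>c i\<bar> \<le> int H" using d(2,3)[of i] by linarith
    ultimately show ?thesis by (intro exI[of _ "\<lambda>e'. if e' = e1 then c i else 0"]) auto
  next
    case False
    then have ed: "Suc (e i) = d i" using e by (auto simp: E_def PiE_iff) (metis Suc_lessI lessThan_iff UNIV_I)
    define m where "m e' = (if \<exists>j<d i. e' = e(i := j) then a i (e' i) else 0)" for e'
    define I where "I = (\<lambda>j. e(i := j)) ` {..<d i}"
    have inj: "inj_on (\<lambda>j. e(i := j)) {..<d i}"
      by (intro inj_onI) (metis fun_upd_same)
    have I: "I \<subseteq> E" using e by (auto simp: E_def PiE_iff I_def)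
    have "(\<Sum>e'\<in>E. of_int (m e') * v e') = (\<Sum>e'\<in>I. of_int (m e') * v e')"
      using I by (intro sum.mono_neutral_right) (auto simp: m_def I_def E_def finite_PiE)
    also have "\<dots> = (\<Sum>j<d i. of_int (m (e(i := j))) * v (e(i := j)))"
      unfolding I_def by (simp add: sum.reindex[OF inj])
    also have "\<dots> = (\<Sum>j<d i. of_int (a i j) * \<alpha> i ^ j) * (\<Prod>k\<in>UNIV - {i}. \<alpha> k ^ e k)"
      unfolding sum_distrib_right by (intro sum.cong) (auto simp: m_def upd)
    also have "(\<Sum>j<d i. of_int (a i j) * \<alpha> i ^ j) = of_int (c i) * \<alpha> i * \<alpha> i ^ e i"
      using eq[of i] unfolding ed[symmetric] by simp
    also have "\<dots> * (\<Prod>k\<in>UNIV - {i}. \<alpha> k ^ e k) = of_int (c i) * \<alpha> i * v e"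
      unfolding ei by simp
    finally show ?thesis using d by (intro exI[of _ m]) (auto simp: m_def)
  qed
qed

text \<open>Here \<open>D\<close> bounds the number of monomials in the \<open>m * m\<close>
  entries, \<open>r\<close> the growth of coefficients under the determinant with denominators
  cleared, and the outer power of \<open>H\<close> the clearing factor; the rest is the bound from
  Siegel's lemma.\<close>

definition det_bound :: "nat \<Rightarrow> nat \<Rightarrow> nat" where
  "det_bound m n =
     (let H = algebraic_bound n; D = n ^ (m * m); r = fact m * (H ^ (m * m) * (D * H)) ^ m
      in (H ^ (m * m)) ^ m * (D * (2 * (D + 1) * r ^ D + 1) ^ D + 1))"

text \<open>With \<open>C\<close> the product of all leading coefficients, Leibniz' formula writes
  \<open>C ^ m * det A\<close> as a signed sum of \<open>fact m\<close> products of the numbers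
  \<open>C * \<alpha> k\<close>, each of which acts integrally on the same lattice.\<close>

lemma algebraic_det_ge:
  fixes A :: "'n::finite sqmat"
  assumes alg: "algebraic_matrix A" and len: "\<And>i j. length (word (code_alg (A $ i $ j))) \<le> n"
    and nz: "det A \<noteq> 0"
  shows "1 \<le> \<bar>det A\<bar> * real (det_bound (CARD('n)) n)"
proof -
  define m where "m = CARD('n)"
  define H where "H = algebraic_bound n"
  define \<alpha> where "\<alpha> k = A $ fst k $ snd k" for k :: "'n \<times> 'n"
  have "\<forall>k. \<exists>d c a. integral_relation n H (\<alpha> k) d c a"
    using ex_integral_relation alg len by (auto simp: \<alpha>_def H_def algebraic_matrix_def)
  then obtain d c a where rel: "\<And>k. integral_relation n H (\<alpha> k) (d k) (c k) (a k)" by metis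
  have c: "1 \<le> c k" "c k \<le> int H" and d: "1 \<le> d k" "d k \<le> n" for k
    using rel[of k] by (auto simp: integral_relation_def)
  define E where "E = (\<Pi>\<^sub>E k\<in>(UNIV :: ('n \<times> 'n) set). {..<d k})"
  define v where "v = (\<lambda>e. \<Prod>k\<in>UNIV. \<alpha> k ^ e k)"
  define D where "D = n ^ (m * m)"
  have cE: "card E \<le> D"
  proof -
    have "card E = (\<Prod>k\<in>UNIV. d k)" by (simp add: E_def card_PiE)
    also have "\<dots> \<le> (\<Prod>k\<in>(UNIV :: ('n \<times> 'n) set). n)" using d by (intro prod_mono) auto
    finally show ?thesis by (simp add: D_def m_def)
  qed
  have H1: "H \<ge> 1" using c[of undefined] by linarith
  define C where "C = (\<Prod>k\<in>UNIV. c k)"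
  have C: "1 \<le> C" "C \<le> int H ^ (m * m)"
  proof -
    have "(\<Prod>k\<in>(UNIV :: ('n \<times> 'n) set). 1) \<le> C" unfolding C_def using c by (intro prod_mono) auto
    then show "1 \<le> C" by simp
    have "C \<le> (\<Prod>k\<in>(UNIV :: ('n \<times> 'n) set). int H)"
      unfolding C_def using c by (intro prod_mono) (auto intro: order_trans[of 0 1])
    then show "C \<le> int H ^ (m * m)" by (simp add: m_def)
  qed
  define s where "s = H ^ (m * m) * (D * H)"
  have entry: "acts_integrally E v (of_int C * \<alpha> k) s" for k
  proof -
    define P where "P = (\<Prod>k'\<in>UNIV - {k}. c k')"
    have "C = P * c k" unfolding C_def P_def by (subst prod.remove[of _ k]) auto
    have "0 \<le> P" unfolding P_def using c by (intro prod_nonneg) (auto intro: order_trans[of 0 1])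
    moreover have "P * 1 \<le> P * c k" using c \<open>0 \<le> P\<close> by (intro mult_left_mono) auto
    ultimately have "\<bar>P\<bar> \<le> int (H ^ (m * m))" using C(2) \<open>C = P * c k\<close> by simp
    from acts_integrally_mult[OF acts_integrally_of_int[OF this]
        acts_integrally_generator[of n H \<alpha> d c a k, OF rel]]
    have "acts_integrally E v (of_int P * (of_int (c k) * \<alpha> k)) (H ^ (m * m) * (card E * H))"
      by (simp add: E_def v_def)
    then have "acts_integrally E v (of_int P * (of_int (c k) * \<alpha> k)) s"
      by (rule acts_integrally_mono) (use cE in \<open>auto simp: s_def intro!: mult_le_mono\<close>)
    then show ?thesis using \<open>C = P * c k\<close> by (simp add: mult.assoc)
  qed
  define r where "r = fact m * s ^ m"
  have r: "acts_integrally E v (of_int C ^ m * det A) r"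
  proof -
    have "of_int C ^ m * det A =
        (\<Sum>p | p permutes (UNIV :: 'n set). of_int (sign p) * (\<Prod>i\<in>UNIV. of_int C * \<alpha> (i, p i)))"
      unfolding det_def sum_distrib_left
      by (intro sum.cong) (simp_all add: \<alpha>_def prod.distrib m_def mult_ac)
    moreover have "acts_integrally E v (of_int (sign p) * (\<Prod>i\<in>UNIV. of_int C * \<alpha> (i, p i))) (1 * s ^ m)"
      for p :: "'n \<Rightarrow> 'n"
      using acts_integrally_mult[OF acts_integrally_of_int[of "sign p" 1 E v]
          acts_integrally_prod[of UNIV E v "\<lambda>i. of_int C * \<alpha> (i, p i)" s]] entry
      by (simp add: sign_def m_def)
    ultimately show ?thesis
      using acts_integrally_sum[of "{p. p permutes (UNIV :: 'n set)}" E v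
          "\<lambda>p. of_int (sign p) * (\<Prod>i\<in>UNIV. of_int C * \<alpha> (i, p i))" "1 * s ^ m"]
      by (simp add: finite_permutations card_permutations[OF refl] r_def m_def)
  qed
  \<comment> \<open>The monomial \<open>1\<close> is a nonzero lattice vector, so a relation between
    its multiples by powers of a number is a relation for the number itself.\<close>
  define e0 :: "'n \<times> 'n \<Rightarrow> nat" where "e0 = (\<lambda>_. 0)"
  have e0: "e0 \<in> E" "v e0 \<noteq> 0" using d by (auto simp: e0_def E_def v_def PiE_iff Suc_le_eq)
  have fE: "finite E" by (simp add: E_def finite_PiE)
  have "card E \<ge> 1" using e0 fE by (metis One_nat_def Suc_leI card_gt_0_iff empty_iff)
  then have D1: "D \<ge> 1" using cE by simp
  have "r \<ge> 1" using H1 D1 by (simp add: r_def s_def)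
  let ?B = "\<lambda>D. D * (2 * (D + 1) * r ^ D + 1) ^ D"
  have "1 \<le> \<bar>of_int C ^ m * det A\<bar> * (real (?B (card E)) + 1)"
    by (rule acts_integrally_abs_ge[OF fE e0 r \<open>r \<ge> 1\<close>]) (use nz C in auto)
  also have "\<dots> \<le> \<bar>of_int C ^ m * det A\<bar> * (real (?B D) + 1)"
  proof -
    have "r ^ card E \<le> r ^ D" using cE \<open>r \<ge> 1\<close> by (rule power_increasing)
    then have "2 * (card E + 1) * r ^ card E + 1 \<le> 2 * (D + 1) * r ^ D + 1"
      using cE by (intro add_mono mult_le_mono) auto
    then have "(2 * (card E + 1) * r ^ card E + 1) ^ card E \<le> (2 * (D + 1) * r ^ D + 1) ^ D"
      using cE by (meson le_add2 order_trans power_increasing power_mono zero_le)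
    then have "?B (card E) \<le> ?B D" using cE by (intro mult_le_mono)
    then show ?thesis by (intro mult_left_mono) (simp_all only: of_nat_le_iff add_le_cancel_right abs_ge_zero)
  qed
  also have "\<dots> \<le> (real ((H ^ (m * m)) ^ m) * \<bar>det A\<bar>) * (real (?B D) + 1)"
  proof -
    have "\<bar>of_int C ^ m :: real\<bar> \<le> real ((H ^ (m * m)) ^ m)"
      using C by (simp add: power_abs[symmetric] del: of_nat_power) (metis (no_types, opaque_lifting)
          of_int_le_iff of_int_of_nat_eq of_nat_power order_trans power_mono zero_le_one of_int_0_le_iff)
    then show ?thesis unfolding abs_mult by (intro mult_right_mono) auto
  qed
  also have "\<dots> = \<bar>det A\<bar> * real (det_bound m n)"
  proof -
    have "det_bound m n = (H ^ (m * m)) ^ m * (?B D + 1)"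
      by (simp only: det_bound_def Let_def H_def D_def r_def s_def)
    then show ?thesis by (simp only: of_nat_mult of_nat_add of_nat_1 mult_ac)
  qed
  finally show ?thesis by (simp add: m_def)
qed

section \<open>Generalized eigenvalues and the splitting of the flux\<close>

definition energy :: "real ^ 'n ^ 'n \<Rightarrow> real ^ 'n \<Rightarrow> real" where
  "energy M x = x \<bullet> (M *v x)"

definition pos_semidef :: "real ^ 'n ^ 'n \<Rightarrow> bool" where
  "pos_semidef M \<longleftrightarrow> symmetric_matrix M \<and> (\<forall>x. 0 \<le> energy M x)"

lemma symmetric_inner: "symmetric_matrix M \<Longrightarrow> x \<bullet> (M *v y) = y \<bullet> (M *v x)"
  by (metis dot_lmul_matrix inner_commute symmetric_matrix_def transpose_matrix_vector)

lemma energy_add: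
  assumes "symmetric_matrix M"
  shows "energy M (x + y) = energy M x + 2 * (x \<bullet> (M *v y)) + energy M y"
  using symmetric_inner[OF assms, of x y]
  by (simp add: energy_def matrix_vector_right_distrib inner_add_left inner_add_right)

lemma matrix_vector_minus: "M *v (- x) = - (M *v x)" for M :: "real ^ 'n ^ 'm"
  by (rule linear_neg[OF matrix_vector_mul_linear])

lemma energy_scaleR: "energy M (c *\<^sub>R x) = c\<^sup>2 * energy M x"
  by (simp add: energy_def power2_eq_square matrix_vector_mult_scaleR)

lemma energy_minus [simp]: "energy M (- x) = energy M x"
  using energy_scaleR[of M "-1" x] by simp

lemma energy_0 [simp]: "energy M 0 = 0"
  by (simp add: energy_def)

lemma energy_diff_matrix: "energy (M - K) x = energy M x - energy K x"
  by (simp add: energy_def matrix_vector_mult_diff_rdistrib inner_diff_right)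

text \<open>Young's inequality for the form \<open>M\<close>, read off from the nonnegative energy
  of \<open>s *\<^sub>R x - y\<close>.\<close>

lemma inner_le_energies:
  assumes "pos_semidef M" "s > 0"
  shows "2 * (x \<bullet> (M *v y)) \<le> s * energy M x + energy M y / s"
proof -
  have sym: "symmetric_matrix M" using assms by (simp add: pos_semidef_def)
  have "0 \<le> energy M (s *\<^sub>R x + (- y))" using assms by (simp add: pos_semidef_def)
  also have "\<dots> = s\<^sup>2 * energy M x - 2 * s * (x \<bullet> (M *v y)) + energy M y"
    unfolding energy_add[OF sym] by (simp add: energy_scaleR matrix_vector_mult_scaleR matrix_vector_minus)
  finally have "s * (2 * (x \<bullet> (M *v y))) \<le> s * (s * energy M x) + energy M y"
    by (simp add: power2_eq_square)
  then have "s * (2 * (x \<bullet> (M *v y))) / s \<le> (s * (s * energy M x) + energy M y) / s"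
    using assms(2) by (intro divide_right_mono) auto
  then show ?thesis using assms(2) by (simp add: add_divide_distrib)
qed

text \<open>Young's inequality for \<open>M *v x\<close> and \<open>x\<close>, where the second
  energy vanishes, bounds \<open>\<bar>M x\<bar>\<^sup>2\<close> by arbitrarily small multiples of a
  fixed number.\<close>

lemma pos_semidef_null:
  assumes "pos_semidef M" "energy M x = 0"
  shows "M *v x = 0"
proof -
  have "(M *v x) \<bullet> (M *v x) \<le> e" if "e > 0" for e
  proof -
    define s where "s = e / (energy M (M *v x) + 1)"
    have nn: "energy M (M *v x) \<ge> 0" using assms by (simp add: pos_semidef_def)
    then have s: "s > 0" "s * energy M (M *v x) \<le> e" using that by (auto simp: s_def field_simps)
    have "2 * ((M *v x) \<bullet> (M *v x)) \<le> e"
      using inner_le_energies[OF assms(1) s(1), of "M *v x" x] assms(2) s(2) by simp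
    then show ?thesis using inner_ge_zero[of "M *v x"] by linarith
  qed
  then have "(M *v x) \<bullet> (M *v x) \<le> 0" by (rule field_le_epsilon[of _ 0, simplified]) 
  then show ?thesis by (metis inner_eq_zero_iff inner_ge_zero order_antisym)
qed

lemma positive_definite_energy: "positive_definite A \<Longrightarrow> x \<noteq> 0 \<Longrightarrow> 0 < energy A x"
  by (simp add: positive_definite_def energy_def)

lemma positive_definite_pos_semidef: "positive_definite A \<Longrightarrow> pos_semidef A"
  unfolding pos_semidef_def
  by (metis energy_0 less_eq_real_def positive_definite_def positive_definite_energy)

lemma positive_definite_symmetric: "positive_definite A \<Longrightarrow> symmetric_matrix A"
  by (simp add: positive_definite_def)

lemma matrix_inv_mult:
  fixes A :: "real ^ 'n ^ 'n"
  assumes "invertible A"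
  shows "A ** matrix_inv A = mat 1" "matrix_inv A ** A = mat 1"
  using someI_ex[OF assms[unfolded invertible_def]] by (auto simp: matrix_inv_def)

lemma matrix_inv_vector:
  fixes A :: "real ^ 'n ^ 'n"
  assumes "invertible A"
  shows "A *v (matrix_inv A *v x) = x" "matrix_inv A *v (A *v x) = x"
  using matrix_inv_mult[OF assms] by (simp_all add: matrix_vector_mul_assoc)

lemma positive_definite_invertible:
  fixes A :: "real ^ 'n ^ 'n"
  assumes "positive_definite A"
  shows "invertible A"
proof -
  have "\<forall>x. A *v x = 0 \<longrightarrow> x = 0"
    using assms by (metis inner_zero_right less_irrefl positive_definite_def)
  then show ?thesis
    by (metis invertible_left_inverse matrix_left_invertible_ker)
qed

text \<open>Eigenvectors for different eigenvalues are orthogonal for the inner product of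
  \<open>A\<close>, hence independent, so there are at most \<open>CARD('n)\<close>
  eigenvalues.\<close>

lemma finite_generalized_eigenvalues:
  fixes A B :: "real ^ 'n ^ 'n"
  assumes "positive_definite A" "symmetric_matrix B"
  shows "finite (eigenvalues (matrix_inv A ** B))"
proof (rule ccontr)
  let ?E = "eigenvalues (matrix_inv A ** B)"
  assume "infinite ?E"
  then obtain F where F: "finite F" "card F = CARD('n) + 1" "F \<subseteq> ?E"
    using infinite_arbitrarily_large by blast
  note inv = matrix_inv_vector[OF positive_definite_invertible[OF assms(1)]]
  note A = positive_definite_symmetric[OF assms(1)]
  have "\<forall>\<mu>\<in>F. \<exists>v. v \<noteq> 0 \<and> B *v v = \<mu> *\<^sub>R (A *v v)"
  proof
    fix \<mu> assume "\<mu> \<in> F"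
    then obtain v where "v \<noteq> 0" "(matrix_inv A ** B) *v v = \<mu> *\<^sub>R v"
      using F(3) by (auto simp: eigenvalues_def)
    then have "A *v (matrix_inv A *v (B *v v)) = \<mu> *\<^sub>R (A *v v)"
      by (simp add: matrix_vector_mul_assoc[symmetric] matrix_vector_mult_scaleR)
    then show "\<exists>v. v \<noteq> 0 \<and> B *v v = \<mu> *\<^sub>R (A *v v)" using \<open>v \<noteq> 0\<close> inv by auto
  qed
  then obtain v where v: "\<And>\<mu>. \<mu> \<in> F \<Longrightarrow> v \<mu> \<noteq> 0" "\<And>\<mu>. \<mu> \<in> F \<Longrightarrow> B *v v \<mu> = \<mu> *\<^sub>R (A *v v \<mu>)"
    by metis
  have orth: "v \<nu> \<bullet> (A *v v \<mu>) = 0" if "\<mu> \<in> F" "\<nu> \<in> F" "\<mu> \<noteq> \<nu>" for \<mu> \<nu>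
  proof -
    have "\<mu> * (v \<nu> \<bullet> (A *v v \<mu>)) = v \<nu> \<bullet> (B *v v \<mu>)" using v(2)[OF that(1)] by simp
    also have "\<dots> = v \<mu> \<bullet> (B *v v \<nu>)" by (rule symmetric_inner[OF assms(2)])
    also have "\<dots> = \<nu> * (v \<nu> \<bullet> (A *v v \<mu>))" using v(2)[OF that(2)] symmetric_inner[OF A] by simp
    finally show ?thesis using that(3) by simp
  qed
  have pos: "v \<mu> \<bullet> (A *v v \<mu>) > 0" if "\<mu> \<in> F" for \<mu>
    using v(1)[OF that] assms(1) by (simp add: positive_definite_def)
  have inj: "inj_on v F"
  proof (rule inj_onI, rule ccontr)
    fix \<mu> \<nu> assume "\<mu> \<in> F" "\<nu> \<in> F" "v \<mu> = v \<nu>" "\<mu> \<noteq> \<nu>"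
    then show False using orth[of \<mu> \<nu>] pos[of \<mu>] by simp
  qed
  have "independent (v ` F)"
  proof (rule independent_if_scalars_zero)
    show "finite (v ` F)" using F by simp
    fix f x assume s: "(\<Sum>x\<in>v ` F. f x *\<^sub>R x) = 0" and "x \<in> v ` F"
    then obtain \<nu> where \<nu>: "\<nu> \<in> F" "x = v \<nu>" by blast
    have "0 = (\<Sum>\<mu>\<in>F. f (v \<mu>) *\<^sub>R v \<mu>) \<bullet> (A *v v \<nu>)"
      using s by (simp add: sum.reindex[OF inj])
    also have "\<dots> = (\<Sum>\<mu>\<in>F. f (v \<mu>) * (v \<mu> \<bullet> (A *v v \<nu>)))" by (simp add: inner_sum_left)
    also have "\<dots> = (\<Sum>\<mu>\<in>F. if \<mu> = \<nu> then f (v \<nu>) * (v \<nu> \<bullet> (A *v v \<nu>)) else 0)"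
      using orth \<nu>(1) by (intro sum.cong) auto
    also have "\<dots> = f x * (v \<nu> \<bullet> (A *v v \<nu>))" using \<nu> F(1) by simp
    finally show "f x = 0" using pos[OF \<nu>(1)] by simp
  qed
  from independent_bound[OF this] have "card (v ` F) \<le> CARD('n)" by simp
  then show False using F(2) card_image[OF inj] by simp
qed

text \<open>The quotient of the two energies attains its maximum \<mu> on the unit sphere. The form
  \<open>\<mu> *\<^sub>R A - B\<close> is then semidefinite with energy zero at the maximizer, so it
  kills this vector, which makes it an eigenvector.\<close>

lemma ex_max_generalized_eigenvalue:
  fixes A B :: "real ^ 'n ^ 'n"
  assumes "positive_definite A" "symmetric_matrix B"
  shows "\<exists>\<mu> \<in> eigenvalues (matrix_inv A ** B). \<forall>x. energy B x \<le> \<mu> * energy A x"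
proof -
  let ?q = "\<lambda>x. energy B x / energy A x"
  have cont: "continuous_on (sphere 0 1) (energy M)" for M :: "real ^ 'n ^ 'n"
    unfolding energy_def by (intro continuous_intros linear_continuous_on linear_linear[THEN iffD2]) auto
  have nz: "\<forall>x\<in>sphere (0 :: real ^ 'n) 1. energy A x \<noteq> 0"
    using positive_definite_energy[OF assms(1)] by (metis less_irrefl mem_sphere_0 norm_zero zero_neq_one)
  have "axis undefined 1 \<in> sphere (0 :: real ^ 'n) 1" by (simp add: norm_axis_1)
  then have ne: "sphere (0 :: real ^ 'n) 1 \<noteq> {}" by blast
  have "continuous_on (sphere 0 1) ?q" by (intro continuous_on_divide cont nz)
  from continuous_attains_sup[OF compact_sphere ne this]
  obtain x0 where x0: "x0 \<in> sphere 0 1" "\<And>x. x \<in> sphere 0 1 \<Longrightarrow> ?q x \<le> ?q x0" by blast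
  define \<mu> where "\<mu> = ?q x0"
  have le: "energy B x \<le> \<mu> * energy A x" for x
  proof (cases "x = 0")
    case False
    define y where "y = (1 / norm x) *\<^sub>R x"
    have "y \<in> sphere 0 1" using False by (simp add: y_def)
    then have "?q y \<le> \<mu>" using x0 by (simp add: \<mu>_def)
    moreover have "energy A y > 0"
      using positive_definite_energy[OF assms(1), of y] False by (simp add: y_def)
    ultimately have "energy B y \<le> \<mu> * energy A y" by (simp add: pos_divide_le_eq)
    then have "(norm x)\<^sup>2 * energy B y \<le> (norm x)\<^sup>2 * (\<mu> * energy A y)" by (intro mult_left_mono) auto
    then show ?thesis using False by (simp add: y_def energy_scaleR power_divide)
  qed simp
  define M where "M = \<mu> *\<^sub>R A - B"
  have enM: "energy M x = \<mu> * energy A x - energy B x" for x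
    by (simp add: M_def energy_diff_matrix) (simp add: energy_def scaleR_matrix_vector_assoc[symmetric])
  have "symmetric_matrix M"
    using assms(2) positive_definite_symmetric[OF assms(1)]
    by (simp add: symmetric_matrix_def M_def transpose_def vec_eq_iff)
  then have "pos_semidef M" using le by (simp add: pos_semidef_def enM)
  moreover have "energy M x0 = 0" using x0(1) nz by (simp add: enM \<mu>_def)
  ultimately have "M *v x0 = 0" by (rule pos_semidef_null)
  then have "B *v x0 = \<mu> *\<^sub>R (A *v x0)"
    by (simp add: M_def matrix_vector_mult_diff_rdistrib scaleR_matrix_vector_assoc[symmetric])
  then have "(matrix_inv A ** B) *v x0 = \<mu> *\<^sub>R x0"
    using matrix_inv_vector[OF positive_definite_invertible[OF assms(1)]]
    by (simp add: matrix_vector_mul_assoc[symmetric] matrix_vector_mult_scaleR)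
  moreover have "x0 \<noteq> 0" using x0(1) by auto
  ultimately have "\<mu> \<in> eigenvalues (matrix_inv A ** B)" by (auto simp: eigenvalues_def)
  then show ?thesis using le by blast
qed

lemma energy_le_mu_max:
  assumes "positive_definite A" "symmetric_matrix B"
  shows "energy B x \<le> mu_max A B * energy A x"
proof -
  obtain \<mu> where \<mu>: "\<mu> \<in> eigenvalues (matrix_inv A ** B)" "energy B x \<le> \<mu> * energy A x"
    using ex_max_generalized_eigenvalue[OF assms] by blast
  have "\<mu> \<le> mu_max A B"
    unfolding mu_max_def using finite_generalized_eigenvalues[OF assms] \<mu>(1) by (rule Max_ge)
  then have "\<mu> * energy A x \<le> mu_max A B * energy A x"
    using positive_definite_pos_semidef[OF assms(1)]
    by (intro mult_right_mono) (auto simp: pos_semidef_def)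
  then show ?thesis using \<mu>(2) by linarith
qed

text \<open>The statement for the maximum, applied to \<open>- B\<close>.\<close>

lemma mu_min_energy_le:
  fixes A B :: "real ^ 'n ^ 'n"
  assumes "positive_definite A" "symmetric_matrix B"
  shows "mu_min A B * energy A x \<le> energy B x"
proof -
  have "symmetric_matrix (- B)" using assms(2)
    by (simp add: symmetric_matrix_def transpose_def vec_eq_iff)
  have neg: "(- M) *v y = - (M *v y)" for M :: "real ^ 'n ^ 'n" and y
    using matrix_vector_mult_diff_rdistrib[of 0 M y] by simp
  obtain \<mu> where \<mu>: "\<mu> \<in> eigenvalues (matrix_inv A ** (- B))" "energy (- B) x \<le> \<mu> * energy A x"
    using ex_max_generalized_eigenvalue[OF assms(1) \<open>symmetric_matrix (- B)\<close>] by blast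
  have "- \<mu> \<in> eigenvalues (matrix_inv A ** B)"
  proof -
    obtain v where v: "v \<noteq> 0" "matrix_inv A *v ((- B) *v v) = \<mu> *\<^sub>R v"
      using \<mu>(1) by (auto simp: eigenvalues_def matrix_vector_mul_assoc)
    then have "matrix_inv A *v (B *v v) = (- \<mu>) *\<^sub>R v"
      by (simp add: neg matrix_vector_minus minus_equation_iff)
    then show ?thesis using v(1) by (auto simp: eigenvalues_def matrix_vector_mul_assoc)
  qed
  then have "mu_min A B \<le> - \<mu>"
    unfolding mu_min_def by (intro Min_le finite_generalized_eigenvalues[OF assms])
  then have "mu_min A B * energy A x \<le> (- \<mu>) * energy A x"
    using positive_definite_pos_semidef[OF assms(1)]
    by (intro mult_right_mono) (auto simp: pos_semidef_def)
  then show ?thesis using \<mu>(2) by (simp add: energy_def neg)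
qed

section \<open>Explicit bounds for matrices, inverses and the height of the domain\<close>

lemma abs_bilinear_le:
  fixes M :: "real ^ 'n ^ 'm"
  assumes "\<And>i j. \<bar>M $ i $ j\<bar> \<le> R"
  shows "\<bar>x \<bullet> (M *v y)\<bar> \<le> real CARD('m) * real CARD('n) * R * norm x * norm y"
proof -
  have R: "0 \<le> R" using assms[of undefined undefined] by linarith
  have "x \<bullet> (M *v y) = (\<Sum>i\<in>UNIV. \<Sum>j\<in>UNIV. x $ i * (M $ i $ j * y $ j))"
    by (simp add: inner_vec_def matrix_vector_mult_def sum_distrib_left)
  also have "\<bar>\<dots>\<bar> \<le> (\<Sum>i\<in>UNIV. \<Sum>j\<in>UNIV. \<bar>x $ i * (M $ i $ j * y $ j)\<bar>)"
    by (intro order_trans[OF sum_abs] sum_mono sum_abs)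
  also have "\<dots> \<le> (\<Sum>i\<in>(UNIV::'m set). \<Sum>j\<in>(UNIV::'n set). norm x * (R * norm y))"
    using R assms by (intro sum_mono) (auto simp: abs_mult intro!: mult_mono component_le_norm_cart)
  finally show ?thesis by (simp add: mult_ac)
qed

lemma norm_matrix_vector_le:
  fixes M :: "real ^ 'n ^ 'm"
  assumes "\<And>i j. \<bar>M $ i $ j\<bar> \<le> R"
  shows "norm (M *v y) \<le> real CARD('m) * real CARD('n) * R * norm y"
proof (cases "M *v y = 0")
  case True
  have "0 \<le> R" using assms[of undefined undefined] by linarith
  then show ?thesis using True by simp
next
  case False
  have "norm (M *v y) * norm (M *v y) = (M *v y) \<bullet> (M *v y)"
    by (simp add: norm_eq_sqrt_inner)
  also have "\<dots> \<le> real CARD('m) * real CARD('n) * R * norm (M *v y) * norm y"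
    using abs_bilinear_le[of M R "M *v y" y, OF assms] by linarith
  finally have "norm (M *v y) * norm (M *v y) \<le> norm (M *v y) * (real CARD('m) * real CARD('n) * R * norm y)"
    by (simp add: mult_ac)
  then show ?thesis using False by (simp only: mult_le_cancel_left) auto
qed

lemma abs_det_le:
  fixes A :: "real ^ 'n ^ 'n"
  assumes "\<And>i j. \<bar>A $ i $ j\<bar> \<le> R"
  shows "\<bar>det A\<bar> \<le> fact CARD('n) * R ^ CARD('n)"
proof -
  have "\<bar>det A\<bar> \<le> (\<Sum>p | p permutes (UNIV :: 'n set). \<bar>of_int (sign p) * (\<Prod>i\<in>UNIV. A $ i $ p i)\<bar>)"
    unfolding det_def by (rule sum_abs)
  also have "\<dots> \<le> (\<Sum>p | p permutes (UNIV :: 'n set). R ^ CARD('n))"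
  proof (rule sum_mono)
    fix p :: "'n \<Rightarrow> 'n"
    have "\<bar>of_int (sign p) * (\<Prod>i\<in>UNIV. A $ i $ p i)\<bar> = (\<Prod>i\<in>UNIV. \<bar>A $ i $ p i\<bar>)"
      by (simp add: abs_mult abs_prod sign_def)
    also have "\<dots> \<le> (\<Prod>i\<in>(UNIV :: 'n set). R)" using assms by (intro prod_mono) auto
    finally show "\<bar>of_int (sign p) * (\<Prod>i\<in>UNIV. A $ i $ p i)\<bar> \<le> R ^ CARD('n)" by simp
  qed
  finally show ?thesis by (simp add: card_permutations[OF refl])
qed

text \<open>Cramer's rule: an entry of the inverse is a determinant with one unit column, divided by
  \<open>det A\<close>, whose reciprocal is at most \<open>D\<close>.\<close>

lemma abs_matrix_inv_le:
  fixes A :: "real ^ 'n ^ 'n"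
  assumes "\<And>i j. \<bar>A $ i $ j\<bar> \<le> R" "1 \<le> R" "invertible A" "1 \<le> \<bar>det A\<bar> * D"
  shows "\<bar>matrix_inv A $ k $ j\<bar> \<le> fact CARD('n) * R ^ CARD('n) * D"
proof -
  have d0: "det A \<noteq> 0" using assms(3) by (simp add: invertible_det_nz)
  define x where "x = matrix_inv A *v axis j 1"
  have "A *v x = axis j 1" using matrix_inv_vector(1)[OF assms(3)] by (simp add: x_def)
  then have "x = (\<chi> k. det (\<chi> i l. if l = k then axis j 1 $ i else A $ i $ l) / det A)"
    using cramer[OF d0] by blast
  then have "x $ k = det (\<chi> i l. if l = k then axis j 1 $ i else A $ i $ l) / det A"
    using vec_lambda_beta[of "\<lambda>k. det (\<chi> i l. if l = k then axis j 1 $ i else A $ i $ l) / det A" k]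
    by (simp only:)
  moreover have "x $ k = matrix_inv A $ k $ j"
    by (simp add: x_def matrix_vector_mult_basis column_def)
  ultimately have eq: "matrix_inv A $ k $ j * det A =
      det (\<chi> i l. if l = k then axis j 1 $ i else A $ i $ l)"
    using d0 by simp
  have "\<bar>det (\<chi> i l. if l = k then axis j 1 $ i else A $ i $ l)\<bar> \<le> fact CARD('n) * R ^ CARD('n)"
    using assms(1,2) by (intro abs_det_le) (auto simp: axis_def)
  then have "\<bar>matrix_inv A $ k $ j\<bar> * \<bar>det A\<bar> \<le> fact CARD('n) * R ^ CARD('n)"
    using eq by (metis abs_mult)
  moreover have D: "0 \<le> D"
  proof (rule ccontr)
    assume "\<not> 0 \<le> D"
    then have "\<bar>det A\<bar> * D \<le> 0" by (intro mult_nonneg_nonpos) auto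
    then show False using assms(4) by linarith
  qed
  ultimately have "\<bar>matrix_inv A $ k $ j\<bar> * \<bar>det A\<bar> * D \<le> fact CARD('n) * R ^ CARD('n) * D"
    by (intro mult_right_mono) auto
  moreover have "\<bar>matrix_inv A $ k $ j\<bar> * 1 \<le> \<bar>matrix_inv A $ k $ j\<bar> * (\<bar>det A\<bar> * D)"
    using assms(4) by (intro mult_left_mono) auto
  ultimately show ?thesis by (simp add: mult.assoc)
qed

text \<open>Young's inequality for \<open>x\<close> and \<open>A\<^sup>-\<^sup>1 x\<close>, whose
  mixed term is the squared norm of \<open>x\<close>. It replaces a lower bound for the smallest
  eigenvalue of \<open>A\<close>.\<close>

lemma norm_le_energy:
  fixes A :: "real ^ 'n ^ 'n"
  assumes "positive_definite A" "\<And>x. energy A (matrix_inv A *v x) \<le> s * (norm x)\<^sup>2" "s > 0"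
  shows "(norm x)\<^sup>2 \<le> s * energy A x"
proof -
  note inv = matrix_inv_vector[OF positive_definite_invertible[OF assms(1)]]
  have "2 * (norm x)\<^sup>2 = 2 * (x \<bullet> (A *v (matrix_inv A *v x)))"
    using inv(1) by (simp add: power2_norm_eq_inner)
  also have "\<dots> \<le> s * energy A x + energy A (matrix_inv A *v x) / s"
    by (rule inner_le_energies[OF positive_definite_pos_semidef[OF assms(1)] assms(3)])
  also have "energy A (matrix_inv A *v x) / s \<le> (norm x)\<^sup>2"
    using assms(2)[of x] assms(3) by (simp add: pos_divide_le_eq mult.commute)
  finally show ?thesis by simp
qed

text \<open>Polarization: an entry of \<open>B\<close> is a combination of the energies at
  \<open>axis i 1\<close>, \<open>axis j 1\<close> and their sum, and every energy is at most the
  gap times that of \<open>A\<close>. Read backwards, a nonzero entry keeps the gap between the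
  extremal speeds from being small.\<close>

lemma mu_gap_ge:
  fixes A B :: "real ^ 'n ^ 'n"
  assumes "positive_definite A" "symmetric_matrix B" "mu_min A B < 0" "0 < mu_max A B"
    and "\<And>x. energy A x \<le> R * (norm x)\<^sup>2" "R > 0"
  shows "\<bar>B $ i $ j\<bar> \<le> 4 * R * (mu_max A B - mu_min A B)"
proof -
  define g where "g = mu_max A B - mu_min A B"
  have b: "\<bar>energy B x\<bar> \<le> g * (R * (norm x)\<^sup>2)" for x
  proof -
    have nn: "0 \<le> energy A x"
      using positive_definite_pos_semidef[OF assms(1)] by (simp add: pos_semidef_def)
    have "energy B x \<le> g * energy A x"
      using energy_le_mu_max[OF assms(1,2), of x] assms(3) nn
      by (simp add: g_def left_diff_distrib) (smt (verit) mult_nonpos_nonneg)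
    moreover have "- (g * energy A x) \<le> energy B x"
      using mu_min_energy_le[OF assms(1,2), of x] assms(4) nn
      by (simp add: g_def left_diff_distrib) (smt (verit) mult_nonneg_nonneg)
    moreover have "g * energy A x \<le> g * (R * (norm x)\<^sup>2)"
      using assms(3-5) by (intro mult_left_mono) (auto simp: g_def)
    ultimately show ?thesis by linarith
  qed
  have Bij: "axis i 1 \<bullet> (B *v axis j 1) = B $ i $ j"
    by (simp add: matrix_vector_mult_basis column_def inner_axis')
  have "energy B (axis i 1 + axis j 1) = energy B (axis i 1) + 2 * B $ i $ j + energy B (axis j 1)"
    unfolding energy_add[OF assms(2)] Bij ..
  moreover have "\<bar>energy B (axis i 1)\<bar> \<le> g * R" "\<bar>energy B (axis j 1)\<bar> \<le> g * R"
    using b[of "axis i 1"] b[of "axis j 1"] by (simp_all add: norm_axis_1)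
  moreover have "\<bar>energy B (axis i 1 + axis j 1)\<bar> \<le> g * (R * 4)"
  proof -
    have "norm (axis i 1 + axis j 1 :: real ^ 'n) \<le> 2"
      using norm_triangle_ineq[of "axis i 1 :: real ^ 'n" "axis j 1"] by (simp add: norm_axis_1)
    then have "(norm (axis i 1 + axis j 1 :: real ^ 'n))\<^sup>2 \<le> 2\<^sup>2" by (intro power_mono) auto
    then have "g * (R * (norm (axis i 1 + axis j 1 :: real ^ 'n))\<^sup>2) \<le> g * (R * 4)"
      using assms(3-6) by (intro mult_left_mono) (auto simp: g_def)
    then show ?thesis using b[of "axis i 1 + axis j 1"] by linarith
  qed
  ultimately have "\<bar>B $ i $ j\<bar> \<le> 4 * (g * R)"
    using mult_nonneg_nonneg[of g R] assms(3,4,6) by (simp add: g_def)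
  then show ?thesis by (simp add: g_def mult_ac)
qed

text \<open>The height is limited by one coordinate alone: its two constraints together force
  \<open>t * (mu_max - mu_min) \<le> 1\<close>. The signs of the speeds keep the slices inside the
  cube.\<close>

lemma domain_H_subset:
  fixes B :: "'m::finite \<Rightarrow> real ^ 'n ^ 'n"
  assumes "\<And>i. mu_min A (B i) < 0" "\<And>i. 0 < mu_max A (B i)"
    and "1 \<le> T * (mu_max A (B i) - mu_min A (B i))"
  shows "domain_H A B \<subseteq> {0..T} \<times> unit_cube"
proof
  fix z assume "z \<in> domain_H A B"
  then obtain t x where z: "z = (t, x)" "0 \<le> t"
    "\<And>i. x $ i - mu_max A (B i) * t \<ge> 0" "\<And>i. x $ i - 1 - mu_min A (B i) * t \<le> 0"
    by (auto simp: domain_H_def)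
  have "0 \<le> x $ k" "x $ k \<le> 1" for k
  proof -
    show "0 \<le> x $ k" using z(3)[of k] mult_nonneg_nonneg[of "mu_max A (B k)" t] assms(2)[of k] z(2) by linarith
    show "x $ k \<le> 1" using z(4)[of k] mult_nonpos_nonneg[of "mu_min A (B k)" t] assms(1)[of k] z(2) by linarith
  qed
  moreover have "t \<le> T"
  proof (rule ccontr)
    assume "\<not> t \<le> T"
    then have "T * (mu_max A (B i) - mu_min A (B i)) < t * (mu_max A (B i) - mu_min A (B i))"
      using assms(1,2)[of i] by (intro mult_strict_right_mono) auto
    then show False using assms(3) z(3)[of i] z(4)[of i] by (simp add: right_diff_distrib mult.commute)
  qed
  ultimately show "z \<in> {0..T} \<times> unit_cube" using z by (auto simp: unit_cube_def)
qed

section \<open>Simultaneous diagonalization and the upwind splitting\<close>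

lemma diag_matrix_vector: "(diag_matrix d *v x) $ k = d k * x $ k"
  by (simp add: diag_matrix_def matrix_vector_mult_def if_distrib[of "\<lambda>u. u * _"] cong: if_cong)

lemma transpose_diag_matrix [simp]: "transpose (diag_matrix d) = diag_matrix d"
  by (auto simp: transpose_def diag_matrix_def vec_eq_iff)

lemma inner_diag_matrix: "x \<bullet> (diag_matrix d *v y) = (\<Sum>k\<in>UNIV. d k * (x $ k * y $ k))"
  by (simp add: inner_vec_def diag_matrix_vector mult_ac)

lemma orthonormal_eigenbasis_diag:
  assumes "orthonormal_eigenbasis S lam L"
  shows "transpose L ** S ** L = diag_matrix lam"
proof -
  have S: "S *v column j L = lam j *\<^sub>R column j L" for j
    using assms by (simp add: orthonormal_eigenbasis_def)
  have LL: "transpose L ** L = mat 1"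
    using assms by (simp add: orthonormal_eigenbasis_def orthogonal_matrix)
  have "(transpose L ** S ** L) *v axis j 1 = diag_matrix lam *v axis j 1" for j
  proof -
    have "(transpose L ** S ** L) *v axis j 1 = transpose L *v (S *v (L *v axis j 1))"
      by (simp only: matrix_vector_mul_assoc matrix_mul_assoc)
    also have "\<dots> = transpose L *v (lam j *\<^sub>R (L *v axis j 1))"
      unfolding matrix_vector_mult_basis S ..
    also have "\<dots> = lam j *\<^sub>R ((transpose L ** L) *v axis j 1)"
      by (simp only: matrix_vector_mul_assoc matrix_vector_mult_scaleR)
    also have "\<dots> = diag_matrix lam *v axis j 1"
      unfolding LL by (auto simp: vec_eq_iff diag_matrix_vector axis_def)
    finally show ?thesis .
  qed
  then have "column j (transpose L ** S ** L) = column j (diag_matrix lam)" for j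
    by (simp add: matrix_vector_mult_basis)
  then show ?thesis by (simp add: vec_eq_iff column_def)
qed

text \<open>From here on only these two congruences are used, so the choice of the eigenbases in the
  scheme does not matter. Positivity of the eigenvalues of \<open>A\<close> makes the scaling by
  \<open>1 / sqrt (lam j)\<close> meaningful.\<close>

lemma scheme_matrices_diagonalize:
  fixes A :: "'n::{finite,linorder} sqmat"
  assumes "positive_definite A" "scheme_matrices A B \<mu> Tm"
  shows "transpose (Tm i) ** A ** Tm i = mat 1" "transpose (Tm i) ** B i ** Tm i = diag_matrix (\<mu> i)"
proof -
  obtain lam L K where L: "orthonormal_eigenbasis A lam L"
    and K: "\<And>i. orthonormal_eigenbasis
        (transpose (diag_matrix (\<lambda>j. 1 / sqrt (lam j))) ** transpose L ** B i ** L **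
           diag_matrix (\<lambda>j. 1 / sqrt (lam j))) (\<mu> i) (K i)"
    and T: "\<And>i. Tm i = L ** diag_matrix (\<lambda>j. 1 / sqrt (lam j)) ** K i"
    using assms(2) unfolding scheme_matrices_def Let_def by blast
  define D where "D = diag_matrix (\<lambda>j. 1 / sqrt (lam j))"
  have tT: "transpose (Tm i) = transpose (K i) ** (D ** transpose L)"
    unfolding T D_def[symmetric] by (simp add: matrix_transpose_mul D_def)
  have "transpose (Tm i) ** B i ** Tm i = transpose (K i) ** (D ** transpose L ** B i ** L ** D) ** K i"
    unfolding tT unfolding T D_def[symmetric] by (simp add: matrix_mul_assoc)
  also have "\<dots> = diag_matrix (\<mu> i)"
    using orthonormal_eigenbasis_diag[OF K[of i]] by (simp add: D_def)
  finally show "transpose (Tm i) ** B i ** Tm i = diag_matrix (\<mu> i)" .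
  have lam: "lam j > 0" for j
  proof -
    have "norm (column j L) = 1"
      using L by (simp add: orthonormal_eigenbasis_def orthogonal_matrix_orthonormal_columns)
    then have "column j L \<noteq> 0" by auto
    then have "0 < column j L \<bullet> (A *v column j L)" using assms(1) by (simp add: positive_definite_def)
    also have "\<dots> = lam j * (column j L \<bullet> column j L)" using L by (simp add: orthonormal_eigenbasis_def)
    finally show ?thesis by (metis inner_ge_zero zero_less_mult_iff not_less)
  qed
  have "D ** diag_matrix lam ** D = mat 1"
  proof -
    have "(D ** diag_matrix lam ** D) *v x = x" for x
      using lam less_imp_neq[OF lam] by (auto simp: vec_eq_iff matrix_vector_mul_assoc[symmetric] D_def diag_matrix_vector
          real_sqrt_mult_self less_imp_le field_simps)
    then show ?thesis by (metis matrix_eq matrix_vector_mul_lid)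
  qed
  then have "D ** (transpose L ** A ** L) ** D = mat 1"
    using orthonormal_eigenbasis_diag[OF L] by simp
  moreover have "transpose (Tm i) ** A ** Tm i = transpose (K i) ** (D ** (transpose L ** A ** L) ** D) ** K i"
    unfolding tT unfolding T D_def[symmetric] by (simp add: matrix_mul_assoc)
  ultimately show "transpose (Tm i) ** A ** Tm i = mat 1"
    using K[of i] by (simp add: orthonormal_eigenbasis_def orthogonal_matrix)
qed

text \<open>In characteristic variables the upwind rule takes the positive part of
  \<open>diag_matrix (\<mu> i)\<close> from the lower cell and the negative part from the upper one.
  Transported back, the two parts become semidefinite forms \<open>P i\<close> and
  \<open>Q i\<close>, and the energy estimates need nothing else about the flux.\<close>

lemma upwind_split:
  fixes A :: "'n::{finite,linorder} sqmat" and B :: "'m::finite \<Rightarrow> 'n sqmat"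
  assumes A: "positive_definite A" and sm: "scheme_matrices A B \<mu> Tm"
    and \<beta>: "\<And>i x. \<bar>energy (B i) x\<bar> \<le> \<beta> * energy A x"
  obtains P Q :: "'m \<Rightarrow> 'n sqmat" where
    "\<And>i. pos_semidef (P i)" "\<And>i. pos_semidef (Q i)" "\<And>i. B i = P i - Q i"
    "\<And>i x. energy (P i) x + energy (Q i) x \<le> \<beta> * energy A x"
    "\<And>N U i j. B i *v face_value N \<mu> Tm U i j =
       P i *v U (j(i := wrap N (j i))) - Q i *v U (j(i := wrap N (j i + 1)))"
proof -
  note TAT = scheme_matrices_diagonalize(1)[OF A sm] and TBT = scheme_matrices_diagonalize(2)[OF A sm]
  have inv: "invertible (Tm i)" for i
    using TAT[of i] invertible_left_inverse by blast
  define W where "W i = matrix_inv (Tm i)" for i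
  have WT: "W i ** Tm i = mat 1" "Tm i ** W i = mat 1" for i
    using matrix_inv_mult[OF inv] by (auto simp: W_def)
  have TW': "transpose (W i) ** transpose (Tm i) = mat 1" for i
    using WT(2)[of i] by (metis matrix_transpose_mul transpose_mat)
  have recover: "transpose (W i) ** (transpose (Tm i) ** M ** Tm i) ** W i = M" for i and M :: "'n sqmat"
  proof -
    have "transpose (W i) ** (transpose (Tm i) ** M ** Tm i) ** W i =
        (transpose (W i) ** transpose (Tm i)) ** M ** (Tm i ** W i)"
      by (simp add: matrix_mul_assoc)
    then show ?thesis by (simp add: TW' WT)
  qed
  have Aeq: "A = transpose (W i) ** W i" for i
    using recover[of i A] by (simp add: TAT)
  have Beq: "B i = transpose (W i) ** diag_matrix (\<mu> i) ** W i" for i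
    using recover[of i "B i"] by (simp add: TBT)
  define G where "G i d = transpose (W i) ** diag_matrix d ** W i" for i and d :: "'n \<Rightarrow> real"
  have Gv: "G i d *v x = transpose (W i) *v (diag_matrix d *v (W i *v x))" for i d x
    by (simp add: G_def matrix_vector_mul_assoc[symmetric] del: transpose_matrix_vector)
  have enG: "energy (G i d) x = (\<Sum>k\<in>UNIV. d k * ((W i *v x) $ k)\<^sup>2)" for i d x
  proof -
    have "energy (G i d) x = (W i *v x) \<bullet> (diag_matrix d *v (W i *v x))"
      unfolding energy_def Gv by (metis dot_lmul_matrix inner_commute transpose_matrix_vector)
    then show ?thesis by (simp add: inner_diag_matrix power2_eq_square)
  qed
  have enA: "energy A x = (\<Sum>k\<in>UNIV. ((W i *v x) $ k)\<^sup>2)" for i x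
  proof -
    have "energy A x = (W i *v x) \<bullet> (W i *v x)"
      unfolding energy_def Aeq[of i] matrix_vector_mul_assoc[symmetric]
      by (metis dot_lmul_matrix inner_commute transpose_matrix_vector)
    then show ?thesis by (simp add: inner_vec_def power2_eq_square)
  qed
  have symG: "symmetric_matrix (G i d)" for i d
    by (simp add: symmetric_matrix_def G_def matrix_transpose_mul matrix_mul_assoc)
  have \<mu>: "\<bar>\<mu> i k\<bar> \<le> \<beta>" for i k
  proof -
    \<comment> \<open>The \<open>k\<close>-th column of \<open>Tm i\<close> has energy
      \<open>1\<close> for \<open>A\<close> and energy \<open>\<mu> i k\<close> for
      \<open>B i\<close>.\<close>
    define x where "x = Tm i *v axis k 1"
    have Wx: "W i *v x = axis k 1" by (simp add: x_def matrix_vector_mul_assoc WT)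
    have a2: "(axis k 1 $ l)\<^sup>2 = (if l = k then 1 else 0 :: real)" for l by (simp add: axis_def)
    have "energy A x = 1" unfolding enA[of x i] Wx a2 by simp
    have "energy (G i (\<mu> i)) x = (\<Sum>l\<in>UNIV. if l = k then \<mu> i l else 0)"
      unfolding enG Wx a2 by (intro sum.cong) auto
    then have "energy (B i) x = \<mu> i k" by (simp add: Beq[of i] G_def[symmetric])
    then show ?thesis using \<beta>[of i x] \<open>energy A x = 1\<close> by simp
  qed
  define P where "P i = G i (\<lambda>k. max 0 (\<mu> i k))" for i
  define Q where "Q i = G i (\<lambda>k. max 0 (- \<mu> i k))" for i
  show thesis
  proof (rule that[of P Q])
    show "pos_semidef (P i)" "pos_semidef (Q i)" for i
      unfolding pos_semidef_def P_def Q_def enG using symG by (auto intro!: sum_nonneg)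
    show "B i = P i - Q i" for i
    proof -
      have "B i *v x = (P i - Q i) *v x" for x
      proof -
        have "diag_matrix (\<lambda>k. max 0 (\<mu> i k)) *v (W i *v x) - diag_matrix (\<lambda>k. max 0 (- \<mu> i k)) *v (W i *v x) =
            diag_matrix (\<mu> i) *v (W i *v x)"
          by (auto simp: vec_eq_iff diag_matrix_vector max_def algebra_simps)
        then show ?thesis
          unfolding matrix_vector_mult_diff_rdistrib P_def Q_def Gv
            matrix_vector_mult_diff_distrib[symmetric]
          using Gv[of i "\<mu> i" x] by (simp add: G_def Beq[symmetric])
      qed
      then show ?thesis by (simp add: matrix_eq)
    qed
    show "energy (P i) x + energy (Q i) x \<le> \<beta> * energy A x" for i x
    proof -
      have "energy (P i) x + energy (Q i) x = (\<Sum>k\<in>UNIV. \<bar>\<mu> i k\<bar> * ((W i *v x) $ k)\<^sup>2)"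
        unfolding P_def Q_def enG sum.distrib[symmetric]
        by (intro sum.cong) (auto simp: max_def distrib_right[symmetric] algebra_simps)
      also have "\<dots> \<le> (\<Sum>k\<in>UNIV. \<beta> * ((W i *v x) $ k)\<^sup>2)"
        using \<mu> by (intro sum_mono mult_right_mono) auto
      finally show ?thesis unfolding enA[of x i] sum_distrib_left .
    qed
    show "B i *v face_value N \<mu> Tm U i j =
       P i *v U (j(i := wrap N (j i))) - Q i *v U (j(i := wrap N (j i + 1)))" for N U i j
    proof -
      let ?l = "U (j(i := wrap N (j i)))" and ?r = "U (j(i := wrap N (j i + 1)))"
      define V :: "(real, 'n) vec" where "V = (\<chi> k. if \<mu> i k \<ge> 0 then (W i *v ?l) $ k else (W i *v ?r) $ k)"
      have "B i *v face_value N \<mu> Tm U i j = G i (\<mu> i) *v (Tm i *v V)"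
        by (simp add: face_value_def Let_def V_def W_def[symmetric] G_def Beq[symmetric])
      also have "\<dots> = transpose (W i) *v (diag_matrix (\<mu> i) *v V)"
        unfolding Gv by (simp add: matrix_vector_mul_assoc WT del: transpose_matrix_vector)
      also have "diag_matrix (\<mu> i) *v V = diag_matrix (\<lambda>k. max 0 (\<mu> i k)) *v (W i *v ?l) -
          diag_matrix (\<lambda>k. max 0 (- \<mu> i k)) *v (W i *v ?r)"
        by (auto simp: vec_eq_iff diag_matrix_vector V_def max_def)
      finally show ?thesis unfolding P_def Q_def Gv matrix_vector_mult_diff_distrib .
    qed
  qed
qed

section \<open>Polynomial solutions\<close>

text \<open>
  Polynomial maps of degree less than \<open>d\<close>, all of whose partial derivatives are bounded by \<open>M\<close> on the
  unit cube.
\<close>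

primrec poly_map_bdd :: "nat \<Rightarrow> real \<Rightarrow> (real ^ 'm::finite \<Rightarrow> real ^ 'n::finite) \<Rightarrow> bool" where
  "poly_map_bdd 0 M q \<longleftrightarrow> (\<forall>x. q x = 0)"
| "poly_map_bdd (Suc d) M q \<longleftrightarrow> (\<forall>x\<in>unit_cube. norm (q x) \<le> M) \<and>
     (\<exists>q'. (\<forall>i. poly_map_bdd d M (q' i)) \<and>
           (\<forall>x. (q has_derivative (\<lambda>v. \<Sum>i\<in>UNIV. v $ i *\<^sub>R q' i x)) (at x)))"

definition partial :: "'m::finite \<Rightarrow> (real ^ 'm \<Rightarrow> real ^ 'n) \<Rightarrow> real ^ 'm \<Rightarrow> real ^ 'n" where
  "partial i q x = frechet_derivative q (at x) (axis i 1)"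

lemma partial_eq:
  assumes "(q has_derivative (\<lambda>v. \<Sum>i\<in>UNIV. v $ i *\<^sub>R q' i x)) (at x)"
  shows "partial i q x = q' i x"
proof -
  have "partial i q x = (\<Sum>k\<in>UNIV. axis i 1 $ k *\<^sub>R q' k x)"
    unfolding partial_def frechet_derivative_at[OF assms, symmetric] ..
  also have "\<dots> = (\<Sum>k\<in>UNIV. if k = i then q' k x else 0)" by (intro sum.cong) (auto simp: axis_def)
  finally show ?thesis by simp
qed

lemma poly_map_bdd_norm_le:
  "poly_map_bdd d M q \<Longrightarrow> 0 \<le> M \<Longrightarrow> x \<in> unit_cube \<Longrightarrow> norm (q x) \<le> M"
  by (cases d) auto

lemma poly_map_bdd_mono: "poly_map_bdd d M q \<Longrightarrow> M \<le> M' \<Longrightarrow> poly_map_bdd d M' q"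
proof (induction d arbitrary: q)
  case (Suc d)
  then show ?case by (auto intro: order_trans)
qed simp

lemma poly_map_bdd_zero: "0 \<le> M \<Longrightarrow> poly_map_bdd d M (\<lambda>_. 0)"
  by (induction d) (auto intro!: exI[of _ "\<lambda>_ _. 0"])

lemma poly_map_bdd_Suc: "poly_map_bdd d M q \<Longrightarrow> 0 \<le> M \<Longrightarrow> poly_map_bdd (Suc d) M q"
proof (induction d arbitrary: q)
  case 0
  then have "q = (\<lambda>_. 0)" by auto
  then show ?case using poly_map_bdd_zero[OF 0(2), of "Suc 0"] by simp
next
  case (Suc d)
  then obtain q' where "\<forall>i. poly_map_bdd d M (q' i)"
    "\<forall>x. (q has_derivative (\<lambda>v. \<Sum>i\<in>UNIV. v $ i *\<^sub>R q' i x)) (at x)"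
    by auto
  then have "\<forall>i. poly_map_bdd (Suc d) M (q' i)"
    "\<forall>x. (q has_derivative (\<lambda>v. \<Sum>i\<in>UNIV. v $ i *\<^sub>R q' i x)) (at x)"
    using Suc.IH Suc.prems(2) by blast+
  moreover have "\<forall>x\<in>unit_cube. norm (q x) \<le> M" using Suc.prems by auto
  ultimately show ?case by (subst poly_map_bdd.simps) blast
qed

lemma poly_map_bdd_le:
  assumes "poly_map_bdd d M q" "0 \<le> M" "d \<le> d'"
  shows "poly_map_bdd d' M q"
  using assms(3,1) by (induction rule: dec_induct) (auto intro: poly_map_bdd_Suc[OF _ assms(2)] simp del: poly_map_bdd.simps)

lemma poly_map_bdd_derivative:
  assumes "poly_map_bdd d M q" "0 \<le> M"
  shows "(q has_derivative (\<lambda>v. \<Sum>i\<in>UNIV. v $ i *\<^sub>R partial i q x)) (at x)"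
    and "poly_map_bdd (d - 1) M (partial i q)"
proof -
  obtain q' where q': "\<And>i. poly_map_bdd (d - 1) M (q' i)"
    "\<And>x. (q has_derivative (\<lambda>v. \<Sum>i\<in>UNIV. v $ i *\<^sub>R q' i x)) (at x)"
    using poly_map_bdd_Suc[OF assms] assms(1)
    by (cases d) auto
  have "partial i q = q' i" for i by (rule ext) (rule partial_eq, rule q'(2))
  then show "(q has_derivative (\<lambda>v. \<Sum>i\<in>UNIV. v $ i *\<^sub>R partial i q x)) (at x)"
    "poly_map_bdd (d - 1) M (partial i q)" using q' by simp_all
qed

lemma poly_map_bdd_add:
  "poly_map_bdd d M q \<Longrightarrow> poly_map_bdd d K r \<Longrightarrow> poly_map_bdd d (M + K) (\<lambda>x. q x + r x)"
proof (induction d arbitrary: q r)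
  case (Suc d)
  then obtain q' r' where "\<forall>i. poly_map_bdd d M (q' i)" "\<forall>i. poly_map_bdd d K (r' i)"
    and d: "\<And>x. (q has_derivative (\<lambda>v. \<Sum>i\<in>UNIV. v $ i *\<^sub>R q' i x)) (at x)"
    "\<And>x. (r has_derivative (\<lambda>v. \<Sum>i\<in>UNIV. v $ i *\<^sub>R r' i x)) (at x)"
    by auto
  then have "\<forall>i. poly_map_bdd d (M + K) (\<lambda>x. q' i x + r' i x)" using Suc.IH by blast
  moreover have "((\<lambda>x. q x + r x) has_derivative (\<lambda>v. \<Sum>i\<in>UNIV. v $ i *\<^sub>R (q' i x + r' i x))) (at x)" for x
    using has_derivative_add[OF d(1)[of x] d(2)[of x]] by (simp add: scaleR_add_right sum.distrib)
  moreover have "norm (q x + r x) \<le> M + K" if "x \<in> unit_cube" for x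
    using Suc.prems that by (intro norm_triangle_le) (auto intro: add_mono)
  ultimately show ?case
    by (auto intro!: exI[of _ "\<lambda>i x. q' i x + r' i x"])
qed simp

lemma poly_map_bdd_sum:
  assumes "finite I" "\<And>k. k \<in> I \<Longrightarrow> poly_map_bdd d (M k) (q k)"
  shows "poly_map_bdd d (\<Sum>k\<in>I. M k) (\<lambda>x. \<Sum>k\<in>I. q k x)"
  using assms
proof (induction I)
  case empty
  then show ?case using poly_map_bdd_zero[of 0 d] by simp
next
  case (insert k I)
  then show ?case using poly_map_bdd_add[of d "M k" "q k"] by (simp del: poly_map_bdd.simps)
qed

lemma poly_map_bdd_linear:
  fixes C :: "real ^ 'n \<Rightarrow> real ^ 'k"
  assumes "linear C" "\<And>y. norm (C y) \<le> c * norm y" "0 \<le> c"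
  shows "poly_map_bdd d M q \<Longrightarrow> poly_map_bdd d (c * M) (\<lambda>x. C (q x))"
proof (induction d arbitrary: q)
  case 0
  then show ?case using linear_0[OF assms(1)] by simp
next
  case (Suc d)
  then obtain q' where q': "\<forall>i. poly_map_bdd d M (q' i)"
    "\<And>x. (q has_derivative (\<lambda>v. \<Sum>i\<in>UNIV. v $ i *\<^sub>R q' i x)) (at x)" "\<forall>x\<in>unit_cube. norm (q x) \<le> M"
    by auto
  have bl: "bounded_linear C" using assms(1) by (simp add: linear_conv_bounded_linear)
  have "((\<lambda>x. C (q x)) has_derivative (\<lambda>v. \<Sum>i\<in>UNIV. v $ i *\<^sub>R C (q' i x))) (at x)" for x
    using bounded_linear.has_derivative[OF bl q'(2)[of x]]
    by (simp add: linear_sum[OF assms(1)] linear_cmul[OF assms(1)])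
  moreover have "norm (C (q x)) \<le> c * M" if "x \<in> unit_cube" for x
    using assms(2)[of "q x"] mult_left_mono[of "norm (q x)" M c] q'(3) that assms(3) by fastforce
  ultimately show ?case using q'(1) Suc.IH by (auto intro!: exI[of _ "\<lambda>i x. C (q' i x)"])
qed

lemma poly_map_bdd_scaleR:
  assumes "poly_map_bdd d M q" "\<bar>c\<bar> \<le> b"
  shows "poly_map_bdd d (b * M) (\<lambda>x. c *\<^sub>R q x)"
proof (rule poly_map_bdd_linear[OF _ _ _ assms(1)])
  show "linear (\<lambda>y. c *\<^sub>R y)" by (rule linear_scale_self)
  show "norm (c *\<^sub>R y) \<le> b * norm y" for y using assms(2) by (simp add: mult_right_mono)
  show "0 \<le> b" using assms(2) by linarith
qed

lemma abs_monomial_le: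
  assumes "x \<in> unit_cube"
  shows "\<bar>\<Prod>i\<in>UNIV. x $ i ^ e i\<bar> \<le> 1"
  using assms by (auto simp: abs_prod power_abs unit_cube_def intro!: prod_le_1 power_le_one)

text \<open>Each differentiation lowers the total degree by one and brings down an exponent, at most
  \<open>D\<close>; after \<open>s\<close> of them only a constant is left. Thus
  \<open>D ^ s\<close> serves for all derivatives.\<close>

lemma poly_map_bdd_monomial:
  fixes e :: "'m::finite \<Rightarrow> nat" and v :: "real ^ 'n"
  assumes "sum e UNIV \<le> s" "\<And>i. e i \<le> D" "1 \<le> D"
  shows "poly_map_bdd (Suc s) (real D ^ s * norm v) (\<lambda>x. (\<Prod>i\<in>UNIV. x $ i ^ e i) *\<^sub>R v)"
  using assms(1,2)
proof (induction s arbitrary: e v)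
  case 0
  then have "e = (\<lambda>_. 0)" by auto
  then show ?case by (auto intro!: exI[of _ "\<lambda>_ _. 0"])
next
  case (Suc s)
  define q' where "q' i x = (\<Prod>k\<in>UNIV. x $ k ^ (e(i := e i - 1)) k) *\<^sub>R (real (e i) *\<^sub>R v)" for i and x :: "real ^ 'm"
  have q': "poly_map_bdd (Suc s) (real D ^ Suc s * norm v) (q' i)" for i
  proof (cases "e i = 0")
    case True
    then have "q' i = (\<lambda>_. 0)" by (simp add: q'_def fun_eq_iff)
    then show ?thesis using poly_map_bdd_zero[of "real D ^ Suc s * norm v"] by (simp del: poly_map_bdd.simps)
  next
    case False
    have "sum e UNIV = e i + sum e (UNIV - {i})" by (intro sum.remove) auto
    moreover have "sum (e(i := e i - 1)) UNIV = (e i - 1) + sum (e(i := e i - 1)) (UNIV - {i})"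
      by (subst sum.remove[of UNIV i]) auto
    ultimately have "sum (e(i := e i - 1)) UNIV \<le> s" using False Suc.prems(1) by simp
    then have "poly_map_bdd (Suc s) (real D ^ s * norm (real (e i) *\<^sub>R v)) (q' i)"
      unfolding q'_def using Suc.prems(2) by (intro Suc.IH) (auto intro: order_trans[OF diff_le_self])
    moreover have "real D ^ s * norm (real (e i) *\<^sub>R v) \<le> real D ^ Suc s * norm v"
      using mult_right_mono[of "real (e i)" "real D" "real D ^ s * norm v"] Suc.prems(2)[of i]
      by (simp add: mult_ac)
    ultimately show ?thesis by (rule poly_map_bdd_mono)
  qed
  have der: "((\<lambda>x. (\<Prod>i\<in>UNIV. x $ i ^ e i) *\<^sub>R v) has_derivative (\<lambda>y. \<Sum>i\<in>UNIV. y $ i *\<^sub>R q' i x)) (at x)"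
    for x :: "real ^ 'm"
  proof -
    have "((\<lambda>x. x $ i ^ e i) has_derivative (\<lambda>y. real (e i) * y $ i * x $ i ^ (e i - 1))) (at x)" for i
      by (auto intro!: derivative_eq_intros bounded_linear.has_derivative[OF bounded_linear_vec_nth])
    then have "((\<lambda>x. \<Prod>i\<in>UNIV. x $ i ^ e i) has_derivative
        (\<lambda>y. \<Sum>i\<in>UNIV. real (e i) * y $ i * x $ i ^ (e i - 1) * (\<Prod>k\<in>UNIV - {i}. x $ k ^ e k))) (at x)"
      by (intro has_derivative_prod)
    from has_derivative_scaleR_left[OF this, of v]
    have "((\<lambda>x. (\<Prod>i\<in>UNIV. x $ i ^ e i) *\<^sub>R v) has_derivative
        (\<lambda>y. (\<Sum>i\<in>UNIV. real (e i) * y $ i * x $ i ^ (e i - 1) * (\<Prod>k\<in>UNIV - {i}. x $ k ^ e k)) *\<^sub>R v)) (at x)" .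
    moreover have "(\<Prod>k\<in>UNIV. x $ k ^ (e(i := e i - 1)) k) = x $ i ^ (e i - 1) * (\<Prod>k\<in>UNIV - {i}. x $ k ^ e k)" for i
      by (subst prod.remove[of UNIV i]) auto
    ultimately show ?thesis by (simp add: q'_def scaleR_sum_left mult_ac)
  qed
  have "norm ((\<Prod>i\<in>UNIV. x $ i ^ e i) *\<^sub>R v) \<le> real D ^ Suc s * norm v" if "x \<in> unit_cube" for x :: "real ^ 'm"
  proof -
    have "1 \<le> real D ^ Suc s" using assms(3) by (intro one_le_power) simp
    then have "\<bar>\<Prod>i\<in>UNIV. x $ i ^ e i\<bar> \<le> real D ^ Suc s" using abs_monomial_le[OF that, of e] by linarith
    then show ?thesis by (simp add: mult_right_mono)
  qed
  then show ?case using q' der by (subst poly_map_bdd.simps) blast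
qed

section \<open>Polynomials in time with polynomial coefficients in space\<close>

definition time_poly :: "nat \<Rightarrow> (nat \<Rightarrow> real ^ 'm \<Rightarrow> real ^ 'n) \<Rightarrow> real \<times> (real ^ 'm) \<Rightarrow> real ^ 'n" where
  "time_poly D q z = (\<Sum>k<D. fst z ^ k *\<^sub>R q k (snd z))"

lemma time_poly_derivative:
  fixes q :: "nat \<Rightarrow> real ^ 'm::finite \<Rightarrow> real ^ 'n::finite"
  assumes q: "\<And>k. poly_map_bdd D M (q k)" "0 \<le> M" and qD: "\<And>x. q D x = 0"
  shows "(time_poly D q has_derivative
     (\<lambda>w. fst w *\<^sub>R time_poly D (\<lambda>k x. real (k + 1) *\<^sub>R q (k + 1) x) z +
          (\<Sum>i\<in>UNIV. snd w $ i *\<^sub>R time_poly D (\<lambda>k. partial i (q k)) z))) (at z)"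
proof -
  have summand: "((\<lambda>z. fst z ^ k *\<^sub>R q k (snd z)) has_derivative
      (\<lambda>w. fst z ^ k *\<^sub>R (\<Sum>i\<in>UNIV. snd w $ i *\<^sub>R partial i (q k) (snd z)) +
           (real k * fst w * fst z ^ (k - 1)) *\<^sub>R q k (snd z))) (at z)" for k
  proof (rule has_derivative_scaleR)
    show "((\<lambda>z. fst z ^ k) has_derivative (\<lambda>w. real k * fst w * fst z ^ (k - 1))) (at z)"
      by (auto intro!: derivative_eq_intros)
    show "((\<lambda>z. q k (snd z)) has_derivative (\<lambda>w. \<Sum>i\<in>UNIV. snd w $ i *\<^sub>R partial i (q k) (snd z))) (at z)"
      using has_derivative_compose[OF has_derivative_snd[OF has_derivative_ident]
          poly_map_bdd_derivative(1)[OF q, of k "snd z"]] by simp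
  qed
  \<comment> \<open>The coefficient number \<open>D\<close> vanishes, so shifting the index of the
    time derivative keeps the range of summation.\<close>
  have shift: "(\<Sum>k<D. (real k * t ^ (k - 1)) *\<^sub>R q k x) = (\<Sum>k<D. t ^ k *\<^sub>R (real (k + 1) *\<^sub>R q (k + 1) x))" for t x
  proof -
    have "(\<Sum>k<D. (real k * t ^ (k - 1)) *\<^sub>R q k x) = (\<Sum>k<Suc D. (real k * t ^ (k - 1)) *\<^sub>R q k x)"
      using qD by simp
    also have "\<dots> = (\<Sum>k<D. t ^ k *\<^sub>R (real (k + 1) *\<^sub>R q (k + 1) x))"
      unfolding sum.lessThan_Suc_shift by (simp add: mult.commute)
    finally show ?thesis .
  qed
  have "(time_poly D q has_derivative (\<lambda>w. \<Sum>k<D.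
      fst z ^ k *\<^sub>R (\<Sum>i\<in>UNIV. snd w $ i *\<^sub>R partial i (q k) (snd z)) +
           (real k * fst w * fst z ^ (k - 1)) *\<^sub>R q k (snd z))) (at z)"
    unfolding time_poly_def[abs_def] by (intro has_derivative_sum summand)
  moreover have "(\<Sum>k<D. fst z ^ k *\<^sub>R (\<Sum>i\<in>UNIV. snd w $ i *\<^sub>R partial i (q k) (snd z)) +
           (real k * fst w * fst z ^ (k - 1)) *\<^sub>R q k (snd z)) =
     fst w *\<^sub>R time_poly D (\<lambda>k x. real (k + 1) *\<^sub>R q (k + 1) x) z +
          (\<Sum>i\<in>UNIV. snd w $ i *\<^sub>R time_poly D (\<lambda>k. partial i (q k)) z)" for w
  proof -
    have "(\<Sum>k<D. (real k * fst w * fst z ^ (k - 1)) *\<^sub>R q k (snd z)) =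
        fst w *\<^sub>R (\<Sum>k<D. (real k * fst z ^ (k - 1)) *\<^sub>R q k (snd z))"
      by (simp add: scaleR_sum_right mult_ac)
    also have "\<dots> = fst w *\<^sub>R time_poly D (\<lambda>k x. real (k + 1) *\<^sub>R q (k + 1) x) z"
      unfolding shift time_poly_def ..
    finally have 1: "(\<Sum>k<D. (real k * fst w * fst z ^ (k - 1)) *\<^sub>R q k (snd z)) =
        fst w *\<^sub>R time_poly D (\<lambda>k x. real (k + 1) *\<^sub>R q (k + 1) x) z" .
    have "(\<Sum>k<D. fst z ^ k *\<^sub>R (\<Sum>i\<in>UNIV. snd w $ i *\<^sub>R partial i (q k) (snd z))) =
        (\<Sum>k<D. \<Sum>i\<in>UNIV. snd w $ i *\<^sub>R (fst z ^ k *\<^sub>R partial i (q k) (snd z)))"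
      by (simp add: scaleR_sum_right mult_ac)
    also have "\<dots> = (\<Sum>i\<in>UNIV. \<Sum>k<D. snd w $ i *\<^sub>R (fst z ^ k *\<^sub>R partial i (q k) (snd z)))"
      by (rule sum.swap)
    also have "\<dots> = (\<Sum>i\<in>UNIV. snd w $ i *\<^sub>R time_poly D (\<lambda>k. partial i (q k)) z)"
      by (simp add: time_poly_def scaleR_sum_right)
    finally show ?thesis unfolding sum.distrib 1 by simp
  qed
  ultimately show ?thesis by simp
qed

lemma time_poly_norm_le:
  assumes "\<And>k. poly_map_bdd d M (q k)" "0 \<le> M" "1 \<le> T" "z \<in> {0..T} \<times> unit_cube"
  shows "norm (time_poly D q z) \<le> real D * T ^ D * M"
proof -
  have "norm (time_poly D q z) \<le> (\<Sum>k<D. norm (fst z ^ k *\<^sub>R q k (snd z)))"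
    unfolding time_poly_def by (rule norm_sum)
  also have "\<dots> \<le> (\<Sum>k<D. T ^ D * M)"
  proof (rule sum_mono)
    fix k assume "k \<in> {..<D}"
    have "fst z ^ k \<le> T ^ k" using assms(4) by (intro power_mono) auto
    also have "\<dots> \<le> T ^ D" using \<open>k \<in> {..<D}\<close> assms(3) by (intro power_increasing) auto
    finally have "\<bar>fst z ^ k\<bar> \<le> T ^ D" using assms(4) by auto
    moreover have "norm (q k (snd z)) \<le> M"
      using assms(4) by (intro poly_map_bdd_norm_le[OF assms(1,2)]) auto
    ultimately show "norm (fst z ^ k *\<^sub>R q k (snd z)) \<le> T ^ D * M"
      by (simp add: mult_mono')
  qed
  finally show ?thesis by simp
qed

lemma convex_unit_cube: "convex (unit_cube :: (real ^ 'm::finite) set)"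
proof -
  have "unit_cube = (\<Inter>i. {x :: real ^ 'm. axis i 1 \<bullet> x \<ge> 0} \<inter> {x. axis i 1 \<bullet> x \<le> 1})"
    by (auto simp: unit_cube_def inner_axis')
  from this[THEN arg_cong, of convex] show ?thesis
    by (auto intro!: convex_INT convex_Int convex_halfspace_ge convex_halfspace_le)
qed

text \<open>Mean value inequality on a convex slab; the \<open>CARD('m) + 1\<close> partial
  derivatives share one bound, in which the second factor \<open>D\<close> pays for the
  differentiation in time.\<close>

lemma time_poly_lipschitz:
  fixes q :: "nat \<Rightarrow> real ^ 'm::finite \<Rightarrow> real ^ 'n::finite"
  assumes q: "\<And>k. poly_map_bdd D M (q k)" "0 \<le> M" and qD: "\<And>x k. D \<le> k \<Longrightarrow> q k x = 0"
    and T: "1 \<le> T" and z: "z \<in> {0..T} \<times> unit_cube" "z' \<in> {0..T} \<times> unit_cube" and D: "1 \<le> D"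
  shows "norm (time_poly D q z - time_poly D q z') \<le> (real CARD('m) + 1) * (real D)\<^sup>2 * T ^ D * M * norm (z - z')"
proof -
  have q1: "poly_map_bdd D (real D * M) (\<lambda>x. real (k + 1) *\<^sub>R q (k + 1) x)" for k
  proof (cases "k + 1 \<le> D")
    case True
    then show ?thesis by (intro poly_map_bdd_scaleR q(1)) simp
  next
    case False
    then have "(\<lambda>x. real (k + 1) *\<^sub>R q (k + 1) x) = (\<lambda>_. 0)" using qD[of "k + 1"] by simp
    then show ?thesis using poly_map_bdd_zero[of "real D * M" D] q(2) by simp
  qed
  have q2: "poly_map_bdd (D - 1) M (partial i (q k))" for i k
    by (rule poly_map_bdd_derivative(2)[OF q])
  show ?thesis
  proof (rule differentiable_bound)
    show "convex ({0..T} \<times> (unit_cube :: (real ^ 'm) set))" by (intro convex_Times convex_unit_cube) simp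
    fix y :: "real \<times> (real ^ 'm)" assume y: "y \<in> {0..T} \<times> unit_cube"
    let ?F = "\<lambda>w. fst w *\<^sub>R time_poly D (\<lambda>k x. real (k + 1) *\<^sub>R q (k + 1) x) y +
          (\<Sum>i\<in>UNIV. snd w $ i *\<^sub>R time_poly D (\<lambda>k. partial i (q k)) y)"
    show "(time_poly D q has_derivative ?F) (at y within {0..T} \<times> unit_cube)"
      by (rule has_derivative_at_withinI[OF time_poly_derivative[of D M q y, OF q qD[OF order_refl]]])
    define b where "b = (real D)\<^sup>2 * T ^ D * M"
    have b1: "norm (time_poly D (\<lambda>k x. real (k + 1) *\<^sub>R q (k + 1) x) y) \<le> b"
      using time_poly_norm_le[OF q1 _ T y] q(2) by (simp add: b_def power2_eq_square mult_ac)
    have b2: "norm (time_poly D (\<lambda>k. partial i (q k)) y) \<le> b" for i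
    proof -
      have "norm (time_poly D (\<lambda>k. partial i (q k)) y) \<le> real D * T ^ D * M"
        by (rule time_poly_norm_le[OF q2 q(2) T y])
      also have "\<dots> \<le> b"
        unfolding b_def power2_eq_square using D T q(2)
        by (intro mult_right_mono) (auto simp: mult_le_cancel_left1)
      finally show ?thesis .
    qed
    show "onorm ?F \<le> (real CARD('m) + 1) * (real D)\<^sup>2 * T ^ D * M"
    proof (rule onorm_bound)
      show "0 \<le> (real CARD('m) + 1) * (real D)\<^sup>2 * T ^ D * M" using q(2) T by simp
      fix w :: "real \<times> (real ^ 'm)"
      have "norm (?F w) \<le> norm (fst w *\<^sub>R time_poly D (\<lambda>k x. real (k + 1) *\<^sub>R q (k + 1) x) y) +
          (\<Sum>i\<in>UNIV. norm (snd w $ i *\<^sub>R time_poly D (\<lambda>k. partial i (q k)) y))"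
        by (intro norm_triangle_le add_mono norm_sum) simp
      also have "\<dots> \<le> norm w * b + (\<Sum>i\<in>(UNIV :: 'm set). norm w * b)"
      proof (intro add_mono sum_mono)
        have "\<bar>fst w\<bar> \<le> norm w" using norm_fst_le[of "fst w" "snd w"] by simp
        then show "norm (fst w *\<^sub>R time_poly D (\<lambda>k x. real (k + 1) *\<^sub>R q (k + 1) x) y) \<le> norm w * b"
          using b1 by (simp add: mult_mono')
        have "\<bar>snd w $ i\<bar> \<le> norm w" for i
          using component_le_norm_cart[of "snd w" i] norm_snd_le[of "snd w" "fst w"] by simp
        then show "norm (snd w $ i *\<^sub>R time_poly D (\<lambda>k. partial i (q k)) y) \<le> norm w * b" for i
          using b2[of i] by (simp add: mult_mono')
      qed
      also have "\<dots> = (real CARD('m) + 1) * (real D)\<^sup>2 * T ^ D * M * norm w"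
        by (simp add: b_def algebra_simps)
      finally show "norm (?F w) \<le> (real CARD('m) + 1) * (real D)\<^sup>2 * T ^ D * M * norm w" .
    qed
  qed (use z in auto)
qed

text \<open>Coefficients of the power series in time of the solution of \<open>u\<^sub>t + \<Sum>\<^sub>i C\<^sub>i u\<^sub>i = \<Sum>\<^sub>k t\<^sup>k g\<^sub>k\<close>.\<close>

primrec solution_coeff ::
    "('m::finite \<Rightarrow> real ^ 'n ^ 'n) \<Rightarrow> (real ^ 'm \<Rightarrow> real ^ 'n) \<Rightarrow> (nat \<Rightarrow> real ^ 'm \<Rightarrow> real ^ 'n) \<Rightarrow>
     nat \<Rightarrow> real ^ 'm \<Rightarrow> real ^ 'n::finite" where
  "solution_coeff C \<phi> g 0 = \<phi>"
| "solution_coeff C \<phi> g (Suc k) = (\<lambda>x. (1 / real (Suc k)) *\<^sub>R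
     (g k x + (\<Sum>i\<in>UNIV. - (C i *v partial i (solution_coeff C \<phi> g k) x))))"

text \<open>
  Each differentiation in \<open>x\<close> lowers the degree, so the series terminates and the solution is a
  polynomial.
\<close>

lemma solution_coeff_bdd:
  fixes C :: "'m::finite \<Rightarrow> real ^ 'n ^ 'n"
  assumes C: "\<And>i y. norm (C i *v y) \<le> c * norm y" "0 \<le> c"
    and \<phi>: "poly_map_bdd D M \<phi>" and g: "\<And>k. poly_map_bdd (D - Suc k) M (g k)" and M: "0 \<le> M"
  shows "poly_map_bdd (D - k) ((real CARD('m) * c + 1) ^ k * M) (solution_coeff C \<phi> g k)"
proof (induction k)
  case (Suc k)
  let ?b = "real CARD('m) * c + 1"
  define M' where "M' = ?b ^ k * M"
  have b: "1 \<le> ?b" using C(2) by simp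
  have M': "M \<le> M'" unfolding M'_def using mult_right_mono[OF one_le_power[OF b, of k] M] by simp
  have p: "poly_map_bdd (D - Suc k) M' (partial i (solution_coeff C \<phi> g k))" for i
    using poly_map_bdd_derivative(2)[OF Suc.IH[folded M'_def], of i] M M' by (simp add: diff_diff_eq)
  have "poly_map_bdd (D - Suc k) (c * M') (\<lambda>x. - (C i *v partial i (solution_coeff C \<phi> g k) x))" for i
    by (rule poly_map_bdd_linear[OF _ _ C(2) p])
      (use C(1) in \<open>auto intro: linear_compose_neg\<close>)
  then have "poly_map_bdd (D - Suc k) (M + (\<Sum>i\<in>(UNIV :: 'm set). c * M'))
      (\<lambda>x. g k x + (\<Sum>i\<in>UNIV. - (C i *v partial i (solution_coeff C \<phi> g k) x)))"
    by (intro poly_map_bdd_add g poly_map_bdd_sum) auto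
  then have "poly_map_bdd (D - Suc k) (1 * (M + (\<Sum>i\<in>(UNIV :: 'm set). c * M'))) (solution_coeff C \<phi> g (Suc k))"
    unfolding solution_coeff.simps by (rule poly_map_bdd_scaleR) (simp add: field_simps)
  then show ?case
    by (rule poly_map_bdd_mono) (use M' in \<open>simp add: M'_def algebra_simps\<close>)
qed (use \<phi> in simp)

text \<open>Besides the solution its first derivatives are Lipschitz with the same constant: this is
  the smoothness that makes the residual of the scheme of order \<open>h\<close>.\<close>

lemma polynomial_solution:
  fixes C :: "'m::finite \<Rightarrow> real ^ 'n ^ 'n"
  assumes C: "\<And>i y. norm (C i *v y) \<le> c * norm y" "0 \<le> c"
    and \<phi>: "poly_map_bdd D M \<phi>" and g: "\<And>k. poly_map_bdd (D - Suc k) M (g k)"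
    and M: "0 \<le> M" and T: "1 \<le> T" and D: "1 \<le> D"
  defines "K \<equiv> (real CARD('m) + 1) * real D ^ 3 * T ^ D * ((real CARD('m) * c + 1) ^ D * M)"
  obtains p pt px where
    "\<And>z. (p has_derivative (\<lambda>w. fst w *\<^sub>R pt z + (\<Sum>i\<in>UNIV. snd w $ i *\<^sub>R px i z))) (at z)"
    "\<And>z. pt z + (\<Sum>i\<in>UNIV. C i *v px i z) = time_poly D g z"
    "\<And>x. p (0, x) = \<phi> x"
    "\<And>z. z \<in> {0..T} \<times> unit_cube \<Longrightarrow> norm (p z) \<le> K"
    "\<And>z z'. z \<in> {0..T} \<times> unit_cube \<Longrightarrow> z' \<in> {0..T} \<times> unit_cube \<Longrightarrow>
       norm (p z - p z') \<le> K * norm (z - z')"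
    "\<And>z z'. z \<in> {0..T} \<times> unit_cube \<Longrightarrow> z' \<in> {0..T} \<times> unit_cube \<Longrightarrow>
       norm (pt z - pt z') \<le> K * norm (z - z')"
    "\<And>i z z'. z \<in> {0..T} \<times> unit_cube \<Longrightarrow> z' \<in> {0..T} \<times> unit_cube \<Longrightarrow>
       norm (px i z - px i z') \<le> K * norm (z - z')"
proof -
  let ?b = "real CARD('m) * c + 1"
  define M' where "M' = ?b ^ D * M"
  have b: "1 \<le> ?b" using C(2) by simp
  have M': "0 \<le> M'" using M C(2) by (simp add: M'_def)
  define q where "q = solution_coeff C \<phi> g"
  have q: "poly_map_bdd (D - k) M' (q k)" for k
  proof (cases "k \<le> D")
    case True
    have "poly_map_bdd (D - k) (?b ^ k * M) (q k)"
      unfolding q_def by (rule solution_coeff_bdd[OF C \<phi> g M])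
    then show ?thesis
      by (rule poly_map_bdd_mono)
        (use True b M in \<open>auto simp: M'_def intro!: mult_right_mono power_increasing\<close>)
  next
    case False
    have "poly_map_bdd (D - k) (?b ^ k * M) (q k)"
      unfolding q_def by (rule solution_coeff_bdd[OF C \<phi> g M])
    then show ?thesis using False by simp
  qed
  have q0: "q k x = 0" if "D \<le> k" for k x using q[of k] that by simp
  have qD: "poly_map_bdd D M' (q k)" for k by (rule poly_map_bdd_le[OF q M']) simp
  define pt where "pt = time_poly D (\<lambda>k x. real (k + 1) *\<^sub>R q (k + 1) x)"
  define px where "px i = time_poly D (\<lambda>k. partial i (q k))" for i
  have partial0: "partial i (q k) x = 0" if "D \<le> k" for i k x
  proof -
    have "q k = (\<lambda>_. 0)" using q0[OF that] by auto
    then show ?thesis using poly_map_bdd_derivative(2)[of 0 0 "q k" i] by simp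
  qed
  have DM: "M' \<le> real D * M'" using D M' by (simp add: mult_le_cancel_right1)
  \<comment> \<open>Two factors \<open>D\<close> come from the Lipschitz estimate; the third is for
    the coefficients \<open>real (k + 1) *\<^sub>R q (k + 1)\<close> of the time derivative.\<close>
  have K: "K = (real CARD('m) + 1) * (real D)\<^sup>2 * T ^ D * (real D * M')"
    by (simp add: K_def M'_def power2_eq_square power3_eq_cube)
  have K0: "0 \<le> K" unfolding K using M' T by simp
  have lip: "norm (time_poly D r z - time_poly D r z') \<le> K * norm (z - z')"
    if "\<And>k. poly_map_bdd D (real D * M') (r k)" "\<And>k x. D \<le> k \<Longrightarrow> r k x = 0"
      "z \<in> {0..T} \<times> unit_cube" "z' \<in> {0..T} \<times> unit_cube" for r :: "nat \<Rightarrow> real ^ 'm \<Rightarrow> real ^ 'n" and z z'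
    unfolding K by (rule time_poly_lipschitz[OF that(1) _ that(2) T that(3,4) D]) (use M' in auto)
  show thesis
  proof (rule that[of "time_poly D q" pt px])
    show "(time_poly D q has_derivative (\<lambda>w. fst w *\<^sub>R pt z + (\<Sum>i\<in>UNIV. snd w $ i *\<^sub>R px i z))) (at z)" for z
      unfolding pt_def px_def by (rule time_poly_derivative[OF qD M' q0]) simp
    show "pt z + (\<Sum>i\<in>UNIV. C i *v px i z) = time_poly D g z" for z
    proof -
      have C_px: "C i *v px i z = (\<Sum>k<D. fst z ^ k *\<^sub>R (C i *v partial i (q k) (snd z)))" for i
        by (simp add: px_def time_poly_def linear_sum[OF matrix_vector_mul_linear] matrix_vector_mult_scaleR)
      have "(\<Sum>i\<in>UNIV. C i *v px i z) = (\<Sum>k<D. \<Sum>i\<in>UNIV. fst z ^ k *\<^sub>R (C i *v partial i (q k) (snd z)))"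
        unfolding C_px by (rule sum.swap)
      \<comment> \<open>By the recursion, \<open>k + 1\<close> times the coefficient number
        \<open>k + 1\<close> is \<open>g k\<close> minus the transport terms of the coefficient
        number \<open>k\<close>, so the equation holds for each power of \<open>t\<close>.\<close>
      moreover have "pt z = (\<Sum>k<D. fst z ^ k *\<^sub>R
          (g k (snd z) + (\<Sum>i\<in>UNIV. - (C i *v partial i (q k) (snd z)))))"
        unfolding pt_def time_poly_def by (intro sum.cong) (simp_all add: q_def)
      ultimately show ?thesis
        by (simp add: time_poly_def sum.distrib[symmetric] scaleR_right_diff_distrib sum_negf scaleR_sum_right)
    qed
    show "time_poly D q (0, x) = \<phi> x" for x
    proof -
      have "time_poly D q (0, x) = (\<Sum>k<D. if k = 0 then q 0 x else 0)"
        unfolding time_poly_def by (intro sum.cong) auto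
      then show ?thesis using D by (simp add: q_def)
    qed
    show "norm (time_poly D q z) \<le> K" if "z \<in> {0..T} \<times> unit_cube" for z
    proof -
      have "norm (time_poly D q z) \<le> 1 * real D * T ^ D * M'"
        using time_poly_norm_le[OF qD M' T that, of D] by simp
      also have "\<dots> \<le> ((real CARD('m) + 1) * (real D)\<^sup>2) * real D * T ^ D * M'"
      proof -
        have "1 \<le> (real D)\<^sup>2" using D by (intro one_le_power) simp
        then have "1 * 1 \<le> (real CARD('m) + 1) * (real D)\<^sup>2" by (intro mult_mono) auto
        then show ?thesis using T M' by (intro mult_right_mono) auto
      qed
      finally show ?thesis by (simp add: K mult_ac)
    qed
    fix z z' :: "real \<times> (real ^ 'm)"
    assume z: "z \<in> {0..T} \<times> unit_cube" "z' \<in> {0..T} \<times> unit_cube"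
    show "norm (time_poly D q z - time_poly D q z') \<le> K * norm (z - z')"
      by (rule lip[OF poly_map_bdd_mono[OF qD DM] q0 z])
    show "norm (px i z - px i z') \<le> K * norm (z - z')" for i
      unfolding px_def
    proof (rule lip[OF _ partial0 z])
      show "poly_map_bdd D (real D * M') (partial i (q k))" for k
        by (rule poly_map_bdd_mono[OF _ DM], rule poly_map_bdd_le[of "D - 1" M'])
          (rule poly_map_bdd_derivative(2)[OF qD M'], use M' in auto)
    qed
    show "norm (pt z - pt z') \<le> K * norm (z - z')"
      unfolding pt_def
    proof (rule lip[OF _ _ z])
      show "poly_map_bdd D (real D * M') (\<lambda>x. real (k + 1) *\<^sub>R q (k + 1) x)" for k
      proof (cases "k + 1 \<le> D")
        case True
        then show ?thesis by (intro poly_map_bdd_scaleR qD) simp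
      next
        case False
        then have "(\<lambda>x. real (k + 1) *\<^sub>R q (k + 1) x) = (\<lambda>_. 0)" using q0[of "k + 1"] by simp
        then show ?thesis using poly_map_bdd_zero[of "real D * M'" D] M' by simp
      qed
    qed (simp add: q0)
  qed
qed

section \<open>Energy estimates for the upwind scheme\<close>

definition up :: "nat \<Rightarrow> 'm \<Rightarrow> ('m \<Rightarrow> int) \<Rightarrow> 'm \<Rightarrow> int" where
  "up N i j = j(i := wrap N (j i + 1))"

definition down :: "nat \<Rightarrow> 'm \<Rightarrow> ('m \<Rightarrow> int) \<Rightarrow> 'm \<Rightarrow> int" where
  "down N i j = j(i := wrap N (j i - 1))"

lemma wrap_props:
  assumes "k \<in> {1..2 ^ N}"
  shows "wrap N k = k" "wrap N (k + 1) \<in> {1..2 ^ N}" "wrap N (k - 1) \<in> {1..2 ^ N}"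
    "wrap N (wrap N (k + 1) - 1) = k" "wrap N (wrap N (k - 1) + 1) = k"
  using assms by (auto simp: wrap_def)

lemma grid_indicesD: "j \<in> grid_indices N \<Longrightarrow> j i \<in> {1..2 ^ N}"
  by (simp add: grid_indices_def)

lemma grid_indices_upd: "j \<in> grid_indices N \<Longrightarrow> k \<in> {1..2 ^ N} \<Longrightarrow> j(i := k) \<in> grid_indices N"
  by (simp add: grid_indices_def)

lemma grid_indices_PiE: "grid_indices N = (\<Pi>\<^sub>E i\<in>UNIV. {1..2 ^ N})"
  by (auto simp: grid_indices_def PiE_iff)

lemma finite_grid_indices [simp]: "finite (grid_indices N :: ('m::finite \<Rightarrow> int) set)"
  by (simp add: grid_indices_PiE finite_PiE)

lemma card_grid_indices: "card (grid_indices N :: ('m::finite \<Rightarrow> int) set) = (2 ^ N) ^ CARD('m)"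
  by (simp add: grid_indices_PiE card_PiE nat_power_eq)

lemma up_down:
  assumes "j \<in> grid_indices N"
  shows "up N i j \<in> grid_indices N" "down N i j \<in> grid_indices N"
    "down N i (up N i j) = j" "up N i (down N i j) = j"
    "up N i (up N k j) = up N k (up N i j)" "down N i (up N k j) = up N k (down N i j)"
proof -
  note w = wrap_props[OF grid_indicesD[OF assms]]
  show "up N i j \<in> grid_indices N" "down N i j \<in> grid_indices N"
    using grid_indices_upd[OF assms w(2)] grid_indices_upd[OF assms w(3)] by (auto simp: up_def down_def)
  show du: "down N i (up N i j) = j" "up N i (down N i j) = j"
    using w(4,5)[of i] by (simp_all add: up_def down_def)
  show "up N i (up N k j) = up N k (up N i j)"
    by (cases "i = k") (auto simp: up_def fun_eq_iff)
  show "down N i (up N k j) = up N k (down N i j)"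
    using du by (cases "i = k") (auto simp: up_def down_def fun_eq_iff)
qed

text \<open>With periodic continuation \<open>up\<close> and \<open>down\<close> are inverse
  bijections of the grid, so summation by parts leaves no boundary terms.\<close>

lemma sum_up:
  fixes f :: "('m::finite \<Rightarrow> int) \<Rightarrow> 'b::comm_monoid_add"
  shows "(\<Sum>j\<in>grid_indices N. f (up N i j)) = (\<Sum>j\<in>grid_indices N. f j)"
  by (rule sum.reindex_bij_betw, rule bij_betw_byWitness[where f' = "down N i"])
    (auto simp: up_down)

lemma sum_down:
  fixes f :: "('m::finite \<Rightarrow> int) \<Rightarrow> 'b::comm_monoid_add"
  shows "(\<Sum>j\<in>grid_indices N. f (down N i j)) = (\<Sum>j\<in>grid_indices N. f j)"
  by (rule sum.reindex_bij_betw, rule bij_betw_byWitness[where f' = "up N i"])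
    (auto simp: up_down)

lemma sum_lines:
  fixes f :: "('m::finite \<Rightarrow> int) \<Rightarrow> 'b::comm_monoid_add"
  assumes "k \<in> {1..2 ^ N}"
  shows "(\<Sum>r\<in>{1..2 ^ N}. \<Sum>j\<in>{j \<in> grid_indices N. j i = k}. f (j(i := r))) = (\<Sum>j\<in>grid_indices N. f j)"
proof -
  have "(\<Sum>r\<in>{1..2 ^ N}. \<Sum>j\<in>{j \<in> grid_indices N. j i = k}. f (j(i := r))) =
      (\<Sum>(r, j)\<in>{1..2 ^ N} \<times> {j \<in> grid_indices N. j i = k}. f (j(i := r)))"
    by (simp add: sum.cartesian_product)
  also have "\<dots> = (\<Sum>j\<in>grid_indices N. f j)"
    by (rule sum.reindex_bij_witness[where i = "\<lambda>j. (j i, j(i := k))" and j = "\<lambda>(r, j). j(i := r)"])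
      (use assms in \<open>auto simp: grid_indices_def\<close>)
  finally show ?thesis .
qed

lemma telescope_bound:
  fixes f :: "int \<Rightarrow> 'b::real_normed_vector"
  assumes "a \<in> {1..M}" "b \<in> {1..M}"
  shows "norm (f a - f b) \<le> (\<Sum>r\<in>{1..<M}. norm (f (r + 1) - f r))"
proof -
  have *: "norm (f d - f c) \<le> (\<Sum>r\<in>{c..<d}. norm (f (r + 1) - f r))" if "c \<le> d" for c d
    using that
  proof (induction d rule: int_ge_induct)
    case (step d)
    have "{c..<d + 1} = insert d {c..<d}" using step by auto
    then have "(\<Sum>r\<in>{c..<d + 1}. norm (f (r + 1) - f r)) =
        norm (f (d + 1) - f d) + (\<Sum>r\<in>{c..<d}. norm (f (r + 1) - f r))" by simp
    moreover have "norm (f (d + 1) - f c) \<le> norm (f (d + 1) - f d) + norm (f d - f c)"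
      using norm_triangle_ineq[of "f (d + 1) - f d" "f d - f c"] by simp
    ultimately show ?case using step by simp
  qed simp
  have mono: "(\<Sum>r\<in>{c..<d}. norm (f (r + 1) - f r)) \<le> (\<Sum>r\<in>{1..<M}. norm (f (r + 1) - f r))"
    if "c \<in> {1..M}" "d \<in> {1..M}" for c d
    using that by (intro sum_mono2) auto
  show ?thesis
  proof (cases "a \<le> b")
    case True
    then show ?thesis using *[of a b] mono[OF assms] by (simp add: norm_minus_commute)
  next
    case False
    then show ?thesis using *[of b a] mono[OF assms(2,1)] by simp
  qed
qed

lemma sum_squared_le: "(\<Sum>r\<in>I. a r)\<^sup>2 \<le> real (card I) * (\<Sum>r\<in>I. (a r)\<^sup>2)" for a :: "'i \<Rightarrow> real"
  using Cauchy_Schwarz_ineq_sum[of "\<lambda>_. 1" a I] by simp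

text \<open>Discrete trace inequality: telescope to the parallel layers and average over them.\<close>

lemma sum_layer_le:
  fixes V :: "('m::finite \<Rightarrow> int) \<Rightarrow> 'b::real_normed_vector"
  assumes k: "k \<in> {1..2 ^ N}"
  shows "2 ^ N * (\<Sum>j\<in>{j \<in> grid_indices N. j i = k}. (norm (V j))\<^sup>2) \<le>
     2 * (\<Sum>j\<in>grid_indices N. (norm (V j))\<^sup>2) +
     2 * (2 ^ N)\<^sup>2 * (\<Sum>j\<in>grid_indices N. (norm (V (up N i j) - V j))\<^sup>2)"
proof -
  define J where "J = {j :: 'm \<Rightarrow> int. j \<in> grid_indices N \<and> j i = k}"
  define M :: int where "M = 2 ^ N"
  have M: "real (card {1..M}) = 2 ^ N" by (simp add: M_def nat_power_eq)
  define D where "D j = (norm (V (up N i j) - V j))\<^sup>2" for j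
  have pt: "(norm (V j))\<^sup>2 \<le> 2 * (norm (V (j(i := r))))\<^sup>2 + 2 * (2 ^ N * (\<Sum>s\<in>{1..M}. D (j(i := s))))"
    if j: "j \<in> J" and r: "r \<in> {1..M}" for j r
  proof -
    define f where "f s = V (j(i := s))" for s
    have jk: "j(i := k) = j" using j by (auto simp: J_def)
    have "norm (f k - f r) \<le> (\<Sum>s\<in>{1..<M}. norm (f (s + 1) - f s))"
      using telescope_bound[of k M r f] k r by (simp add: M_def)
    also have "\<dots> = (\<Sum>s\<in>{1..<M}. norm (V (up N i (j(i := s))) - V (j(i := s))))"
      \<comment> \<open>For \<open>s < M\<close> the periodic neighbour is the true one. The
        periodic difference at \<open>s = M\<close> is only added afterwards, as a further
        nonnegative term.\<close>
      by (intro sum.cong) (auto simp: f_def up_def wrap_def M_def)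
    also have "\<dots> \<le> (\<Sum>s\<in>{1..M}. norm (V (up N i (j(i := s))) - V (j(i := s))))"
      by (intro sum_mono2) auto
    finally have "norm (f k - f r) \<le> (\<Sum>s\<in>{1..M}. norm (V (up N i (j(i := s))) - V (j(i := s))))" .
    then have "(norm (f k - f r))\<^sup>2 \<le> (\<Sum>s\<in>{1..M}. norm (V (up N i (j(i := s))) - V (j(i := s))))\<^sup>2"
      by (intro power_mono) auto
    also have "\<dots> \<le> real (card {1..M}) * (\<Sum>s\<in>{1..M}. D (j(i := s)))"
      unfolding D_def by (rule sum_squared_le)
    finally have d: "(norm (f k - f r))\<^sup>2 \<le> 2 ^ N * (\<Sum>s\<in>{1..M}. D (j(i := s)))" unfolding M .
    have "norm (V j) \<le> norm (f r) + norm (f k - f r)"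
      using norm_triangle_ineq[of "f r" "f k - f r"] by (simp add: f_def jk)
    then have "(norm (V j))\<^sup>2 \<le> (norm (f r) + norm (f k - f r))\<^sup>2" by (intro power_mono) auto
    also have "\<dots> \<le> 2 * (norm (f r))\<^sup>2 + 2 * (norm (f k - f r))\<^sup>2"
      using sum_squares_bound[of "norm (f r)" "norm (f k - f r)"] by (simp add: power2_sum)
    finally show ?thesis using d by (simp add: f_def)
  qed
  have lines: "(\<Sum>r\<in>{1..M}. \<Sum>j\<in>J. F (j(i := r))) = (\<Sum>j\<in>grid_indices N. F j)"
    for F :: "('m \<Rightarrow> int) \<Rightarrow> real"
    unfolding M_def J_def by (rule sum_lines[OF k])
  have "2 ^ N * (\<Sum>j\<in>J. (norm (V j))\<^sup>2) = (\<Sum>r\<in>{1..M}. \<Sum>j\<in>J. (norm (V j))\<^sup>2)"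
    unfolding M[symmetric] by simp
  also have "\<dots> \<le> (\<Sum>r\<in>{1..M}. \<Sum>j\<in>J. 2 * (norm (V (j(i := r))))\<^sup>2 +
      2 * (2 ^ N * (\<Sum>s\<in>{1..M}. D (j(i := s)))))"
    by (intro sum_mono pt)
  also have "\<dots> = 2 * (\<Sum>r\<in>{1..M}. \<Sum>j\<in>J. (norm (V (j(i := r))))\<^sup>2) +
      (\<Sum>r\<in>{1..M}. 2 * (2 ^ N * (\<Sum>s\<in>{1..M}. \<Sum>j\<in>J. D (j(i := s)))))"
    by (simp add: sum.distrib sum_distrib_left sum.swap[of _ "{1..M}" J])
  also have "(\<Sum>r\<in>{1..M}. 2 * (2 ^ N * (\<Sum>s\<in>{1..M}. \<Sum>j\<in>J. D (j(i := s))))) =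
      2 * (2 ^ N)\<^sup>2 * (\<Sum>j\<in>grid_indices N. D j)"
    unfolding lines sum_constant M by (simp add: power2_eq_square)
  finally show ?thesis unfolding lines[of "\<lambda>j. (norm (V j))\<^sup>2"] by (simp add: J_def D_def)
qed

text \<open>The square has the Lipschitz continuous derivative \<open>2 * max 0 s\<close>, so a
  shift by \<open>h\<close> leaves a remainder of order \<open>h\<^sup>2\<close>; the positive part
  itself would leave one of order \<open>h\<close>, too much after division by the cell
  size.\<close>

definition relu_sq :: "real \<Rightarrow> real" where
  "relu_sq s = (max 0 s)\<^sup>2"

lemma relu_sq_nonneg [simp]: "0 \<le> relu_sq s"
  by (simp add: relu_sq_def)

lemma relu_sq_neg: "s \<le> 0 \<Longrightarrow> relu_sq s = 0"
  by (simp add: relu_sq_def)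

lemma relu_sq_eq_0_iff: "relu_sq s = 0 \<longleftrightarrow> s \<le> 0"
  by (auto simp: relu_sq_def max_def)

lemma relu_sq_le_1: "s \<le> 1 \<Longrightarrow> relu_sq s \<le> 1"
  by (simp add: relu_sq_def power_le_one)

text \<open>One-sided Taylor estimates. The upper ones serve for shifts in space, the lower one,
  which is convexity, for the motion of the faces in time.\<close>

lemma relu_sq_shift:
  assumes "0 \<le> h"
  shows "relu_sq (s + h) \<le> relu_sq s + h * (2 * max 0 s) + h\<^sup>2"
    "relu_sq s + h * (2 * max 0 s) \<le> relu_sq (s + h)"
    "relu_sq (s - h) \<le> relu_sq s - h * (2 * max 0 s) + h\<^sup>2"
proof -
  have 1: "(s + h)\<^sup>2 \<le> h\<^sup>2" if "s < 0" "0 \<le> s + h" using that assms by (intro power_mono) auto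
  show "relu_sq (s + h) \<le> relu_sq s + h * (2 * max 0 s) + h\<^sup>2"
    using 1 assms by (auto simp: relu_sq_def max_def power2_sum)
  have 3: "0 \<le> (s + h)\<^sup>2" by simp
  show "relu_sq s + h * (2 * max 0 s) \<le> relu_sq (s + h)"
    using 3 assms by (auto simp: relu_sq_def max_def power2_sum)
  have 2: "0 \<le> (s - h)\<^sup>2" by simp
  show "relu_sq (s - h) \<le> relu_sq s - h * (2 * max 0 s) + h\<^sup>2"
    using 2 assms by (auto simp: relu_sq_def max_def power2_diff mult_ac)
qed

lemma relu_sq_product_shift:
  assumes "0 \<le> h" "h \<le> 1" "x \<le> 1" "y \<le> 1"
  shows "relu_sq (x + h) * relu_sq (y - h) - relu_sq x * relu_sq y \<le>
     h * (2 * max 0 x * relu_sq y - relu_sq x * (2 * max 0 y)) + 5 * h\<^sup>2"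
proof -
  define a where "a = relu_sq x"
  define b where "b = relu_sq y"
  define a' where "a' = 2 * max 0 x"
  define b' where "b' = 2 * max 0 y"
  have r: "0 \<le> a" "a \<le> 1" "0 \<le> b" "b \<le> 1" "0 \<le> a'" "a' \<le> 2" "0 \<le> b'" "b' \<le> 2"
    using assms relu_sq_le_1[of x] relu_sq_le_1[of y] by (auto simp: a_def b_def a'_def b'_def)
  have "relu_sq (x + h) * relu_sq (y - h) \<le> (a + h * a' + h\<^sup>2) * relu_sq (y - h)"
    using relu_sq_shift(1)[OF assms(1), of x] by (intro mult_right_mono) (auto simp: a_def a'_def)
  also have "\<dots> \<le> (a + h * a' + h\<^sup>2) * (b - h * b' + h\<^sup>2)"
    using relu_sq_shift(3)[OF assms(1), of y] r assms(1) by (intro mult_left_mono) (auto simp: b_def b'_def)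
  also have "\<dots> = a * b + h * (a' * b - a * b') + h\<^sup>2 * (a + b + h * a' - h * b' + h\<^sup>2 - a' * b')"
    by (simp add: power2_eq_square algebra_simps)
  \<comment> \<open>The constant is \<open>1 + 1 + 2 + 1\<close>, from \<open>a\<close>,
    \<open>b\<close>, \<open>h * a'\<close> and \<open>h\<^sup>2\<close>; the other two terms are
    subtracted.\<close>
  also have "\<dots> \<le> a * b + h * (a' * b - a * b') + h\<^sup>2 * 5"
  proof -
    have "h * a' \<le> 1 * 2" using assms r by (intro mult_mono) auto
    moreover have "0 \<le> h * b'" "0 \<le> a' * b'" using assms r by auto
    moreover have "h\<^sup>2 \<le> 1" using assms by (simp add: power_le_one)
    ultimately have "a + b + h * a' - h * b' + h\<^sup>2 - a' * b' \<le> 5" using r by linarith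
    then show ?thesis by (intro add_left_mono mult_left_mono) auto
  qed
  finally show ?thesis by (simp add: a_def b_def a'_def b'_def)
qed

text \<open>Expand the product and keep the terms of order at most one in \<open>b\<close>; the
  others are nonnegative.\<close>

lemma prod_add_ge:
  fixes a b :: "'i \<Rightarrow> real"
  assumes "finite I" "\<And>i. i \<in> I \<Longrightarrow> 0 \<le> a i" "\<And>i. i \<in> I \<Longrightarrow> 0 \<le> b i"
  shows "(\<Prod>i\<in>I. a i) + (\<Sum>i\<in>I. b i * (\<Prod>k\<in>I - {i}. a k)) \<le> (\<Prod>i\<in>I. a i + b i)"
  using assms
proof (induction I)
  case (insert x I)
  have IH: "(\<Prod>i\<in>I. a i) + (\<Sum>i\<in>I. b i * (\<Prod>k\<in>I - {i}. a k)) \<le> (\<Prod>i\<in>I. a i + b i)"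
    using insert by simp
  have "(\<Sum>i\<in>I. b i * (\<Prod>k\<in>insert x I - {i}. a k)) = a x * (\<Sum>i\<in>I. b i * (\<Prod>k\<in>I - {i}. a k))"
    unfolding sum_distrib_left
  proof (rule sum.cong[OF refl])
    fix i assume "i \<in> I"
    then have "insert x I - {i} = insert x (I - {i})" using insert by auto
    then show "b i * (\<Prod>k\<in>insert x I - {i}. a k) = a x * (b i * (\<Prod>k\<in>I - {i}. a k))"
      using insert by simp
  qed
  moreover have "insert x I - {x} = I" using insert by auto
  ultimately have "(\<Prod>i\<in>insert x I. a i) + (\<Sum>i\<in>insert x I. b i * (\<Prod>k\<in>insert x I - {i}. a k)) =
      a x * ((\<Prod>i\<in>I. a i) + (\<Sum>i\<in>I. b i * (\<Prod>k\<in>I - {i}. a k))) + b x * (\<Prod>i\<in>I. a i)"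
    using insert by (simp add: algebra_simps)
  also have "\<dots> \<le> a x * (\<Prod>i\<in>I. a i + b i) + b x * (\<Prod>i\<in>I. a i + b i)"
    using insert IH by (intro add_mono mult_left_mono prod_mono) auto
  finally show ?case using insert by (simp add: algebra_simps)
qed simp


lemma energy_sum: "energy (\<Sum>i\<in>I. M i) x = (\<Sum>i\<in>I. energy (M i) x)"
proof (induction I rule: infinite_finite_induct)
  case (insert i I)
  then show ?case by (simp add: energy_def matrix_vector_mult_add_rdistrib inner_add_right)
qed (simp_all add: energy_def)

text \<open>The scheme without its eigenbases: a splitting into semidefinite forms of total speed
  \<open>b\<close>. The conditions \<open>speed\<close> and \<open>cfl\<close> together say that
  \<open>A\<close> dominates the flux forms scaled by the Courant factor
  \<open>\<tau> * 2 ^ N\<close>.\<close>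

locale upwind =
  fixes A :: "real ^ 'n ^ 'n" and P Q :: "'m::finite \<Rightarrow> real ^ 'n ^ 'n" and N :: nat and \<tau> b :: real
  assumes A: "positive_definite A"
    and P: "pos_semidef (P i)" and Q: "pos_semidef (Q i)"
    and speed: "(\<Sum>i\<in>UNIV. energy (P i) x + energy (Q i) x) \<le> b * energy A x"
    and \<tau>: "0 < \<tau>" and b: "0 \<le> b" and cfl: "\<tau> * 2 ^ N * b \<le> 1"
begin

definition sweep :: "(('m \<Rightarrow> int) \<Rightarrow> real ^ 'n) \<Rightarrow> ('m \<Rightarrow> int) \<Rightarrow> real ^ 'n" where
  "sweep U j = U j - (\<tau> * 2 ^ N) *\<^sub>R (matrix_inv A *v
     (\<Sum>i\<in>UNIV. P i *v (U j - U (down N i j)) - Q i *v (U (up N i j) - U j)))"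

definition total :: "(('m \<Rightarrow> int) \<Rightarrow> real ^ 'n) \<Rightarrow> real" where
  "total U = (\<Sum>j\<in>grid_indices N. energy A (U j))"

lemma energy_nonneg [simp]: "0 \<le> energy A x" "0 \<le> energy (P i) x" "0 \<le> energy (Q i) x"
  using positive_definite_pos_semidef[OF A] P Q by (auto simp: pos_semidef_def)

lemma A_matrix_inv: "A *v (matrix_inv A *v x) = x"
  by (rule matrix_inv_vector(1)[OF positive_definite_invertible[OF A]])

lemma total_nonneg [simp]: "0 \<le> total U"
  by (simp add: total_def sum_nonneg)

lemma sweep_diff: "sweep (\<lambda>j. U j - V j) j = sweep U j - sweep V j"
proof -
  have "(\<Sum>i\<in>UNIV. P i *v (U j - V j - (U (down N i j) - V (down N i j))) -
        Q i *v (U (up N i j) - V (up N i j) - (U j - V j))) =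
      (\<Sum>i\<in>UNIV. P i *v (U j - U (down N i j)) - Q i *v (U (up N i j) - U j)) -
      (\<Sum>i\<in>UNIV. P i *v (V j - V (down N i j)) - Q i *v (V (up N i j) - V j))"
    unfolding sum_subtractf[symmetric] by (simp add: matrix_vector_mult_diff_distrib algebra_simps)
  then show ?thesis
    unfolding sweep_def by (simp only: matrix_vector_mult_diff_distrib scaleR_diff_right) simp
qed

text \<open>Periodicity makes the scheme commute with shifts, so the differences of its values in a
  coordinate direction evolve by the scheme again.\<close>

lemma sweep_up:
  assumes "j \<in> grid_indices N"
  shows "sweep (\<lambda>j. U (up N k j)) j = sweep U (up N k j)"
  using assms by (simp add: sweep_def up_down(5)[of j N _ k] up_down(6))

text \<open>
  The new value is a convex combination of the old ones with the positive semidefinite matrix weights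
  \<open>A - \<lambda> \<Sum>\<^sub>i (P\<^sub>i + Q\<^sub>i)\<close>, \<open>\<lambda> P\<^sub>i\<close> and \<open>\<lambda> Q\<^sub>i\<close>, so that the energy obeys Jensen's inequality.
\<close>

lemma energy_sweep_le:
  "energy A (sweep U j) \<le> energy A (U j) + \<tau> * 2 ^ N * (\<Sum>i\<in>UNIV.
     (energy (P i) (U (down N i j)) - energy (P i) (U j)) +
     (energy (Q i) (U (up N i j)) - energy (Q i) (U j)))"
proof -
  define c where "c = \<tau> * 2 ^ N"
  have c: "0 \<le> c" "c * b \<le> 1" using \<tau> cfl by (auto simp: c_def)
  define R where "R = (\<Sum>i\<in>UNIV. P i + Q i)"
  define G where "G = A - c *\<^sub>R R"
  have enR: "energy R x = (\<Sum>i\<in>UNIV. energy (P i) x + energy (Q i) x)" for x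
    unfolding R_def energy_sum by (simp add: energy_def matrix_vector_mult_add_rdistrib inner_add_right)
  have enG: "energy G x = energy A x - c * energy R x" for x
    by (simp add: G_def energy_diff_matrix) (simp add: energy_def scaleR_matrix_vector_assoc[symmetric])
  have "symmetric_matrix R"
    unfolding symmetric_matrix_def R_def
    using P Q by (simp add: pos_semidef_def symmetric_matrix_def transpose_def vec_eq_iff)
  then have symG: "symmetric_matrix G"
    using positive_definite_symmetric[OF A] by (simp add: symmetric_matrix_def G_def transpose_def vec_eq_iff)
  have G: "pos_semidef G" unfolding pos_semidef_def
  proof (intro conjI symG allI)
    fix x
    have "c * energy R x \<le> c * (b * energy A x)"
      unfolding enR using speed c(1) by (rule mult_left_mono)
    also have "\<dots> \<le> 1 * energy A x"
      unfolding mult.assoc[symmetric] using c(2) by (rule mult_right_mono) simp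
    finally show "0 \<le> energy G x" by (simp add: enG)
  qed
  define y where "y = sweep U j"
  define u where "u = U j"
  have Ay: "A *v y = G *v u + c *\<^sub>R (\<Sum>i\<in>UNIV. P i *v U (down N i j) + Q i *v U (up N i j))"
  proof -
    have "A *v y = A *v u - c *\<^sub>R (\<Sum>i\<in>UNIV. P i *v (u - U (down N i j)) - Q i *v (U (up N i j) - u))"
      unfolding y_def sweep_def matrix_vector_mult_diff_distrib matrix_vector_mult_scaleR A_matrix_inv
      by (simp add: u_def c_def)
    moreover have "G *v u = A *v u - c *\<^sub>R (\<Sum>i\<in>UNIV. P i *v u + Q i *v u)"
    proof -
      have "R *v u = (\<Sum>i\<in>UNIV. P i *v u + Q i *v u)"
      proof -
        have "(\<Sum>i\<in>I. P i + Q i) *v u = (\<Sum>i\<in>I. P i *v u + Q i *v u)" if "finite I" for I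
          using that by induction (auto simp: matrix_vector_mult_add_rdistrib)
        then show ?thesis by (simp add: R_def)
      qed
      then show ?thesis by (simp add: G_def matrix_vector_mult_diff_rdistrib scaleR_matrix_vector_assoc[symmetric])
    qed
    moreover have "(\<Sum>i\<in>UNIV. P i *v (u - U (down N i j)) - Q i *v (U (up N i j) - u)) =
      (\<Sum>i\<in>UNIV. P i *v u + Q i *v u) - (\<Sum>i\<in>UNIV. P i *v U (down N i j) + Q i *v U (up N i j))"
      unfolding sum_subtractf[symmetric] by (simp add: matrix_vector_mult_diff_distrib algebra_simps)
    ultimately show ?thesis by (simp add: scaleR_diff_right)
  qed
  \<comment> \<open>Test \<open>A *v y\<close> with \<open>y\<close> and apply Young's inequality
    with parameter \<open>1\<close> to each weight. As the weights add up to \<open>A\<close>, the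
    energies of \<open>y\<close> on the right sum to one \<open>energy A y\<close>, which is
    absorbed on the left.\<close>
  have "2 * energy A y = 2 * (y \<bullet> (G *v u)) +
      c * (\<Sum>i\<in>UNIV. 2 * (y \<bullet> (P i *v U (down N i j))) + 2 * (y \<bullet> (Q i *v U (up N i j))))"
    unfolding energy_def[of A] Ay
    by (simp add: inner_add_right inner_sum_right sum.distrib sum_distrib_left[symmetric] algebra_simps)
  also have "\<dots> \<le> (energy G y + energy G u) +
      c * (\<Sum>i\<in>UNIV. (energy (P i) y + energy (P i) (U (down N i j))) + (energy (Q i) y + energy (Q i) (U (up N i j))))"
    using inner_le_energies[OF G, of 1] inner_le_energies[OF P, of 1] inner_le_energies[OF Q, of 1] c(1)
    by (intro add_mono mult_left_mono sum_mono) auto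
  finally show ?thesis
    unfolding enG enR by (simp add: y_def u_def c_def sum.distrib sum_subtractf algebra_simps)
qed

text \<open>Summation by parts moves the shifts from the values to the weight, so that only
  differences of the weight enter.\<close>

lemma weighted_sweep_le:
  fixes W :: "('m \<Rightarrow> int) \<Rightarrow> real"
  assumes W: "\<And>j. j \<in> grid_indices N \<Longrightarrow> 0 \<le> W j"
  shows "(\<Sum>j\<in>grid_indices N. W j * energy A (sweep U j)) \<le>
    (\<Sum>j\<in>grid_indices N. W j * energy A (U j) + \<tau> * 2 ^ N * (\<Sum>i\<in>UNIV.
       (W (up N i j) - W j) * energy (P i) (U j) + (W (down N i j) - W j) * energy (Q i) (U j)))"
proof -
  let ?J = "grid_indices N :: ('m \<Rightarrow> int) set"
  have shiftP: "(\<Sum>j\<in>?J. W j * energy (P i) (U (down N i j))) = (\<Sum>j\<in>?J. W (up N i j) * energy (P i) (U j))" for i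
    unfolding sum_up[of "\<lambda>j. W j * energy (P i) (U (down N i j))" N i, symmetric]
    by (intro sum.cong) (simp_all add: up_down)
  have shiftQ: "(\<Sum>j\<in>?J. W j * energy (Q i) (U (up N i j))) = (\<Sum>j\<in>?J. W (down N i j) * energy (Q i) (U j))" for i
    unfolding sum_down[of "\<lambda>j. W j * energy (Q i) (U (up N i j))" N i, symmetric]
    by (intro sum.cong) (simp_all add: up_down)
  have "(\<Sum>j\<in>?J. W j * energy A (sweep U j)) \<le> (\<Sum>j\<in>?J. W j * (energy A (U j) + \<tau> * 2 ^ N * (\<Sum>i\<in>UNIV.
     (energy (P i) (U (down N i j)) - energy (P i) (U j)) + (energy (Q i) (U (up N i j)) - energy (Q i) (U j)))))"
    using W by (intro sum_mono mult_left_mono energy_sweep_le) auto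
  also have "\<dots> = (\<Sum>j\<in>?J. W j * energy A (U j)) + \<tau> * 2 ^ N * (\<Sum>i\<in>UNIV.
      (\<Sum>j\<in>?J. W j * energy (P i) (U (down N i j))) - (\<Sum>j\<in>?J. W j * energy (P i) (U j)) +
      ((\<Sum>j\<in>?J. W j * energy (Q i) (U (up N i j))) - (\<Sum>j\<in>?J. W j * energy (Q i) (U j))))"
    by (simp add: algebra_simps sum.distrib sum_distrib_left sum_subtractf sum.swap[of _ UNIV ?J])
  also have "\<dots> = (\<Sum>j\<in>?J. W j * energy A (U j) + \<tau> * 2 ^ N * (\<Sum>i\<in>UNIV.
       (W (up N i j) - W j) * energy (P i) (U j) + (W (down N i j) - W j) * energy (Q i) (U j)))"
    unfolding shiftP shiftQ
    by (simp add: algebra_simps sum.distrib sum_distrib_left sum_subtractf sum.swap[of _ UNIV ?J])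
  finally show ?thesis .
qed

lemma total_sweep_le: "total (sweep U) \<le> total U"
  using weighted_sweep_le[of "\<lambda>_. 1" U] by (simp add: total_def)

lemma energy_add_scaled_le:
  assumes "0 < s"
  shows "energy A (x + \<tau> *\<^sub>R r) \<le> energy A x + \<tau> * (s * energy A x + energy A r / s) + \<tau>\<^sup>2 * energy A r"
proof -
  have "energy A (x + \<tau> *\<^sub>R r) = energy A x + \<tau> * (2 * (x \<bullet> (A *v r))) + \<tau>\<^sup>2 * energy A r"
    unfolding energy_add[OF positive_definite_symmetric[OF A]]
    by (simp add: energy_scaleR matrix_vector_mult_scaleR)
  then show ?thesis
    using mult_left_mono[OF inner_le_energies[OF positive_definite_pos_semidef[OF A] assms, of x r], of \<tau>] \<tau>
    by simp
qed

text \<open>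
  Weighing the inhomogeneity with the total time \<open>T\<close> keeps the growth factor below \<open>e\<close>, whatever \<open>T\<close>
  is.
\<close>

lemma total_growth:
  assumes step: "\<And>l j. l < L \<Longrightarrow> j \<in> grid_indices N \<Longrightarrow> V (Suc l) j = sweep (V l) j + \<tau> *\<^sub>R g l j"
    and g: "\<And>l. l < L \<Longrightarrow> total (g l) \<le> F" and T: "real L * \<tau> = T" "l \<le> L" "0 \<le> F"
  shows "total (V l) \<le> 3 * (total (V 0) + T * (T + \<tau>) * F)"
proof (cases "L = 0")
  case True
  then show ?thesis using T total_nonneg[of "V 0"] by simp
next
  case False
  have T0: "0 < T" "\<tau> \<le> T" using T(1) \<tau> False by auto
  have "total (V l) \<le> (1 + \<tau> / T) ^ l * (total (V 0) + real l * \<tau> * (T + \<tau>) * F)"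
    using T(2)
  proof (induction l)
    case (Suc l)
    then have l: "l < L" by simp
    have "total (V (Suc l)) \<le> (\<Sum>j\<in>grid_indices N. energy A (sweep (V l) j) +
        \<tau> * (1 / T * energy A (sweep (V l) j) + energy A (g l j) / (1 / T)) + \<tau>\<^sup>2 * energy A (g l j))"
      unfolding total_def
    proof (rule sum_mono)
      fix j :: "'m \<Rightarrow> int" assume j: "j \<in> grid_indices N"
      show "energy A (V (Suc l) j) \<le> energy A (sweep (V l) j) +
        \<tau> * (1 / T * energy A (sweep (V l) j) + energy A (g l j) / (1 / T)) + \<tau>\<^sup>2 * energy A (g l j)"
        unfolding step[OF l j] using T0 by (intro energy_add_scaled_le) simp
    qed
    also have "\<dots> = (1 + \<tau> / T) * total (sweep (V l)) + \<tau> * (T + \<tau>) * total (g l)"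
      by (simp add: total_def sum.distrib sum_distrib_left power2_eq_square algebra_simps)
    also have "\<dots> \<le> (1 + \<tau> / T) * total (V l) + \<tau> * (T + \<tau>) * F"
      using total_sweep_le[of "V l"] g[OF l] T0 \<tau> by (intro add_mono mult_left_mono) auto
    also have "\<dots> \<le> (1 + \<tau> / T) * ((1 + \<tau> / T) ^ l * (total (V 0) + real l * \<tau> * (T + \<tau>) * F)) +
        (1 + \<tau> / T) ^ Suc l * (\<tau> * (T + \<tau>) * F)"
    proof (intro add_mono mult_left_mono)
      show "total (V l) \<le> (1 + \<tau> / T) ^ l * (total (V 0) + real l * \<tau> * (T + \<tau>) * F)"
        using Suc by simp
      have "1 \<le> (1 + \<tau> / T) ^ Suc l" using T0 \<tau> by (intro one_le_power) simp
      then show "\<tau> * (T + \<tau>) * F \<le> (1 + \<tau> / T) ^ Suc l * (\<tau> * (T + \<tau>) * F)"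
        using T0 \<tau> T(3) mult_right_mono[of 1 "(1 + \<tau> / T) ^ Suc l" "\<tau> * (T + \<tau>) * F"]
        by (simp only: mult_1) simp
    qed (use T0 \<tau> in simp)
    also have "\<dots> = (1 + \<tau> / T) ^ Suc l * (total (V 0) + real (Suc l) * \<tau> * (T + \<tau>) * F)"
    proof -
      have "p * (p ^ l * (a + real l * x)) + p ^ Suc l * x = p ^ Suc l * (a + real (Suc l) * x)"
        for p a x :: real by (simp add: algebra_simps)
      from this[of "1 + \<tau> / T" "total (V 0)" "\<tau> * (T + \<tau>) * F"] show ?thesis
        by (simp only: mult.assoc)
    qed
    finally show ?case .
  qed simp
  also have "\<dots> \<le> 3 * (total (V 0) + T * (T + \<tau>) * F)"
  proof (intro mult_mono)
    have "(1 + \<tau> / T) ^ l \<le> exp (\<tau> / T) ^ l"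
      using T0 \<tau> by (intro power_mono exp_ge_add_one_self) simp
    also have "\<dots> = exp (real l * \<tau> / T)" by (simp add: exp_of_nat_mult[symmetric])
    also have "\<dots> \<le> exp 1" using T T0 \<tau> by (auto simp: divide_le_eq_1 intro!: mult_right_mono)
    also have "\<dots> \<le> 3" by (rule exp_le)
    finally show "(1 + \<tau> / T) ^ l \<le> 3" .
    have "real l * \<tau> \<le> T" using T \<tau> by (auto intro!: mult_right_mono)
    then show "total (V 0) + real l * \<tau> * (T + \<tau>) * F \<le> total (V 0) + T * (T + \<tau>) * F"
      using T0 \<tau> T(3) by (intro add_left_mono mult_right_mono) auto
  qed (use T0 \<tau> T(3) in auto)
  finally show ?thesis .
qed

end

text \<open>
  The weight vanishes outside the domain of dependence shrunk by one cell, so that the periodic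
  continuation is not seen.
\<close>

locale upwind_cone = upwind A P Q N \<tau> b
  for A :: "real ^ 'n ^ 'n" and P Q :: "'m::finite \<Rightarrow> real ^ 'n ^ 'n" and N :: nat and \<tau> b :: real +
  fixes mx mn :: "'m \<Rightarrow> real"
  assumes mx: "energy (P i) x - energy (Q i) x \<le> mx i * energy A x" "0 \<le> mx i"
    and mn: "mn i * energy A x \<le> energy (P i) x - energy (Q i) x" "mn i \<le> 0"
begin

definition low :: "'m \<Rightarrow> real \<Rightarrow> ('m \<Rightarrow> int) \<Rightarrow> real" where
  "low i t j = grid_point N j $ i - 1 / 2 ^ N - mx i * t"

definition high :: "'m \<Rightarrow> real \<Rightarrow> ('m \<Rightarrow> int) \<Rightarrow> real" where
  "high i t j = 1 - 1 / 2 ^ N + mn i * t - grid_point N j $ i"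

definition weight :: "real \<Rightarrow> ('m \<Rightarrow> int) \<Rightarrow> real" where
  "weight t j = (\<Prod>i\<in>UNIV. relu_sq (low i t j) * relu_sq (high i t j))"

lemma low_high_le_1:
  assumes "j \<in> grid_indices N" "0 \<le> t"
  shows "low i t j \<le> 1" "high i t j \<le> 1"
proof -
  have "real_of_int (j i) \<le> real_of_int (2 ^ N)" "1 \<le> real_of_int (j i)"
    using grid_indicesD[OF assms(1), of i] by (simp_all only: of_int_le_iff atLeastAtMost_iff) auto
  then have "0 \<le> real_of_int (j i) - 1 / 2" "real_of_int (j i) - 1 / 2 \<le> real_of_int (2 ^ N)"
    by linarith+
  then have "0 \<le> grid_point N j $ i" "grid_point N j $ i \<le> 1"
    by (simp_all add: grid_point_def divide_le_eq)
  moreover have "0 \<le> mx i * t" "mn i * t \<le> 0"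
    using mx(2) mn(2) assms(2) by (auto intro: mult_nonpos_nonneg)
  moreover have "0 \<le> 1 / (2 ^ N :: real)" by simp
  ultimately show "low i t j \<le> 1" "high i t j \<le> 1" unfolding low_def high_def by linarith+
qed

lemma weight_nonneg [simp]: "0 \<le> weight t j"
  by (simp add: weight_def prod_nonneg)

lemma weight_le_1:
  assumes "j \<in> grid_indices N" "0 \<le> t"
  shows "weight t j \<le> 1"
  unfolding weight_def using low_high_le_1[OF assms]
  by (intro prod_le_1) (auto intro!: mult_le_one relu_sq_le_1)

lemma weight_pos_iff: "0 < weight t j \<longleftrightarrow> (\<forall>i. 0 < low i t j \<and> 0 < high i t j)"
proof -
  have "0 < weight t j \<longleftrightarrow> weight t j \<noteq> 0" using weight_nonneg[of t j] by linarith
  also have "\<dots> \<longleftrightarrow> (\<forall>i. 0 < low i t j \<and> 0 < high i t j)"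
    by (auto simp: weight_def relu_sq_eq_0_iff not_le)
  finally show ?thesis .
qed

text \<open>The formulas of interior shifts remain true across a periodic face, since both sides
  vanish there: one of the factors \<open>low\<close>, \<open>high\<close> is nonpositive at the
  continued neighbour, and the other one after the formal shift. Hence the periodic continuation is
  invisible to the weight.\<close>

lemma weight_shift:
  fixes j :: "'m \<Rightarrow> int"
  assumes j: "j \<in> grid_indices N" and t: "0 \<le> t"
  defines "h \<equiv> 1 / 2 ^ N"
  defines "R \<equiv> \<lambda>i. \<Prod>k\<in>UNIV - {i}. relu_sq (low k t j) * relu_sq (high k t j)"
  shows "weight t j = R i * (relu_sq (low i t j) * relu_sq (high i t j))"
    "weight t (up N i j) = R i * (relu_sq (low i t j + h) * relu_sq (high i t j - h))"
    "weight t (down N i j) = R i * (relu_sq (low i t j - h) * relu_sq (high i t j + h))"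
proof -
  have gen: "weight t j' = R i * (relu_sq (low i t j') * relu_sq (high i t j'))"
    if "\<And>k. k \<noteq> i \<Longrightarrow> j' k = j k" for j'
  proof -
    have "weight t j' = relu_sq (low i t j') * relu_sq (high i t j') *
        (\<Prod>k\<in>UNIV - {i}. relu_sq (low k t j') * relu_sq (high k t j'))"
      unfolding weight_def by (rule prod.remove) auto
    also have "(\<Prod>k\<in>UNIV - {i}. relu_sq (low k t j') * relu_sq (high k t j')) = R i"
      unfolding R_def using that by (intro prod.cong) (auto simp: low_def high_def grid_point_def)
    finally show ?thesis by (simp add: mult.commute)
  qed
  show "weight t j = R i * (relu_sq (low i t j) * relu_sq (high i t j))" by (rule gen) simp
  have h: "0 < h" by (simp add: h_def)
  have jj: "j i \<in> {1..2 ^ N}" by (rule grid_indicesD[OF j])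
  have m: "0 \<le> mx i * t" "mn i * t \<le> 0" using mx(2) mn(2) t by (auto intro: mult_nonpos_nonneg)
  have gp: "grid_point N j' $ i = (of_int (j' i) - 1 / 2) * h" for j' by (simp add: grid_point_def h_def)
  have M: "2 ^ N * h = 1" by (simp add: h_def)
  have M1: "(2 :: int) ^ N + 1 \<noteq> 0" using zero_less_power[of "2 :: int" N] by linarith
  show "weight t (up N i j) = R i * (relu_sq (low i t j + h) * relu_sq (high i t j - h))"
  proof (cases "j i = 2 ^ N")
    case True
    have "low i t (up N i j) \<le> 0"
      using True h m M1 by (simp add: low_def gp up_def wrap_def h_def[symmetric])
    moreover have "high i t j - h \<le> 0"
      using True h m M by (simp add: high_def gp h_def[symmetric] algebra_simps)
    ultimately show ?thesis using gen[of "up N i j"] by (simp add: up_def relu_sq_neg)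
  next
    case False
    then have "up N i j i = j i + 1" using jj by (simp add: up_def wrap_def)
    then have "low i t (up N i j) = low i t j + h" "high i t (up N i j) = high i t j - h"
      by (simp_all add: low_def high_def gp algebra_simps)
    then show ?thesis using gen[of "up N i j"] by (simp add: up_def)
  qed
  show "weight t (down N i j) = R i * (relu_sq (low i t j - h) * relu_sq (high i t j + h))"
  proof (cases "j i = 1")
    case True
    have "high i t (down N i j) \<le> 0"
      using True h m M by (simp add: high_def gp down_def wrap_def h_def[symmetric] algebra_simps)
    moreover have "low i t j - h \<le> 0"
      using True h m by (simp add: low_def gp h_def[symmetric])
    ultimately show ?thesis using gen[of "down N i j"] by (simp add: down_def relu_sq_neg)
  next
    case False
    then have "down N i j i = j i - 1" using jj by (simp add: down_def wrap_def)
    then have d: "real_of_int (down N i j i) = real_of_int (j i) - 1" by simp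
    have "low i t (down N i j) = low i t j - h" "high i t (down N i j) = high i t j + h"
      unfolding low_def high_def gp h_def[symmetric] d by (simp_all add: algebra_simps)
    then show ?thesis using gen[of "down N i j"] by (simp add: down_def)
  qed
qed

text \<open>To first order the differences of the weight give \<open>h * R i * d i\<close> times the
  energy of \<open>P i - Q i\<close>. The extremal speeds bound this by \<open>h * R i * c i\<close>
  times the energy of \<open>A\<close>, and the weight loses at least
  \<open>\<tau> * R i * c i\<close> by the motion of the faces. Only the second order remainders
  survive.\<close>

lemma weight_transport:
  assumes j: "j \<in> grid_indices N" and t: "0 \<le> t"
  shows "weight (t + \<tau>) j * energy A u + \<tau> * 2 ^ N * (\<Sum>i\<in>UNIV.
       (weight (t + \<tau>) (up N i j) - weight (t + \<tau>) j) * energy (P i) u +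
       (weight (t + \<tau>) (down N i j) - weight (t + \<tau>) j) * energy (Q i) u)
     \<le> weight t j * energy A u + 5 * \<tau> * (1 / 2 ^ N) * b * energy A u"
proof -
  define h :: real where "h = 1 / 2 ^ N"
  have h: "0 \<le> h" "h \<le> 1" by (auto simp: h_def)
  define x where "x i = low i (t + \<tau>) j" for i
  define y where "y i = high i (t + \<tau>) j" for i
  have t': "0 \<le> t + \<tau>" using t \<tau> by simp
  have xy: "x i \<le> 1" "y i \<le> 1" for i using low_high_le_1[OF j t'] by (auto simp: x_def y_def)
  define a where "a i = relu_sq (x i) * relu_sq (y i)" for i
  define R where "R i = (\<Prod>k\<in>UNIV - {i}. a k)" for i
  have a01: "0 \<le> a i" "a i \<le> 1" for i
    using xy by (auto simp: a_def intro!: mult_le_one relu_sq_le_1)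
  have R01: "0 \<le> R i" "R i \<le> 1" for i
    using a01 by (auto simp: R_def intro!: prod_nonneg prod_le_1)
  note ws = weight_shift[OF j t', folded x_def y_def h_def, folded a_def, folded R_def]
  \<comment> \<open>This is the derivative of the \<open>i\<close>-th factor of the weight along the
    axis; in \<open>c\<close> its two parts carry the speeds of their faces, which gives the rate of
    decrease in time.\<close>
  define d where "d i = 2 * max 0 (x i) * relu_sq (y i) - relu_sq (x i) * (2 * max 0 (y i))" for i
  define c where "c i = 2 * max 0 (x i) * relu_sq (y i) * mx i - relu_sq (x i) * (2 * max 0 (y i)) * mn i" for i
  have c0: "0 \<le> c i" for i
  proof -
    have "relu_sq (x i) * (2 * max 0 (y i)) * mn i \<le> 0"
      using mn(2) by (intro mult_nonneg_nonpos) auto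
    moreover have "0 \<le> 2 * max 0 (x i) * relu_sq (y i) * mx i" using mx(2) by simp
    ultimately show ?thesis unfolding c_def by linarith
  qed
  have step: "(weight (t + \<tau>) (up N i j) - weight (t + \<tau>) j) * energy (P i) u +
       (weight (t + \<tau>) (down N i j) - weight (t + \<tau>) j) * energy (Q i) u
     \<le> h * (R i * c i) * energy A u + 5 * h\<^sup>2 * (energy (P i) u + energy (Q i) u)" for i
  proof -
    have "weight (t + \<tau>) (up N i j) - weight (t + \<tau>) j \<le> R i * (h * d i + 5 * h\<^sup>2)"
      unfolding ws(1)[of i] ws(2) d_def a_def right_diff_distrib[symmetric]
      using relu_sq_product_shift[OF h xy] R01 by (intro mult_left_mono) auto
    then have 1: "(weight (t + \<tau>) (up N i j) - weight (t + \<tau>) j) * energy (P i) u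
        \<le> R i * (h * d i + 5 * h\<^sup>2) * energy (P i) u"
      by (intro mult_right_mono) auto
    have "weight (t + \<tau>) (down N i j) - weight (t + \<tau>) j \<le> R i * (- (h * d i) + 5 * h\<^sup>2)"
    proof -
      have "relu_sq (x i - h) * relu_sq (y i + h) - a i \<le> - (h * d i) + 5 * h\<^sup>2"
        using relu_sq_product_shift[OF h xy(2,1), of i i] by (simp add: a_def d_def algebra_simps)
      then show ?thesis
        unfolding ws(1)[of i] ws(3) right_diff_distrib[symmetric] using R01 by (intro mult_left_mono) auto
    qed
    then have 2: "(weight (t + \<tau>) (down N i j) - weight (t + \<tau>) j) * energy (Q i) u
        \<le> R i * (- (h * d i) + 5 * h\<^sup>2) * energy (Q i) u"
      by (intro mult_right_mono) auto
    have "d i * (energy (P i) u - energy (Q i) u) \<le> c i * energy A u"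
    proof -
      have "2 * max 0 (x i) * relu_sq (y i) * (energy (P i) u - energy (Q i) u)
          \<le> 2 * max 0 (x i) * relu_sq (y i) * (mx i * energy A u)"
        using mx(1) by (intro mult_left_mono) auto
      moreover have "relu_sq (x i) * (2 * max 0 (y i)) * (mn i * energy A u)
          \<le> relu_sq (x i) * (2 * max 0 (y i)) * (energy (P i) u - energy (Q i) u)"
        using mn(1) by (intro mult_left_mono) auto
      ultimately show ?thesis by (simp add: d_def c_def algebra_simps)
    qed
    then have "(h * R i) * (d i * (energy (P i) u - energy (Q i) u)) \<le> (h * R i) * (c i * energy A u)"
      using h R01 by (intro mult_left_mono) auto
    moreover have "R i * (5 * h\<^sup>2 * (energy (P i) u + energy (Q i) u)) \<le> 1 * (5 * h\<^sup>2 * (energy (P i) u + energy (Q i) u))"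
      using R01 by (intro mult_right_mono) auto
    moreover have "R i * (h * d i + 5 * h\<^sup>2) * energy (P i) u + R i * (- (h * d i) + 5 * h\<^sup>2) * energy (Q i) u =
       (h * R i) * (d i * (energy (P i) u - energy (Q i) u)) + R i * (5 * h\<^sup>2 * (energy (P i) u + energy (Q i) u))"
      by (simp add: algebra_simps)
    ultimately show ?thesis using 1 2 by (simp add: mult_ac)
  qed
  \<comment> \<open>Going back by \<tau>, \<open>low\<close> grows by \<open>mx i * \<tau>\<close>
    and \<open>high\<close> by \<open>- mn i * \<tau>\<close>. By convexity of
    \<open>relu_sq\<close> each factor gains at least its first order term, and the products of
    gains are nonnegative.\<close>
  have "weight t j \<ge> (\<Prod>i\<in>UNIV. a i) + (\<Sum>i\<in>UNIV. (\<tau> * c i) * (\<Prod>k\<in>UNIV - {i}. a k))"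
  proof -
    have "(\<Prod>i\<in>UNIV. a i) + (\<Sum>i\<in>UNIV. (\<tau> * c i) * (\<Prod>k\<in>UNIV - {i}. a k)) \<le> (\<Prod>i\<in>UNIV. a i + \<tau> * c i)"
      using a01 c0 \<tau> by (intro prod_add_ge) auto
    also have "\<dots> \<le> weight t j"
      unfolding weight_def
    proof (intro prod_mono conjI)
      fix i
      show "0 \<le> a i + \<tau> * c i" using a01 c0 \<tau> by simp
      have "low i t j = x i + mx i * \<tau>" "high i t j = y i + (- mn i) * \<tau>"
        by (simp_all add: low_def high_def x_def y_def algebra_simps)
      moreover have "a i + \<tau> * c i \<le> (relu_sq (x i) + mx i * \<tau> * (2 * max 0 (x i))) *
          (relu_sq (y i) + (- mn i) * \<tau> * (2 * max 0 (y i)))"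
      proof -
        have "0 \<le> (mx i * \<tau> * (2 * max 0 (x i))) * ((- mn i) * \<tau> * (2 * max 0 (y i)))"
          using mx(2) mn(2) \<tau> by (intro mult_nonneg_nonneg) auto
        then show ?thesis by (simp add: a_def c_def algebra_simps)
      qed
      moreover have "\<dots> \<le> relu_sq (x i + mx i * \<tau>) * relu_sq (y i + (- mn i) * \<tau>)"
      proof (intro mult_mono)
        show "relu_sq (x i) + mx i * \<tau> * (2 * max 0 (x i)) \<le> relu_sq (x i + mx i * \<tau>)"
          using mx(2) \<tau> by (intro relu_sq_shift) simp
        show "relu_sq (y i) + (- mn i) * \<tau> * (2 * max 0 (y i)) \<le> relu_sq (y i + (- mn i) * \<tau>)"
          using mn(2) \<tau> by (intro relu_sq_shift mult_nonneg_nonneg) auto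
        show "0 \<le> relu_sq (y i) + (- mn i) * \<tau> * (2 * max 0 (y i))"
          using mn(2)[of i] \<tau> by (intro add_nonneg_nonneg mult_nonneg_nonneg) auto
      qed simp
      ultimately show "a i + \<tau> * c i \<le> relu_sq (low i t j) * relu_sq (high i t j)" by simp
    qed
    finally show ?thesis .
  qed
  moreover have "(\<Prod>i\<in>UNIV. a i) = weight (t + \<tau>) j"
    by (simp add: weight_def a_def x_def y_def)
  ultimately have w: "weight (t + \<tau>) j + \<tau> * (\<Sum>i\<in>UNIV. R i * c i) \<le> weight t j"
    by (simp add: R_def sum_distrib_left mult_ac)
  have "\<tau> * 2 ^ N * (\<Sum>i\<in>UNIV. (weight (t + \<tau>) (up N i j) - weight (t + \<tau>) j) * energy (P i) u +
       (weight (t + \<tau>) (down N i j) - weight (t + \<tau>) j) * energy (Q i) u)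
    \<le> \<tau> * 2 ^ N * (\<Sum>i\<in>UNIV. h * (R i * c i) * energy A u + 5 * h\<^sup>2 * (energy (P i) u + energy (Q i) u))"
    using \<tau> by (intro mult_left_mono sum_mono step) auto
  also have "\<dots> = \<tau> * (2 ^ N * h) * ((\<Sum>i\<in>UNIV. R i * c i) * energy A u +
      5 * h * (\<Sum>i\<in>UNIV. energy (P i) u + energy (Q i) u))"
    by (simp add: sum.distrib sum_distrib_left sum_distrib_right power2_eq_square algebra_simps)
  also have "\<dots> = \<tau> * ((\<Sum>i\<in>UNIV. R i * c i) * energy A u +
      5 * h * (\<Sum>i\<in>UNIV. energy (P i) u + energy (Q i) u))"
    by (simp add: h_def)
  also have "\<dots> \<le> \<tau> * ((\<Sum>i\<in>UNIV. R i * c i) * energy A u + 5 * h * (b * energy A u))"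
    using \<tau> h speed by (intro mult_left_mono add_left_mono) auto
  finally have "\<tau> * 2 ^ N * (\<Sum>i\<in>UNIV. (weight (t + \<tau>) (up N i j) - weight (t + \<tau>) j) * energy (P i) u +
       (weight (t + \<tau>) (down N i j) - weight (t + \<tau>) j) * energy (Q i) u)
    \<le> \<tau> * (\<Sum>i\<in>UNIV. R i * c i) * energy A u + 5 * \<tau> * h * b * energy A u"
    by (simp add: algebra_simps)
  moreover have "(weight (t + \<tau>) j + \<tau> * (\<Sum>i\<in>UNIV. R i * c i)) * energy A u \<le> weight t j * energy A u"
    using w by (intro mult_right_mono) auto
  ultimately show ?thesis unfolding h_def by (simp add: distrib_right)
qed

text \<open>The scheme with a small residual is required only where the new weight is positive. The
  crude bound \<open>K\<close> for the unweighted energy needs no smallness: it is multiplied by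
  \<open>1 / 2 ^ N\<close> or by \<rho>.\<close>

lemma weighted_growth:
  assumes step: "\<And>l j. l < L \<Longrightarrow> j \<in> grid_indices N \<Longrightarrow> 0 < weight (real (Suc l) * \<tau>) j \<Longrightarrow>
       \<exists>r. e (Suc l) j = sweep (e l) j + \<tau> *\<^sub>R r \<and> energy A r \<le> \<rho>\<^sup>2"
    and tot: "\<And>l. l < L \<Longrightarrow> total (e l) \<le> K * 2 ^ (N * CARD('m))"
    and \<rho>: "0 < \<rho>" "\<rho> \<le> 1" and \<tau>1: "\<tau> \<le> 1" and l: "l \<le> L"
  shows "(\<Sum>j\<in>grid_indices N. weight (real l * \<tau>) j * energy A (e l j)) \<le>
     (\<Sum>j\<in>grid_indices N. weight 0 j * energy A (e 0 j)) +
       real l * \<tau> * (5 * (1 / 2 ^ N) * b * K + \<rho> * K + 2 * \<rho>) * 2 ^ (N * CARD('m))"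
  using l
proof (induction l)
  case (Suc l)
  let ?J = "grid_indices N :: ('m \<Rightarrow> int) set"
  define t where "t = real l * \<tau>"
  have t: "0 \<le> t" using \<tau> by (simp add: t_def)
  have t': "real (Suc l) * \<tau> = t + \<tau>" by (simp add: t_def algebra_simps)
  have l: "l < L" using Suc by simp
  have pt: "weight (t + \<tau>) j * energy A (e (Suc l) j) \<le>
      weight (t + \<tau>) j * energy A (sweep (e l) j) + \<tau> * \<rho> * energy A (sweep (e l) j) + 2 * \<tau> * \<rho>"
    if j: "j \<in> ?J" for j
  proof (cases "0 < weight (t + \<tau>) j")
    case True
    obtain r where s: "e (Suc l) j = sweep (e l) j + \<tau> *\<^sub>R r" "energy A r \<le> \<rho>\<^sup>2"
      using step[OF l j True[folded t']] by blast
    \<comment> \<open>Young's parameter \<rho> is matched to the bound \<open>\<rho>\<^sup>2\<close>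
      for the energy of \<open>r\<close>, so that both resulting terms carry a factor
      \<rho>.\<close>
    have "energy A (e (Suc l) j) \<le> energy A (sweep (e l) j) +
        \<tau> * (\<rho> * energy A (sweep (e l) j) + energy A r / \<rho>) + \<tau>\<^sup>2 * energy A r"
      unfolding s(1) by (rule energy_add_scaled_le[OF \<rho>(1)])
    also have "\<dots> \<le> energy A (sweep (e l) j) + \<tau> * (\<rho> * energy A (sweep (e l) j) + \<rho>) + \<tau> * \<rho>"
    proof (intro add_mono mult_left_mono order_refl)
      show "energy A r / \<rho> \<le> \<rho>" using s \<rho>(1) by (simp add: divide_le_eq power2_eq_square)
      have "\<tau>\<^sup>2 * energy A r \<le> \<tau>\<^sup>2 * \<rho>\<^sup>2" using s by (intro mult_left_mono) auto
      also have "\<dots> = (\<tau> * \<rho>) * (\<tau> * \<rho>)" by (simp add: power2_eq_square mult_ac)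
      also have "\<dots> \<le> 1 * (\<tau> * \<rho>)" using \<tau> \<tau>1 \<rho> by (intro mult_right_mono mult_le_one) auto
      finally show "\<tau>\<^sup>2 * energy A r \<le> \<tau> * \<rho>" by simp
    qed (use \<tau> \<rho> in auto)
    finally have "energy A (e (Suc l) j) \<le> energy A (sweep (e l) j) +
        (\<tau> * \<rho> * energy A (sweep (e l) j) + 2 * \<tau> * \<rho>)"
      by (simp add: algebra_simps)
    then have "weight (t + \<tau>) j * energy A (e (Suc l) j) \<le> weight (t + \<tau>) j * (energy A (sweep (e l) j) +
        (\<tau> * \<rho> * energy A (sweep (e l) j) + 2 * \<tau> * \<rho>))"
      by (rule mult_left_mono) simp
    also have "\<dots> = weight (t + \<tau>) j * energy A (sweep (e l) j) +
        weight (t + \<tau>) j * (\<tau> * \<rho> * energy A (sweep (e l) j) + 2 * \<tau> * \<rho>)"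
      by (rule distrib_left)
    also have "weight (t + \<tau>) j * (\<tau> * \<rho> * energy A (sweep (e l) j) + 2 * \<tau> * \<rho>) \<le>
       1 * (\<tau> * \<rho> * energy A (sweep (e l) j) + 2 * \<tau> * \<rho>)"
      using weight_le_1[OF j, of "t + \<tau>"] t \<tau> \<rho> by (intro mult_right_mono) auto
    finally show ?thesis by simp
  next
    case False
    then have "weight (t + \<tau>) j = 0" using weight_nonneg[of "t + \<tau>" j] by linarith
    then show ?thesis using \<tau> \<rho> by simp
  qed
  have "(\<Sum>j\<in>?J. weight (t + \<tau>) j * energy A (e (Suc l) j)) \<le>
      (\<Sum>j\<in>?J. weight (t + \<tau>) j * energy A (sweep (e l) j) + \<tau> * \<rho> * energy A (sweep (e l) j) + 2 * \<tau> * \<rho>)"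
    by (intro sum_mono pt)
  also have "\<dots> = (\<Sum>j\<in>?J. weight (t + \<tau>) j * energy A (sweep (e l) j)) + \<tau> * \<rho> * total (sweep (e l)) +
      2 * \<tau> * \<rho> * 2 ^ (N * CARD('m))"
    by (simp add: sum.distrib total_def sum_distrib_left card_grid_indices power_mult)
  also have "(\<Sum>j\<in>?J. weight (t + \<tau>) j * energy A (sweep (e l) j)) \<le>
      (\<Sum>j\<in>?J. weight t j * energy A (e l j) + 5 * \<tau> * (1 / 2 ^ N) * b * energy A (e l j))"
    by (rule order_trans[OF weighted_sweep_le]) (rule weight_nonneg, rule sum_mono, rule weight_transport[OF _ t])
  also have "\<dots> = (\<Sum>j\<in>?J. weight t j * energy A (e l j)) + 5 * \<tau> * (1 / 2 ^ N) * b * total (e l)"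
    by (simp add: sum.distrib total_def sum_distrib_left)
  finally have "(\<Sum>j\<in>?J. weight (t + \<tau>) j * energy A (e (Suc l) j)) \<le>
      (\<Sum>j\<in>?J. weight t j * energy A (e l j)) + 5 * \<tau> * (1 / 2 ^ N) * b * total (e l) +
      \<tau> * \<rho> * total (sweep (e l)) + 2 * \<tau> * \<rho> * 2 ^ (N * CARD('m))"
    by simp
  also have "\<dots> \<le> (\<Sum>j\<in>?J. weight t j * energy A (e l j)) + 5 * \<tau> * (1 / 2 ^ N) * b * (K * 2 ^ (N * CARD('m))) +
      \<tau> * \<rho> * (K * 2 ^ (N * CARD('m))) + 2 * \<tau> * \<rho> * 2 ^ (N * CARD('m))"
    using tot[OF l] total_sweep_le[of "e l"] \<tau> \<rho> b
    by (intro add_mono mult_left_mono order_refl) auto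
  also have "\<dots> \<le> ((\<Sum>j\<in>?J. weight 0 j * energy A (e 0 j)) +
       real l * \<tau> * (5 * (1 / 2 ^ N) * b * K + \<rho> * K + 2 * \<rho>) * 2 ^ (N * CARD('m))) +
      5 * \<tau> * (1 / 2 ^ N) * b * (K * 2 ^ (N * CARD('m))) +
      \<tau> * \<rho> * (K * 2 ^ (N * CARD('m))) + 2 * \<tau> * \<rho> * 2 ^ (N * CARD('m))"
    using Suc by (simp add: t_def)
  finally show ?case unfolding t'[symmetric] by (simp add: algebra_simps add_divide_distrib)
qed simp

end

section \<open>Consistency and uniqueness\<close>

text \<open>Formulated with the oscillation of the first derivatives rather than with second
  derivatives, so that it applies both to the polynomial solution and to merely continuously
  differentiable ones.\<close>

lemma linearization_bound:
  fixes u :: "real \<times> (real ^ 'm::finite) \<Rightarrow> real ^ 'n::finite"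
  assumes Z: "convex Z" "z \<in> Z" "z' \<in> Z"
    and du: "\<And>z. z \<in> Z \<Longrightarrow>
      (u has_derivative (\<lambda>w. fst w *\<^sub>R ut z + (\<Sum>i\<in>UNIV. snd w $ i *\<^sub>R ux i z))) (at z within Z)"
    and osc: "\<And>y. y \<in> Z \<Longrightarrow> norm (y - z) \<le> norm (z' - z) \<Longrightarrow> norm (ut y - ut z) \<le> \<epsilon>"
      "\<And>i y. y \<in> Z \<Longrightarrow> norm (y - z) \<le> norm (z' - z) \<Longrightarrow> norm (ux i y - ux i z) \<le> \<epsilon>"
  shows "norm (u z' - u z - (fst (z' - z) *\<^sub>R ut z + (\<Sum>i\<in>UNIV. snd (z' - z) $ i *\<^sub>R ux i z)))
     \<le> norm (z' - z) * ((real CARD('m) + 1) * \<epsilon>)"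
proof -
  let ?S = "closed_segment z z'"
  define F where "F y w = fst w *\<^sub>R ut y + (\<Sum>i\<in>UNIV. snd w $ i *\<^sub>R ux i y)" for y w
  have S: "?S \<subseteq> Z" using Z by (simp add: closed_segment_subset)
  have e0: "0 \<le> \<epsilon>" using osc(1)[OF Z(2)] by simp
  have seg: "z + t *\<^sub>R (z' - z) \<in> ?S" if "t \<in> {0..1}" for t
    using that by (auto simp: in_segment algebra_simps intro!: exI[of _ t])
  have der: "(u has_derivative F y) (at y within ?S)" if "y \<in> ?S" for y
    using du[of y] that S unfolding F_def by (meson has_derivative_subset subsetD)
  have on: "onorm (\<lambda>w. F y w - F z w) \<le> (real CARD('m) + 1) * \<epsilon>" if y: "y \<in> ?S" for y
  proof (rule onorm_bound)
    fix w :: "real \<times> (real ^ 'm)"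
    have d: "norm (y - z) \<le> norm (z' - z)" using segment_bound(1)[OF y] .
    have "F y w - F z w = fst w *\<^sub>R (ut y - ut z) + (\<Sum>i\<in>UNIV. snd w $ i *\<^sub>R (ux i y - ux i z))"
      by (simp add: F_def scaleR_diff_right sum_subtractf)
    also have "norm \<dots> \<le> norm (fst w *\<^sub>R (ut y - ut z)) + (\<Sum>i\<in>UNIV. norm (snd w $ i *\<^sub>R (ux i y - ux i z)))"
      by (intro norm_triangle_le add_mono norm_sum) simp
    also have "\<dots> \<le> norm w * \<epsilon> + (\<Sum>i\<in>(UNIV :: 'm set). norm w * \<epsilon>)"
    proof (intro add_mono sum_mono)
      have "\<bar>fst w\<bar> \<le> norm w" using norm_fst_le[of "fst w" "snd w"] by simp
      then show "norm (fst w *\<^sub>R (ut y - ut z)) \<le> norm w * \<epsilon>"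
        using osc(1)[OF _ d] y S by (auto intro!: mult_mono')
      have "\<bar>snd w $ i\<bar> \<le> norm w" for i
        using component_le_norm_cart[of "snd w" i] norm_snd_le[of "snd w" "fst w"] by simp
      then show "norm (snd w $ i *\<^sub>R (ux i y - ux i z)) \<le> norm w * \<epsilon>" for i
        using osc(2)[OF _ d] y S by (auto intro!: mult_mono')
    qed
    finally show "norm (F y w - F z w) \<le> (real CARD('m) + 1) * \<epsilon> * norm w" by (simp add: algebra_simps)
  qed (use e0 in simp)
  have "norm (u z' - u z - F z (z' - z)) \<le> norm (z' - z) * ((real CARD('m) + 1) * \<epsilon>)"
    by (rule differentiable_bound_linearization[of z z' ?S u F z])
      (use seg der on in \<open>auto simp: fun_diff_def\<close>)
  then show ?thesis by (simp add: F_def)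
qed

lemma godunov_sweep:
  fixes A :: "'n::{finite,linorder} sqmat" and B :: "'m::finite \<Rightarrow> 'n sqmat"
  assumes up: "upwind A P Q N \<tau> b"
    and flux: "\<And>U i j. B i *v face_value N \<mu> Tm U i j =
       P i *v U (j(i := wrap N (j i))) - Q i *v U (j(i := wrap N (j i + 1)))"
    and j: "j \<in> grid_indices N"
  shows "godunov A B \<mu> Tm f \<phi> N \<tau> (Suc l) j =
     upwind.sweep A P Q N \<tau> (godunov A B \<mu> Tm f \<phi> N \<tau> l) j +
     \<tau> *\<^sub>R (matrix_inv A *v f (real l * \<tau>, grid_point N j))"
proof -
  interpret upwind A P Q N \<tau> b by (rule up)
  define U where "U = godunov A B \<mu> Tm f \<phi> N \<tau> l"
  have w: "wrap N (j i) = j i" for i using wrap_props(1)[OF grid_indicesD[OF j]] .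
  have "B i *v (face_value N \<mu> Tm U i j - face_value N \<mu> Tm U i (j(i := j i - 1))) =
      P i *v (U j - U (down N i j)) - Q i *v (U (up N i j) - U j)" for i
    unfolding matrix_vector_mult_diff_distrib flux
    by (simp add: w up_def down_def matrix_vector_mult_diff_distrib)
  then show ?thesis by (simp add: U_def[symmetric] Let_def sweep_def)
qed

context upwind begin

text \<open>The vectors \<open>a\<close>, \<open>c i\<close> and \<open>d i\<close> are the errors
  of the difference quotients in time and in the two directions of each axis. By the differential
  equation \<open>A *v r\<close> is composed of their images under \<open>A\<close>,
  \<open>P i\<close> and \<open>Q i\<close>, so the energy of \<open>r\<close> is controlled by
  theirs.\<close>

lemma residual:
  fixes u :: "real \<times> (real ^ 'm) \<Rightarrow> real ^ 'n"
  assumes Z: "convex Z"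
    and du: "\<And>z. z \<in> Z \<Longrightarrow>
      (u has_derivative (\<lambda>w. fst w *\<^sub>R ut z + (\<Sum>i\<in>UNIV. snd w $ i *\<^sub>R ux i z))) (at z within Z)"
    and osc: "\<And>z y. z \<in> Z \<Longrightarrow> y \<in> Z \<Longrightarrow> norm (y - z) \<le> 1 / 2 ^ N \<Longrightarrow> norm (ut y - ut z) \<le> \<epsilon>"
      "\<And>i z y. z \<in> Z \<Longrightarrow> y \<in> Z \<Longrightarrow> norm (y - z) \<le> 1 / 2 ^ N \<Longrightarrow> norm (ux i y - ux i z) \<le> \<epsilon>"
    and \<tau>h: "\<tau> \<le> 1 / 2 ^ N"
    and pde: "A *v ut (t, x) + (\<Sum>i\<in>UNIV. (P i - Q i) *v ux i (t, x)) = F"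
    and inZ: "(t, x) \<in> Z" "(t + \<tau>, x) \<in> Z"
      "\<And>i. (t, x + axis i (1 / 2 ^ N)) \<in> Z" "\<And>i. (t, x - axis i (1 / 2 ^ N)) \<in> Z"
    and g: "g j = u (t, x)" "\<And>i. g (up N i j) = u (t, x + axis i (1 / 2 ^ N))"
      "\<And>i. g (down N i j) = u (t, x - axis i (1 / 2 ^ N))"
    and R: "\<And>y. energy A y \<le> R * (norm y)\<^sup>2" "0 \<le> R"
  obtains r where "u (t + \<tau>, x) = sweep g j + \<tau> *\<^sub>R (r + matrix_inv A *v F)"
    "energy A r \<le> (1 + b) * (1 + 2 * real CARD('m) * b) * R * ((real CARD('m) + 1) * \<epsilon>)\<^sup>2"
proof -
  define h :: real where "h = 1 / 2 ^ N"
  have h: "0 < h" by (simp add: h_def)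
  define E where "E = (real CARD('m) + 1) * \<epsilon>"
  have e0: "0 \<le> \<epsilon>" using osc(1)[OF inZ(1,1)] by simp
  have lin: "norm (u z' - u (t, x) - (fst (z' - (t, x)) *\<^sub>R ut (t, x) + (\<Sum>i\<in>UNIV. snd (z' - (t, x)) $ i *\<^sub>R ux i (t, x))))
      \<le> norm (z' - (t, x)) * E" if "z' \<in> Z" "norm (z' - (t, x)) \<le> h" for z'
    unfolding E_def using that osc inZ(1)
    by (intro linearization_bound[OF Z inZ(1) that(1) du]) (auto simp: h_def)
  define a where "a = (1 / \<tau>) *\<^sub>R (u (t + \<tau>, x) - u (t, x)) - ut (t, x)"
  define c where "c i = (1 / h) *\<^sub>R (u (t, x + axis i h) - u (t, x)) - ux i (t, x)" for i
  define d where "d i = (1 / h) *\<^sub>R (u (t, x) - u (t, x - axis i h)) - ux i (t, x)" for i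
  have a: "norm a \<le> E"
  proof -
    have "norm (u (t + \<tau>, x) - u (t, x) - \<tau> *\<^sub>R ut (t, x)) \<le> \<tau> * E"
      using lin[OF inZ(2)] \<tau> \<tau>h by (simp add: h_def norm_Pair)
    moreover have "u (t + \<tau>, x) - u (t, x) - \<tau> *\<^sub>R ut (t, x) = \<tau> *\<^sub>R a"
      using \<tau> by (simp add: a_def scaleR_diff_right)
    ultimately show ?thesis using \<tau> by simp
  qed
  have axis_sum: "(\<Sum>k\<in>UNIV. axis i s $ k *\<^sub>R v k) = s *\<^sub>R v i" for s and v :: "'m \<Rightarrow> real ^ 'n" and i
  proof -
    have "(\<Sum>k\<in>UNIV. axis i s $ k *\<^sub>R v k) = (\<Sum>k\<in>UNIV. if k = i then s *\<^sub>R v k else 0)"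
      by (intro sum.cong) (auto simp: axis_def)
    then show ?thesis by simp
  qed
  have nax: "norm (axis i s :: real ^ 'm) = \<bar>s\<bar>" for i s
  proof -
    have "axis i s = s *\<^sub>R (axis i 1 :: real ^ 'm)" by (simp add: axis_def vec_eq_iff)
    then show ?thesis by (simp add: norm_axis_1)
  qed
  have c: "norm (c i) \<le> E" for i
  proof -
    have "norm (u (t, x + axis i h) - u (t, x) - h *\<^sub>R ux i (t, x)) \<le> h * E"
      using lin[OF inZ(3)[of i, folded h_def]] h by (simp add: norm_Pair nax axis_sum)
    moreover have "u (t, x + axis i h) - u (t, x) - h *\<^sub>R ux i (t, x) = h *\<^sub>R c i"
      using h by (simp add: c_def scaleR_diff_right)
    ultimately show ?thesis using h by simp
  qed
  have neg: "- axis i h = (axis i (- h) :: real ^ 'm)" for i by (simp add: axis_def vec_eq_iff)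
  have d: "norm (d i) \<le> E" for i
  proof -
    have "norm (u (t, x - axis i h) - u (t, x) - (- h) *\<^sub>R ux i (t, x)) \<le> h * E"
      using lin[OF inZ(4)[of i, folded h_def]] h by (simp add: norm_Pair nax axis_sum neg del: scaleR_minus_left)
    moreover have "u (t, x - axis i h) - u (t, x) - (- h) *\<^sub>R ux i (t, x) = - (h *\<^sub>R d i)"
      using h by (simp add: d_def scaleR_diff_right)
    ultimately show ?thesis using h by simp
  qed
  define r where "r = (1 / \<tau>) *\<^sub>R (u (t + \<tau>, x) - sweep g j) - matrix_inv A *v F"
  have eq: "u (t + \<tau>, x) = sweep g j + \<tau> *\<^sub>R (r + matrix_inv A *v F)"
    using \<tau> by (simp add: r_def)
  define X where "X = (\<Sum>i\<in>UNIV. P i *v (g j - g (down N i j)) - Q i *v (g (up N i j) - g j))"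
  have "A *v r = (1 / \<tau>) *\<^sub>R (A *v (u (t + \<tau>, x) - u (t, x))) + (1 / h) *\<^sub>R X - F"
  proof -
    have "sweep g j = u (t, x) - (\<tau> / h) *\<^sub>R (matrix_inv A *v X)"
      by (simp add: sweep_def X_def g(1) h_def)
    then have "r = (1 / \<tau>) *\<^sub>R (u (t + \<tau>, x) - u (t, x)) + (1 / h) *\<^sub>R (matrix_inv A *v X) - matrix_inv A *v F"
      using \<tau> by (simp add: r_def scaleR_diff_right scaleR_add_right)
    then show ?thesis
      by (simp add: matrix_vector_right_distrib matrix_vector_mult_diff_distrib matrix_vector_mult_scaleR A_matrix_inv)
  qed
  moreover have "(1 / h) *\<^sub>R X = (\<Sum>i\<in>UNIV. P i *v (d i + ux i (t, x)) - Q i *v (c i + ux i (t, x)))"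
    unfolding X_def g h_def[symmetric] scaleR_sum_right
    by (simp add: scaleR_diff_right matrix_vector_mult_scaleR[symmetric] c_def d_def)
  moreover have "F = A *v ut (t, x) + (\<Sum>i\<in>UNIV. P i *v ux i (t, x) - Q i *v ux i (t, x))"
    using pde by (simp add: matrix_vector_mult_diff_rdistrib)
  ultimately have Ar: "A *v r = A *v a + (\<Sum>i\<in>UNIV. P i *v d i + Q i *v (- c i))"
    by (simp add: a_def matrix_vector_mult_diff_distrib matrix_vector_mult_scaleR matrix_vector_right_distrib
        matrix_vector_minus sum.distrib sum_subtractf sum_negf)
  \<comment> \<open>With this Young parameter the energies of \<open>r\<close> on the right add up
    to at most \<open>s * (1 + b) * energy A r\<close>, that is one \<open>energy A r\<close>, half
    of the left side.\<close>
  define s where "s = 1 / (1 + b)"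
  have s: "0 < s" "s * (1 + b) = 1" "1 / s = 1 + b" using b by (auto simp: s_def)
  define Y where "Y = energy A a + (\<Sum>i\<in>UNIV. energy (P i) (d i) + energy (Q i) (c i))"
  have "2 * energy A r = 2 * (r \<bullet> (A *v a)) + (\<Sum>i\<in>UNIV. 2 * (r \<bullet> (P i *v d i)) + 2 * (r \<bullet> (Q i *v (- c i))))"
    unfolding energy_def[of A r] Ar by (simp add: inner_add_right inner_sum_right sum_distrib_left)
  also have "\<dots> \<le> (s * energy A r + energy A a / s) +
     (\<Sum>i\<in>UNIV. (s * energy (P i) r + energy (P i) (d i) / s) + (s * energy (Q i) r + energy (Q i) (- c i) / s))"
    by (intro add_mono sum_mono inner_le_energies positive_definite_pos_semidef[OF A] P Q s)
  also have "\<dots> = s * (energy A r + (\<Sum>i\<in>UNIV. energy (P i) r + energy (Q i) r)) + (1 / s) * Y"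
    by (simp add: Y_def sum.distrib sum_distrib_left algebra_simps)
  also have "\<dots> \<le> s * (energy A r + b * energy A r) + (1 / s) * Y"
    using s speed[of r] by (intro add_right_mono mult_left_mono add_left_mono) auto
  also have "s * (energy A r + b * energy A r) = energy A r"
    using s(2) by (metis distrib_right mult.assoc mult_1)
  finally have er: "energy A r \<le> (1 + b) * Y" using s(3) by simp
  have E0: "0 \<le> E" using e0 by (simp add: E_def)
  have sq: "(norm y)\<^sup>2 \<le> E\<^sup>2" if "norm y \<le> E" for y :: "real ^ 'n" using that by (intro power_mono) auto
  have bA: "energy A y \<le> R * E\<^sup>2" if "norm y \<le> E" for y
    using R(1)[of y] mult_left_mono[OF sq[OF that] R(2)] by linarith
  have PQ: "energy (P i) y \<le> b * (R * E\<^sup>2)" "energy (Q i) y \<le> b * (R * E\<^sup>2)" if "norm y \<le> E" for y i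
  proof -
    have "energy (P i) y + energy (Q i) y \<le> (\<Sum>i\<in>UNIV. energy (P i) y + energy (Q i) y)"
      by (rule member_le_sum) auto
    also have "\<dots> \<le> b * energy A y" by (rule speed)
    also have "\<dots> \<le> b * (R * E\<^sup>2)" using bA[OF that] b by (rule mult_left_mono)
    finally show "energy (P i) y \<le> b * (R * E\<^sup>2)" "energy (Q i) y \<le> b * (R * E\<^sup>2)"
      using energy_nonneg(2)[of i y] energy_nonneg(3)[of i y] by linarith+
  qed
  have "Y \<le> R * E\<^sup>2 + (\<Sum>i\<in>(UNIV :: 'm set). b * (R * E\<^sup>2) + b * (R * E\<^sup>2))"
    unfolding Y_def using bA[OF a] PQ(1)[OF d] PQ(2)[OF c] by (intro add_mono sum_mono) auto
  also have "\<dots> = (1 + 2 * real CARD('m) * b) * R * E\<^sup>2" by (simp add: algebra_simps)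
  finally have "(1 + b) * Y \<le> (1 + b) * ((1 + 2 * real CARD('m) * b) * R * E\<^sup>2)"
    using b by (intro mult_left_mono) auto
  then have "energy A r \<le> (1 + b) * (1 + 2 * real CARD('m) * b) * R * E\<^sup>2" using er by (simp add: mult.assoc)
  then show thesis using eq by (intro that[of r]) (simp_all add: E_def)
qed

end

context upwind_cone begin

definition cone :: "(real \<times> (real ^ 'm)) set" where
  "cone = {(t, x). t \<ge> 0 \<and> (\<forall>i. x $ i - mx i * t \<ge> 0 \<and> x $ i - 1 - mn i * t \<le> 0)}"

text \<open>The margin of one cell in \<open>low\<close> and \<open>high\<close> pays for the
  stencil: where the later weight is positive, all its points at the earlier time lie in the cone,
  and the neighbours are true ones, not periodic images.\<close>

lemma weight_pos_points:
  assumes j: "j \<in> grid_indices N" and t: "0 \<le> t" and w: "0 < weight (t + \<tau>) j"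
  shows "(t + \<tau>, grid_point N j) \<in> cone" "(t, grid_point N j) \<in> cone"
    "(t, grid_point N j + axis i (1 / 2 ^ N)) \<in> cone" "(t, grid_point N j - axis i (1 / 2 ^ N)) \<in> cone"
    "grid_point N (up N i j) = grid_point N j + axis i (1 / 2 ^ N)"
    "grid_point N (down N i j) = grid_point N j - axis i (1 / 2 ^ N)"
proof -
  define h :: real where "h = 1 / 2 ^ N"
  have h: "0 < h" "2 ^ N * h = 1" by (auto simp: h_def)
  define y where "y = grid_point N j"
  have p: "h + mx k * (t + \<tau>) < y $ k" "y $ k < 1 - h + mn k * (t + \<tau>)" for k
    using w unfolding weight_pos_iff low_def high_def h_def[symmetric] y_def[symmetric] by (auto simp: algebra_simps)
  have m: "0 \<le> mx k * \<tau>" "mn k * \<tau> \<le> 0" "0 \<le> mx k * t" "mn k * t \<le> 0" for k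
    using mx(2) mn(2) t \<tau> by (auto intro: mult_nonpos_nonneg)
  have m': "mx k * (t + \<tau>) = mx k * t + mx k * \<tau>" "mn k * (t + \<tau>) = mn k * t + mn k * \<tau>" for k
    by (simp_all add: distrib_left)
  note pm = p[unfolded m']
  show "(t + \<tau>, grid_point N j) \<in> cone"
    unfolding cone_def y_def[symmetric] using t \<tau> p h by (auto simp: m') (smt (verit) pm)+
  have ax: "axis i h $ k = (if k = i then h else 0)" for k by (simp add: axis_def)
  have b: "h + mx k * t < y $ k \<and> y $ k < 1 - h + mn k * t" for k
    using pm[of k] m[of k] by linarith
  have "y $ k - mx k * t \<ge> 0 \<and> y $ k - 1 - mn k * t \<le> 0" for k
    using b[of k] h by linarith
  then show "(t, grid_point N j) \<in> cone" using t by (simp add: cone_def y_def)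
  have "(y + axis i h) $ k - mx k * t \<ge> 0 \<and> (y + axis i h) $ k - 1 - mn k * t \<le> 0" for k
    using b[of k] h by (cases "k = i") (auto simp: ax)
  then show "(t, grid_point N j + axis i (1 / 2 ^ N)) \<in> cone" using t by (simp add: cone_def y_def h_def)
  have "(y - axis i h) $ k - mx k * t \<ge> 0 \<and> (y - axis i h) $ k - 1 - mn k * t \<le> 0" for k
    using b[of k] h by (cases "k = i") (auto simp: ax)
  then show "(t, grid_point N j - axis i (1 / 2 ^ N)) \<in> cone" using t by (simp add: cone_def y_def h_def)
  have jr: "j i \<in> {1..2 ^ N}" by (rule grid_indicesD[OF j])
  have yi: "y $ i = (of_int (j i) - 1 / 2) * h" by (simp add: y_def grid_point_def h_def)
  have "j i \<noteq> 1"
  proof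
    assume "j i = 1"
    then have "y $ i = h / 2" by (simp add: yi)
    then show False using b[of i] m(3)[of i] h by linarith
  qed
  moreover have "j i \<noteq> 2 ^ N"
  proof
    assume "j i = 2 ^ N"
    then have "y $ i = 1 - h / 2" using h(2) by (simp add: yi algebra_simps)
    then show False using b[of i] m(4)[of i] h by linarith
  qed
  ultimately have "up N i j = j(i := j i + 1)" "down N i j = j(i := j i - 1)"
    using jr by (auto simp: up_def down_def wrap_def)
  then show "grid_point N (up N i j) = grid_point N j + axis i (1 / 2 ^ N)"
    "grid_point N (down N i j) = grid_point N j - axis i (1 / 2 ^ N)"
    by (auto simp: grid_point_def vec_eq_iff axis_def field_simps)
qed

end


text \<open>The set \<open>cone\<close> of the locale, freed from the grid parameters, so that one
  set serves for a whole sequence of grids.\<close>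

definition space_cone :: "('m::finite \<Rightarrow> real) \<Rightarrow> ('m \<Rightarrow> real) \<Rightarrow> (real \<times> (real ^ 'm)) set" where
  "space_cone mx mn = {(t, x). t \<ge> 0 \<and> (\<forall>i. x $ i - mx i * t \<ge> 0 \<and> x $ i - 1 - mn i * t \<le> 0)}"

lemma closed_space_cone: "closed (space_cone mx mn)"
proof -
  have "space_cone mx mn = {z. 0 \<le> fst z} \<inter> (\<Inter>i. {z. 0 \<le>
      snd z $ i - mx i * fst z} \<inter> {z. snd z $ i - 1 - mn i * fst z \<le> 0})"
    by (auto simp: space_cone_def)
  also have "closed \<dots>"
    by (intro closed_Int closed_INT ballI closed_Collect_le continuous_intros)
  finally show ?thesis .
qed

lemma convex_space_cone: "convex (space_cone mx mn)"
proof (rule convexI)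
  fix y z :: "real \<times> (real ^ 'a)" and u v :: real
  assume y: "y \<in> space_cone mx mn" and z: "z \<in> space_cone mx mn" and uv: "0 \<le> u" "0 \<le> v" "u + v = 1"
  obtain t x s k where yz: "y = (t, x)" "z = (s, k)" by (cases y, cases z)
  have "0 \<le> u * t + v * s" using y z uv yz by (auto simp: space_cone_def)
  moreover have "(u * x $ i + v * k $ i) - mx i * (u * t + v * s) \<ge> 0" for i
  proof -
    have "0 \<le> u * (x $ i - mx i * t) + v * (k $ i - mx i * s)"
      using y z uv yz by (auto simp: space_cone_def intro!: add_nonneg_nonneg mult_nonneg_nonneg)
    then show ?thesis by (simp add: algebra_simps)
  qed
  moreover have "(u * x $ i + v * k $ i) - 1 - mn i * (u * t + v * s) \<le> 0" for i
  proof -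
    have "u * (x $ i - 1 - mn i * t) + v * (k $ i - 1 - mn i * s) \<le> 0"
      using y z uv yz by (auto simp: space_cone_def intro!: add_nonpos_nonpos mult_nonneg_nonpos)
    moreover have "u * (x $ i - 1 - mn i * t) + v * (k $ i - 1 - mn i * s) =
        (u * x $ i + v * k $ i) - (u + v) - mn i * (u * t + v * s)" by (simp add: algebra_simps)
    ultimately show ?thesis using uv(3) by simp
  qed
  ultimately show "u *\<^sub>R y + v *\<^sub>R z \<in> space_cone mx mn" by (simp add: yz space_cone_def)
qed

section \<open>Counting grid points; uniqueness of the solution\<close>

lemma card_int_interval_ge: "c - a - 1 \<le> real (card {k :: int. a \<le> of_int k \<and> of_int k \<le> c})"
proof -
  have "{k :: int. a \<le> of_int k \<and> of_int k \<le> c} = {\<lceil>a\<rceil>..\<lfloor>c\<rfloor>}"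
    by (auto simp: ceiling_le_iff le_floor_iff)
  then have "real (card {k :: int. a \<le> of_int k \<and> of_int k \<le> c}) = real (nat (\<lfloor>c\<rfloor> - \<lceil>a\<rceil> + 1))"
    by simp
  moreover have "of_int (\<lfloor>c\<rfloor> - \<lceil>a\<rceil> + 1) \<ge> c - a - 1" by linarith
  ultimately show ?thesis by linarith
qed

lemma card_int_interval_le:
  assumes "a \<le> c"
  shows "real (card {k :: int. a \<le> of_int k \<and> of_int k \<le> c}) \<le> c - a + 1"
proof -
  have "{k :: int. a \<le> of_int k \<and> of_int k \<le> c} = {\<lceil>a\<rceil>..\<lfloor>c\<rfloor>}"
    by (auto simp: ceiling_le_iff le_floor_iff)
  then have "real (card {k :: int. a \<le> of_int k \<and> of_int k \<le> c}) = real (nat (\<lfloor>c\<rfloor> - \<lceil>a\<rceil> + 1))"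
    by simp
  also have "\<dots> \<le> c - a + 1" using assms by linarith
  finally show ?thesis .
qed

text \<open>In each coordinate an interval of length \<open>2 * d\<close> holds at least
  \<open>2 * d * 2 ^ N - 1 \<ge> d * 2 ^ N\<close> grid coordinates.\<close>

lemma card_grid_box_ge:
  fixes x :: "real ^ 'm::finite"
  assumes d: "0 \<le> d" "1 \<le> d * 2 ^ N" and x: "\<And>i. d \<le> x $ i" "\<And>i. x $ i \<le> 1 - d"
  shows "(d * 2 ^ N) ^ CARD('m) \<le>
    real (card {j \<in> grid_indices N. \<forall>i. \<bar>grid_point N j $ i - x $ i\<bar> \<le> d})"
proof -
  define M :: real where "M = 2 ^ N"
  have M: "0 < M" by (simp add: M_def)
  define S where "S i = {k :: int. (x $ i - d) * M + 1 / 2 \<le> of_int k \<and> of_int k \<le> (x $ i + d) * M + 1 / 2}" for i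
  have S1: "d * M \<le> real (card (S i))" for i
  proof -
    have "((x $ i + d) * M + 1 / 2) - ((x $ i - d) * M + 1 / 2) - 1 \<le> real (card (S i))"
      unfolding S_def by (rule card_int_interval_ge)
    moreover have "((x $ i + d) * M + 1 / 2) - ((x $ i - d) * M + 1 / 2) - 1 = 2 * (d * M) - 1"
      by (simp add: algebra_simps)
    ultimately show ?thesis using d(2) by (simp add: M_def)
  qed
  have fS: "finite (S i)" for i
    using S1[of i] d(2) card_ge_0_finite[of "S i"] by (auto simp: M_def)
  have Sr: "S i \<subseteq> {1..2 ^ N}" for i
  proof
    fix k assume k: "k \<in> S i"
    have "0 \<le> (x $ i - d) * M" using x(1)[of i] M by simp
    moreover have "(x $ i + d) * M \<le> 1 * M" using x(2)[of i] M by (intro mult_right_mono) auto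
    ultimately have "1 / 2 \<le> real_of_int k" "real_of_int k \<le> M + 1 / 2" using k by (auto simp: S_def)
    then have "1 \<le> k" "real_of_int k \<le> real_of_int (2 ^ N) + 1 / 2" by (auto simp: M_def)
    moreover have "k \<le> 2 ^ N" using calculation(2) by linarith
    ultimately show "k \<in> {1..2 ^ N}" by simp
  qed
  have "(\<Pi>\<^sub>E i\<in>UNIV. S i) \<subseteq> {j \<in> grid_indices N. \<forall>i. \<bar>grid_point N j $ i - x $ i\<bar> \<le> d}"
  proof
    fix j assume j: "j \<in> (\<Pi>\<^sub>E i\<in>UNIV. S i)"
    then have jS: "j i \<in> S i" for i by auto
    have "\<bar>grid_point N j $ i - x $ i\<bar> \<le> d" for i
    proof -
      have "(x $ i - d) * M \<le> (of_int (j i) - 1 / 2)" "(of_int (j i) - 1 / 2) \<le> (x $ i + d) * M"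
        using jS[of i] by (auto simp: S_def)
      then have "x $ i - d \<le> (of_int (j i) - 1 / 2) / M" "(of_int (j i) - 1 / 2) / M \<le> x $ i + d"
        using M by (auto simp: pos_le_divide_eq pos_divide_le_eq)
      then show ?thesis by (simp add: grid_point_def M_def abs_le_iff)
    qed
    then show "j \<in> {j \<in> grid_indices N. \<forall>i. \<bar>grid_point N j $ i - x $ i\<bar> \<le> d}"
      using jS Sr by (auto simp: grid_indices_def subset_iff)
  qed
  then have "card (\<Pi>\<^sub>E i\<in>UNIV. S i) \<le> card {j \<in> grid_indices N. \<forall>i. \<bar>grid_point N j $ i - x $ i\<bar> \<le> d}"
    by (intro card_mono) auto
  moreover have "(d * M) ^ CARD('m) \<le> real (card (\<Pi>\<^sub>E i\<in>UNIV. S i))"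
  proof -
    have "(\<Prod>i\<in>(UNIV :: 'm set). d * M) \<le> (\<Prod>i\<in>UNIV. real (card (S i)))"
      using S1 d(1) M by (intro prod_mono) auto
    then show ?thesis by (simp add: card_PiE)
  qed
  ultimately show ?thesis by (simp add: M_def)
qed

text \<open>
  Uniqueness is read off from the stability of the scheme: the restriction of a solution with zero data
  to the grids satisfies the scheme up to a residual that tends to zero.
\<close>

lemma zero_data_solution_interior:
  fixes A :: "real ^ 'n ^ 'n" and P Q :: "'m::finite \<Rightarrow> real ^ 'n ^ 'n"
  assumes cone: "\<And>N \<tau>. 0 < \<tau> \<Longrightarrow> \<tau> * 2 ^ N * b \<le> 1 \<Longrightarrow> upwind_cone A P Q N \<tau> b mx mn"
  defines "H \<equiv> space_cone mx mn"
  assumes cpt: "compact H"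
    and dw: "\<And>z. z \<in> H \<Longrightarrow>
      (w has_derivative (\<lambda>v. fst v *\<^sub>R wt z + (\<Sum>i\<in>UNIV. snd v $ i *\<^sub>R wx i z))) (at z within H)"
    and cont: "continuous_on H wt" "\<And>i. continuous_on H (wx i)"
    and pde: "\<And>z. z \<in> H \<Longrightarrow> A *v wt z + (\<Sum>i\<in>UNIV. (P i - Q i) *v wx i z) = 0"
    and init: "\<And>x. (0, x) \<in> H \<Longrightarrow> w (0, x) = 0"
    and R: "\<And>y. energy A y \<le> R * (norm y)\<^sup>2" "\<And>y. (norm y)\<^sup>2 \<le> R * energy A y" "0 < R"
    and b: "0 \<le> b"
    and z0: "0 \<le> t0" "\<And>i. mx i * t0 < x0 $ i" "\<And>i. x0 $ i < 1 + mn i * t0"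
    and sgn: "\<And>i. 0 \<le> mx i" "\<And>i. mn i \<le> 0"
  shows "w (t0, x0) = 0"
proof (rule ccontr)
  assume nz: "w (t0, x0) \<noteq> 0"
  define m where "m = CARD('m)"
  have z0H: "(t0, x0) \<in> H" using z0 less_imp_le[OF z0(2)] less_imp_le[OF z0(3)] by (auto simp: H_def space_cone_def algebra_simps)
  have contw: "continuous_on H w"
    unfolding continuous_on_eq_continuous_within using dw has_derivative_continuous by blast
  obtain W where W: "\<And>z. z \<in> H \<Longrightarrow> norm (w z) \<le> W" "0 \<le> W"
    using compact_imp_bounded[OF compact_continuous_image[OF contw cpt]]
    by (metis bounded_iff image_eqI norm_ge_zero order_trans z0H)
  define K where "K = R * W\<^sup>2"
  have K: "0 \<le> K" using R(3) by (simp add: K_def)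
  \<comment> \<open>A quarter of the distance from the lateral faces: after moving by
    \<open>\<delta> \<le> s\<close> and giving up one cell \<open>h \<le> s\<close>, the factors of
    the weight are still at least \<open>2 * s\<close>.\<close>
  define s where "s = Min ((\<lambda>i. min (x0 $ i - mx i * t0) (1 + mn i * t0 - x0 $ i)) ` UNIV) / 4"
  have "0 < 4 * s" using z0(2,3) by (simp add: s_def)
  moreover have "4 * s \<le> min (x0 $ i - mx i * t0) (1 + mn i * t0 - x0 $ i)" for i
  proof -
    have "Min ((\<lambda>i. min (x0 $ i - mx i * t0) (1 + mn i * t0 - x0 $ i)) ` UNIV)
        \<le> min (x0 $ i - mx i * t0) (1 + mn i * t0 - x0 $ i)"
      by (intro Min_le) auto
    then show ?thesis unfolding s_def by linarith
  qed
  ultimately have s: "0 < s" "\<And>i. 4 * s \<le> x0 $ i - mx i * t0" "\<And>i. 4 * s \<le> 1 + mn i * t0 - x0 $ i" by auto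
  define c where "c = norm (w (t0, x0)) / 2"
  have c: "0 < c" using nz by (simp add: c_def)
  obtain d where d: "0 < d" "\<And>z. z \<in> H \<Longrightarrow> dist z (t0, x0) < d \<Longrightarrow> dist (w z) (w (t0, x0)) < c"
    using contw z0H c unfolding continuous_on_iff by metis
  define \<delta> where "\<delta> = min s (d / (2 * (real m + 1)))"
  have \<delta>: "0 < \<delta>" "\<delta> \<le> s" "(real m + 1) * \<delta> < d"
  proof -
    show "0 < \<delta>" "\<delta> \<le> s" using s d by (auto simp: \<delta>_def)
    have "(real m + 1) * \<delta> \<le> (real m + 1) * (d / (2 * (real m + 1)))"
      unfolding \<delta>_def by (intro mult_left_mono) auto
    also have "\<dots> = d / 2" by (simp add: field_simps)
    also have "\<dots> < d" using d(1) by simp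
    finally show "(real m + 1) * \<delta> < d" .
  qed
  define \<omega> where "\<omega> = ((2 * s)\<^sup>2 * (2 * s)\<^sup>2) ^ m"
  \<comment> \<open>The weighted energy per cell that a nonzero value at \<open>(t0, x0)\<close>
    forces: \<omega> bounds the weight in the box of radius \<delta>, and
    \<open>\<delta> ^ m\<close> is the share of the cells in it. The choices of \<rho> and
    \<open>hmax\<close> let stability allow only half of it.\<close>
  define \<kappa> where "\<kappa> = \<delta> ^ m * (\<omega> * (c\<^sup>2 / R))"
  have \<kappa>: "0 < \<kappa>" using \<delta> s c R(3) by (simp add: \<kappa>_def \<omega>_def)
  define \<rho> where "\<rho> = min 1 (\<kappa> / (4 * (t0 + 1) * (K + 2)))"
  have \<rho>: "0 < \<rho>" "\<rho> \<le> 1" using \<kappa> K z0(1) by (auto simp: \<rho>_def)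
  have quarter: "p * (\<kappa> / (4 * p * q) * q) = \<kappa> / 4" if "p \<noteq> 0" "q \<noteq> 0" for p q
    using that by simp
  have \<rho>\<kappa>: "t0 * (\<rho> * K + 2 * \<rho>) \<le> \<kappa> / 4"
  proof -
    have "t0 * (\<rho> * (K + 2)) \<le> (t0 + 1) * (\<rho> * (K + 2))" using \<rho> K by (intro mult_right_mono) auto
    also have "\<dots> \<le> (t0 + 1) * (\<kappa> / (4 * (t0 + 1) * (K + 2)) * (K + 2))"
      using z0(1) K by (intro mult_left_mono mult_right_mono) (auto simp: \<rho>_def)
    also have "\<dots> = \<kappa> / 4"
    proof -
      have "t0 + 1 \<noteq> 0" "K + 2 \<noteq> 0" using z0(1) K by linarith+
      then show ?thesis by (rule quarter)
    qed
    finally show ?thesis by (simp add: algebra_simps)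
  qed
  define G where "G = (1 + b) * (1 + 2 * real m * b) * R * (real m + 1)\<^sup>2"
  have G: "0 < G"
  proof -
    have "0 < 1 + b" "0 < 1 + 2 * real m * b" using b by (auto intro: add_pos_nonneg)
    then show ?thesis using R(3) by (simp add: G_def)
  qed
  define \<epsilon> where "\<epsilon> = \<rho> / sqrt G"
  have \<epsilon>: "0 < \<epsilon>" "G * \<epsilon>\<^sup>2 = \<rho>\<^sup>2" using G \<rho> by (auto simp: \<epsilon>_def power_divide)
  have uc: "\<exists>d>0. \<forall>z\<in>H. \<forall>y\<in>H. norm (y - z) < d \<longrightarrow> norm (f y - f z) \<le> \<epsilon>" if "continuous_on H f"
    for f :: "real \<times> (real ^ 'm) \<Rightarrow> real ^ 'n"
    using compact_uniformly_continuous[OF that cpt] \<epsilon>(1)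
    unfolding uniformly_continuous_on_def dist_norm by (meson less_imp_le)
  obtain dt where dt: "0 < dt" "\<And>z y. z \<in> H \<Longrightarrow> y \<in> H \<Longrightarrow> norm (y - z) < dt \<Longrightarrow> norm (wt y - wt z) \<le> \<epsilon>"
    using uc[OF cont(1)] by blast
  have "\<forall>i. \<exists>d>0. \<forall>z\<in>H. \<forall>y\<in>H. norm (y - z) < d \<longrightarrow> norm (wx i y - wx i z) \<le> \<epsilon>"
    using uc[OF cont(2)] by blast
  then obtain dx where dx: "\<And>i. 0 < dx i"
    "\<And>i z y. z \<in> H \<Longrightarrow> y \<in> H \<Longrightarrow> norm (y - z) < dx i \<Longrightarrow> norm (wx i y - wx i z) \<le> \<epsilon>"
    by metis
  define hmax where "hmax = Min {1, dt, Min (range dx), s, \<delta>, 1 / (b + 1), \<kappa> / (4 * (t0 + 1) * (5 * b * K + 1))}"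
  have hm: "0 < hmax" "hmax \<le> 1" "hmax \<le> dt" "hmax \<le> dx i" "hmax \<le> s" "hmax \<le> \<delta>"
      "hmax \<le> 1 / (b + 1)" "hmax \<le> \<kappa> / (4 * (t0 + 1) * (5 * b * K + 1))" for i
  proof -
    have "0 < 5 * b * K + 1" using b K by (simp add: add_nonneg_pos)
    then show "0 < hmax" using dt dx s \<delta> b K \<kappa> z0(1) by (simp add: hmax_def)
    show "hmax \<le> 1" "hmax \<le> dt" "hmax \<le> s" "hmax \<le> \<delta>"
      "hmax \<le> 1 / (b + 1)" "hmax \<le> \<kappa> / (4 * (t0 + 1) * (5 * b * K + 1))"
      unfolding hmax_def by (rule Min_le; simp)+
    have "hmax \<le> Min (range dx)" unfolding hmax_def by (rule Min_le; simp)
    also have "\<dots> \<le> dx i" by simp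
    finally show "hmax \<le> dx i" .
  qed
  obtain N where N: "(1 / 2 :: real) ^ N < hmax" using real_arch_pow_inv[OF hm(1), of "1 / 2"] by auto
  define h :: real where "h = 1 / 2 ^ N"
  have h: "0 < h" "h < hmax" "2 ^ N * h = 1" using N by (auto simp: h_def power_divide)
  define \<tau> where "\<tau> = h * h"
  have h1: "h < 1" using h(2) hm(2) by linarith
  have tau: "0 < \<tau>" "\<tau> \<le> h" "\<tau> \<le> 1" using h h1 mult_left_le[of h h] by (auto simp: \<tau>_def intro: mult_le_one)
  have hb: "h * (b + 1) \<le> 1"
  proof -
    have "h * (b + 1) \<le> 1 / (b + 1) * (b + 1)" using h(2) hm(7) b by (intro mult_right_mono) auto
    then show ?thesis using b by simp
  qed
  have cfl: "\<tau> * 2 ^ N * b \<le> 1"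
  proof -
    have "\<tau> * 2 ^ N * b = h * b * (2 ^ N * h)" by (simp add: \<tau>_def)
    also have "\<dots> = h * b" by (simp only: h(3) mult_1_right)
    also have "\<dots> \<le> 1" using hb h(1) by (simp add: distrib_left)
    finally show ?thesis .
  qed
  interpret upwind_cone A P Q N \<tau> b mx mn by (rule cone[OF tau(1) cfl])
  have Hc: "cone = H" by (simp add: cone_def H_def space_cone_def)
  \<comment> \<open>Extension by zero outside \<open>H\<close> is harmless, because the scheme is
    needed only where the whole stencil lies in \<open>H\<close>.\<close>
  define e where "e l j = (if (real l * \<tau>, grid_point N j) \<in> H then w (real l * \<tau>, grid_point N j) else 0)"
    for l :: nat and j
  \<comment> \<open>The last time level not after \<open>t0\<close>, which need not be a grid
    time.\<close>
  define l where "l = nat \<lfloor>t0 / \<tau>\<rfloor>"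
  define t where "t = real l * \<tau>"
  have "real l \<le> t0 / \<tau>" "t0 / \<tau> < real l + 1" using z0(1) tau(1) by (auto simp: l_def)
  then have t: "t \<le> t0" "t0 < t + \<tau>" "0 \<le> t"
    using tau(1) by (auto simp: t_def pos_le_divide_eq pos_divide_less_eq algebra_simps)
  have "(\<Sum>j\<in>grid_indices N. weight (real l * \<tau>) j * energy A (e l j)) \<le>
     (\<Sum>j\<in>grid_indices N. weight 0 j * energy A (e 0 j)) +
       real l * \<tau> * (5 * (1 / 2 ^ N) * b * K + \<rho> * K + 2 * \<rho>) * 2 ^ (N * CARD('m))"
  proof (rule weighted_growth[OF _ _ \<rho> tau(3) order_refl])
    fix k j assume j: "j \<in> grid_indices N" and wp: "0 < weight (real (Suc k) * \<tau>) j"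
    define t' where "t' = real k * \<tau>"
    have t': "0 \<le> t'" "real (Suc k) * \<tau> = t' + \<tau>" using tau by (auto simp: t'_def algebra_simps)
    note pts = weight_pos_points[OF j t'(1) wp[unfolded t'(2)], unfolded Hc]
    have ek: "e (Suc k) j = w (t' + \<tau>, grid_point N j)" using pts(1) t'(2) by (simp add: e_def)
    obtain r where r: "w (t' + \<tau>, grid_point N j) = sweep (e k) j + \<tau> *\<^sub>R (r + matrix_inv A *v 0)"
      "energy A r \<le> (1 + b) * (1 + 2 * real CARD('m) * b) * R * ((real CARD('m) + 1) * \<epsilon>)\<^sup>2"
    proof (rule residual[where Z = H and u = w and ut = wt and ux = wx and t = t' and x = "grid_point N j"
          and g = "e k" and F = 0 and j = j and R = R and \<epsilon> = \<epsilon>])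
      show "convex H" unfolding H_def by (rule convex_space_cone)
      show "norm (wt y - wt z) \<le> \<epsilon>" if "z \<in> H" "y \<in> H" "norm (y - z) \<le> 1 / 2 ^ N" for z y
        using that h(2) hm(3) by (intro dt(2)) (auto simp: h_def)
      show "norm (wx i y - wx i z) \<le> \<epsilon>" if "z \<in> H" "y \<in> H" "norm (y - z) \<le> 1 / 2 ^ N" for i z y
        using that h(2) hm(4)[of i] by (intro dx(2)) (auto simp: h_def)
    qed (use dw pde pts tau R in \<open>auto simp: e_def t'_def h_def\<close>)
    have "(1 + b) * (1 + 2 * real CARD('m) * b) * R * ((real CARD('m) + 1) * \<epsilon>)\<^sup>2 = G * \<epsilon>\<^sup>2"
      by (simp add: G_def m_def power_mult_distrib)
    then have "energy A r \<le> \<rho>\<^sup>2" using r(2) \<epsilon>(2) by simp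
    then show "\<exists>r. e (Suc k) j = sweep (e k) j + \<tau> *\<^sub>R r \<and> energy A r \<le> \<rho>\<^sup>2"
      using ek r(1) by auto
  next
    fix k
    have "total (e k) \<le> (\<Sum>j\<in>(grid_indices N :: ('m \<Rightarrow> int) set). K)"
      unfolding total_def
    proof (rule sum_mono)
      fix j
      have "norm (e k j) \<le> W" using W by (auto simp: e_def)
      then have "(norm (e k j))\<^sup>2 \<le> W\<^sup>2" by (intro power_mono) auto
      then have "R * (norm (e k j))\<^sup>2 \<le> R * W\<^sup>2" using R(3) by (intro mult_left_mono) auto
      then show "energy A (e k j) \<le> K" using R(1)[of "e k j"] unfolding K_def by linarith
    qed
    then show "total (e k) \<le> K * 2 ^ (N * CARD('m))" by (simp add: card_grid_indices power_mult mult.commute)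
  qed
  also have "(\<Sum>j\<in>grid_indices N. weight 0 j * energy A (e 0 j)) = 0"
    by (rule sum.neutral) (auto simp: e_def init)
  finally have upper: "(\<Sum>j\<in>grid_indices N. weight t j * energy A (e l j)) \<le>
      t * (5 * h * b * K + \<rho> * K + 2 * \<rho>) * 2 ^ (N * m)"
    by (simp add: t_def h_def m_def)
  have "t * (5 * h * b * K + \<rho> * K + 2 * \<rho>) \<le> t0 * (5 * h * b * K + \<rho> * K + 2 * \<rho>)"
    using t h(1) b K \<rho>(1) by (intro mult_right_mono) auto
  also have "\<dots> \<le> \<kappa> / 4 + \<kappa> / 4"
  proof -
    have pos: "0 < 5 * b * K + 1" using b K by (simp add: add_nonneg_pos)
    have "5 * h * b * K = h * (5 * b * K)" by simp
    also have "\<dots> \<le> h * (5 * b * K + 1)" using h(1) by (intro mult_left_mono) auto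
    finally have "5 * h * b * K \<le> h * (5 * b * K + 1)" .
    then have "t0 * (5 * h * b * K) \<le> (t0 + 1) * (h * (5 * b * K + 1))"
      using z0(1) h(1) b K mult_mono[of t0 "t0 + 1" "5 * h * b * K" "h * (5 * b * K + 1)"] by simp
    also have "\<dots> \<le> (t0 + 1) * (\<kappa> / (4 * (t0 + 1) * (5 * b * K + 1)) * (5 * b * K + 1))"
      using h(2) hm(8) z0(1) pos by (intro mult_left_mono mult_right_mono) auto
    also have "\<dots> = \<kappa> / 4"
    proof -
      have "t0 + 1 \<noteq> 0" "5 * b * K + 1 \<noteq> 0" using z0(1) pos by linarith+
      then show ?thesis by (rule quarter)
    qed
    finally show ?thesis using \<rho>\<kappa> by (simp add: distrib_left)
  qed
  finally have "t * (5 * h * b * K + \<rho> * K + 2 * \<rho>) * 2 ^ (N * m) \<le> (\<kappa> / 2) * 2 ^ (N * m)"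
    by (intro mult_right_mono) auto
  with upper have up2: "(\<Sum>j\<in>grid_indices N. weight t j * energy A (e l j)) \<le> (\<kappa> / 2) * 2 ^ (N * m)"
    by linarith
  define J' where "J' = {j \<in> grid_indices N. \<forall>i. \<bar>grid_point N j $ i - x0 $ i\<bar> \<le> \<delta>}"
  have mt: "mx i * t \<le> mx i * t0" "0 \<le> mx i * t0" "mn i * t0 \<le> mn i * t" "mn i * t0 \<le> 0" for i
    using sgn z0(1) t by (auto intro: mult_left_mono mult_left_mono_neg mult_nonpos_nonneg)
  have big: "(\<delta> * 2 ^ N) ^ m \<le> real (card J')"
    unfolding J'_def m_def
  proof (rule card_grid_box_ge)
    have "2 ^ N * h \<le> 2 ^ N * \<delta>" using h(2) hm(6) by (intro mult_left_mono) auto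
    then show "1 \<le> \<delta> * 2 ^ N" unfolding h(3) by (simp only: mult.commute)
    show "\<delta> \<le> x0 $ i" "x0 $ i \<le> 1 - \<delta>" for i
      using s(1) s(2)[of i] s(3)[of i] mt(2)[of i] mt(4)[of i] \<delta>(2) by linarith+
  qed (use \<delta> in simp)
  have low_energy: "\<omega> * (c\<^sup>2 / R) \<le> weight t j * energy A (e l j)" if j: "j \<in> J'" for j
  proof -
    have near: "\<bar>grid_point N j $ i - x0 $ i\<bar> \<le> \<delta>" for i using j by (simp add: J'_def)
    have lh: "2 * s \<le> low i t j" "2 * s \<le> high i t j" for i
      using near[of i] s(2)[of i] s(3)[of i] mt(1)[of i] mt(3)[of i] \<delta>(2) h(2) hm(5)
      unfolding low_def high_def h_def[symmetric] by linarith+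
    have rs: "(2 * s)\<^sup>2 \<le> relu_sq (low i t j)" "(2 * s)\<^sup>2 \<le> relu_sq (high i t j)" for i
      unfolding relu_sq_def using lh[of i] s(1) by (intro power_mono; simp)+
    have "(\<Prod>i\<in>(UNIV :: 'm set). (2 * s)\<^sup>2 * (2 * s)\<^sup>2) \<le> weight t j"
      unfolding weight_def using rs by (intro prod_mono conjI mult_mono) auto
    then have \<omega>: "\<omega> \<le> weight t j" by (simp add: \<omega>_def m_def)
    have H: "(t, grid_point N j) \<in> H"
    proof -
      have "grid_point N j $ i - mx i * t \<ge> 0 \<and> grid_point N j $ i - 1 - mn i * t \<le> 0" for i
        using near[of i] s(1) s(2)[of i] s(3)[of i] mt(1)[of i] mt(3)[of i] \<delta>(2) by linarith
      then show ?thesis using t(3) by (simp add: H_def space_cone_def)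
    qed
    have "dist (t, grid_point N j) (t0, x0) \<le> \<bar>t - t0\<bar> + norm (grid_point N j - x0)"
      unfolding dist_norm diff_Pair by (rule order_trans[OF norm_Pair_le]) simp
    also have "norm (grid_point N j - x0) \<le> (\<Sum>i\<in>UNIV. \<bar>(grid_point N j - x0) $ i\<bar>)"
      by (rule norm_le_l1_cart)
    also have "\<dots> \<le> (\<Sum>i\<in>(UNIV :: 'm set). \<delta>)" using near by (intro sum_mono) simp
    also have "\<bar>t - t0\<bar> \<le> \<delta>" using t tau(2) h(2) hm(6) by linarith
    finally have "dist (t, grid_point N j) (t0, x0) < d" using \<delta>(3) by (simp add: m_def algebra_simps)
    from d(2)[OF H this] have "norm (w (t, grid_point N j) - w (t0, x0)) < c" by (simp add: dist_norm)
    then have "c \<le> norm (w (t, grid_point N j))"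
      using norm_triangle_ineq2[of "w (t0, x0)" "w (t, grid_point N j)"]
      unfolding c_def by (simp add: norm_minus_commute)
    then have "c\<^sup>2 \<le> (norm (e l j))\<^sup>2" using c H by (intro power_mono) (auto simp: e_def t_def)
    also have "\<dots> \<le> R * energy A (e l j)" by (rule R(2))
    finally have "c\<^sup>2 / R \<le> energy A (e l j)" using R(3) by (simp add: pos_divide_le_eq mult.commute)
    then show ?thesis using \<omega> R(3) by (intro mult_mono) auto
  qed
  have "\<kappa> * 2 ^ (N * m) = (\<delta> * 2 ^ N) ^ m * (\<omega> * (c\<^sup>2 / R))"
    by (simp add: \<kappa>_def power_mult_distrib power_mult)
  also have "\<dots> \<le> real (card J') * (\<omega> * (c\<^sup>2 / R))"
    using big R(3) s(1) by (intro mult_right_mono) (auto simp: \<omega>_def)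
  also have "\<dots> = (\<Sum>j\<in>J'. \<omega> * (c\<^sup>2 / R))" by simp
  also have "\<dots> \<le> (\<Sum>j\<in>J'. weight t j * energy A (e l j))" by (intro sum_mono low_energy)
  also have "\<dots> \<le> (\<Sum>j\<in>grid_indices N. weight t j * energy A (e l j))"
    by (intro sum_mono2) (auto simp: J'_def)
  finally have "\<kappa> * 2 ^ (N * m) \<le> (\<kappa> / 2) * 2 ^ (N * m)" using up2 by linarith
  then show False using \<kappa> by simp
qed

text \<open>Every point of \<open>H\<close> is the limit of points on its segment to the centre of
  the initial cube. These lie strictly between the lateral faces, and continuity does the
  rest.\<close>

lemma zero_data_solution:
  fixes A :: "real ^ 'n ^ 'n" and P Q :: "'m::finite \<Rightarrow> real ^ 'n ^ 'n"
  assumes cone: "\<And>N \<tau>. 0 < \<tau> \<Longrightarrow> \<tau> * 2 ^ N * b \<le> 1 \<Longrightarrow> upwind_cone A P Q N \<tau> b mx mn"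
  defines "H \<equiv> space_cone mx mn"
  assumes cpt: "compact H"
    and dw: "\<And>z. z \<in> H \<Longrightarrow>
      (w has_derivative (\<lambda>v. fst v *\<^sub>R wt z + (\<Sum>i\<in>UNIV. snd v $ i *\<^sub>R wx i z))) (at z within H)"
    and cont: "continuous_on H wt" "\<And>i. continuous_on H (wx i)"
    and pde: "\<And>z. z \<in> H \<Longrightarrow> A *v wt z + (\<Sum>i\<in>UNIV. (P i - Q i) *v wx i z) = 0"
    and init: "\<And>x. (0, x) \<in> H \<Longrightarrow> w (0, x) = 0"
    and R: "\<And>y. energy A y \<le> R * (norm y)\<^sup>2" "\<And>y. (norm y)\<^sup>2 \<le> R * energy A y" "0 < R"
    and b: "0 \<le> b" and sgn: "\<And>i. 0 \<le> mx i" "\<And>i. mn i \<le> 0"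
    and z: "z \<in> H"
  shows "w z = 0"
proof -
  obtain t x where tx: "z = (t, x)" by (cases z)
  have txH: "0 \<le> t" "\<And>i. 0 \<le> x $ i - mx i * t" "\<And>i. x $ i - 1 - mn i * t \<le> 0"
    using z by (auto simp: tx H_def space_cone_def)
  define y where "y k = ((1 - inverse (real (Suc k))) * t, (1 - inverse (real (Suc k))) *\<^sub>R x +
    inverse (real (Suc k)) *\<^sub>R (\<chi> i. 1 / 2))" for k
  have y0: "w (y k) = 0 \<and> y k \<in> H" for k
  proof -
    define s where "s = inverse (real (Suc k))"
    have s: "0 < s" "s \<le> 1" by (auto simp: s_def inverse_le_1_iff)
    define t0 where "t0 = (1 - s) * t"
    define x0 where "x0 = (1 - s) *\<^sub>R x + s *\<^sub>R (\<chi> i. 1 / 2)"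
    have t0: "0 \<le> t0" using s txH by (simp add: t0_def)
    have 1: "mx i * t0 < x0 $ i" for i
    proof -
      have "0 \<le> (1 - s) * (x $ i - mx i * t)" using s txH(2) by simp
      then have "0 < (1 - s) * (x $ i - mx i * t) + s / 2" using s by simp
      then show ?thesis by (simp add: x0_def t0_def algebra_simps)
    qed
    have 2: "x0 $ i < 1 + mn i * t0" for i
    proof -
      have "(1 - s) * (x $ i - 1 - mn i * t) \<le> 0" using s txH(3) by (intro mult_nonneg_nonpos) auto
      then have "(1 - s) * (x $ i - 1 - mn i * t) - s / 2 < 0" using s by simp
      then show ?thesis by (simp add: x0_def t0_def algebra_simps)
    qed
    have "w (t0, x0) = 0"
      by (rule zero_data_solution_interior[OF cone cpt[unfolded H_def] dw[unfolded H_def] cont[unfolded H_def]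
          pde[unfolded H_def] init[unfolded H_def] R b t0 1 2 sgn])
    moreover have "(t0, x0) \<in> H"
      using t0 less_imp_le[OF 1] less_imp_le[OF 2] by (auto simp: H_def space_cone_def algebra_simps)
    ultimately show ?thesis by (simp add: y_def t0_def x0_def s_def)
  qed
  have lim0: "(\<lambda>k. inverse (real (Suc k))) \<longlonglongrightarrow> 0" by (rule LIMSEQ_inverse_real_of_nat)
  have "y \<longlonglongrightarrow> ((1 - 0) * t, (1 - 0) *\<^sub>R x + 0 *\<^sub>R (\<chi> i. 1 / 2))"
    unfolding y_def by (intro tendsto_intros lim0)
  then have ly: "y \<longlonglongrightarrow> z" by (simp add: tx)
  have "continuous_on H w"
    unfolding continuous_on_eq_continuous_within using dw has_derivative_continuous by blast
  then have "(\<lambda>k. w (y k)) \<longlonglongrightarrow> w z"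
    by (rule continuous_on_tendsto_compose[OF _ ly z]) (use y0 in auto)
  then have "(\<lambda>k. 0) \<longlonglongrightarrow> w z" using y0 by simp
  then show ?thesis using LIMSEQ_unique tendsto_const by blast
qed

section \<open>The error of the scheme\<close>

text \<open>The parabola vanishes at both ends of the unit interval and is symmetric, so that cut
  off data fit together across the periodic face; its slope is at most \<open>1\<close> in size,
  which gives the Lipschitz constant \<open>1 / d\<close>.\<close>

definition cutoff :: "real \<Rightarrow> real \<Rightarrow> real" where
  "cutoff d s = min 1 (s * (1 - s) / d)"

lemma cutoff_bounds:
  assumes "0 < d" "0 \<le> s" "s \<le> 1"
  shows "0 \<le> cutoff d s" "cutoff d s \<le> 1" "cutoff d s \<le> s / d" "cutoff d s = cutoff d (1 - s)"
proof -
  show "0 \<le> cutoff d s" "cutoff d s \<le> 1" using assms by (auto simp: cutoff_def)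
  have "s * (1 - s) \<le> s * 1" using assms by (intro mult_left_mono) auto
  then show "cutoff d s \<le> s / d" using assms(1) by (auto simp: cutoff_def min_le_iff_disj divide_right_mono)
  show "cutoff d s = cutoff d (1 - s)" by (simp add: cutoff_def mult.commute)
qed

lemma cutoff_lipschitz:
  assumes d: "0 < d" and s: "0 \<le> s" "s \<le> 1" "0 \<le> s'" "s' \<le> 1"
  shows "\<bar>cutoff d s - cutoff d s'\<bar> \<le> \<bar>s - s'\<bar> / d"
proof -
  have "s * (1 - s) - s' * (1 - s') = (s - s') * (1 - s - s')" by (simp add: algebra_simps)
  moreover have "\<bar>1 - s - s'\<bar> \<le> 1" using s by (auto simp: abs_le_iff)
  ultimately have "\<bar>s * (1 - s) - s' * (1 - s')\<bar> \<le> \<bar>s - s'\<bar>"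
    using mult_left_le[of "\<bar>1 - s - s'\<bar>" "\<bar>s - s'\<bar>"] by (simp add: abs_mult)
  then have "\<bar>s * (1 - s) / d - s' * (1 - s') / d\<bar> \<le> \<bar>s - s'\<bar> / d"
    using d by (simp add: diff_divide_distrib[symmetric] divide_right_mono)
  then show ?thesis unfolding cutoff_def by linarith
qed

lemma cutoff_eq_1:
  assumes "0 < d" "d \<le> 1 / 4" "2 * d \<le> s" "s \<le> 1 - 2 * d"
  shows "cutoff d s = 1"
proof -
  have "0 \<le> (s - 2 * d) * (1 - 2 * d - s)" using assms by simp
  moreover have "s * (1 - s) = (s - 2 * d) * (1 - 2 * d - s) + 2 * d * (1 - 2 * d)"
    by (simp add: algebra_simps)
  moreover have "d * 1 \<le> d * (2 * (1 - 2 * d))" using assms by (intro mult_left_mono) auto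
  ultimately have "d \<le> s * (1 - s)" by (simp add: algebra_simps)
  then show ?thesis using assms(1) by (simp add: cutoff_def)
qed

section \<open>Cut off grid data and sums over slabs\<close>

lemma grid_point_bounds:
  assumes "j \<in> grid_indices N"
  shows "1 / 2 / 2 ^ N \<le> grid_point N j $ i" "grid_point N j $ i \<le> 1 - 1 / 2 / 2 ^ N"
proof -
  have "real_of_int (j i) \<le> real_of_int (2 ^ N)" "1 \<le> real_of_int (j i)"
    using grid_indicesD[OF assms, of i] by (simp_all only: of_int_le_iff atLeastAtMost_iff) auto
  then have "1 / 2 \<le> real_of_int (j i) - 1 / 2" "real_of_int (j i) - 1 / 2 \<le> 2 ^ N - 1 / 2" by simp_all
  then have "1 / 2 / 2 ^ N \<le> (real_of_int (j i) - 1 / 2) / 2 ^ N"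
    "(real_of_int (j i) - 1 / 2) / 2 ^ N \<le> (2 ^ N - 1 / 2) / 2 ^ N" by (intro divide_right_mono; simp)+
  then show "1 / 2 / 2 ^ N \<le> grid_point N j $ i" "grid_point N j $ i \<le> 1 - 1 / 2 / 2 ^ N"
    by (simp_all add: grid_point_def diff_divide_distrib)
qed

lemma grid_point_unit_cube:
  assumes "j \<in> grid_indices N"
  shows "grid_point N j \<in> unit_cube"
proof -
  have "0 \<le> grid_point N j $ i \<and> grid_point N j $ i \<le> 1" for i
  proof -
    have "0 \<le> 1 / 2 / (2 :: real) ^ N" by simp
    then show ?thesis using grid_point_bounds[OF assms, of i] by linarith
  qed
  then show ?thesis by (simp add: unit_cube_def)
qed

definition grid_cutoff :: "nat \<Rightarrow> real \<Rightarrow> ('m::finite \<Rightarrow> int) \<Rightarrow> real" where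
  "grid_cutoff N d j = (\<Prod>i\<in>UNIV. cutoff d (grid_point N j $ i))"

lemma grid_cutoff_bounds:
  assumes "j \<in> grid_indices N" "0 < d"
  shows "0 \<le> grid_cutoff N d j" "grid_cutoff N d j \<le> 1"
proof -
  have "0 \<le> grid_point N j $ i" "grid_point N j $ i \<le> 1" for i
    using grid_point_unit_cube[OF assms(1)] by (auto simp: unit_cube_def)
  then show "0 \<le> grid_cutoff N d j" "grid_cutoff N d j \<le> 1"
    unfolding grid_cutoff_def using assms(2) cutoff_bounds(1,2)[of d]
    by (auto intro!: prod_nonneg prod_le_1)
qed

text \<open>Inside the cube this is the product rule. Across the periodic face the data may jump,
  but both cells have the same cutoff factor, at most \<open>h / (2 * d)\<close> by their distance
  \<open>h / 2\<close> from the boundary.\<close>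

lemma cutoff_difference:
  fixes y :: "real ^ 'm::finite \<Rightarrow> 'b::real_normed_vector"
  assumes j: "j \<in> grid_indices N" and d: "0 < d" "d \<le> 1"
    and y: "\<And>x. x \<in> unit_cube \<Longrightarrow> norm (y x) \<le> K"
      "\<And>x x'. x \<in> unit_cube \<Longrightarrow> x' \<in> unit_cube \<Longrightarrow> norm (y x - y x') \<le> K * norm (x - x')"
    and K: "0 \<le> K"
  shows "norm (grid_cutoff N d (up N i j) *\<^sub>R y (grid_point N (up N i j)) - grid_cutoff N d j *\<^sub>R y (grid_point N j))
     \<le> 2 * K * (1 / 2 ^ N) / d"
proof -
  define h :: real where "h = 1 / 2 ^ N"
  have h: "0 < h" "2 ^ N * h = 1" by (auto simp: h_def)
  let ?x = "grid_point N j" and ?x' = "grid_point N (up N i j)"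
  have cube: "?x \<in> unit_cube" "?x' \<in> unit_cube"
    using grid_point_unit_cube[OF j] grid_point_unit_cube[OF up_down(1)[OF j]] by auto
  have x01: "0 \<le> ?x $ k" "?x $ k \<le> 1" "0 \<le> ?x' $ k" "?x' $ k \<le> 1" for k
    using cube by (auto simp: unit_cube_def)
  define R where "R = (\<Prod>k\<in>UNIV - {i}. cutoff d (?x $ k))"
  have R: "0 \<le> R" "R \<le> 1"
    unfolding R_def using x01 d cutoff_bounds(1,2)[of d] by (auto intro!: prod_nonneg prod_le_1)
  have other: "?x' $ k = ?x $ k" if "k \<noteq> i" for k using that by (simp add: grid_point_def up_def)
  have c: "grid_cutoff N d j = R * cutoff d (?x $ i)"
    unfolding grid_cutoff_def R_def by (subst prod.remove[of UNIV i]) (auto simp: mult.commute)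
  have c': "grid_cutoff N d (up N i j) = R * cutoff d (?x' $ i)"
  proof -
    have "(\<Prod>k\<in>UNIV - {i}. cutoff d (?x' $ k)) = R"
      unfolding R_def using other by (intro prod.cong) auto
    then show ?thesis
      unfolding grid_cutoff_def by (subst prod.remove[of UNIV i]) (auto simp: mult.commute)
  qed
  have jj: "j i \<in> {1..2 ^ N}" by (rule grid_indicesD[OF j])
  have gp: "?x $ i = (of_int (j i) - 1 / 2) * h" "?x' $ i = (of_int (up N i j i) - 1 / 2) * h"
    by (simp_all add: grid_point_def h_def)
  let ?a = "grid_cutoff N d j" and ?a' = "grid_cutoff N d (up N i j)"
  have split: "?a' *\<^sub>R y ?x' - ?a *\<^sub>R y ?x = (?a' - ?a) *\<^sub>R y ?x' + ?a *\<^sub>R (y ?x' - y ?x)"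
    by (simp add: algebra_simps)
  have "norm (?a' *\<^sub>R y ?x' - ?a *\<^sub>R y ?x) \<le> \<bar>?a' - ?a\<bar> * K + ?a * norm (y ?x' - y ?x)"
    unfolding split using y(1)[OF cube(2)] grid_cutoff_bounds(1)[OF j d(1)]
    by (intro norm_triangle_le add_mono) (auto intro!: mult_left_mono)
  also have "\<dots> \<le> 2 * K * h / d"
  proof (cases "j i = 2 ^ N")
    case True
    have M1: "(2 :: int) ^ N + 1 \<noteq> 0" using zero_less_power[of "2 :: int" N] by linarith
    have xi: "?x $ i = 1 - h / 2" "?x' $ i = h / 2"
    proof -
      have "up N i j i = 1" using True M1 by (simp add: up_def wrap_def)
      then show "?x' $ i = h / 2" by (simp add: gp)
      show "?x $ i = 1 - h / 2" using True h by (simp add: gp algebra_simps)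
    qed
    have "?a' = ?a"
      unfolding c c' xi using cutoff_bounds(4)[of d "h / 2"] x01(3,4)[of i] d by (simp add: xi)
    moreover have "?a \<le> 1 * (h / 2 / d)"
      unfolding c using R cutoff_bounds[of d "?x $ i"] cutoff_bounds[of d "h / 2"] x01[of i] d
      by (intro mult_mono) (auto simp: xi)
    moreover have "norm (y ?x' - y ?x) \<le> 2 * K"
      using norm_triangle_ineq4[of "y ?x'" "y ?x"] y(1)[OF cube(1)] y(1)[OF cube(2)] by linarith
    ultimately have "\<bar>?a' - ?a\<bar> * K + ?a * norm (y ?x' - y ?x) \<le> 0 + (1 * (h / 2 / d)) * (2 * K)"
      using grid_cutoff_bounds(1)[OF j d(1)] by (intro add_mono mult_mono) auto
    also have "\<dots> \<le> 2 * K * h / d" using K h d by (simp add: divide_right_mono)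
    finally show ?thesis .
  next
    case False
    then have ui: "up N i j i = j i + 1" using jj by (simp add: up_def wrap_def)
    have xi: "?x' $ i = ?x $ i + h" by (simp add: gp ui algebra_simps)
    have "\<bar>?a' - ?a\<bar> = R * \<bar>cutoff d (?x' $ i) - cutoff d (?x $ i)\<bar>"
      unfolding c c' using R by (simp add: right_diff_distrib[symmetric] abs_mult)
    also have "\<dots> \<le> 1 * (\<bar>?x' $ i - ?x $ i\<bar> / d)"
      using R cutoff_lipschitz[OF d(1) x01(3,4,1,2)] by (intro mult_mono) auto
    finally have 1: "\<bar>?a' - ?a\<bar> \<le> h / d" using h by (simp add: xi)
    have "?x' - ?x = axis i h"
      using other by (auto simp: vec_eq_iff axis_def xi)
    moreover have "norm (axis i h :: real ^ 'm) \<le> h"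
      using norm_le_l1_cart[of "axis i h :: real ^ 'm"] h(1) by (simp add: axis_def if_distrib cong: if_cong)
    ultimately have 2: "norm (y ?x' - y ?x) \<le> K * h"
      using y(2)[OF cube(2,1)] mult_left_mono[of "norm (?x' - ?x)" h K] K by simp
    have "h \<le> h / d" using h d by (simp add: le_divide_eq)
    then have 3: "K * h \<le> K * (h / d)" using K by (rule mult_left_mono)
    have "\<bar>?a' - ?a\<bar> * K + ?a * norm (y ?x' - y ?x) \<le> (h / d) * K + 1 * (K * (h / d))"
      using 1 2 3 grid_cutoff_bounds[OF j d(1)] K by (intro add_mono mult_mono mult_right_mono) auto
    then show ?thesis by (simp add: algebra_simps)
  qed
  finally show ?thesis by (simp add: h_def)
qed

text \<open>The slab meets at most \<open>(c - a) * 2 ^ N + 1\<close> layers orthogonal to the axis,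
  and each contributes at most \<open>X\<close>.\<close>

lemma slab_sum_le:
  fixes f :: "('m::finite \<Rightarrow> int) \<Rightarrow> real"
  assumes f: "\<And>j. j \<in> grid_indices N \<Longrightarrow> 0 \<le> f j"
    and X: "\<And>k. k \<in> {1..2 ^ N} \<Longrightarrow> (\<Sum>j\<in>{j \<in> grid_indices N. j i = k}. f j) \<le> X" "0 \<le> X"
    and ac: "a \<le> c"
  shows "(\<Sum>j\<in>{j \<in> grid_indices N. a \<le> grid_point N j $ i \<and> grid_point N j $ i \<le> c}. f j)
     \<le> ((c - a) * 2 ^ N + 1) * X"
proof -
  define S where "S = {j \<in> grid_indices N. a \<le> grid_point N j $ i \<and> grid_point N j $ i \<le> c}"
  define M :: real where "M = 2 ^ N"
  have M: "0 < M" by (simp add: M_def)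
  define Ks where "Ks = {k :: int. k \<in> {1..2 ^ N} \<and> a * M + 1 / 2 \<le> of_int k \<and> of_int k \<le> c * M + 1 / 2}"
  have fK: "finite Ks" by (rule finite_subset[of _ "{1..2 ^ N}"]) (auto simp: Ks_def)
  have "(\<lambda>j. j i) ` S \<subseteq> Ks"
  proof
    fix k assume "k \<in> (\<lambda>j. j i) ` S"
    then obtain j where j: "j \<in> S" "k = j i" by blast
    have "a \<le> (of_int k - 1 / 2) / M" "(of_int k - 1 / 2) / M \<le> c"
      using j by (auto simp: S_def grid_point_def M_def)
    then have "a * M \<le> of_int k - 1 / 2" "of_int k - 1 / 2 \<le> c * M"
      using M by (auto simp: pos_le_divide_eq pos_divide_le_eq)
    then show "k \<in> Ks" using grid_indicesD[of j N i] j by (auto simp: Ks_def S_def)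
  qed
  then have "(\<Sum>j\<in>S. f j) = (\<Sum>k\<in>Ks. \<Sum>j\<in>{j \<in> S. j i = k}. f j)"
    by (intro sum.group[symmetric] fK) (auto simp: S_def)
  also have "\<dots> \<le> (\<Sum>k\<in>Ks. X)"
  proof (rule sum_mono)
    fix k assume "k \<in> Ks"
    have "(\<Sum>j\<in>{j \<in> S. j i = k}. f j) \<le> (\<Sum>j\<in>{j \<in> grid_indices N. j i = k}. f j)"
      using f by (intro sum_mono2) (auto simp: S_def)
    also have "\<dots> \<le> X" using X(1)[of k] \<open>k \<in> Ks\<close> by (simp add: Ks_def)
    finally show "(\<Sum>j\<in>{j \<in> S. j i = k}. f j) \<le> X" .
  qed
  also have "\<dots> = real (card Ks) * X" by simp
  also have "\<dots> \<le> ((c - a) * M + 1) * X"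
  proof (rule mult_right_mono[OF _ X(2)])
    have le: "a * M + 1 / 2 \<le> c * M + 1 / 2" using ac M by simp
    have fin: "finite {k :: int. a * M + 1 / 2 \<le> of_int k \<and> of_int k \<le> c * M + 1 / 2}"
      by (rule finite_subset[of _ "{\<lceil>a * M + 1 / 2\<rceil>..\<lfloor>c * M + 1 / 2\<rfloor>}"]) (auto simp: ceiling_le_iff le_floor_iff)
    have "card Ks \<le> card {k :: int. a * M + 1 / 2 \<le> of_int k \<and> of_int k \<le> c * M + 1 / 2}"
      by (intro card_mono fin) (auto simp: Ks_def)
    then have "real (card Ks) \<le> (c * M + 1 / 2) - (a * M + 1 / 2) + 1"
      using card_int_interval_le[OF le] by linarith
    then show "real (card Ks) \<le> (c - a) * M + 1" by (simp add: algebra_simps)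
  qed
  finally show ?thesis by (simp add: S_def M_def)
qed

lemma layer_const:
  fixes c :: real
  assumes "k \<in> {1..2 ^ N}"
  shows "(\<Sum>j\<in>{j :: 'm::finite \<Rightarrow> int. j \<in> grid_indices N \<and> j i = k}. c) = c * 2 ^ (N * CARD('m)) / 2 ^ N"
proof -
  have "2 ^ N * (\<Sum>j\<in>{j :: 'm \<Rightarrow> int. j \<in> grid_indices N \<and> j i = k}. c) =
      (\<Sum>j\<in>(grid_indices N :: ('m \<Rightarrow> int) set). c)"
    using sum_lines[OF assms, where i = i and f = "\<lambda>_. c"] by (simp add: nat_power_eq)
  then show ?thesis by (simp add: card_grid_indices power_mult field_simps)
qed

context upwind begin

primrec evolve :: "(('m \<Rightarrow> int) \<Rightarrow> real ^ 'n) \<Rightarrow> (nat \<Rightarrow> ('m \<Rightarrow> int) \<Rightarrow> real ^ 'n) \<Rightarrow> nat \<Rightarrow> ('m \<Rightarrow> int) \<Rightarrow> real ^ 'n" where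
  "evolve u g 0 = u"
| "evolve u g (Suc l) = (\<lambda>j. sweep (evolve u g l) j + \<tau> *\<^sub>R g l j)"

lemma total_cong: "(\<And>j. j \<in> grid_indices N \<Longrightarrow> U j = V j) \<Longrightarrow> total U = total V"
  by (simp add: total_def)

lemma total_le:
  assumes "\<And>j. j \<in> grid_indices N \<Longrightarrow> norm (V j) \<le> v" "\<And>y. energy A y \<le> K * (norm y)\<^sup>2" "0 \<le> K"
  shows "total V \<le> K * v\<^sup>2 * 2 ^ (N * CARD('m))"
proof -
  have "total V \<le> (\<Sum>j\<in>(grid_indices N :: ('m \<Rightarrow> int) set). K * v\<^sup>2)"
    unfolding total_def
  proof (rule sum_mono)
    fix j assume "j \<in> (grid_indices N :: ('m \<Rightarrow> int) set)"
    then have "(norm (V j))\<^sup>2 \<le> v\<^sup>2" using assms(1) by (intro power_mono) auto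
    then show "energy A (V j) \<le> K * v\<^sup>2"
      using assms(2)[of "V j"] mult_left_mono[OF _ assms(3)] by (meson order_trans)
  qed
  then show ?thesis by (simp add: card_grid_indices power_mult mult.commute)
qed

lemma energy_diff_le: "energy A (x - y) \<le> 2 * energy A x + 2 * energy A y"
  using energy_add[OF positive_definite_symmetric[OF A], of x "- y"]
    inner_le_energies[OF positive_definite_pos_semidef[OF A], of 1 x "- y"] by simp

lemma total_diff_le: "total (\<lambda>j. U j - V j) \<le> 2 * total U + 2 * total V"
  unfolding total_def sum_distrib_left sum.distrib[symmetric] by (intro sum_mono energy_diff_le)

end

lemma sum_Un_le:
  fixes f :: "'i \<Rightarrow> real"
  assumes "finite B" "finite C" "\<And>j. 0 \<le> f j"
  shows "sum f (B \<union> C) \<le> sum f B + sum f C"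
  using sum.union_inter[OF assms(1,2), of f] sum_nonneg[of "B \<inter> C" f] assms(3) by simp

lemma sum_UN_le:
  fixes f :: "'i \<Rightarrow> real"
  assumes "finite I" "\<And>i. finite (B i)" "\<And>j. 0 \<le> f j"
  shows "sum f (\<Union>i\<in>I. B i) \<le> (\<Sum>i\<in>I. sum f (B i))"
  using assms(1)
proof (induction I)
  case (insert i I)
  then show ?case using sum_Un_le[of "B i" "\<Union>i\<in>I. B i" f] assms(2,3) by simp
qed simp

text \<open>A single \<open>K\<close> dominates the speeds, the time, the solution and both
  comparisons of energy with norm. High powers of \<open>K\<close> in the estimates do no harm,
  since the class of functions in which it lies is closed under fixed powers.\<close>

locale scheme_error = upwind_cone A P Q N \<tau> b mx mn
  for A :: "real ^ 'n ^ 'n" and P Q :: "'m::finite \<Rightarrow> real ^ 'n ^ 'n" and N :: nat and \<tau> b :: real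
    and mx mn :: "'m \<Rightarrow> real" +
  fixes K T :: real and L :: nat
    and p pt G :: "real \<times> (real ^ 'm) \<Rightarrow> real ^ 'n" and px :: "'m \<Rightarrow> real \<times> (real ^ 'm) \<Rightarrow> real ^ 'n"
    and U :: "nat \<Rightarrow> ('m \<Rightarrow> int) \<Rightarrow> real ^ 'n"
  assumes K: "1 \<le> K" and T: "1 \<le> T" "T \<le> K" "real L * \<tau> = T" and \<tau>h: "\<tau> \<le> 1 / 2 ^ N" and bK: "b \<le> K"
    and R: "\<And>y. energy A y \<le> K * (norm y)\<^sup>2" "\<And>y. (norm y)\<^sup>2 \<le> K * energy A y"
    and dp: "\<And>z. z \<in> {0..T} \<times> unit_cube \<Longrightarrow> (p has_derivative (\<lambda>w. fst w *\<^sub>R pt z +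
       (\<Sum>i\<in>UNIV. snd w $ i *\<^sub>R px i z))) (at z within {0..T} \<times> unit_cube)"
    and pde: "\<And>z. z \<in> {0..T} \<times> unit_cube \<Longrightarrow> A *v pt z + (\<Sum>i\<in>UNIV. (P i - Q i) *v px i z) = A *v G z"
    and p_le: "\<And>z. z \<in> {0..T} \<times> unit_cube \<Longrightarrow> norm (p z) \<le> K"
    and p_lip: "\<And>z z'. z \<in> {0..T} \<times> unit_cube \<Longrightarrow> z' \<in> {0..T} \<times> unit_cube \<Longrightarrow> norm (p z - p z') \<le> K * norm (z - z')"
    and pt_lip: "\<And>z z'. z \<in> {0..T} \<times> unit_cube \<Longrightarrow> z' \<in> {0..T} \<times> unit_cube \<Longrightarrow> norm (pt z - pt z') \<le> K * norm (z - z')"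
    and px_lip: "\<And>i z z'. z \<in> {0..T} \<times> unit_cube \<Longrightarrow> z' \<in> {0..T} \<times> unit_cube \<Longrightarrow> norm (px i z - px i z') \<le>
        K * norm (z - z')"
    and G_le: "\<And>z. z \<in> {0..T} \<times> unit_cube \<Longrightarrow> norm (G z) \<le> K"
    and G_lip: "\<And>z z'. z \<in> {0..T} \<times> unit_cube \<Longrightarrow> z' \<in> {0..T} \<times> unit_cube \<Longrightarrow> norm (G z - G z') \<le> K * norm (z - z')"
    and U0: "\<And>j. j \<in> grid_indices N \<Longrightarrow> U 0 j = p (0, grid_point N j)"
    and USuc: "\<And>l j. l < L \<Longrightarrow> j \<in> grid_indices N \<Longrightarrow>
       U (Suc l) j = sweep (U l) j + \<tau> *\<^sub>R G (real l * \<tau>, grid_point N j)"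
begin

abbreviation "J \<equiv> grid_indices N :: ('m \<Rightarrow> int) set"

definition h :: real where "h = 1 / 2 ^ N"

definition err :: "nat \<Rightarrow> ('m \<Rightarrow> int) \<Rightarrow> real ^ 'n" where
  "err l j = p (real l * \<tau>, grid_point N j) - U l j"

lemma h: "0 < h" "h \<le> 1" "2 ^ N * h = 1" "\<tau> \<le> h"
  using \<tau>h by (auto simp: h_def)

lemma \<tau>_le: "\<tau> \<le> 1"
  using h by linarith

lemma time_range: "l \<le> L \<Longrightarrow> real l * \<tau> \<in> {0..T}"
  using T(3) \<tau> by (auto intro!: mult_right_mono)

lemma point_range: "l \<le> L \<Longrightarrow> j \<in> J \<Longrightarrow> (real l * \<tau>, grid_point N j) \<in> {0..T} \<times> unit_cube"
  using time_range grid_point_unit_cube by blast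

lemma growth_le:
  assumes V: "\<And>l j. l < L \<Longrightarrow> j \<in> J \<Longrightarrow> V (Suc l) j = sweep (V l) j + \<tau> *\<^sub>R g l j"
    and F: "total (V 0) \<le> F" "\<And>l. l < L \<Longrightarrow> total (g l) \<le> F" and l: "l \<le> L"
  shows "total (V l) \<le> 9 * K\<^sup>2 * F"
proof -
  have F0: "0 \<le> F" using F(1) total_nonneg[of "V 0"] by linarith
  have "total (V l) \<le> 3 * (total (V 0) + T * (T + \<tau>) * F)"
    by (rule total_growth[where V = V and g = g, OF V F(2) T(3) l F0])
  \<comment> \<open>Since \<open>T \<le> K\<close> and \<open>\<tau> \<le> 1 \<le> K\<close>, the
    factor is at most \<open>3 * (K\<^sup>2 + 2 * K\<^sup>2)\<close>.\<close>
  also have "\<dots> \<le> 3 * (K\<^sup>2 * F + K * (K + K) * F)"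
  proof (intro mult_left_mono add_mono mult_right_mono mult_mono)
    have "1 \<le> K\<^sup>2" using K by (intro one_le_power)
    then have "1 * F \<le> K\<^sup>2 * F" using F0 by (rule mult_right_mono)
    then show "total (V 0) \<le> K\<^sup>2 * F" using F(1) by linarith
  qed (use T K F0 \<tau>_le \<tau> in auto)
  also have "\<dots> = 9 * K\<^sup>2 * F" by (simp add: power2_eq_square algebra_simps)
  finally show ?thesis .
qed

lemma total_le_K: "(\<And>j. j \<in> J \<Longrightarrow> norm (V j) \<le> v) \<Longrightarrow> total V \<le> K * v\<^sup>2 * 2 ^ (N * CARD('m))"
  using total_le[OF _ R(1)] K by simp

lemma total_U: "l \<le> L \<Longrightarrow> total (U l) \<le> 9 * K ^ 5 * 2 ^ (N * CARD('m))"
proof -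
  assume l: "l \<le> L"
  have "total (U l) \<le> 9 * K\<^sup>2 * (K * K\<^sup>2 * 2 ^ (N * CARD('m)))"
  proof (rule growth_le[where V = U and g = "\<lambda>l j. G (real l * \<tau>, grid_point N j)", OF USuc _ _ l])
    show "total (U 0) \<le> K * K\<^sup>2 * 2 ^ (N * CARD('m))"
      by (rule total_le_K) (use U0 p_le point_range[of 0] in auto)
    show "total (\<lambda>j. G (real l * \<tau>, grid_point N j)) \<le> K * K\<^sup>2 * 2 ^ (N * CARD('m))" if "l < L" for l
      by (rule total_le_K) (use G_le point_range[of l] that in auto)
  qed
  then show ?thesis by (simp add: power_numeral_reduce power2_eq_square mult.assoc)
qed

lemma total_err: "l \<le> L \<Longrightarrow> total (err l) \<le> 20 * K ^ 5 * 2 ^ (N * CARD('m))"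
proof -
  assume l: "l \<le> L"
  have "total (err l) \<le> 2 * total (\<lambda>j. p (real l * \<tau>, grid_point N j)) + 2 * total (U l)"
    unfolding err_def by (rule total_diff_le)
  also have "\<dots> \<le> 2 * (K * K\<^sup>2 * 2 ^ (N * CARD('m))) + 2 * (9 * K ^ 5 * 2 ^ (N * CARD('m)))"
    by (intro add_mono mult_left_mono total_U l total_le_K) (use p_le point_range[OF l] in auto)
  also have "\<dots> \<le> 2 * (K ^ 5 * 2 ^ (N * CARD('m))) + 2 * (9 * K ^ 5 * 2 ^ (N * CARD('m)))"
  proof -
    have "K * K\<^sup>2 = K ^ 3" by (simp add: power_numeral_reduce)
    also have "\<dots> \<le> K ^ 5" using K by (intro power_increasing) auto
    finally show ?thesis by (intro add_right_mono mult_left_mono mult_right_mono) auto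
  qed
  finally show ?thesis by simp
qed

lemma cone_subset: "z \<in> cone \<Longrightarrow> fst z \<le> T \<Longrightarrow> z \<in> {0..T} \<times> unit_cube"
proof -
  assume z: "z \<in> cone" "fst z \<le> T"
  obtain t x where tx: "z = (t, x)" by (cases z)
  have t: "0 \<le> t" "\<And>i. x $ i - mx i * t \<ge> 0 \<and> x $ i - 1 - mn i * t \<le> 0"
    using z by (auto simp: tx cone_def)
  have "0 \<le> mx i * t" "mn i * t \<le> 0" for i
    using t(1) mx(2) mn(2) by (auto intro: mult_nonpos_nonneg)
  then have "0 \<le> x $ i \<and> x $ i \<le> 1" for i using t(2)[of i] by (smt (verit))
  then show ?thesis using z t by (simp add: tx unit_cube_def)
qed

text \<open>The first derivatives of \<open>p\<close> oscillate by at most \<open>K * h\<close> over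
  one cell, which makes the residual of order \<open>h\<close>; the initial error is zero on the
  grid. The weighted growth estimate then leaves order \<open>h\<close> per cell.\<close>

lemma inner_error:
  assumes \<rho>: "3 * (real CARD('m) + 1)\<^sup>2 * K ^ 3 * h \<le> 1" and l: "l \<le> L"
  shows "(\<Sum>j\<in>J. weight (real l * \<tau>) j * energy A (err l j)) \<le> 166 * (real CARD('m) + 1)\<^sup>2 * K ^ 9 * h * 2 ^ (N * CARD('m))"
proof -
  \<comment> \<open>The residual energy will be at most
    \<open>6 (m + 1) ^ 3 K ^ 5 h\<^sup>2\<close>, where \<open>m\<close> is the dimension; this lies
    below the square of the value chosen here.\<close>
  define \<rho>' where "\<rho>' = 3 * (real CARD('m) + 1)\<^sup>2 * K ^ 3 * h"
  have r0: "0 < \<rho>'" using K h by (simp add: \<rho>'_def)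
  define E where "E = 20 * K ^ 5"
  have "(\<Sum>j\<in>J. weight (real l * \<tau>) j * energy A (err l j)) \<le>
     (\<Sum>j\<in>J. weight 0 j * energy A (err 0 j)) + real l * \<tau> * (5 * (1 / 2 ^ N) * b * E + \<rho>' * E + 2 * \<rho>') * 2 ^ (N * CARD('m))"
  proof (rule weighted_growth[OF _ _ r0 _ \<tau>_le l])
    show "\<rho>' \<le> 1" using \<rho> by (simp add: \<rho>'_def)
    show "total (err l) \<le> E * 2 ^ (N * CARD('m))" if "l < L" for l
      using total_err[of l] that by (simp add: E_def)
    fix k j assume k: "k < L" and j: "j \<in> J" and wp: "0 < weight (real (Suc k) * \<tau>) j"
    define t' where "t' = real k * \<tau>"
    have t': "0 \<le> t'" "real (Suc k) * \<tau> = t' + \<tau>" using \<tau> by (auto simp: t'_def algebra_simps)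
    have tT: "t' \<le> T" "t' + \<tau> \<le> T"
      using time_range[of k] time_range[of "Suc k"] k unfolding t'(2) by (auto simp: t'_def)
    note pts = weight_pos_points[OF j t'(1) wp[unfolded t'(2)]]
    define z where "z = (t', grid_point N j)"
    have Z: "(t' + \<tau>, grid_point N j) \<in> {0..T} \<times> unit_cube" "(t', grid_point N j) \<in> {0..T} \<times> unit_cube"
        "(t', grid_point N j + axis i (1 / 2 ^ N)) \<in> {0..T} \<times> unit_cube"
        "(t', grid_point N j - axis i (1 / 2 ^ N)) \<in> {0..T} \<times> unit_cube" for i
      using cone_subset[OF pts(1)] cone_subset[OF pts(2)] cone_subset[OF pts(3)] cone_subset[OF pts(4)] tT
      by (simp_all only: fst_conv)
    define g where "g j = p (t', grid_point N j)" for j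
    obtain r where r: "p (t' + \<tau>, grid_point N j) = sweep g j + \<tau> *\<^sub>R (r + matrix_inv A *v (A *v G z))"
      "energy A r \<le> (1 + b) * (1 + 2 * real CARD('m) * b) * K * ((real CARD('m) + 1) * (K * h))\<^sup>2"
    proof (rule residual[where Z = "{0..T} \<times> unit_cube" and u = p and ut = pt and ux = px and t = t'
          and x = "grid_point N j" and g = g and F = "A *v G z" and j = j and R = K and \<epsilon> = "K * h"])
      show "convex ({0..T} \<times> (unit_cube :: (real ^ 'm) set))" by (intro convex_Times convex_unit_cube) simp
      fix y y' :: "real \<times> (real ^ 'm)" and i
      assume y: "y \<in> {0..T} \<times> unit_cube" "y' \<in> {0..T} \<times> unit_cube" "norm (y' - y) \<le> 1 / 2 ^ N"
      have le: "K * norm (y' - y) \<le> K * h" using y(3) K by (intro mult_left_mono) (auto simp: h_def)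
      show "norm (pt y' - pt y) \<le> K * h" using pt_lip[OF y(2,1)] le by linarith
      show "norm (px i y' - px i y) \<le> K * h" using px_lip[OF y(2,1)] le by (meson order_trans)
    next
      show "A *v pt (t', grid_point N j) + (\<Sum>i\<in>UNIV. (P i - Q i) *v px i (t', grid_point N j)) = A *v G z"
        unfolding z_def by (rule pde[OF Z(2)])
    qed (use dp Z \<tau>h R K pts(5,6) in \<open>auto simp: g_def simp del: mem_Sigma_iff\<close>)
    have eq: "err (Suc k) j = sweep (err k) j + \<tau> *\<^sub>R r"
    proof -
      have "err (Suc k) j = p (t' + \<tau>, grid_point N j) - U (Suc k) j" by (simp only: err_def t'(2))
      also have "\<dots> = (sweep g j + \<tau> *\<^sub>R (r + G z)) - (sweep (U k) j + \<tau> *\<^sub>R G z)"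
        unfolding r(1) unfolding USuc[OF k j] z_def t'_def
        by (simp add: matrix_inv_vector(2)[OF positive_definite_invertible[OF A]])
      also have "\<dots> = sweep (\<lambda>j. g j - U k j) j + \<tau> *\<^sub>R r"
        by (simp add: sweep_diff scaleR_add_right)
      also have "(\<lambda>j. g j - U k j) = err k" by (simp add: err_def[abs_def] g_def t'_def)
      finally show ?thesis .
    qed
    have "energy A r \<le> (2 * K) * (3 * (real CARD('m) + 1) * K) * K * ((real CARD('m) + 1) * (K * h))\<^sup>2"
    proof (rule order_trans[OF r(2)], intro mult_right_mono mult_mono)
      show "1 + b \<le> 2 * K" using bK K by simp
      have "1 * 1 \<le> (real CARD('m) + 1) * K" using K by (intro mult_mono) auto
      then have "1 + 2 * real CARD('m) * b \<le> (real CARD('m) + 1) * K + 2 * real CARD('m) * K"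
        using bK by (intro add_mono mult_left_mono) auto
      also have "\<dots> \<le> 3 * (real CARD('m) + 1) * K" using K by (simp add: algebra_simps)
      finally show "1 + 2 * real CARD('m) * b \<le> 3 * (real CARD('m) + 1) * K" .
    qed (use K b in auto)
    also have "\<dots> = 6 * ((real CARD('m) + 1) ^ 3 * (K ^ 5 * h\<^sup>2))"
      by (simp add: power_mult_distrib power_numeral_reduce mult_ac)
    also have "\<dots> \<le> 9 * ((real CARD('m) + 1) ^ 4 * (K ^ 6 * h\<^sup>2))"
      using K h by (intro order_refl mult_mono power_increasing) auto
    also have "\<dots> = \<rho>'\<^sup>2"
      by (simp add: \<rho>'_def power_mult_distrib power_mult[symmetric])
    finally show "\<exists>r. err (Suc k) j = sweep (err k) j + \<tau> *\<^sub>R r \<and> energy A r \<le> \<rho>'\<^sup>2"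
      using eq by blast
  qed
  also have "(\<Sum>j\<in>J. weight 0 j * energy A (err 0 j)) = 0"
    by (rule sum.neutral) (simp add: err_def U0)
  also have "0 + real l * \<tau> * (5 * (1 / 2 ^ N) * b * E + \<rho>' * E + 2 * \<rho>') * 2 ^ (N * CARD('m)) \<le>
      K * (5 * h * K * E + \<rho>' * E + \<rho>' * (2 * K ^ 5)) * 2 ^ (N * CARD('m))"
  proof -
    have lK: "real l * \<tau> \<le> K" using time_range[OF l] T(2) by auto
    have 1: "5 * (1 / 2 ^ N) * b * E \<le> 5 * h * K * E"
      unfolding h_def[symmetric] using bK h K by (intro mult_right_mono mult_left_mono) (auto simp: E_def)
    have 2: "2 * \<rho>' \<le> \<rho>' * (2 * K ^ 5)" using r0 one_le_power[OF K, of 5] by simp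
    have "0 \<le> 5 * (1 / 2 ^ N) * b * E + \<rho>' * E + 2 * \<rho>'"
      using b K r0 by (simp add: E_def)
    then have "real l * \<tau> * (5 * (1 / 2 ^ N) * b * E + \<rho>' * E + 2 * \<rho>') \<le>
        K * (5 * h * K * E + \<rho>' * E + \<rho>' * (2 * K ^ 5))"
      by (rule mult_mono[OF lK add_mono[OF add_mono[OF 1 order_refl] 2], rotated]) (use K in simp)
    then show ?thesis unfolding add_0 by (rule mult_right_mono) simp
  qed
  also have "\<dots> = (100 * (K ^ 7 * h) + 66 * ((real CARD('m) + 1)\<^sup>2 * (K ^ 9 * h))) * 2 ^ (N * CARD('m))"
    by (simp add: E_def \<rho>'_def power_numeral_reduce algebra_simps)
  also have "\<dots> \<le> (100 * ((real CARD('m) + 1)\<^sup>2 * (K ^ 9 * h)) + 66 * ((real CARD('m) + 1)\<^sup>2 * (K ^ 9 * h))) *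
      2 ^ (N * CARD('m))"
  proof (intro mult_right_mono add_mono mult_left_mono order_refl)
    have "1 * (K ^ 7 * h) \<le> (real CARD('m) + 1)\<^sup>2 * (K ^ 9 * h)"
      using K h by (intro order_refl mult_mono power_increasing one_le_power) auto
    then show "K ^ 7 * h \<le> (real CARD('m) + 1)\<^sup>2 * (K ^ 9 * h)" by simp
  qed (use K h in auto)
  also have "\<dots> = 166 * (real CARD('m) + 1)\<^sup>2 * K ^ 9 * h * 2 ^ (N * CARD('m))" by (simp add: algebra_simps)
  finally show ?thesis .
qed

lemma sum_norm_le_total: "(\<Sum>j\<in>J. (norm (V j))\<^sup>2) \<le> K * total V"
  unfolding total_def sum_distrib_left by (intro sum_mono R(2))

text \<open>The margin \<open>4 * h\<close> accounts for all grid points seen by the interpolation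
  at a point of \<open>H\<close>: they are up to \<open>2 * h\<close> away in each coordinate,
  \<open>low\<close> is shifted by \<open>h\<close>, and a face moves by at most \<open>h\<close>
  during one time step.\<close>

definition layer_low :: "nat \<Rightarrow> real \<Rightarrow> 'm \<Rightarrow> ('m \<Rightarrow> int) set" where
  "layer_low l \<eta> i = {j \<in> J. - 4 * h \<le> low i (real l * \<tau>) j \<and> low i (real l * \<tau>) j \<le> \<eta>}"

definition layer_high :: "nat \<Rightarrow> real \<Rightarrow> 'm \<Rightarrow> ('m \<Rightarrow> int) set" where
  "layer_high l \<eta> i = {j \<in> J. - 4 * h \<le> high i (real l * \<tau>) j \<and> high i (real l * \<tau>) j \<le> \<eta>}"

text \<open>A slab of thickness \<open>\<eta> + 4 * h\<close> meets one layer more than its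
  thickness suggests, and \<open>\<eta> + 5 * h \<le> 6 * \<eta>\<close>.\<close>

lemma layer_sum_le:
  assumes f: "\<And>j. 0 \<le> f j" and \<eta>: "h \<le> \<eta>" "0 \<le> X"
    and X: "\<And>k. k \<in> {1..2 ^ N} \<Longrightarrow> 2 ^ N * (\<Sum>j\<in>{j \<in> J. j i = k}. f j) \<le> X"
  shows "(\<Sum>j\<in>layer_low l \<eta> i. f j) \<le> 6 * \<eta> * X" "(\<Sum>j\<in>layer_high l \<eta> i. f j) \<le> 6 * \<eta> * X"
proof -
  have M: "(0 :: real) < 2 ^ N" by simp
  have Y: "(\<Sum>j\<in>{j \<in> J. j i = k}. f j) \<le> h * X" if "k \<in> {1..2 ^ N}" for k
    using X[OF that] by (simp add: h_def field_simps)
  have q: "((\<eta> + 4 * h) * 2 ^ N + 1) * (h * X) \<le> 6 * \<eta> * X"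
  proof -
    have "((\<eta> + 4 * h) * 2 ^ N + 1) * (h * X) = ((\<eta> + 4 * h) * (2 ^ N * h) + h) * X"
      by (simp add: algebra_simps)
    also have "\<dots> = (\<eta> + 5 * h) * X" unfolding h(3) by simp
    also have "\<dots> \<le> 6 * \<eta> * X" using \<eta> by (intro mult_right_mono) auto
    finally show ?thesis .
  qed
  have hX: "0 \<le> h * X" using h \<eta> by simp
  define a where "a = h + mx i * (real l * \<tau>) - 4 * h"
  have "layer_low l \<eta> i = {j \<in> J. a \<le> grid_point N j $ i \<and> grid_point N j $ i \<le> a + (\<eta> + 4 * h)}"
    by (auto simp: layer_low_def low_def a_def h_def[symmetric])
  moreover have "(\<Sum>j\<in>{j \<in> J. a \<le> grid_point N j $ i \<and> grid_point N j $ i \<le> a + (\<eta> + 4 * h)}. f j) \<le>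
      ((a + (\<eta> + 4 * h) - a) * 2 ^ N + 1) * (h * X)"
    by (rule slab_sum_le[OF f Y hX]) (use \<eta> h in auto)
  ultimately show "(\<Sum>j\<in>layer_low l \<eta> i. f j) \<le> 6 * \<eta> * X" using q by simp
  define c where "c = 1 - h + mn i * (real l * \<tau>) - \<eta>"
  have "layer_high l \<eta> i = {j \<in> J. c \<le> grid_point N j $ i \<and> grid_point N j $ i \<le> c + (\<eta> + 4 * h)}"
    by (auto simp: layer_high_def high_def c_def h_def[symmetric])
  moreover have "(\<Sum>j\<in>{j \<in> J. c \<le> grid_point N j $ i \<and> grid_point N j $ i \<le> c + (\<eta> + 4 * h)}. f j) \<le>
      ((c + (\<eta> + 4 * h) - c) * 2 ^ N + 1) * (h * X)"
    by (rule slab_sum_le[OF f Y hX]) (use \<eta> h in auto)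
  ultimately show "(\<Sum>j\<in>layer_high l \<eta> i. f j) \<le> 6 * \<eta> * X" using q by simp
qed

text \<open>
  Cut off data are compatible with the periodic continuation, so that the differences of the values of
  the scheme stay small.
\<close>

definition trunc :: "real \<Rightarrow> nat \<Rightarrow> ('m \<Rightarrow> int) \<Rightarrow> real ^ 'n" where
  "trunc d = evolve (\<lambda>j. grid_cutoff N d j *\<^sub>R p (0, grid_point N j))
     (\<lambda>l j. grid_cutoff N d j *\<^sub>R G (real l * \<tau>, grid_point N j))"

lemma trunc_simps:
  "trunc d 0 j = grid_cutoff N d j *\<^sub>R p (0, grid_point N j)"
  "trunc d (Suc l) j = sweep (trunc d l) j + \<tau> *\<^sub>R (grid_cutoff N d j *\<^sub>R G (real l * \<tau>, grid_point N j))"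
  by (simp_all add: trunc_def)

text \<open>The cutoff changes the data only in two slabs of thickness \<open>2 * d\<close> for each
  coordinate, each with at most the share \<open>3 * d\<close> of all cells. As the scheme does not
  increase energy, the smallness of this change persists in time.\<close>

lemma trunc_error:
  assumes d: "0 < d" "d \<le> 1 / 4" "h \<le> d" and l: "l \<le> L"
  shows "total (\<lambda>j. U l j - trunc d l j) \<le> 54 * real CARD('m) * K ^ 5 * d * 2 ^ (N * CARD('m))"
proof -
  define S where "S = {j \<in> J. grid_cutoff N d j \<noteq> 1}"
  have cardS: "real (card S) \<le> real CARD('m) * (6 * d * 2 ^ (N * CARD('m)))"
  proof -
    have slab: "(\<Sum>j\<in>{j \<in> J. a \<le> grid_point N j $ i \<and> grid_point N j $ i \<le> a + 2 * d}. (1 :: real)) \<le>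
        3 * d * 2 ^ (N * CARD('m))" for a i
    proof -
      have "(\<Sum>j\<in>{j \<in> J. a \<le> grid_point N j $ i \<and> grid_point N j $ i \<le> a + 2 * d}. (1 :: real)) \<le>
          ((a + 2 * d - a) * 2 ^ N + 1) * (1 * 2 ^ (N * CARD('m)) / 2 ^ N)"
        by (rule slab_sum_le) (use d in \<open>auto simp only: layer_const\<close>, simp_all)
      also have "\<dots> = (2 * d * 2 ^ N + 1) * (2 ^ (N * CARD('m)) * h)" by (simp add: h_def)
      also have "\<dots> = (2 * d * (2 ^ N * h) + h) * 2 ^ (N * CARD('m))" by (simp add: algebra_simps)
      also have "\<dots> \<le> 3 * d * 2 ^ (N * CARD('m))" unfolding h(3) using d by (intro mult_right_mono) auto
      finally show ?thesis .
    qed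
    define W where "W i a = {j \<in> J. a \<le> grid_point N j $ i \<and> grid_point N j $ i \<le> a + 2 * d}" for i a
    have "S \<subseteq> (\<Union>i. W i 0 \<union> W i (1 - 2 * d))"
    proof (rule ccontr)
      assume "\<not> S \<subseteq> (\<Union>i. W i 0 \<union> W i (1 - 2 * d))"
      then obtain j where j: "j \<in> S" "\<And>i. j \<notin> W i 0" "\<And>i. j \<notin> W i (1 - 2 * d)" by blast
      have jJ: "j \<in> J" using j(1) by (simp add: S_def)
      have "0 \<le> grid_point N j $ i" "grid_point N j $ i \<le> 1" for i
        using grid_point_unit_cube[OF jJ] by (auto simp: unit_cube_def)
      then have "cutoff d (grid_point N j $ i) = 1" for i
        using j(2)[of i] j(3)[of i] jJ d by (intro cutoff_eq_1) (auto simp: W_def)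
      then show False using j(1) by (simp add: S_def grid_cutoff_def)
    qed
    then have "card S \<le> card (\<Union>i. W i 0 \<union> W i (1 - 2 * d))" by (intro card_mono) (auto simp: W_def)
    also have "\<dots> \<le> (\<Sum>i\<in>UNIV. card (W i 0 \<union> W i (1 - 2 * d)))" by (intro card_UN_le) auto
    also have "\<dots> \<le> (\<Sum>i\<in>UNIV. card (W i 0) + card (W i (1 - 2 * d)))" by (intro sum_mono card_Un_le)
    finally have "real (card S) \<le> real (\<Sum>i\<in>UNIV. card (W i 0) + card (W i (1 - 2 * d)))" by (rule of_nat_mono)
    also have "\<dots> = (\<Sum>i\<in>UNIV. real (card (W i 0)) + real (card (W i (1 - 2 * d))))" by simp
    also have "\<dots> \<le> (\<Sum>i\<in>(UNIV :: 'm set). 3 * d * 2 ^ (N * CARD('m)) + 3 * d * 2 ^ (N * CARD('m)))"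
      using slab[of 0] slab[of "1 - 2 * d"] by (intro sum_mono add_mono) (simp_all add: W_def)
    finally show ?thesis by simp
  qed
  have tot: "total (\<lambda>j. y j - grid_cutoff N d j *\<^sub>R y j) \<le> 6 * real CARD('m) * K ^ 3 * d * 2 ^ (N * CARD('m))"
    if y: "\<And>j. j \<in> J \<Longrightarrow> norm (y j) \<le> K" for y :: "('m \<Rightarrow> int) \<Rightarrow> real ^ 'n"
  proof -
    have "total (\<lambda>j. y j - grid_cutoff N d j *\<^sub>R y j) = (\<Sum>j\<in>S. energy A (y j - grid_cutoff N d j *\<^sub>R y j))"
      unfolding total_def by (rule sum.mono_neutral_right) (auto simp: S_def)
    also have "\<dots> \<le> (\<Sum>j\<in>S. K ^ 3)"
    proof (rule sum_mono)
      fix j assume j: "j \<in> S"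
      then have jJ: "j \<in> J" by (simp add: S_def)
      have "y j - grid_cutoff N d j *\<^sub>R y j = (1 - grid_cutoff N d j) *\<^sub>R y j" by (simp add: algebra_simps)
      then have "norm (y j - grid_cutoff N d j *\<^sub>R y j) = (1 - grid_cutoff N d j) * norm (y j)"
        using grid_cutoff_bounds[OF jJ d(1)] by simp
      also have "\<dots> \<le> 1 * K" using grid_cutoff_bounds[OF jJ d(1)] y[OF jJ] by (intro mult_mono) auto
      finally have "(norm (y j - grid_cutoff N d j *\<^sub>R y j))\<^sup>2 \<le> K\<^sup>2" by (intro power_mono) auto
      then have "K * (norm (y j - grid_cutoff N d j *\<^sub>R y j))\<^sup>2 \<le> K * K\<^sup>2" using K by (intro mult_left_mono) auto
      then show "energy A (y j - grid_cutoff N d j *\<^sub>R y j) \<le> K ^ 3"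
        using R(1)[of "y j - grid_cutoff N d j *\<^sub>R y j"] by (simp add: power_numeral_reduce)
    qed
    also have "\<dots> = real (card S) * K ^ 3" by simp
    also have "\<dots> \<le> real CARD('m) * (6 * d * 2 ^ (N * CARD('m))) * K ^ 3" using cardS K by (intro mult_right_mono) auto
    finally show ?thesis by (simp add: mult_ac)
  qed
  have "total (\<lambda>j. U l j - trunc d l j) \<le> 9 * K\<^sup>2 * (6 * real CARD('m) * K ^ 3 * d * 2 ^ (N * CARD('m)))"
  proof (rule growth_le[where V = "\<lambda>l j. U l j - trunc d l j"
        and g = "\<lambda>l j. G (real l * \<tau>, grid_point N j) - grid_cutoff N d j *\<^sub>R G (real l * \<tau>, grid_point N j)"])
    show "U (Suc l) j - trunc d (Suc l) j = sweep (\<lambda>j. U l j - trunc d l j) j +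
        \<tau> *\<^sub>R (G (real l * \<tau>, grid_point N j) - grid_cutoff N d j *\<^sub>R G (real l * \<tau>, grid_point N j))"
      if "l < L" "j \<in> J" for l j
      by (simp add: USuc[OF that] trunc_simps sweep_diff algebra_simps)
    have "total (\<lambda>j. U 0 j - trunc d 0 j) = total (\<lambda>j. p (0, grid_point N j) - grid_cutoff N d j *\<^sub>R p (0, grid_point N j))"
      by (rule total_cong) (simp add: U0 trunc_simps)
    also have "\<dots> \<le> 6 * real CARD('m) * K ^ 3 * d * 2 ^ (N * CARD('m))"
      by (rule tot) (use p_le point_range[of 0] in auto)
    finally show "total (\<lambda>j. U 0 j - trunc d 0 j) \<le> 6 * real CARD('m) * K ^ 3 * d * 2 ^ (N * CARD('m))" .
    show "total (\<lambda>j. G (real l * \<tau>, grid_point N j) - grid_cutoff N d j *\<^sub>R G (real l * \<tau>, grid_point N j)) \<le>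
        6 * real CARD('m) * K ^ 3 * d * 2 ^ (N * CARD('m))"
      if "l < L" for l
      by (rule tot) (use G_le point_range[of l] that in auto)
  qed (rule l)
  then show ?thesis by (simp add: power_numeral_reduce mult_ac)
qed

lemma trunc_total:
  assumes d: "0 < d" "d \<le> 1" and l: "l \<le> L"
  shows "total (trunc d l) \<le> 9 * K ^ 5 * 2 ^ (N * CARD('m))"
proof -
  have le: "norm (grid_cutoff N d j *\<^sub>R y) \<le> K" if "j \<in> J" "norm y \<le> K" for j and y :: "real ^ 'n"
    using grid_cutoff_bounds[OF that(1) d(1)] mult_mono[of "grid_cutoff N d j" 1 "norm y" K] that(2) by simp
  have "total (trunc d l) \<le> 9 * K\<^sup>2 * (K * K\<^sup>2 * 2 ^ (N * CARD('m)))"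
  proof (rule growth_le[where V = "trunc d" and g = "\<lambda>l j. grid_cutoff N d j *\<^sub>R G (real l * \<tau>, grid_point N j)", OF _ _ _ l])
    show "trunc d (Suc l) j = sweep (trunc d l) j + \<tau> *\<^sub>R (grid_cutoff N d j *\<^sub>R G (real l * \<tau>, grid_point N j))" for l j
      by (rule trunc_simps(2))
    show "total (trunc d 0) \<le> K * K\<^sup>2 * 2 ^ (N * CARD('m))"
      by (rule total_le_K) (use le p_le point_range[of 0] in \<open>auto simp: trunc_simps\<close>)
    show "total (\<lambda>j. grid_cutoff N d j *\<^sub>R G (real l * \<tau>, grid_point N j)) \<le>
        K * K\<^sup>2 * 2 ^ (N * CARD('m))" if "l < L" for l
      by (rule total_le_K) (use le G_le point_range[of l] that in auto)
  qed
  then show ?thesis by (simp add: power_numeral_reduce mult.assoc)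
qed

lemma norm_Pair_same: "norm ((t, x) - (t, x')) = norm (x - x')" for t :: real and x x' :: "real ^ 'm"
  by (simp add: norm_Pair)

text \<open>The differences satisfy the scheme themselves, and the differences of cut off data are
  at most \<open>2 * K * h / d\<close>, also across the periodic faces.\<close>

lemma trunc_difference:
  assumes d: "0 < d" "d \<le> 1" and l: "l \<le> L"
  shows "total (\<lambda>j. trunc d l (up N i j) - trunc d l j) \<le> 36 * K ^ 5 * (h / d)\<^sup>2 * 2 ^ (N * CARD('m))"
proof -
  let ?s = "\<lambda>l j. grid_cutoff N d j *\<^sub>R G (real l * \<tau>, grid_point N j)"
  have "total (\<lambda>j. trunc d l (up N i j) - trunc d l j) \<le> 9 * K\<^sup>2 * (K * (2 * K * h / d)\<^sup>2 * 2 ^ (N * CARD('m)))"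
  proof (rule growth_le[where V = "\<lambda>l j. trunc d l (up N i j) - trunc d l j" and g = "\<lambda>l j. ?s l (up N i j) - ?s l j"])
    show "trunc d (Suc l) (up N i j) - trunc d (Suc l) j =
        sweep (\<lambda>j. trunc d l (up N i j) - trunc d l j) j + \<tau> *\<^sub>R (?s l (up N i j) - ?s l j)"
      if "l < L" "j \<in> J" for l j
      unfolding sweep_diff sweep_up[OF that(2)] trunc_simps by (simp add: algebra_simps)
    show "total (\<lambda>j. trunc d 0 (up N i j) - trunc d 0 j) \<le> K * (2 * K * h / d)\<^sup>2 * 2 ^ (N * CARD('m))"
    proof (rule total_le_K)
      fix j assume j: "j \<in> J"
      have "norm (grid_cutoff N d (up N i j) *\<^sub>R p (0, grid_point N (up N i j)) - grid_cutoff N d j *\<^sub>R p (0, grid_point N j))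
          \<le> 2 * K * (1 / 2 ^ N) / d"
        using p_le p_lip T K d
        by (intro cutoff_difference[OF j d, where y = "\<lambda>x. p (0, x)"])
          (auto simp del: diff_Pair simp: norm_Pair_same[symmetric, of _ _ 0])
      then show "norm (trunc d 0 (up N i j) - trunc d 0 j) \<le> 2 * K * h / d"
        by (simp add: trunc_simps h_def)
    qed
    show "total (\<lambda>j. ?s l (up N i j) - ?s l j) \<le> K * (2 * K * h / d)\<^sup>2 * 2 ^ (N * CARD('m))" if "l < L" for l
    proof (rule total_le_K)
      fix j assume j: "j \<in> J"
      have t: "0 \<le> real l * \<tau>" "real l * \<tau> \<le> T" using time_range[of l] that by auto
      have "norm (?s l (up N i j) - ?s l j) \<le> 2 * K * (1 / 2 ^ N) / d"
        using G_le G_lip t K d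
        by (intro cutoff_difference[OF j d, where y = "\<lambda>x. G (real l * \<tau>, x)"])
          (auto simp del: diff_Pair simp: norm_Pair_same[symmetric, of _ _ "real l * \<tau>"])
      then show "norm (?s l (up N i j) - ?s l j) \<le> 2 * K * h / d" by (simp add: h_def)
    qed
  qed (rule l)
  then show ?thesis by (simp add: power_numeral_reduce power_divide power_mult_distrib mult_ac)
qed


definition nearby :: "nat \<Rightarrow> ('m \<Rightarrow> int) set" where
  "nearby l = {j \<in> J. \<forall>i. - 4 * h \<le> low i (real l * \<tau>) j \<and> - 4 * h \<le> high i (real l * \<tau>) j}"

text \<open>The interior uses the weighted estimate divided by the least weight there. In the layers
  the error need not be small at a point; smallness comes from their thickness and from the mean
  square distance to the cut off scheme.\<close>

lemma grid_error:
  assumes d: "0 < d" "d \<le> 1 / 4" "h \<le> d ^ 3" "h \<le> d ^ (12 * CARD('m)) * d"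
    and \<rho>: "3 * (real CARD('m) + 1)\<^sup>2 * K ^ 3 * h \<le> 1" and l: "l \<le> L"
  shows "(\<Sum>j\<in>nearby l. (norm (err l j))\<^sup>2) \<le> 4000 * (real CARD('m) + 1)\<^sup>2 * K ^ 10 * d * 2 ^ (N * CARD('m))"
proof -
  \<comment> \<open>The trace inequality costs \<open>1 / d\<^sup>2\<close> per layer, so thickness
    \<open>d ^ 3\<close> leaves a factor \<open>d\<close>.\<close>
  define \<eta> where "\<eta> = d ^ 3"
  have d1: "d \<le> 1" using d by simp
  have \<eta>: "0 < \<eta>" "h \<le> \<eta>" using d by (auto simp: \<eta>_def)
  have hd: "h \<le> d"
  proof -
    have "d ^ 3 \<le> d ^ 1" using d d1 by (intro power_decreasing) auto
    then show ?thesis using d(3) by simp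
  qed
  define nJ where "nJ = (2 :: real) ^ (N * CARD('m))"
  define f where "f j = (norm (err l j))\<^sup>2" for j
  define inner where "inner = {j \<in> J. \<forall>i. \<eta> < low i (real l * \<tau>) j \<and> \<eta> < high i (real l * \<tau>) j}"
  have cover: "nearby l \<subseteq> inner \<union> (\<Union>i. layer_low l \<eta> i \<union> layer_high l \<eta> i)"
    by (auto simp: nearby_def inner_def layer_low_def layer_high_def not_less)
  have fin: "finite inner" "finite (layer_low l \<eta> i)" "finite (layer_high l \<eta> i)" for i
    by (auto simp: inner_def layer_low_def layer_high_def)
  have "(\<Sum>j\<in>nearby l. f j) \<le> (\<Sum>j\<in>inner \<union> (\<Union>i. layer_low l \<eta> i \<union> layer_high l \<eta> i). f j)"
    using cover fin by (intro sum_mono2) (auto simp: f_def)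
  also have "\<dots> \<le> (\<Sum>j\<in>inner. f j) + (\<Sum>j\<in>(\<Union>i. layer_low l \<eta> i \<union> layer_high l \<eta> i). f j)"
    using fin by (intro sum_Un_le) (auto simp: f_def)
  also have "(\<Sum>j\<in>(\<Union>i. layer_low l \<eta> i \<union> layer_high l \<eta> i). f j) \<le>
      (\<Sum>i\<in>UNIV. \<Sum>j\<in>layer_low l \<eta> i \<union> layer_high l \<eta> i. f j)"
    using fin by (intro sum_UN_le) (auto simp: f_def)
  also have "\<dots> \<le> (\<Sum>i\<in>UNIV. (\<Sum>j\<in>layer_low l \<eta> i. f j) + (\<Sum>j\<in>layer_high l \<eta> i. f j))"
    using fin by (intro sum_mono sum_Un_le) (auto simp: f_def)
  finally have split: "(\<Sum>j\<in>nearby l. f j) \<le> (\<Sum>j\<in>inner. f j) +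
      (\<Sum>i\<in>UNIV. (\<Sum>j\<in>layer_low l \<eta> i. f j) + (\<Sum>j\<in>layer_high l \<eta> i. f j))" by simp
  have inner_le: "(\<Sum>j\<in>inner. f j) \<le> 166 * (real CARD('m) + 1)\<^sup>2 * K ^ 10 * d * nJ"
  proof -
    \<comment> \<open>The least weight in the interior: two factors of at least
      \<open>\<eta>\<^sup>2 = d ^ 6\<close> for each coordinate. The fourth assumption makes
      \<open>h / q\<close> at most \<open>d\<close>.\<close>
    define q where "q = d ^ (12 * CARD('m))"
    have q: "0 < q" using d by (simp add: q_def)
    have w: "q \<le> weight (real l * \<tau>) j" if j: "j \<in> inner" for j
    proof -
      have "\<eta>\<^sup>2 \<le> relu_sq (low i (real l * \<tau>) j)" "\<eta>\<^sup>2 \<le> relu_sq (high i (real l * \<tau>) j)" for i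
        unfolding relu_sq_def using j \<eta>(1) by (intro power_mono; auto simp: inner_def less_imp_le le_max_iff_disj)+
      then have "(\<Prod>i\<in>(UNIV :: 'm set). \<eta>\<^sup>2 * \<eta>\<^sup>2) \<le> weight (real l * \<tau>) j"
        unfolding weight_def by (intro prod_mono conjI mult_mono) auto
      moreover have "(\<Prod>i\<in>(UNIV :: 'm set). \<eta>\<^sup>2 * \<eta>\<^sup>2) = q"
        by (simp add: q_def \<eta>_def power_mult[symmetric] power_add[symmetric] mult.commute)
      ultimately show ?thesis by simp
    qed
    have "q * (\<Sum>j\<in>inner. f j) \<le> (\<Sum>j\<in>inner. K * (weight (real l * \<tau>) j * energy A (err l j)))"
      unfolding sum_distrib_left
    proof (rule sum_mono)
      fix j assume j: "j \<in> inner"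
      have "q * f j \<le> q * (K * energy A (err l j))" using R(2) q by (intro mult_left_mono) (auto simp: f_def)
      also have "\<dots> \<le> weight (real l * \<tau>) j * (K * energy A (err l j))"
        using w[OF j] K by (intro mult_right_mono) auto
      finally show "q * f j \<le> K * (weight (real l * \<tau>) j * energy A (err l j))" by (simp add: mult_ac)
    qed
    also have "\<dots> \<le> (\<Sum>j\<in>J. K * (weight (real l * \<tau>) j * energy A (err l j)))"
      using K by (intro sum_mono2) (auto simp: inner_def)
    also have "\<dots> \<le> K * (166 * (real CARD('m) + 1)\<^sup>2 * K ^ 9 * h * nJ)"
      unfolding sum_distrib_left[symmetric] nJ_def using K by (intro mult_left_mono inner_error[OF \<rho> l]) auto
    also have "\<dots> = (166 * (real CARD('m) + 1)\<^sup>2 * K ^ 10 * nJ) * h" by (simp add: power_numeral_reduce)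
    also have "\<dots> \<le> (166 * (real CARD('m) + 1)\<^sup>2 * K ^ 10 * nJ) * (q * d)"
      using d(4) K by (intro mult_left_mono) (auto simp: q_def nJ_def)
    finally have "q * (\<Sum>j\<in>inner. f j) \<le> q * (166 * (real CARD('m) + 1)\<^sup>2 * K ^ 10 * d * nJ)"
      by (simp add: mult_ac)
    then show ?thesis using q by (simp only: mult_le_cancel_left_pos)
  qed
  \<comment> \<open>In the trace inequality the factor \<open>(2 ^ N)\<^sup>2\<close> meets squared
    differences of order \<open>(h / d)\<^sup>2\<close>, hence \<open>1 / d\<^sup>2\<close>. The
    constant is \<open>1 + 18 + 72\<close>, from \<open>K\<^sup>2\<close>, the values and the
    differences.\<close>
  define X where "X = 91 * K ^ 6 / d\<^sup>2 * nJ"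
  define g where "g j = K\<^sup>2 + (norm (trunc d l j))\<^sup>2" for j
  have X0: "0 \<le> X" using K by (simp add: X_def nJ_def)
  have gX: "2 ^ N * (\<Sum>j\<in>{j \<in> J. j i = k}. g j) \<le> X" if k: "k \<in> {1..2 ^ N}" for i k
  proof -
    have "2 ^ N * (\<Sum>j\<in>{j \<in> J. j i = k}. g j) = 2 ^ N * (\<Sum>j\<in>{j \<in> J. j i = k}. K\<^sup>2) +
        2 ^ N * (\<Sum>j\<in>{j \<in> J. j i = k}. (norm (trunc d l j))\<^sup>2)"
      unfolding g_def sum.distrib by (rule distrib_left)
    also have "2 ^ N * (\<Sum>j\<in>{j \<in> J. j i = k}. K\<^sup>2) = K\<^sup>2 * nJ"
      unfolding layer_const[OF k] nJ_def by simp
    also have "2 ^ N * (\<Sum>j\<in>{j \<in> J. j i = k}. (norm (trunc d l j))\<^sup>2) \<le>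
        2 * (\<Sum>j\<in>J. (norm (trunc d l j))\<^sup>2) + 2 * (2 ^ N)\<^sup>2 * (\<Sum>j\<in>J. (norm (trunc d l (up N i j) - trunc d l j))\<^sup>2)"
      by (rule sum_layer_le[OF k])
    also have "\<dots> \<le> 2 * (K * (9 * K ^ 5 * nJ)) + 2 * (2 ^ N)\<^sup>2 * (K * (36 * K ^ 5 * (h / d)\<^sup>2 * nJ))"
      unfolding nJ_def
      using K trunc_total[OF d(1) d1 l] trunc_difference[OF d(1) d1 l, of i]
      by (intro add_mono mult_left_mono order_trans[OF sum_norm_le_total]) auto
    also have "\<dots> = 18 * K ^ 6 * nJ + 72 * K ^ 6 / d\<^sup>2 * nJ * ((2 ^ N * h)\<^sup>2)"
      by (simp add: power_numeral_reduce power_mult_distrib power_divide)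
    also have "\<dots> = 18 * K ^ 6 * nJ + 72 * K ^ 6 / d\<^sup>2 * nJ" unfolding h(3) by simp
    finally have le: "2 ^ N * (\<Sum>j\<in>{j \<in> J. j i = k}. g j) \<le> K\<^sup>2 * nJ + (18 * K ^ 6 * nJ + 72 * K ^ 6 / d\<^sup>2 * nJ)"
      by simp
    have "1 \<le> 1 / d\<^sup>2" using d d1 by (simp add: power_le_one)
    then have "K ^ 6 * 1 \<le> K ^ 6 * (1 / d\<^sup>2)" using K by (intro mult_left_mono) auto
    moreover have "K\<^sup>2 \<le> K ^ 6" using K by (intro power_increasing) auto
    ultimately have "K\<^sup>2 + 18 * K ^ 6 + 72 * K ^ 6 / d\<^sup>2 \<le> 91 * K ^ 6 / d\<^sup>2" by simp
    then have "(K\<^sup>2 + 18 * K ^ 6 + 72 * K ^ 6 / d\<^sup>2) * nJ \<le> X"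
      unfolding X_def by (rule mult_right_mono) (simp add: nJ_def)
    then show ?thesis using le by (simp add: algebra_simps)
  qed
  define Y where "Y = 54 * real CARD('m) * K ^ 6 * d * nJ"
  have diff: "(\<Sum>j\<in>S. (norm (U l j - trunc d l j))\<^sup>2) \<le> Y" if "S \<subseteq> J" for S
  proof -
    have "(\<Sum>j\<in>S. (norm (U l j - trunc d l j))\<^sup>2) \<le> (\<Sum>j\<in>J. (norm (U l j - trunc d l j))\<^sup>2)"
      using that by (intro sum_mono2) auto
    also have "\<dots> \<le> K * total (\<lambda>j. U l j - trunc d l j)" by (rule sum_norm_le_total)
    also have "\<dots> \<le> K * (54 * real CARD('m) * K ^ 5 * d * nJ)"
      unfolding nJ_def using K by (intro mult_left_mono trunc_error d hd l) auto
    finally show ?thesis by (simp add: Y_def power_numeral_reduce mult_ac)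
  qed
  \<comment> \<open>The error is split into the bounded solution, the cut off values, which the
    trace inequality controls on each layer, and the difference of the two schemes, whose total is
    small.\<close>
  have f_le: "f j \<le> 3 * g j + 3 * (norm (U l j - trunc d l j))\<^sup>2" if j: "j \<in> J" for j
  proof -
    let ?a = "p (real l * \<tau>, grid_point N j)"
    have "norm (err l j) \<le> norm ?a + norm (U l j - trunc d l j) + norm (trunc d l j)"
      unfolding err_def using norm_triangle_ineq4[of ?a "U l j"]
        norm_triangle_ineq[of "U l j - trunc d l j" "trunc d l j"] by simp
    also have "\<dots> \<le> K + norm (U l j - trunc d l j) + norm (trunc d l j)"
      using p_le[OF point_range[OF l j]] by simp
    finally have "f j \<le> (K + norm (U l j - trunc d l j) + norm (trunc d l j))\<^sup>2"
      unfolding f_def by (intro power_mono) auto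
    also have "\<dots> \<le> 3 * (K\<^sup>2 + (norm (U l j - trunc d l j))\<^sup>2 + (norm (trunc d l j))\<^sup>2)"
    proof -
      have "(a + b + c)\<^sup>2 \<le> 3 * (a\<^sup>2 + b\<^sup>2 + c\<^sup>2)" for a b c :: real
        using sum_squares_bound[of a b] sum_squares_bound[of b c] sum_squares_bound[of a c]
        by (simp add: power2_eq_square algebra_simps)
      then show ?thesis .
    qed
    finally show ?thesis by (simp add: g_def algebra_simps)
  qed
  have layer: "(\<Sum>j\<in>S. f j) \<le> 3 * (6 * \<eta> * X) + 3 * Y"
    if S: "S \<subseteq> J" "(\<Sum>j\<in>S. g j) \<le> 6 * \<eta> * X" for S
  proof -
    have "(\<Sum>j\<in>S. f j) \<le> (\<Sum>j\<in>S. 3 * g j + 3 * (norm (U l j - trunc d l j))\<^sup>2)"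
      using S(1) by (intro sum_mono f_le) auto
    also have "\<dots> = 3 * (\<Sum>j\<in>S. g j) + 3 * (\<Sum>j\<in>S. (norm (U l j - trunc d l j))\<^sup>2)"
      by (simp add: sum.distrib sum_distrib_left)
    finally show ?thesis using S(2) diff[OF S(1)] by linarith
  qed
  have "(\<Sum>i\<in>UNIV. (\<Sum>j\<in>layer_low l \<eta> i. f j) + (\<Sum>j\<in>layer_high l \<eta> i. f j)) \<le>
      (\<Sum>i\<in>(UNIV :: 'm set). (3 * (6 * \<eta> * X) + 3 * Y) + (3 * (6 * \<eta> * X) + 3 * Y))"
    by (intro sum_mono add_mono layer layer_sum_le[OF _ \<eta>(2) X0 gX])
      (auto simp: layer_low_def layer_high_def g_def)
  also have "\<dots> = real CARD('m) * (36 * (\<eta> * X) + 6 * Y)" by simp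
  also have "\<eta> * X = 91 * K ^ 6 * d * nJ"
    using d(1) by (simp add: \<eta>_def X_def power_numeral_reduce)
  finally have layers: "(\<Sum>i\<in>UNIV. (\<Sum>j\<in>layer_low l \<eta> i. f j) + (\<Sum>j\<in>layer_high l \<eta> i. f j)) \<le>
      (3276 * real CARD('m) + 324 * (real CARD('m))\<^sup>2) * (K ^ 6 * d * nJ)"
    by (simp add: Y_def power2_eq_square algebra_simps)
  also have "\<dots> \<le> (3600 * (real CARD('m) + 1)\<^sup>2) * (K ^ 10 * d * nJ)"
  proof (intro mult_mono order_refl power_increasing K)
    show "3276 * real CARD('m) + 324 * (real CARD('m))\<^sup>2 \<le> 3600 * (real CARD('m) + 1)\<^sup>2"
      by (simp add: power2_eq_square algebra_simps)
  qed (use d K in \<open>auto simp: nJ_def\<close>)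
  finally have "(\<Sum>j\<in>nearby l. f j) \<le> 3766 * ((real CARD('m) + 1)\<^sup>2 * K ^ 10 * d * nJ)"
    using split inner_le by (simp add: algebra_simps)
  also have "\<dots> \<le> 4000 * ((real CARD('m) + 1)\<^sup>2 * K ^ 10 * d * nJ)"
    using K d by (intro mult_right_mono) (auto simp: nJ_def)
  finally show ?thesis by (simp add: f_def nJ_def mult.assoc)
qed

end

section \<open>The error of the interpolation\<close>

lemma hat_nonneg [simp]: "0 \<le> hat s"
  by (simp add: hat_def)

lemma hat_le_1: "hat s \<le> 1"
  by (simp add: hat_def)

lemma hat_pos_iff: "0 < hat s \<longleftrightarrow> \<bar>s\<bar> < 1"
  by (auto simp: hat_def)

lemma hat_eq_0: "1 \<le> \<bar>s\<bar> \<Longrightarrow> hat s = 0"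
  by (simp add: hat_def)

text \<open>Only the two integers next to \<open>s\<close> contribute, with weights adding up to
  one; the right end of the range is separate because its upper neighbour is missing.\<close>

lemma hat_partition:
  assumes "1 \<le> s" "s \<le> of_int M"
  shows "(\<Sum>k\<in>{1..M}. hat (s - of_int k)) = 1"
proof (cases "s = of_int M")
  case True
  have "(\<Sum>k\<in>{1..M}. hat (s - of_int k)) = (\<Sum>k\<in>{M}. hat (s - of_int k))"
    using assms True by (intro sum.mono_neutral_right) (auto intro!: hat_eq_0)
  then show ?thesis by (simp add: True hat_def)
next
  case False
  define n where "n = \<lfloor>s\<rfloor>"
  have n: "of_int n \<le> s" "s < of_int n + 1" by (auto simp: n_def)
  have n1: "1 \<le> n" using assms(1) by (simp add: n_def le_floor_iff)
  have nM: "n < M" using assms(2) False n(1) by linarith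
  have "(\<Sum>k\<in>{1..M}. hat (s - of_int k)) = (\<Sum>k\<in>{n, n + 1}. hat (s - of_int k))"
  proof (rule sum.mono_neutral_right)
    show "\<forall>k\<in>{1..M} - {n, n + 1}. hat (s - of_int k) = 0"
    proof
      fix k assume "k \<in> {1..M} - {n, n + 1}"
      then have "k \<le> n - 1 \<or> n + 2 \<le> k" by auto
      then have "real_of_int k \<le> real_of_int n - 1 \<or> real_of_int n + 2 \<le> real_of_int k" by linarith
      then show "hat (s - of_int k) = 0" using n by (intro hat_eq_0) linarith
    qed
  qed (use n1 nM in auto)
  also have "\<dots> = 1" using n by (simp add: hat_def)
  finally show ?thesis .
qed

lemma hat_partition_nat:
  assumes "1 \<le> s" "s \<le> real L"
  shows "(\<Sum>l\<in>{1..L}. hat (s - real l)) = 1"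
proof -
  have "(\<Sum>l\<in>{1..L}. hat (s - real l)) = (\<Sum>k\<in>{1..int L}. hat (s - of_int k))"
    by (rule sum.reindex_bij_witness[where i = nat and j = int]) auto
  then show ?thesis using hat_partition[of s "int L"] assms by simp
qed

lemma clamp_range_bounds: "1 \<le> K \<Longrightarrow> 1 \<le> clamp_range K s" "1 \<le> K \<Longrightarrow> clamp_range K s \<le> K"
  by (auto simp: clamp_range_def)

text \<open>Jensen's inequality for the square, by nonnegativity of the variance of the norms about
  their mean \<mu>.\<close>

lemma norm_convex_sum_le:
  fixes v :: "'i \<Rightarrow> 'b::real_normed_vector"
  assumes c: "finite S" "\<And>k. k \<in> S \<Longrightarrow> 0 \<le> c k" "(\<Sum>k\<in>S. c k) = 1"
  shows "(norm (\<Sum>k\<in>S. c k *\<^sub>R v k))\<^sup>2 \<le> (\<Sum>k\<in>S. c k * (norm (v k))\<^sup>2)"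
proof -
  define \<mu> where "\<mu> = (\<Sum>k\<in>S. c k * norm (v k))"
  have "norm (\<Sum>k\<in>S. c k *\<^sub>R v k) \<le> (\<Sum>k\<in>S. norm (c k *\<^sub>R v k))" by (rule norm_sum)
  also have "\<dots> = \<mu>" unfolding \<mu>_def using c(2) by (intro sum.cong) auto
  finally have "(norm (\<Sum>k\<in>S. c k *\<^sub>R v k))\<^sup>2 \<le> \<mu>\<^sup>2" by (intro power_mono) auto
  also have "\<mu>\<^sup>2 \<le> (\<Sum>k\<in>S. c k * (norm (v k))\<^sup>2)"
  proof -
    have "0 \<le> (\<Sum>k\<in>S. c k * (norm (v k) - \<mu>)\<^sup>2)" using c(2) by (intro sum_nonneg) auto
    also have "\<dots> = (\<Sum>k\<in>S. c k * (norm (v k))\<^sup>2) - 2 * \<mu> * (\<Sum>k\<in>S. c k * norm (v k)) + \<mu>\<^sup>2 * (\<Sum>k\<in>S. c k)"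
      unfolding sum_distrib_left sum_subtractf[symmetric] sum.distrib[symmetric]
      by (intro sum.cong) (simp_all add: power2_eq_square algebra_simps)
    also have "\<dots> = (\<Sum>k\<in>S. c k * (norm (v k))\<^sup>2) - \<mu>\<^sup>2"
      unfolding c(3) \<mu>_def[symmetric] by (simp add: power2_eq_square)
    finally show ?thesis by simp
  qed
  finally show ?thesis .
qed

lemma esqrt_le:
  assumes "I \<le> ennreal (\<epsilon>\<^sup>2)" "0 \<le> \<epsilon>"
  shows "esqrt I \<le> ennreal \<epsilon>"
proof -
  have "I \<noteq> \<infinity>" using assms(1) by (metis ennreal_less_top infinity_ennreal_def not_less top.not_eq_extremum)
  moreover have "enn2real I \<le> \<epsilon>\<^sup>2" using assms(1) by (rule enn2real_leI[rotated]) simp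
  then have "sqrt (enn2real I) \<le> \<epsilon>" using assms(2) real_sqrt_le_mono by fastforce
  ultimately show ?thesis by (simp add: esqrt_def ennreal_leI)
qed

lemma emeasure_cube:
  fixes g :: "real ^ 'm::finite"
  assumes "0 \<le> r"
  shows "emeasure lborel {x. \<forall>i. \<bar>x $ i - g $ i\<bar> \<le> r} = ennreal ((2 * r) ^ CARD('m))"
    and "{x. \<forall>i. \<bar>x $ i - g $ i\<bar> \<le> r} \<in> sets lborel"
proof -
  define e :: "real ^ 'm" where "e = (\<chi> i. r)"
  have eq: "{x. \<forall>i. \<bar>x $ i - g $ i\<bar> \<le> r} = cbox (g - e) (g + e)"
    by (auto simp: mem_box_cart e_def abs_le_iff algebra_simps)
  show "{x. \<forall>i. \<bar>x $ i - g $ i\<bar> \<le> r} \<in> sets lborel" unfolding eq by simp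
  have inner: "e \<bullet> b = r" if "b \<in> Basis" for b :: "real ^ 'm"
    using that by (auto simp: Basis_vec_def inner_axis e_def)
  have "emeasure lborel (cbox (g - e) (g + e)) = ennreal (\<Prod>b\<in>Basis. (g + e - (g - e)) \<bullet> b)"
    using assms by (intro emeasure_lborel_cbox) (simp add: inner_diff_left inner_add_left inner)
  also have "(\<Prod>b\<in>Basis. (g + e - (g - e)) \<bullet> b) = (\<Prod>b\<in>(Basis :: (real ^ 'm) set). 2 * r)"
  proof (rule prod.cong[OF refl])
    fix b :: "real ^ 'm" assume "b \<in> Basis"
    then show "(g + e - (g - e)) \<bullet> b = 2 * r" unfolding inner_diff_left inner_add_left by (simp add: inner)
  qed
  finally show "emeasure lborel {x. \<forall>i. \<bar>x $ i - g $ i\<bar> \<le> r} = ennreal ((2 * r) ^ CARD('m))"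
    unfolding eq by simp
qed

lemma unit_cube_eq: "unit_cube = {x :: real ^ 'm::finite. \<forall>i. \<bar>x $ i - (\<chi> i. 1 / 2) $ i\<bar> \<le> 1 / 2}"
  by (auto simp: unit_cube_def abs_le_iff) (smt (verit) field_sum_of_halves)+

context scheme_error begin

definition time_weight :: "real \<Rightarrow> nat \<Rightarrow> real" where
  "time_weight t l = hat (clamp_range (real L) (t / \<tau>) - real l)"

definition space_weight :: "real ^ 'm \<Rightarrow> ('m \<Rightarrow> int) \<Rightarrow> real" where
  "space_weight x j = (\<Prod>i\<in>UNIV. hat (clamp_range (2 ^ N) (x $ i * 2 ^ N + 1/2) - of_int (j i)))"

lemma L_pos: "1 \<le> L"
  using T by (cases L) auto

lemma time_weight_sum: "(\<Sum>l\<in>{1..L}. time_weight t l) = 1"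
  unfolding time_weight_def using L_pos by (intro hat_partition_nat clamp_range_bounds) auto

lemma space_weight_sum: "(\<Sum>j\<in>J. space_weight x j) = 1"
proof -
  have "(\<Sum>j\<in>J. space_weight x j) =
      (\<Prod>i\<in>UNIV. \<Sum>k\<in>{1..2 ^ N}. hat (clamp_range (2 ^ N) (x $ i * 2 ^ N + 1/2) - of_int k))"
    unfolding space_weight_def grid_indices_PiE by (rule prod_sum_PiE[symmetric]) auto
  also have "\<dots> = (\<Prod>i\<in>(UNIV :: 'm set). 1)"
    by (intro prod.cong refl hat_partition) (auto intro!: clamp_range_bounds)
  finally show ?thesis by simp
qed

lemma weights_nonneg [simp]: "0 \<le> time_weight t l" "0 \<le> space_weight x j"
  by (auto simp: time_weight_def space_weight_def prod_nonneg)

lemma space_weight_le_1: "space_weight x j \<le> 1"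
  unfolding space_weight_def by (intro prod_le_1) (auto simp: hat_le_1)

lemma interpolate_eq:
  "interpolate N \<tau> L V (t, x) = (\<Sum>(l, j)\<in>{1..L} \<times> J. (time_weight t l * space_weight x j) *\<^sub>R V l j)"
  by (simp add: interpolate_def time_weight_def space_weight_def sum.cartesian_product)

lemma time_weight_pos:
  assumes "0 \<le> t" "t \<le> T" "l \<in> {1..L}" "0 < time_weight t l"
  shows "\<bar>t - real l * \<tau>\<bar> \<le> \<tau>"
proof -
  have "t / \<tau> \<le> real L" using assms(2) \<tau> T(3) by (simp add: pos_divide_le_eq)
  then have c: "clamp_range (real L) (t / \<tau>) = max 1 (t / \<tau>)" by (simp add: clamp_range_def min_def)
  have lt: "\<bar>max 1 (t / \<tau>) - real l\<bar> < 1"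
    using assms(4) unfolding time_weight_def hat_pos_iff c .
  have "\<bar>t / \<tau> - real l\<bar> \<le> 1"
  proof (cases "1 \<le> t / \<tau>")
    case True
    then show ?thesis using lt by (simp add: max_def)
  next
    \<comment> \<open>The grid has no level at time \<open>0\<close>: below the first level \<tau>
      the time is clamped to it and only \<open>l = 1\<close> has weight.\<close>
    case False
    then have "\<bar>1 - real l\<bar> < 1" using lt by (simp add: max_def)
    then have "l = 1" using assms(3) by auto
    then show ?thesis using False assms(1) \<tau> by simp
  qed
  then have "\<bar>t / \<tau> - real l\<bar> * \<tau> \<le> 1 * \<tau>" using \<tau> by (intro mult_right_mono) auto
  moreover have "\<bar>t / \<tau> - real l\<bar> * \<tau> = \<bar>t - real l * \<tau>\<bar>"
  proof -
    have "(t / \<tau> - real l) * \<tau> = t - real l * \<tau>" using \<tau> by (simp add: left_diff_distrib)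
    then show ?thesis using \<tau> by (metis abs_mult abs_of_pos)
  qed
  ultimately show ?thesis by simp
qed

lemma space_weight_pos:
  assumes "x \<in> unit_cube" "0 < space_weight x j"
  shows "\<bar>x $ i - grid_point N j $ i\<bar> \<le> 2 * h"
proof -
  define M :: real where "M = 2 ^ N"
  have M: "1 \<le> M" "M * h = 1" using h by (auto simp: M_def)
  have x: "0 \<le> x $ i" "x $ i \<le> 1" using assms(1) by (auto simp: unit_cube_def)
  define s where "s = x $ i * M + 1 / 2"
  have "x $ i * M \<le> M" "0 \<le> x $ i * M" using x M mult_right_mono[of "x $ i" 1 M] by auto
  \<comment> \<open>Between the cube boundary and the nearest cell centres the clamping moves the
    rescaled coordinate by at most one half. With the radius \<open>1\<close> of the hat this stays
    below two cells.\<close>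
  then have "\<bar>clamp_range M s - s\<bar> \<le> 1 / 2" using M(1) unfolding clamp_range_def s_def by linarith
  moreover have "0 < hat (clamp_range M s - of_int (j i))"
  proof (rule ccontr)
    assume "\<not> 0 < hat (clamp_range M s - of_int (j i))"
    then have "hat (clamp_range M s - of_int (j i)) = 0" using hat_nonneg by (simp add: order_antisym not_less)
    then have "space_weight x j = 0"
      unfolding space_weight_def s_def M_def by (intro prod_zero) auto
    then show False using assms(2) by simp
  qed
  ultimately have "\<bar>s - of_int (j i)\<bar> \<le> 2" unfolding hat_pos_iff by linarith
  then have "\<bar>s - of_int (j i)\<bar> * h \<le> 2 * h" using h by (intro mult_right_mono) auto
  moreover have "\<bar>s - of_int (j i)\<bar> * h = \<bar>x $ i - grid_point N j $ i\<bar>"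
  proof -
    have "(s - of_int (j i)) * h = x $ i * (M * h) - (of_int (j i) - 1 / 2) * h"
      by (simp add: s_def algebra_simps)
    then have "(s - of_int (j i)) * h = x $ i - grid_point N j $ i"
      unfolding M(2) by (simp add: grid_point_def h_def)
    then show ?thesis using h(1) by (metis abs_mult abs_of_pos)
  qed
  ultimately show ?thesis by simp
qed

text \<open>Since the interpolation weights add up to one, the deviation is an average of increments
  of \<open>p\<close> plus an average of grid errors. The first is small by the Lipschitz bound; the
  second goes through Jensen's inequality to the mean square error of \<open>nearby\<close>.\<close>

lemma interpolation_error:
  assumes near: "\<And>i. mx i * \<tau> \<le> h" "\<And>i. - mn i * \<tau> \<le> h"
    and C: "\<And>l. l \<le> L \<Longrightarrow> (\<Sum>j\<in>nearby l. (norm (err l j))\<^sup>2) \<le> C * 2 ^ (N * CARD('m))" "0 \<le> C"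
    and \<epsilon>: "0 \<le> \<epsilon>" "2 * (3 * real CARD('m) * K * h)\<^sup>2 + 2 * (4 ^ CARD('m) * C) \<le> \<epsilon>\<^sup>2"
    and cone_time: "\<And>z. z \<in> cone \<Longrightarrow> fst z \<le> T"
    and u: "\<And>z. z \<in> cone \<Longrightarrow> u z = p z"
  shows "sL2_norm cone (\<lambda>z. u z - interpolate N \<tau> L U z) \<le> ennreal \<epsilon>"
  unfolding sL2_norm_def
proof (rule SUP_least, rule esqrt_le[OF _ \<epsilon>(1)])
  fix t assume "t \<in> {t. slice cone t \<noteq> {}}"
  then obtain x1 where "(t, x1) \<in> cone" by (auto simp: slice_def)
  then have t: "0 \<le> t" "t \<le> T" using cone_time by (auto simp: cone_def)
  define c0 where "c0 = 2 * (3 * real CARD('m) * K * h)\<^sup>2"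
  define box where "box j = {x :: real ^ 'm. \<forall>i. \<bar>x $ i - grid_point N j $ i\<bar> \<le> 2 * h}" for j
  \<comment> \<open>For \<open>x\<close> in the slice all pairs outside this set have weight zero,
    by the margin built into \<open>nearby\<close>.\<close>
  define S where "S = (SIGMA l:{1..L}. nearby l)"
  define w where "w l j = 2 * (time_weight t l * (norm (err l j))\<^sup>2)" for l j
  have w0: "0 \<le> w l j" for l j by (simp add: w_def)
  have finS: "finite S" by (auto simp: S_def nearby_def)
  have bound: "(norm (u (t, x) - interpolate N \<tau> L U (t, x)))\<^sup>2 \<le>
      c0 + (\<Sum>(l, j)\<in>S. w l j * indicator (box j) x)" if x: "x \<in> slice cone t" for x
  proof -
    have xc: "x \<in> unit_cube" "(t, x) \<in> cone" using x by (auto simp: slice_def)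
    define c where "c = (\<lambda>(l, j). time_weight t l * space_weight x j)"
    define I where "I = {1..L} \<times> J"
    have cI: "0 \<le> c k" for k by (auto simp: c_def split: prod.splits)
    have c1: "(\<Sum>k\<in>I. c k) = 1"
      unfolding I_def c_def sum.cartesian_product[symmetric] sum_distrib_left[symmetric] space_weight_sum
      by (simp only: mult_1_right time_weight_sum)
    have fI: "finite I" by (simp add: I_def)
    have close: "\<bar>t - real l * \<tau>\<bar> \<le> \<tau> \<and> (\<forall>i. \<bar>x $ i - grid_point N j $ i\<bar> \<le> 2 * h)"
      if "(l, j) \<in> I" "c (l, j) \<noteq> 0" for l j
    proof -
      have "0 < time_weight t l" "0 < space_weight x j"
        using that(2) weights_nonneg(1)[of t l] weights_nonneg(2)[of x j] by (auto simp: c_def less_le)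
      then show ?thesis using time_weight_pos[OF t, of l] space_weight_pos[OF xc(1), of j] that(1)
        by (auto simp: I_def)
    qed
    define a where "a = (\<Sum>k\<in>I. c k *\<^sub>R (p (t, x) - p (real (fst k) * \<tau>, grid_point N (snd k))))"
    define e where "e = (\<Sum>k\<in>I. c k *\<^sub>R err (fst k) (snd k))"
    have 1: "p (t, x) = (\<Sum>k\<in>I. c k *\<^sub>R p (t, x))" unfolding scaleR_sum_left[symmetric] c1 by simp
    have 2: "interpolate N \<tau> L U (t, x) = (\<Sum>k\<in>I. c k *\<^sub>R U (fst k) (snd k))"
      unfolding interpolate_eq I_def c_def by (intro sum.cong) auto
    have "a + e = (\<Sum>k\<in>I. c k *\<^sub>R p (t, x)) - (\<Sum>k\<in>I. c k *\<^sub>R U (fst k) (snd k))"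
      unfolding a_def e_def sum.distrib[symmetric] sum_subtractf[symmetric] err_def
      by (intro sum.cong) (simp_all add: scaleR_diff_right)
    also have "\<dots> = p (t, x) - interpolate N \<tau> L U (t, x)" unfolding 1[symmetric] 2[symmetric] ..
    finally have split: "p (t, x) - interpolate N \<tau> L U (t, x) = a + e" ..
    have "norm a \<le> (\<Sum>k\<in>I. c k * (3 * real CARD('m) * K * h))"
      unfolding a_def
    proof (rule sum_norm_le)
      fix k assume k: "k \<in> I"
      obtain l j where lj: "k = (l, j)" by (cases k)
      show "norm (c k *\<^sub>R (p (t, x) - p (real (fst k) * \<tau>, grid_point N (snd k)))) \<le> c k * (3 * real CARD('m) * K * h)"
      proof (cases "c k = 0")
        case False
        note cl = close[OF k[unfolded lj] False[unfolded lj]]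
        have l: "l \<le> L" "j \<in> J" using k by (auto simp: lj I_def)
        have "norm ((t, x) - (real l * \<tau>, grid_point N j)) \<le> \<bar>t - real l * \<tau>\<bar> + norm (x - grid_point N j)"
          unfolding diff_Pair by (rule order_trans[OF norm_Pair_le]) simp
        also have "norm (x - grid_point N j) \<le> (\<Sum>i\<in>UNIV. \<bar>(x - grid_point N j) $ i\<bar>)"
          by (rule norm_le_l1_cart)
        also have "\<dots> \<le> (\<Sum>i\<in>(UNIV :: 'm set). 2 * h)" using cl by (intro sum_mono) simp
        also have "\<bar>t - real l * \<tau>\<bar> \<le> real CARD('m) * h"
        proof -
          have "1 * h \<le> real CARD('m) * h" using h(1) by (intro mult_right_mono) (auto simp: Suc_le_eq)
          then show ?thesis using cl h(4) by linarith
        qed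
        finally have "norm ((t, x) - (real l * \<tau>, grid_point N j)) \<le> 3 * real CARD('m) * h"
          by (simp add: mult_ac)
        then have "K * norm ((t, x) - (real l * \<tau>, grid_point N j)) \<le> K * (3 * real CARD('m) * h)"
          using K by (intro mult_left_mono) auto
        moreover have "(t, x) \<in> {0..T} \<times> unit_cube" using t xc(1) by simp
        note p_lip[OF this point_range[OF l]]
        ultimately have "norm (p (t, x) - p (real l * \<tau>, grid_point N j)) \<le> 3 * real CARD('m) * K * h"
          by (simp add: mult_ac)
        then show ?thesis using cI[of k] by (simp add: lj mult_left_mono)
      qed simp
    qed
    also have "\<dots> = 3 * real CARD('m) * K * h" unfolding sum_distrib_right[symmetric] c1 by simp
    finally have a2: "(norm a)\<^sup>2 \<le> (3 * real CARD('m) * K * h)\<^sup>2" by (intro power_mono) auto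
    have "(norm e)\<^sup>2 \<le> (\<Sum>k\<in>I. c k * (norm (err (fst k) (snd k)))\<^sup>2)"
      unfolding e_def by (rule norm_convex_sum_le[OF fI cI c1])
    also have "\<dots> = (\<Sum>k\<in>S. c k * (norm (err (fst k) (snd k)))\<^sup>2)"
    proof (rule sum.mono_neutral_right[OF fI])
      show "S \<subseteq> I" by (auto simp: S_def I_def nearby_def)
      show "\<forall>k\<in>I - S. c k * (norm (err (fst k) (snd k)))\<^sup>2 = 0"
      proof
        fix k assume k: "k \<in> I - S"
        obtain l j where lj: "k = (l, j)" by (cases k)
        have "c k = 0"
        proof (rule ccontr)
          assume "c k \<noteq> 0"
          then have cl: "\<bar>t - real l * \<tau>\<bar> \<le> \<tau>" "\<And>i. \<bar>x $ i - grid_point N j $ i\<bar> \<le> 2 * h"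
            using close[of l j] k by (auto simp: lj)
          have "- 4 * h \<le> low i (real l * \<tau>) j \<and> - 4 * h \<le> high i (real l * \<tau>) j" for i
          proof -
            have xi: "x $ i - mx i * t \<ge> 0" "x $ i - 1 - mn i * t \<le> 0" using xc(2) by (auto simp: cone_def)
            have "mx i * (real l * \<tau> - t) \<le> mx i * \<tau>" using cl(1) mx(2) by (intro mult_left_mono) auto
            then have 1: "mx i * (real l * \<tau>) \<le> mx i * t + h" using near(1)[of i] by (simp add: right_diff_distrib)
            have "- mn i * (real l * \<tau> - t) \<le> - mn i * \<tau>" using cl(1) mn(2) by (intro mult_left_mono) auto
            then have 2: "mn i * t - h \<le> mn i * (real l * \<tau>)" using near(2)[of i] by (simp add: algebra_simps)
            show ?thesis using xi 1 2 cl(2)[of i] unfolding low_def high_def h_def[symmetric] by linarith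
          qed
          then have "k \<in> S" using k by (auto simp: lj S_def I_def nearby_def)
          then show False using k by simp
        qed
        then show "c k * (norm (err (fst k) (snd k)))\<^sup>2 = 0" by simp
      qed
    qed
    also have "\<dots> \<le> (\<Sum>k\<in>S. (time_weight t (fst k) * (norm (err (fst k) (snd k)))\<^sup>2) * indicator (box (snd k)) x)"
    proof (rule sum_mono)
      fix k assume k: "k \<in> S"
      obtain l j where lj: "k = (l, j)" by (cases k)
      have kI: "(l, j) \<in> I" using k by (auto simp: lj S_def I_def nearby_def)
      show "c k * (norm (err (fst k) (snd k)))\<^sup>2 \<le>
          (time_weight t (fst k) * (norm (err (fst k) (snd k)))\<^sup>2) * indicator (box (snd k)) x"
      proof (cases "c k = 0")
        case False
        then have "x \<in> box j" using close[OF kI] by (simp add: lj box_def)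
        moreover have "c k \<le> time_weight t l"
          using mult_left_le[OF space_weight_le_1[of x j] weights_nonneg(1)[of t l]] by (simp add: lj c_def)
        ultimately show ?thesis by (simp add: lj mult_right_mono)
      qed (simp add: lj)
    qed
    finally have e2: "2 * (norm e)\<^sup>2 \<le> (\<Sum>(l, j)\<in>S. w l j * indicator (box j) x)"
      by (simp add: w_def split_def mult.assoc sum_distrib_left[symmetric])
    have "(norm (a + e))\<^sup>2 \<le> (norm a + norm e)\<^sup>2" by (intro power_mono norm_triangle_ineq) simp
    also have "\<dots> \<le> 2 * (norm a)\<^sup>2 + 2 * (norm e)\<^sup>2"
      using sum_squares_bound[of "norm a" "norm e"] by (simp add: power2_sum)
    finally show ?thesis using a2 e2 u[OF xc(2)] split by (simp add: c0_def)
  qed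
  have boxm: "box j \<in> sets lborel" "emeasure lborel (box j) = ennreal ((4 * h) ^ CARD('m))" for j
    using emeasure_cube[of "2 * h" "grid_point N j"] h by (simp_all add: box_def)
  have cubem: "(unit_cube :: (real ^ 'm) set) \<in> sets lborel" "emeasure lborel (unit_cube :: (real ^ 'm) set) = 1"
    unfolding unit_cube_eq using emeasure_cube[of "1 / 2" "(\<chi> i. 1 / 2) :: real ^ 'm"] by simp_all
  \<comment> \<open>The integrand is dominated by a combination of indicators of cubes, whose
    integral is explicit.\<close>
  have "(\<integral>\<^sup>+x \<in> slice cone t. ennreal ((norm (u (t, x) - interpolate N \<tau> L U (t, x)))\<^sup>2) \<partial>lborel) \<le>
      (\<integral>\<^sup>+x. (ennreal c0 * indicator unit_cube x + (\<Sum>(l, j)\<in>S. ennreal (w l j) * indicator (box j) x)) \<partial>lborel)"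
  proof (rule nn_integral_mono)
    fix x :: "real ^ 'm"
    show "ennreal ((norm (u (t, x) - interpolate N \<tau> L U (t, x)))\<^sup>2) * indicator (slice cone t) x \<le>
        ennreal c0 * indicator unit_cube x + (\<Sum>(l, j)\<in>S. ennreal (w l j) * indicator (box j) x)"
    proof (cases "x \<in> slice cone t")
      case True
      then have xc: "x \<in> unit_cube" by (simp add: slice_def)
      have nn: "0 \<le> w l j * indicator (box j) x" for l j using w0 by simp
      have "ennreal (w l j * indicator (box j) x) = ennreal (w l j) * indicator (box j) x" for l j
        by (simp add: indicator_def)
      then have "(\<Sum>(l, j)\<in>S. ennreal (w l j) * indicator (box j) x) = (\<Sum>(l, j)\<in>S. ennreal (w l j * indicator (box j) x))"
        by simp
      also have "\<dots> = ennreal (\<Sum>(l, j)\<in>S. w l j * indicator (box j) x)"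
        using nn by (simp add: split_def sum_ennreal)
      finally have "ennreal c0 * indicator unit_cube x + (\<Sum>(l, j)\<in>S. ennreal (w l j) * indicator (box j) x) =
          ennreal (c0 + (\<Sum>(l, j)\<in>S. w l j * indicator (box j) x))"
        using xc nn by (simp add: ennreal_plus c0_def sum_nonneg split_def)
      then show ?thesis using True bound[OF True] by (simp add: ennreal_leI)
    qed simp
  qed
  also have "\<dots> = ennreal c0 + (\<Sum>(l, j)\<in>S. ennreal (w l j) * ennreal ((4 * h) ^ CARD('m)))"
  proof -
    have "(\<integral>\<^sup>+x. (ennreal c0 * indicator (unit_cube :: (real ^ 'm) set) x + (\<Sum>k\<in>S. ennreal (w (fst k) (snd k)) *
        indicator (box (snd k)) x)) \<partial>lborel) =
        (\<integral>\<^sup>+x. ennreal c0 * indicator (unit_cube :: (real ^ 'm) set) x \<partial>lborel) +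
        (\<Sum>k\<in>S. \<integral>\<^sup>+x. ennreal (w (fst k) (snd k)) * indicator (box (snd k)) x \<partial>lborel)"
    proof -
      have "(\<integral>\<^sup>+x. (\<Sum>k\<in>S. ennreal (w (fst k) (snd k)) * indicator (box (snd k)) x) \<partial>lborel) =
          (\<Sum>k\<in>S. \<integral>\<^sup>+x. ennreal (w (fst k) (snd k)) * indicator (box (snd k)) x \<partial>lborel)"
        using boxm by (intro nn_integral_sum) auto
      then show ?thesis using boxm cubem by (subst nn_integral_add) auto
    qed
    then show ?thesis using boxm cubem by (simp add: nn_integral_cmult_indicator split_def)
  qed
  also have "\<dots> = ennreal (c0 + (\<Sum>(l, j)\<in>S. w l j * (4 * h) ^ CARD('m)))"
    using w0 h by (simp add: split_def ennreal_mult[symmetric] sum_ennreal ennreal_plus[symmetric] c0_def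
        sum_nonneg del: ennreal_plus)
  also have "\<dots> \<le> ennreal (\<epsilon>\<^sup>2)"
  proof (rule ennreal_leI)
    have "(\<Sum>(l, j)\<in>S. w l j * (4 * h) ^ CARD('m)) =
        (\<Sum>l\<in>{1..L}. time_weight t l * (2 * (4 * h) ^ CARD('m) * (\<Sum>j\<in>nearby l. (norm (err l j))\<^sup>2)))"
      unfolding S_def w_def by (subst sum.Sigma[symmetric]) (auto simp: nearby_def sum_distrib_left mult_ac)
    also have "\<dots> \<le> (\<Sum>l\<in>{1..L}. time_weight t l * (2 * (4 * h) ^ CARD('m) * (C * 2 ^ (N * CARD('m)))))"
      using C h by (intro sum_mono mult_left_mono) auto
    also have "\<dots> = 2 * (4 * h) ^ CARD('m) * (C * 2 ^ (N * CARD('m)))"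
      unfolding sum_distrib_right[symmetric] time_weight_sum by (simp only: mult_1)
    \<comment> \<open>The support box of a cell has volume \<open>(4 * h) ^ CARD('m)\<close>;
      against the number of cells only \<open>4 ^ CARD('m)\<close> remains, the overlap of the
      boxes.\<close>
    also have "\<dots> = 2 * (4 ^ CARD('m) * C) * (2 ^ N * h) ^ CARD('m)"
      by (simp add: power_mult_distrib power_mult mult_ac)
    finally show "c0 + (\<Sum>(l, j)\<in>S. w l j * (4 * h) ^ CARD('m)) \<le> \<epsilon>\<^sup>2"
      using \<epsilon>(2) unfolding h(3) c0_def by simp
  qed
  finally show "(\<integral>\<^sup>+x \<in> slice cone t. ennreal ((norm (u (t, x) - interpolate N \<tau> L U (t, x)))\<^sup>2) \<partial>lborel) \<le>
      ennreal (\<epsilon>\<^sup>2)" .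
qed


text \<open>The cutoff width is \<open>d = 1 / 2 ^ r\<close>. The assumption \<open>X\<close> makes
  the error constants times \<open>a\<^sup>2 * d\<close> at most one, and the lower bound for
  \<open>N\<close> makes \<open>h\<close> small against the power of \<open>d\<close> required near
  the faces.\<close>

lemma final_error:
  fixes a :: real
  assumes a: "1 \<le> a" and r: "2 \<le> r" "(12 * CARD('m) + 1) * r \<le> N"
    and X: "32400 * 4 ^ CARD('m) * (real CARD('m) + 1)\<^sup>2 * K ^ 10 * a\<^sup>2 \<le> 2 ^ r"
    and speeds: "\<And>i. mx i \<le> K" "\<And>i. - mn i \<le> K" and \<tau>_eq: "\<tau> = h * h"
    and cone_time: "\<And>z. z \<in> cone \<Longrightarrow> fst z \<le> T"
    and u: "\<And>z. z \<in> cone \<Longrightarrow> u z = p z"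
  shows "sL2_norm cone (\<lambda>z. u z - interpolate N \<tau> L U z) < ennreal (1 / a)"
proof -
  define Y where "Y = 4 ^ CARD('m) * (real CARD('m) + 1)\<^sup>2 * K ^ 10"
  define d :: real where "d = 1 / 2 ^ r"
  have d0: "0 < d" by (simp add: d_def)
  have one: "1 \<le> (4 :: real) ^ CARD('m)" "1 \<le> (real CARD('m) + 1)\<^sup>2" "1 \<le> K ^ 10" "1 \<le> a\<^sup>2"
    using K a by (auto intro: one_le_power)
  have hd: "h \<le> d ^ q" if "q * r \<le> N" for q
  proof -
    have "(2 :: real) ^ (q * r) \<le> 2 ^ N" using that by (intro power_increasing) auto
    then have "1 / (2 :: real) ^ N \<le> 1 / 2 ^ (q * r)" by (intro divide_left_mono) auto
    then show ?thesis by (simp add: h_def d_def power_one_over power_mult[symmetric] mult.commute)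
  qed
  have "3 * r \<le> (12 * CARD('m) + 1) * r" by (intro mult_le_mono) (auto simp: Suc_le_eq)
  from hd[OF order_trans[OF this r(2)]] have d3: "h \<le> d ^ 3" .
  have d12: "h \<le> d ^ (12 * CARD('m)) * d" using hd[of "12 * CARD('m) + 1"] r(2) by (simp add: mult.commute)
  have d14: "d \<le> 1 / 4"
  proof -
    have "(2 :: real) ^ 2 \<le> 2 ^ r" using r(1) by (intro power_increasing) auto
    then show ?thesis by (simp add: d_def field_simps)
  qed
  have h_d: "h \<le> d"
  proof -
    have "d ^ 3 \<le> d ^ 1" using d0 d14 by (intro power_decreasing) auto
    then show ?thesis using d3 by simp
  qed
  have Yd: "32400 * Y * a\<^sup>2 * d \<le> 1"
  proof -
    have "32400 * Y * a\<^sup>2 \<le> 2 ^ r" using X by (simp add: Y_def mult_ac)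
    then show ?thesis by (simp add: d_def)
  qed
  have Y1: "(real CARD('m) + 1)\<^sup>2 * K ^ 10 \<le> Y"
    unfolding Y_def using one K mult_right_mono[OF one(1), of "(real CARD('m) + 1)\<^sup>2 * K ^ 10"] by (simp add: mult.assoc)
  have "3 * ((real CARD('m) + 1)\<^sup>2 * K ^ 3) \<le> 32400 * ((real CARD('m) + 1)\<^sup>2 * K ^ 10)"
    using K by (intro mult_mono order_refl power_increasing) auto
  also have "\<dots> \<le> 32400 * (Y * a\<^sup>2)"
  proof -
    have "0 \<le> Y" using K by (simp add: Y_def)
    then have "Y * 1 \<le> Y * a\<^sup>2" using one(4) by (intro mult_left_mono) auto
    then show ?thesis using Y1 by simp
  qed
  finally have big: "3 * ((real CARD('m) + 1)\<^sup>2 * K ^ 3) \<le> 32400 * (Y * a\<^sup>2)" .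
  have \<rho>: "3 * (real CARD('m) + 1)\<^sup>2 * K ^ 3 * h \<le> 1"
  proof -
    have "3 * ((real CARD('m) + 1)\<^sup>2 * K ^ 3) * h \<le> 32400 * (Y * a\<^sup>2) * d"
      by (rule mult_mono[OF big h_d]) (use K h in \<open>auto simp: Y_def\<close>)
    then show ?thesis using Yd by (simp add: mult_ac)
  qed
  have Kh: "K * h \<le> 1"
  proof -
    have "1 * 1 \<le> (real CARD('m) + 1)\<^sup>2 * K\<^sup>2"
      using one_le_power[OF K, of 2] by (intro mult_mono one(2)) auto
    then have "1 \<le> 3 * (real CARD('m) + 1)\<^sup>2 * K\<^sup>2" by simp
    then have "1 * (K * h) \<le> 3 * (real CARD('m) + 1)\<^sup>2 * K\<^sup>2 * (K * h)"
      using K h by (intro mult_right_mono) auto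
    then show ?thesis using \<rho> by (simp add: power_numeral_reduce mult_ac)
  qed
  define C where "C = 4000 * (real CARD('m) + 1)\<^sup>2 * K ^ 10 * d"
  have "sL2_norm cone (\<lambda>z. u z - interpolate N \<tau> L U z) \<le> ennreal (1 / (2 * a))"
  proof (rule interpolation_error[OF _ _ _ _ _ _ cone_time u])
    show "mx i * \<tau> \<le> h" for i
    proof -
      have "mx i * h \<le> 1" using mult_right_mono[OF speeds(1)[of i], of h] Kh h by linarith
      then have "(mx i * h) * h \<le> 1 * h" using h by (intro mult_right_mono) auto
      then show ?thesis by (simp add: \<tau>_eq)
    qed
    show "- mn i * \<tau> \<le> h" for i
    proof -
      have "- mn i * h \<le> 1" using mult_right_mono[OF speeds(2)[of i], of h] Kh h by linarith
      then have "(- mn i * h) * h \<le> 1 * h" using h by (intro mult_right_mono) auto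
      then show ?thesis by (simp add: \<tau>_eq)
    qed
    show "(\<Sum>j\<in>nearby l. (norm (err l j))\<^sup>2) \<le> C * 2 ^ (N * CARD('m))" if "l \<le> L" for l
      unfolding C_def by (rule grid_error[OF d0 d14 d3 d12 \<rho> that])
    show "0 \<le> C" using K d0 by (simp add: C_def)
    show "0 \<le> 1 / (2 * a)" using a by simp
    have "(3 * real CARD('m) * K * h)\<^sup>2 = 9 * ((real CARD('m))\<^sup>2 * K\<^sup>2 * (h * h))"
      by (simp add: power2_eq_square mult_ac)
    also have "\<dots> \<le> 9 * ((real CARD('m) + 1)\<^sup>2 * K ^ 10 * (d * 1))"
      using K h h_d d0 d14 by (intro mult_mono power_mono power_increasing) auto
    also have "\<dots> \<le> 9 * (Y * d)" using Y1 d0 by simp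
    finally have 1: "(3 * real CARD('m) * K * h)\<^sup>2 \<le> 9 * (Y * d)" .
    have 2: "4 ^ CARD('m) * C = 4000 * (Y * d)" by (simp add: C_def Y_def mult_ac)
    \<comment> \<open>The sum is \<open>2 * 9 + 2 * 4000\<close>, rounded up to \<open>8100\<close>;
      the factor \<open>4\<close> from the square of \<open>2 * a\<close> then gives
      \<open>32400\<close>.\<close>
    have "2 * (3 * real CARD('m) * K * h)\<^sup>2 + 2 * (4 ^ CARD('m) * C) \<le> 8100 * (Y * d)"
    proof -
      have "0 \<le> Y * d" using K d0 by (simp add: Y_def)
      then show ?thesis using 1 2 by linarith
    qed
    also have "\<dots> \<le> (1 / (2 * a))\<^sup>2"
      using Yd a by (simp add: power_divide power_mult_distrib field_simps)
    finally show "2 * (3 * real CARD('m) * K * h)\<^sup>2 + 2 * (4 ^ CARD('m) * C) \<le> (1 / (2 * a))\<^sup>2" .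
  qed
  \<comment> \<open>Aiming at \<open>1 / (2 * a)\<close> turns the estimate for the supremum into a
    strict inequality.\<close>
  also have "ennreal (1 / (2 * a)) < ennreal (1 / a)"
    using a by (intro ennreal_lessI) (auto simp: field_simps)
  finally show ?thesis .
qed

end

section \<open>Choice of the grid\<close>

text \<open>A class closed under sums, products and powers with polynomially bounded exponents, as
  the constants require. Starting at \<open>2\<close> lets one more power of \<open>l\<close> absorb
  a factor two: \<open>2 * l ^ c \<le> l ^ Suc c\<close>.\<close>

definition exp_bounded :: "(nat \<Rightarrow> real) \<Rightarrow> bool" where
  "exp_bounded g \<longleftrightarrow> (\<exists>c. \<forall>l\<ge>2. \<bar>g l\<bar> \<le> 2 ^ (l ^ c))"

definition poly_bounded :: "(nat \<Rightarrow> nat) \<Rightarrow> bool" where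
  "poly_bounded q \<longleftrightarrow> (\<exists>c. \<forall>l\<ge>2. q l \<le> l ^ c)"

lemma poly_bounded_const: "poly_bounded (\<lambda>_. k)"
  unfolding poly_bounded_def
proof (intro exI[of _ k] allI impI)
  fix l :: nat assume "2 \<le> l"
  have "k \<le> 2 ^ k" using less_exp[of k] by simp
  also have "\<dots> \<le> l ^ k" using \<open>2 \<le> l\<close> by (intro power_mono) auto
  finally show "k \<le> l ^ k" .
qed

lemma poly_bounded_id: "poly_bounded (\<lambda>l. l)"
  unfolding poly_bounded_def by (intro exI[of _ 1]) simp

lemma poly_bounded_common:
  assumes "poly_bounded p" "poly_bounded q"
  obtains c where "\<And>l. 2 \<le> l \<Longrightarrow> p l \<le> l ^ c" "\<And>l. 2 \<le> l \<Longrightarrow> q l \<le> l ^ c"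
proof -
  obtain a b where ab: "\<And>l. 2 \<le> l \<Longrightarrow> p l \<le> l ^ a" "\<And>l. 2 \<le> l \<Longrightarrow> q l \<le> l ^ b"
    using assms unfolding poly_bounded_def by blast
  have "l ^ a \<le> l ^ max a b" "l ^ b \<le> l ^ max a b" if "2 \<le> l" for l :: nat
    using that by (auto intro!: power_increasing)
  then show thesis using ab that[of "max a b"] by (meson order_trans)
qed

lemma poly_bounded_add: "poly_bounded p \<Longrightarrow> poly_bounded q \<Longrightarrow> poly_bounded (\<lambda>l. p l + q l)"
proof -
  assume "poly_bounded p" "poly_bounded q"
  then obtain c where c: "\<And>l. 2 \<le> l \<Longrightarrow> p l \<le> l ^ c" "\<And>l. 2 \<le> l \<Longrightarrow> q l \<le> l ^ c"
    using poly_bounded_common by blast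
  have "p l + q l \<le> l ^ Suc c" if "2 \<le> l" for l
  proof -
    have "p l + q l \<le> 2 * l ^ c" using c[OF that] by simp
    also have "\<dots> \<le> l ^ Suc c" using that by simp
    finally show ?thesis .
  qed
  then show ?thesis unfolding poly_bounded_def by blast
qed

lemma poly_bounded_mult: "poly_bounded p \<Longrightarrow> poly_bounded q \<Longrightarrow> poly_bounded (\<lambda>l. p l * q l)"
proof -
  assume "poly_bounded p" "poly_bounded q"
  then obtain c where c: "\<And>l. 2 \<le> l \<Longrightarrow> p l \<le> l ^ c" "\<And>l. 2 \<le> l \<Longrightarrow> q l \<le> l ^ c"
    using poly_bounded_common by blast
  have "p l * q l \<le> l ^ (c + c)" if "2 \<le> l" for l
    unfolding power_add using c[OF that] by (rule mult_le_mono)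
  then show ?thesis unfolding poly_bounded_def by blast
qed

lemma poly_bounded_power: "poly_bounded p \<Longrightarrow> poly_bounded (\<lambda>l. p l ^ k)"
  by (induction k) (auto intro: poly_bounded_const poly_bounded_mult)

lemma exp_bounded_common:
  assumes "exp_bounded f" "exp_bounded g"
  obtains c where "\<And>l. 2 \<le> l \<Longrightarrow> \<bar>f l\<bar> \<le> 2 ^ (l ^ c)" "\<And>l. 2 \<le> l \<Longrightarrow> \<bar>g l\<bar> \<le> 2 ^ (l ^ c)"
proof -
  obtain a b where ab: "\<And>l. 2 \<le> l \<Longrightarrow> \<bar>f l\<bar> \<le> 2 ^ (l ^ a)" "\<And>l. 2 \<le> l \<Longrightarrow> \<bar>g l\<bar> \<le> 2 ^ (l ^ b)"
    using assms unfolding exp_bounded_def by blast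
  have "(2 :: real) ^ (l ^ a) \<le> 2 ^ (l ^ max a b)" "(2 :: real) ^ (l ^ b) \<le> 2 ^ (l ^ max a b)" if "2 \<le> l" for l :: nat
    using that by (auto intro!: power_increasing)
  then show thesis using ab that[of "max a b"] by (meson order_trans)
qed

lemma two_powers_le: "2 \<le> l \<Longrightarrow> (2 :: real) ^ (l ^ c) * 2 ^ (l ^ c) \<le> 2 ^ (l ^ Suc c)"
  unfolding power_add[symmetric] using mult_le_mono1[of 2 l "l ^ c"]
  by (intro power_increasing) (auto simp: mult_2)

lemma exp_bounded_mult: "exp_bounded f \<Longrightarrow> exp_bounded g \<Longrightarrow> exp_bounded (\<lambda>l. f l * g l)"
proof -
  assume "exp_bounded f" "exp_bounded g"
  then obtain c where c: "\<And>l. 2 \<le> l \<Longrightarrow> \<bar>f l\<bar> \<le> 2 ^ (l ^ c)" "\<And>l. 2 \<le> l \<Longrightarrow> \<bar>g l\<bar> \<le> 2 ^ (l ^ c)"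
    using exp_bounded_common by blast
  have "\<bar>f l * g l\<bar> \<le> 2 ^ (l ^ Suc c)" if "2 \<le> l" for l
  proof -
    have "\<bar>f l * g l\<bar> \<le> 2 ^ (l ^ c) * 2 ^ (l ^ c)"
      unfolding abs_mult using c[OF that] by (intro mult_mono) auto
    then show ?thesis using two_powers_le[OF that, of c] by linarith
  qed
  then show ?thesis unfolding exp_bounded_def by blast
qed

lemma exp_bounded_add: "exp_bounded f \<Longrightarrow> exp_bounded g \<Longrightarrow> exp_bounded (\<lambda>l. f l + g l)"
proof -
  assume "exp_bounded f" "exp_bounded g"
  then obtain c where c: "\<And>l. 2 \<le> l \<Longrightarrow> \<bar>f l\<bar> \<le> 2 ^ (l ^ c)" "\<And>l. 2 \<le> l \<Longrightarrow> \<bar>g l\<bar> \<le> 2 ^ (l ^ c)"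
    using exp_bounded_common by blast
  have "\<bar>f l + g l\<bar> \<le> 2 ^ (l ^ Suc c)" if "2 \<le> l" for l
  proof -
    have "1 \<le> l ^ c" using that by simp
    then have "(2 :: real) ^ 1 \<le> 2 ^ (l ^ c)" by (intro power_increasing) auto
    then have "2 * (2 :: real) ^ (l ^ c) \<le> 2 ^ (l ^ c) * 2 ^ (l ^ c)" by (intro mult_right_mono) auto
    then show ?thesis using c[OF that] two_powers_le[OF that, of c] by linarith
  qed
  then show ?thesis unfolding exp_bounded_def by blast
qed

lemma exp_bounded_power:
  assumes "exp_bounded f" "poly_bounded p"
  shows "exp_bounded (\<lambda>l. f l ^ p l)"
proof -
  obtain c where c: "\<And>l. 2 \<le> l \<Longrightarrow> \<bar>f l\<bar> \<le> 2 ^ (l ^ c)" using assms(1) unfolding exp_bounded_def by blast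
  obtain e where e: "\<And>l. 2 \<le> l \<Longrightarrow> p l \<le> l ^ e" using assms(2) unfolding poly_bounded_def by blast
  have "\<bar>f l ^ p l\<bar> \<le> 2 ^ (l ^ (c + e))" if "2 \<le> l" for l
  proof -
    have "\<bar>f l ^ p l\<bar> \<le> (2 ^ (l ^ c)) ^ p l" unfolding power_abs using c[OF that] by (intro power_mono) auto
    also have "\<dots> \<le> (2 ^ (l ^ c)) ^ (l ^ e)" using e[OF that] by (intro power_increasing one_le_power) auto
    finally show ?thesis by (simp add: power_mult[symmetric] power_add)
  qed
  then show ?thesis unfolding exp_bounded_def by blast
qed

lemma exp_bounded_of_nat: "poly_bounded p \<Longrightarrow> exp_bounded (\<lambda>l. real (p l))"
proof -
  assume "poly_bounded p"
  then obtain c where c: "\<And>l. 2 \<le> l \<Longrightarrow> p l \<le> l ^ c" unfolding poly_bounded_def by blast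
  have "\<bar>real (p l)\<bar> \<le> 2 ^ (l ^ c)" if "2 \<le> l" for l
  proof -
    have "real (p l) \<le> real (l ^ c)" using c[OF that] by (simp only: of_nat_le_iff)
    also have "\<dots> \<le> 2 ^ (l ^ c)" by (rule less_imp_le[OF of_nat_less_two_power])
    finally show ?thesis by simp
  qed
  then show ?thesis unfolding exp_bounded_def by blast
qed

lemma exp_bounded_const: "exp_bounded (\<lambda>_. k)"
proof -
  obtain n where n: "\<bar>k\<bar> \<le> real n" using real_arch_simple by blast
  obtain c where c: "\<And>l. 2 \<le> l \<Longrightarrow> \<bar>real n\<bar> \<le> 2 ^ (l ^ c)"
    using exp_bounded_of_nat[OF poly_bounded_const, of n] unfolding exp_bounded_def by blast
  have "\<bar>k\<bar> \<le> 2 ^ (l ^ c)" if "2 \<le> l" for l using n c[OF that] by (metis abs_of_nat order_trans)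
  then show ?thesis unfolding exp_bounded_def by blast
qed

lemmas exp_bounded_intros = exp_bounded_mult exp_bounded_add exp_bounded_power exp_bounded_const
  exp_bounded_of_nat poly_bounded_add poly_bounded_mult poly_bounded_power poly_bounded_const poly_bounded_id

text \<open>Bounds both a coded number and, if it is nonzero, its reciprocal.\<close>

definition entry_bound :: "nat \<Rightarrow> real" where
  "entry_bound l = real l * real (algebraic_bound l) + 1"

lemma exp_bounded_algebraic: "exp_bounded (\<lambda>l. real (algebraic_bound l))"
  unfolding algebraic_bound_def of_nat_power of_nat_numeral
  by (intro exp_bounded_intros)

lemma exp_bounded_entry: "exp_bounded entry_bound"
  unfolding entry_bound_def[abs_def] by (intro exp_bounded_intros exp_bounded_algebraic)

lemma exp_bounded_det: "exp_bounded (\<lambda>l. real (det_bound n l))"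
  unfolding det_bound_def Let_def of_nat_mult of_nat_add of_nat_power of_nat_1 of_nat_numeral
  by (intro exp_bounded_intros exp_bounded_algebraic)

text \<open>Cramer's rule bounds the entries of the inverse; the square of the dimension passes to
  the operator norm.\<close>

definition inverse_bound :: "nat \<Rightarrow> nat \<Rightarrow> real" where
  "inverse_bound n l = (real n)\<^sup>2 * (fact n * entry_bound l ^ n * real (det_bound n l))"

definition form_bound :: "nat \<Rightarrow> nat \<Rightarrow> real" where
  "form_bound n l = (real n)\<^sup>2 * entry_bound l"

definition speed_bound :: "nat \<Rightarrow> nat \<Rightarrow> real" where
  "speed_bound n l = inverse_bound n l * form_bound n l"

text \<open>Equal to \<open>4 * form_bound n l * entry_bound l\<close>: the gap of the speeds is at
  least a nonzero entry divided by \<open>4 * form_bound n l\<close>. Being a natural number, it is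
  a multiple of every dyadic time step \<open>1 / 2 ^ k\<close>.\<close>

definition time_bound :: "nat \<Rightarrow> nat \<Rightarrow> nat" where
  "time_bound n l = 4 * n\<^sup>2 * (l * algebraic_bound l + 1)\<^sup>2"

text \<open>The factors are for the components, the monomials, repeated differentiation, and the
  size of the coefficients. The summand \<open>1\<close> beside the inverse lets one bound serve for
  \<phi> as well as for \<open>A\<^sup>-\<^sup>1 f\<close>.\<close>

definition data_bound :: "nat \<Rightarrow> nat \<Rightarrow> nat \<Rightarrow> real" where
  "data_bound n m l = real n * real ((l + 1) ^ (m + 1)) * (real l ^ (m * l) * (2 ^ l * (inverse_bound n l + 1)))"

text \<open>The source coefficient of \<open>t ^ k\<close> with \<open>k \<le> l\<close> must fit
  into the degree class \<open>D - Suc k\<close>, and \<open>D - (l + 1) = m * l + 1\<close> is just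
  enough for degree \<open>m * l\<close> in space.\<close>

definition degree_bound :: "nat \<Rightarrow> nat \<Rightarrow> nat" where
  "degree_bound m l = (m + 1) * l + 2"

definition solution_bound :: "nat \<Rightarrow> nat \<Rightarrow> nat \<Rightarrow> real" where
  "solution_bound n m l = (real m + 1) * real (degree_bound m l) ^ 3 * real (time_bound n l) ^ degree_bound m l *
     ((real m * speed_bound n l + 1) ^ degree_bound m l * data_bound n m l)"

text \<open>A sum of nonnegative bounds, hence above each of them; it is the \<open>K\<close> of the
  error estimates.\<close>

definition total_bound :: "nat \<Rightarrow> nat \<Rightarrow> nat \<Rightarrow> real" where
  "total_bound n m l = 1 + real (time_bound n l) + real m * speed_bound n l + form_bound n l + inverse_bound n l +
     solution_bound n m l"

lemma exp_bounded_total: "exp_bounded (total_bound n m)"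
proof -
  have inv: "exp_bounded (inverse_bound n)"
    unfolding inverse_bound_def[abs_def] by (intro exp_bounded_intros exp_bounded_entry exp_bounded_det)
  have form: "exp_bounded (form_bound n)"
    unfolding form_bound_def[abs_def] by (intro exp_bounded_intros exp_bounded_entry)
  have speed: "exp_bounded (speed_bound n)"
    unfolding speed_bound_def[abs_def] by (intro exp_bounded_intros inv form)
  have time: "exp_bounded (\<lambda>l. real (time_bound n l))"
    unfolding time_bound_def of_nat_mult of_nat_add of_nat_power of_nat_1 of_nat_numeral
    by (intro exp_bounded_intros exp_bounded_algebraic)
  have data: "exp_bounded (data_bound n m)"
    unfolding data_bound_def[abs_def] by (intro exp_bounded_intros inv)
  have deg: "poly_bounded (degree_bound m)"
    unfolding degree_bound_def[abs_def] by (intro exp_bounded_intros)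
  have sol: "exp_bounded (solution_bound n m)"
    unfolding solution_bound_def[abs_def] by (intro exp_bounded_intros deg speed time data)
  show ?thesis
    unfolding total_bound_def[abs_def] by (intro exp_bounded_intros time speed form inv sol)
qed

lemma grid_exponent:
  obtains k where "\<And>l N. 2 \<le> l \<Longrightarrow> N = (l + 1) ^ k - 1 \<Longrightarrow> \<exists>r. 2 \<le> r \<and> (12 * m + 1) * r \<le> N \<and>
     32400 * 4 ^ m * (real m + 1)\<^sup>2 * total_bound n m l ^ 10 * (2 ^ l)\<^sup>2 \<le> 2 ^ r"
proof -
  have "exp_bounded (\<lambda>l. 32400 * 4 ^ m * (real m + 1)\<^sup>2 * total_bound n m l ^ 10 * (2 ^ l)\<^sup>2)"
    by (intro exp_bounded_intros exp_bounded_total)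
  then obtain c where c: "\<And>l. 2 \<le> l \<Longrightarrow>
      \<bar>32400 * 4 ^ m * (real m + 1)\<^sup>2 * total_bound n m l ^ 10 * (2 ^ l)\<^sup>2\<bar> \<le> 2 ^ (l ^ c)"
    unfolding exp_bounded_def by blast
  \<comment> \<open>With \<open>r = l ^ Suc c\<close>, the factor \<open>12 * m + 1\<close> is
    absorbed by \<open>l ^ (12 * m + 1)\<close>. Passing from \<open>l ^ k\<close> to
    \<open>(l + 1) ^ k\<close> is a strict increase and pays for the subtracted \<open>1\<close> in
    \<open>N\<close>.\<close>
  define k where "k = Suc c + (12 * m + 1)"
  show thesis
  proof (rule that[of k])
    fix l N :: nat assume l: "2 \<le> l" and N: "N = (l + 1) ^ k - 1"
    have "l ^ 1 \<le> l ^ Suc c" using l by (intro power_increasing) auto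
    then have r2: "2 \<le> l ^ Suc c" using l by (metis order_trans power_one_right)
    have "12 * m + 1 \<le> 2 ^ (12 * m + 1)" using less_exp[of "12 * m + 1"] by simp
    also have "\<dots> \<le> l ^ (12 * m + 1)" using l by (intro power_mono) auto
    finally have "(12 * m + 1) * l ^ Suc c \<le> l ^ (12 * m + 1) * l ^ Suc c" by (intro mult_le_mono) auto
    also have "\<dots> = l ^ k" by (simp add: k_def power_add)
    also have "\<dots> < (l + 1) ^ k" by (intro power_strict_mono) (auto simp: k_def)
    finally have "(12 * m + 1) * l ^ Suc c \<le> N" using N by simp
    moreover have "(2 :: real) ^ (l ^ c) \<le> 2 ^ (l ^ Suc c)" using l by (intro power_increasing) auto
    ultimately show "\<exists>r. 2 \<le> r \<and> (12 * m + 1) * r \<le> N \<and>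
        32400 * 4 ^ m * (real m + 1)\<^sup>2 * total_bound n m l ^ 10 * (2 ^ l)\<^sup>2 \<le> 2 ^ r"
      using r2 c[OF l] by (intro exI[of _ "l ^ Suc c"]) linarith
  qed
qed

section \<open>From the length of the code to numerical bounds\<close>

lemma set_index_list: "set (index_list :: 'a::{finite,linorder} list) = UNIV"
  by (simp add: index_list_def)

lemma input_word_bounds:
  fixes a :: int and \<phi> :: "'n::{finite,linorder} \<Rightarrow> 'm::{finite,linorder} qpoly"
    and f :: "'n \<Rightarrow> 'm option qpoly" and A :: "'n sqmat" and B :: "'m \<Rightarrow> 'n sqmat"
  defines "l \<equiv> length (input_word a \<phi> f A B)"
  shows "2 \<le> l" "\<bar>a\<bar> \<le> 2 ^ l"
    "length (word (code_qpoly index_list (\<phi> j))) \<le> l"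
    "length (word (code_qpoly (None # map Some index_list) (f j))) \<le> l"
    "length (word (code_alg (A $ i $ j))) \<le> l"
    "length (word (code_alg (B k $ i $ j))) \<le> l"
proof -
  define cs where "cs = [Num a,
      Seq (map (\<lambda>j. code_qpoly index_list (\<phi> j)) index_list),
      Seq (map (\<lambda>j. code_qpoly (None # map Some index_list) (f j)) index_list),
      code_matrix A,
      Seq (map (\<lambda>i. code_matrix (B i)) index_list)]"
  have l: "l = length (word (Seq cs))" by (simp only: l_def input_word_def cs_def)
  show "2 \<le> l" using length_le_length_word_Seq[of cs] unfolding l by linarith
  have c: "length (word c) \<le> l" if "c \<in> set cs" for c unfolding l by (rule length_word_mem[OF that])
  have c2: "length (word c) \<le> l" if "c \<in> set ds" "Seq ds \<in> set cs" for c ds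
    using length_word_mem[OF that(1)] c[OF that(2)] by linarith
  have "\<bar>a\<bar> \<le> 2 ^ length (word (Num a))" using abs_lt_power_length_word[of a] by linarith
  also have "\<dots> \<le> 2 ^ l" using c[of "Num a"] by (intro power_increasing) (auto simp: cs_def)
  finally show "\<bar>a\<bar> \<le> 2 ^ l" .
  show "length (word (code_qpoly index_list (\<phi> j))) \<le> l"
    by (rule c2[of _ "map (\<lambda>j. code_qpoly index_list (\<phi> j)) index_list"]) (auto simp: cs_def set_index_list)
  show "length (word (code_qpoly (None # map Some index_list) (f j))) \<le> l"
    by (rule c2[of _ "map (\<lambda>j. code_qpoly (None # map Some index_list) (f j)) index_list"]) (auto simp: cs_def set_index_list)
  have entry: "code_alg (M $ i $ j) \<in> set [code_alg (M $ i $ j). i \<leftarrow> index_list, j \<leftarrow> index_list]"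
    for M :: "'n sqmat" and i j
    by (auto simp: set_index_list)
  show "length (word (code_alg (A $ i $ j))) \<le> l"
    by (rule c2[OF entry[of A i j]]) (simp add: cs_def code_matrix_def)
  have "length (word (code_alg (B k $ i $ j))) \<le> length (word (code_matrix (B k)))"
    unfolding code_matrix_def by (rule length_word_mem[OF entry])
  also have "\<dots> \<le> l"
    by (rule c2[of _ "map (\<lambda>i. code_matrix (B i)) index_list"]) (auto simp: cs_def set_index_list)
  finally show "length (word (code_alg (B k $ i $ j))) \<le> l" .
qed

lemma entry_le:
  assumes "algebraic \<alpha>" "length (word (code_alg \<alpha>)) \<le> l"
  shows "\<bar>\<alpha>\<bar> \<le> entry_bound l" "\<alpha> \<noteq> 0 \<Longrightarrow> 1 \<le> \<bar>\<alpha>\<bar> * entry_bound l"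
proof -
  obtain d c a where r: "integral_relation l (algebraic_bound l) \<alpha> d c a"
    using ex_integral_relation[OF assms] by blast
  show "\<bar>\<alpha>\<bar> \<le> entry_bound l" using integral_relation_abs_le[OF r] by (simp add: entry_bound_def)
  show "1 \<le> \<bar>\<alpha>\<bar> * entry_bound l" if "\<alpha> \<noteq> 0"
    using integral_relation_abs_ge[OF r that] by (simp add: entry_bound_def)
qed

lemma entry_bound_ge_1: "1 \<le> entry_bound l"
  by (simp add: entry_bound_def)

lemma card_keys_le:
  fixes p :: "'v::finite qpoly"
  assumes "\<And>e v. e \<in> Poly_Mapping.keys p \<Longrightarrow> Poly_Mapping.lookup e v \<le> l"
  shows "card (Poly_Mapping.keys p) \<le> (l + 1) ^ CARD('v)"
proof -
  have "card (Poly_Mapping.keys p) = card (Poly_Mapping.lookup ` Poly_Mapping.keys p)"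
    by (intro card_image[symmetric] inj_onI) (simp add: poly_mapping_eqI)
  also have "\<dots> \<le> card (\<Pi>\<^sub>E v\<in>(UNIV :: 'v set). {..l})"
    using assms by (intro card_mono) (auto simp: finite_PiE PiE_iff)
  finally show ?thesis by (simp add: card_PiE)
qed

lemma abs_generalized_eigenvalue_le:
  fixes A B :: "real ^ 'n ^ 'n"
  assumes A: "positive_definite A" and B: "symmetric_matrix B"
    and \<beta>: "\<And>x. \<bar>energy B x\<bar> \<le> \<beta> * energy A x"
  shows "mu_max A B \<le> \<beta>" "- mu_min A B \<le> \<beta>"
proof -
  let ?E = "eigenvalues (matrix_inv A ** B)"
  have fin: "finite ?E" by (rule finite_generalized_eigenvalues[OF A B])
  have ne: "?E \<noteq> {}" using ex_max_generalized_eigenvalue[OF A B] by blast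
  have "\<bar>\<mu>\<bar> \<le> \<beta>" if "\<mu> \<in> ?E" for \<mu>
  proof -
    have "\<exists>v. v \<noteq> 0 \<and> (matrix_inv A ** B) *v v = \<mu> *\<^sub>R v"
      using that unfolding eigenvalues_def mem_Collect_eq .
    then obtain v where v0: "v \<noteq> 0" "(matrix_inv A ** B) *v v = \<mu> *\<^sub>R v"
      by (elim exE conjE)
    have v: "v \<noteq> 0" "matrix_inv A *v (B *v v) = \<mu> *\<^sub>R v"
      using v0 by (auto simp only: matrix_vector_mul_assoc)
    have "A *v (matrix_inv A *v (B *v v)) = B *v v"
      by (rule matrix_inv_vector(1)[OF positive_definite_invertible[OF A]])
    then have "B *v v = A *v (\<mu> *\<^sub>R v)" unfolding v(2) by (rule sym)
    then have "energy B v = \<mu> * energy A v" by (simp add: energy_def matrix_vector_mult_scaleR)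
    moreover have pos: "0 < energy A v" by (rule positive_definite_energy[OF A v(1)])
    ultimately have "\<bar>\<mu>\<bar> * energy A v \<le> \<beta> * energy A v" using \<beta>[of v] by (simp add: abs_mult)
    then show ?thesis using pos by simp
  qed
  then show "mu_max A B \<le> \<beta>" "- mu_min A B \<le> \<beta>"
    using Max_in[OF fin ne] Min_in[OF fin ne] unfolding mu_max_def mu_min_def
    by (force simp: abs_le_iff)+
qed

text \<open>The coefficient of \<open>t\<^sup>k\<close> in \<open>A\<^sup>-\<^sup>1 f\<close>.\<close>

definition source_coeff :: "real ^ 'n ^ 'n \<Rightarrow> ('n::finite \<Rightarrow> 'm::finite option qpoly) \<Rightarrow> nat \<Rightarrow> real ^ 'm \<Rightarrow> real ^ 'n" where
  "source_coeff A f k x = (\<Sum>j\<in>UNIV. \<Sum>e\<in>Poly_Mapping.keys (f j).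
     if Poly_Mapping.lookup e None = k
     then (\<Prod>i\<in>UNIV. x $ i ^ Poly_Mapping.lookup e (Some i)) *\<^sub>R
       (of_rat (Poly_Mapping.lookup (f j) e) *\<^sub>R (matrix_inv A *v axis j 1)) else 0)"

lemma time_poly_source_coeff:
  fixes f :: "'n::finite \<Rightarrow> 'm::finite option qpoly"
  assumes "\<And>j e. e \<in> Poly_Mapping.keys (f j) \<Longrightarrow> Poly_Mapping.lookup e None < D"
  shows "time_poly D (source_coeff A f) z = matrix_inv A *v spacetime_field f z"
proof -
  obtain t x where z: "z = (t, x)" by (cases z)
  define c where "c j e = (\<Prod>i\<in>UNIV. x $ i ^ Poly_Mapping.lookup e (Some i)) *\<^sub>R
       (of_rat (Poly_Mapping.lookup (f j) e) *\<^sub>R (matrix_inv A *v axis j 1))" for j e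
  have "time_poly D (source_coeff A f) z = (\<Sum>k<D. \<Sum>j\<in>UNIV. \<Sum>e\<in>Poly_Mapping.keys (f j).
      if Poly_Mapping.lookup e None = k then t ^ k *\<^sub>R c j e else 0)"
    unfolding time_poly_def source_coeff_def z scaleR_sum_right
    by (intro sum.cong refl) (simp add: c_def)
  also have "\<dots> = (\<Sum>j\<in>UNIV. \<Sum>e\<in>Poly_Mapping.keys (f j). \<Sum>k<D.
      if Poly_Mapping.lookup e None = k then t ^ k *\<^sub>R c j e else 0)"
    by (subst sum.swap) (intro sum.cong refl sum.swap)
  also have "\<dots> = (\<Sum>j\<in>UNIV. \<Sum>e\<in>Poly_Mapping.keys (f j). t ^ Poly_Mapping.lookup e None *\<^sub>R c j e)"
    using assms by (intro sum.cong refl) simp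
  also have "\<dots> = (\<Sum>j\<in>UNIV. eval_qpoly (f j) (case_option t (\<lambda>i. x $ i)) *\<^sub>R (matrix_inv A *v axis j 1))"
  proof (rule sum.cong[OF refl])
    fix j :: 'n
    have "(\<Prod>v\<in>UNIV. case_option t (\<lambda>i. x $ i) v ^ Poly_Mapping.lookup e v) =
        t ^ Poly_Mapping.lookup e None * (\<Prod>i\<in>UNIV. x $ i ^ Poly_Mapping.lookup e (Some i))"
      for e :: "'m option \<Rightarrow>\<^sub>0 nat"
      by (simp add: UNIV_option_conv prod.reindex)
    then show "(\<Sum>e\<in>Poly_Mapping.keys (f j). t ^ Poly_Mapping.lookup e None *\<^sub>R c j e) =
        eval_qpoly (f j) (case_option t (\<lambda>i. x $ i)) *\<^sub>R (matrix_inv A *v axis j 1)"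
      unfolding eval_qpoly_def scaleR_sum_left by (intro sum.cong) (simp_all add: c_def mult_ac)
  qed
  also have "\<dots> = matrix_inv A *v (\<Sum>j\<in>UNIV. eval_qpoly (f j) (case_option t (\<lambda>i. x $ i)) *\<^sub>R axis j 1)"
    by (simp add: linear_sum[OF matrix_vector_mul_linear] matrix_vector_mult_scaleR)
  also have "(\<Sum>j\<in>UNIV. eval_qpoly (f j) (case_option t (\<lambda>i. x $ i)) *\<^sub>R axis j 1) = spacetime_field f z"
    unfolding z spacetime_field_def by (auto simp: vec_eq_iff axis_def if_distrib cong: if_cong)
  finally show ?thesis .
qed

lemma sum_exponents_le:
  fixes e :: "'v::finite \<Rightarrow> nat"
  assumes "\<And>v. e v \<le> l"
  shows "sum e UNIV \<le> CARD('v) * l"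
  using sum_mono[of UNIV e "\<lambda>_. l"] assms by simp

lemma source_coeff_bdd:
  fixes f :: "'n::finite \<Rightarrow> 'm::finite option qpoly"
  assumes f: "\<And>j e v. e \<in> Poly_Mapping.keys (f j) \<Longrightarrow>
      \<bar>Poly_Mapping.lookup (f j) e\<bar> \<le> 2 ^ l \<and> (\<forall>v. Poly_Mapping.lookup e v \<le> l)"
    and l: "1 \<le> l" and R: "\<And>y. norm (matrix_inv A *v y) \<le> R * norm y" "0 \<le> R"
  shows "poly_map_bdd (Suc (CARD('m) * l))
     (real CARD('n) * real ((l + 1) ^ (CARD('m) + 1)) * (real l ^ (CARD('m) * l) * (2 ^ l * R))) (source_coeff A f k)"
proof -
  define X where "X = real l ^ (CARD('m) * l) * (2 ^ l * R)"
  have X: "0 \<le> X" using R by (simp add: X_def)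
  have "poly_map_bdd (Suc (CARD('m) * l)) (\<Sum>j\<in>(UNIV :: 'n set). \<Sum>e\<in>Poly_Mapping.keys (f j). X) (source_coeff A f k)"
    unfolding source_coeff_def[abs_def]
  proof (intro poly_map_bdd_sum)
    fix j e assume e: "e \<in> Poly_Mapping.keys (f j)"
    define v where "v = of_rat (Poly_Mapping.lookup (f j) e) *\<^sub>R (matrix_inv A *v axis j 1)"
    show "poly_map_bdd (Suc (CARD('m) * l)) X (\<lambda>x. if Poly_Mapping.lookup e None = k
       then (\<Prod>i\<in>UNIV. x $ i ^ Poly_Mapping.lookup e (Some i)) *\<^sub>R
       (of_rat (Poly_Mapping.lookup (f j) e) *\<^sub>R (matrix_inv A *v axis j 1)) else 0)"
    proof (cases "Poly_Mapping.lookup e None = k")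
      case True
      have "poly_map_bdd (Suc (CARD('m) * l)) (real l ^ (CARD('m) * l) * norm v)
          (\<lambda>x. (\<Prod>i\<in>UNIV. x $ i ^ Poly_Mapping.lookup e (Some i)) *\<^sub>R v)"
        using f[OF e] l by (intro poly_map_bdd_monomial sum_exponents_le) auto
      moreover have "norm v \<le> 2 ^ l * R"
      proof -
        have "\<bar>real_of_rat (Poly_Mapping.lookup (f j) e)\<bar> = real_of_rat \<bar>Poly_Mapping.lookup (f j) e\<bar>" by simp
        also have "\<dots> \<le> real_of_rat (2 ^ l)" using f[OF e] by (simp only: of_rat_less_eq)
        finally have "\<bar>real_of_rat (Poly_Mapping.lookup (f j) e)\<bar> \<le> 2 ^ l" by (simp add: of_rat_power)
        moreover have "norm (matrix_inv A *v axis j 1) \<le> R" using R(1)[of "axis j 1"] by (simp add: norm_axis_1)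
        ultimately show ?thesis unfolding v_def norm_scaleR using R by (intro mult_mono) auto
      qed
      ultimately have "poly_map_bdd (Suc (CARD('m) * l)) X
          (\<lambda>x. (\<Prod>i\<in>UNIV. x $ i ^ Poly_Mapping.lookup e (Some i)) *\<^sub>R v)"
        unfolding X_def by (elim poly_map_bdd_mono) (auto intro!: mult_left_mono)
      then show ?thesis using True by (simp add: v_def del: poly_map_bdd.simps)
    next
      case False
      then show ?thesis using poly_map_bdd_zero[OF X] by (simp del: poly_map_bdd.simps)
    qed
  qed auto
  moreover have "(\<Sum>j\<in>(UNIV :: 'n set). \<Sum>e\<in>Poly_Mapping.keys (f j). X) \<le>
      (\<Sum>j\<in>(UNIV :: 'n set). real ((l + 1) ^ (CARD('m) + 1)) * X)"
  proof (rule sum_mono)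
    fix j :: 'n
    have "card (Poly_Mapping.keys (f j)) \<le> (l + 1) ^ CARD('m option)"
      using f by (intro card_keys_le) blast
    then have "real (card (Poly_Mapping.keys (f j))) \<le> real ((l + 1) ^ (CARD('m) + 1))"
      by (simp only: of_nat_le_iff) (simp add: card_UNIV_option)
    then show "(\<Sum>e\<in>Poly_Mapping.keys (f j). X) \<le> real ((l + 1) ^ (CARD('m) + 1)) * X"
      using X by (simp add: mult_right_mono)
  qed
  ultimately have "poly_map_bdd (Suc (CARD('m) * l)) (\<Sum>j\<in>(UNIV :: 'n set). real ((l + 1) ^ (CARD('m) + 1)) * X)
      (source_coeff A f k)" by (rule poly_map_bdd_mono)
  then show ?thesis by (simp add: X_def mult.assoc del: poly_map_bdd.simps)
qed

lemma space_field_bdd: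
  fixes \<phi> :: "'n::finite \<Rightarrow> 'm::finite qpoly"
  assumes \<phi>: "\<And>j e v. e \<in> Poly_Mapping.keys (\<phi> j) \<Longrightarrow>
      \<bar>Poly_Mapping.lookup (\<phi> j) e\<bar> \<le> 2 ^ l \<and> (\<forall>v. Poly_Mapping.lookup e v \<le> l)"
    and l: "1 \<le> l"
  shows "poly_map_bdd (Suc (CARD('m) * l))
     (real CARD('n) * real ((l + 1) ^ CARD('m)) * (real l ^ (CARD('m) * l) * 2 ^ l)) (space_field \<phi>)"
proof -
  define X :: real where "X = real l ^ (CARD('m) * l) * 2 ^ l"
  have X: "0 \<le> X" by (simp add: X_def)
  define v :: "'n \<Rightarrow> ('m \<Rightarrow>\<^sub>0 nat) \<Rightarrow> real ^ 'n" where "v j e =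
      of_rat (Poly_Mapping.lookup (\<phi> j) e) *\<^sub>R axis j 1" for j e
  have sf: "space_field \<phi> = (\<lambda>x. \<Sum>j\<in>UNIV. \<Sum>e\<in>Poly_Mapping.keys (\<phi> j).
      (\<Prod>i\<in>UNIV. x $ i ^ Poly_Mapping.lookup e i) *\<^sub>R v j e)"
  proof
    fix x :: "real ^ 'm"
    have "space_field \<phi> x = (\<Sum>j\<in>UNIV. eval_qpoly (\<phi> j) (\<lambda>i. x $ i) *\<^sub>R axis j 1)"
      by (auto simp: space_field_def vec_eq_iff axis_def if_distrib cong: if_cong)
    also have "\<dots> = (\<Sum>j\<in>UNIV. \<Sum>e\<in>Poly_Mapping.keys (\<phi> j).
      (\<Prod>i\<in>UNIV. x $ i ^ Poly_Mapping.lookup e i) *\<^sub>R v j e)"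
      unfolding eval_qpoly_def scaleR_sum_left by (intro sum.cong refl) (simp add: v_def mult.commute)
    finally show "space_field \<phi> x = (\<Sum>j\<in>UNIV. \<Sum>e\<in>Poly_Mapping.keys (\<phi> j).
      (\<Prod>i\<in>UNIV. x $ i ^ Poly_Mapping.lookup e i) *\<^sub>R v j e)" .
  qed
  have "poly_map_bdd (Suc (CARD('m) * l)) (\<Sum>j\<in>(UNIV :: 'n set). \<Sum>e\<in>Poly_Mapping.keys (\<phi> j). X) (space_field \<phi>)"
    unfolding sf
  proof (intro poly_map_bdd_sum)
    fix j e assume e: "e \<in> Poly_Mapping.keys (\<phi> j)"
    have "poly_map_bdd (Suc (CARD('m) * l)) (real l ^ (CARD('m) * l) * norm (v j e))
        (\<lambda>x. (\<Prod>i\<in>UNIV. x $ i ^ Poly_Mapping.lookup e i) *\<^sub>R v j e)"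
      using \<phi>[OF e] l by (intro poly_map_bdd_monomial sum_exponents_le) auto
    moreover have "norm (v j e) \<le> 2 ^ l"
    proof -
      have "\<bar>real_of_rat (Poly_Mapping.lookup (\<phi> j) e)\<bar> = real_of_rat \<bar>Poly_Mapping.lookup (\<phi> j) e\<bar>" by simp
      also have "\<dots> \<le> real_of_rat (2 ^ l)" using \<phi>[OF e] by (simp only: of_rat_less_eq)
      finally show ?thesis by (simp add: v_def norm_axis_1 of_rat_power)
    qed
    ultimately show "poly_map_bdd (Suc (CARD('m) * l)) X
        (\<lambda>x. (\<Prod>i\<in>UNIV. x $ i ^ Poly_Mapping.lookup e i) *\<^sub>R v j e)"
      unfolding X_def by (elim poly_map_bdd_mono) (auto intro!: mult_left_mono)
  qed auto
  moreover have "(\<Sum>j\<in>(UNIV :: 'n set). \<Sum>e\<in>Poly_Mapping.keys (\<phi> j). X) \<le>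
      (\<Sum>j\<in>(UNIV :: 'n set). real ((l + 1) ^ CARD('m)) * X)"
  proof (rule sum_mono)
    fix j :: 'n
    have "card (Poly_Mapping.keys (\<phi> j)) \<le> (l + 1) ^ CARD('m)"
      using \<phi> by (intro card_keys_le) blast
    then have "real (card (Poly_Mapping.keys (\<phi> j))) \<le> real ((l + 1) ^ CARD('m))"
      by (simp only: of_nat_le_iff)
    then show "(\<Sum>e\<in>Poly_Mapping.keys (\<phi> j). X) \<le> real ((l + 1) ^ CARD('m)) * X"
      using X by (simp add: mult_right_mono)
  qed
  ultimately have "poly_map_bdd (Suc (CARD('m) * l)) (\<Sum>j\<in>(UNIV :: 'n set). real ((l + 1) ^ CARD('m)) * X)
      (space_field \<phi>)" by (rule poly_map_bdd_mono)
  then show ?thesis by (simp add: X_def mult.assoc del: poly_map_bdd.simps)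
qed

text \<open>All that is used of the input word is its length \<open>l\<close>, as a bound for
  coefficients, exponents and the codes of matrix entries.\<close>

locale cauchy_input =
  fixes l :: nat and \<phi> :: "'n::{finite,linorder} \<Rightarrow> 'm::finite qpoly" and f :: "'n \<Rightarrow> 'm option qpoly"
    and A :: "'n sqmat" and B :: "'m \<Rightarrow> 'n sqmat"
  assumes l: "2 \<le> l"
    and \<phi>: "\<And>j e v. e \<in> Poly_Mapping.keys (\<phi> j) \<Longrightarrow>
      \<bar>Poly_Mapping.lookup (\<phi> j) e\<bar> \<le> 2 ^ l \<and> (\<forall>v. Poly_Mapping.lookup e v \<le> l)"
    and f: "\<And>j e v. e \<in> Poly_Mapping.keys (f j) \<Longrightarrow>
      \<bar>Poly_Mapping.lookup (f j) e\<bar> \<le> 2 ^ l \<and> (\<forall>v. Poly_Mapping.lookup e v \<le> l)"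
    and A: "positive_definite A" "algebraic_matrix A" "\<And>i j. length (word (code_alg (A $ i $ j))) \<le> l"
    and B: "\<And>i. algebraic_matrix (B i)" "\<And>i. symmetric_matrix (B i)"
      "\<And>i. mu_min A (B i) < 0" "\<And>i. 0 < mu_max A (B i)"
      "\<And>i j k. length (word (code_alg (B i $ j $ k))) \<le> l"
begin

abbreviation "mx \<equiv> \<lambda>i. mu_max A (B i)"
abbreviation "mn \<equiv> \<lambda>i. mu_min A (B i)"

lemma abs_entry_le: "\<bar>A $ i $ j\<bar> \<le> entry_bound l" "\<bar>B k $ i $ j\<bar> \<le> entry_bound l"
  "B k $ i $ j \<noteq> 0 \<Longrightarrow> 1 \<le> \<bar>B k $ i $ j\<bar> * entry_bound l"
  using entry_le(1)[OF _ A(3)] entry_le[OF _ B(5)] A(2) B(1) by (auto simp: algebraic_matrix_def)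

lemma det_ge: "1 \<le> \<bar>det A\<bar> * real (det_bound CARD('n) l)"
  using algebraic_det_ge[OF A(2,3)] positive_definite_invertible[OF A(1)] by (simp add: invertible_det_nz)

lemma norm_inverse_le: "norm (matrix_inv A *v y) \<le> inverse_bound CARD('n) l * norm y"
proof -
  have "\<bar>matrix_inv A $ i $ j\<bar> \<le> fact CARD('n) * entry_bound l ^ CARD('n) * real (det_bound CARD('n) l)" for i j
    by (intro abs_matrix_inv_le abs_entry_le entry_bound_ge_1 positive_definite_invertible[OF A(1)] det_ge)
  then show ?thesis using norm_matrix_vector_le[of "matrix_inv A"]
    by (auto simp: inverse_bound_def power2_eq_square)
qed

lemma inverse_bound_pos: "0 < inverse_bound CARD('n) l"
proof -
  have "det_bound CARD('n) l \<noteq> 0" using det_ge by (metis mult_zero_right not_one_le_zero of_nat_0)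
  then show ?thesis using entry_bound_ge_1[of l] by (simp add: inverse_bound_def)
qed

lemma form_bound_pos: "0 < form_bound CARD('n) l"
  using entry_bound_ge_1[of l] by (simp add: form_bound_def)

lemma speed_bound_pos: "0 < speed_bound CARD('n) l"
  using inverse_bound_pos form_bound_pos by (simp add: speed_bound_def)

lemma abs_energy_le: "\<bar>energy A y\<bar> \<le> form_bound CARD('n) l * (norm y)\<^sup>2"
    "\<bar>energy (B i) y\<bar> \<le> form_bound CARD('n) l * (norm y)\<^sup>2"
  unfolding energy_def
  using abs_bilinear_le[of A "entry_bound l" y y] abs_bilinear_le[of "B i" "entry_bound l" y y] abs_entry_le
  by (auto simp: form_bound_def power2_eq_square mult_ac)

lemma norm_le_energy_A: "(norm y)\<^sup>2 \<le> inverse_bound CARD('n) l * energy A y"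
proof (rule norm_le_energy[OF A(1) _ inverse_bound_pos])
  fix x
  have "energy A (matrix_inv A *v x) = (matrix_inv A *v x) \<bullet> x"
    by (simp add: energy_def matrix_inv_vector(1)[OF positive_definite_invertible[OF A(1)]])
  also have "\<dots> \<le> norm (matrix_inv A *v x) * norm x" by (rule norm_cauchy_schwarz)
  also have "\<dots> \<le> inverse_bound CARD('n) l * norm x * norm x" by (intro mult_right_mono norm_inverse_le) auto
  finally show "energy A (matrix_inv A *v x) \<le> inverse_bound CARD('n) l * (norm x)\<^sup>2" by (simp add: power2_eq_square mult_ac)
qed

lemma abs_energy_B_le: "\<bar>energy (B i) y\<bar> \<le> speed_bound CARD('n) l * energy A y"
proof -
  have "\<bar>energy (B i) y\<bar> \<le> form_bound CARD('n) l * (norm y)\<^sup>2" by (rule abs_energy_le(2))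
  also have "\<dots> \<le> form_bound CARD('n) l * (inverse_bound CARD('n) l * energy A y)"
    using form_bound_pos by (intro mult_left_mono norm_le_energy_A) auto
  finally show ?thesis by (simp add: speed_bound_def mult_ac)
qed

lemma norm_speed_matrix_le: "norm ((matrix_inv A ** B i) *v y) \<le> speed_bound CARD('n) l * norm y"
proof -
  have "norm (B i *v y) \<le> form_bound CARD('n) l * norm y"
    using norm_matrix_vector_le[of "B i" "entry_bound l" y] abs_entry_le(2)
    by (auto simp: form_bound_def power2_eq_square mult_ac)
  then have "inverse_bound CARD('n) l * norm (B i *v y) \<le> inverse_bound CARD('n) l * (form_bound CARD('n) l * norm y)"
    using inverse_bound_pos by (intro mult_left_mono) auto
  then show ?thesis using norm_inverse_le[of "B i *v y"]
    by (auto simp: speed_bound_def matrix_vector_mul_assoc[symmetric] mult_ac)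
qed

lemma speeds_le: "mx i \<le> speed_bound CARD('n) l" "- mn i \<le> speed_bound CARD('n) l"
  by (intro abs_generalized_eigenvalue_le A(1) B(2) abs_energy_B_le)+

text \<open>A nonzero extremal speed excludes \<open>B i0 = 0\<close>. A nonzero entry is at least
  the reciprocal of \<open>entry_bound l\<close>, and the gap of the speeds inherits a lower bound
  from it.\<close>

lemma domain_subset: "domain_H A B \<subseteq> {0..real (time_bound CARD('n) l)} \<times> unit_cube"
proof (rule domain_H_subset[OF B(3,4)])
  fix i0 :: 'm
  have "\<exists>i j. B i0 $ i $ j \<noteq> 0"
  proof (rule ccontr)
    assume "\<not> ?thesis"
    then have z: "B i0 = 0" by (simp add: vec_eq_iff)
    obtain \<mu> where \<mu>: "\<mu> \<in> eigenvalues (matrix_inv A ** B i0)" "\<mu> = mx i0"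
      using Max_in[OF finite_generalized_eigenvalues[OF A(1) B(2)[of i0]]]
        ex_max_generalized_eigenvalue[OF A(1) B(2)[of i0]] unfolding mu_max_def by blast
    have "mx i0 = 0"
      using \<mu> unfolding eigenvalues_def by (auto simp: z)
    then show False using B(4)[of i0] by simp
  qed
  then obtain i j where nz: "B i0 $ i $ j \<noteq> 0" by blast
  define e where "e = entry_bound l"
  have e: "1 \<le> e" by (simp add: e_def entry_bound_ge_1)
  have "energy A x \<le> form_bound CARD('n) l * (norm x)\<^sup>2" for x using abs_energy_le(1)[of x] by linarith
  then have "\<bar>B i0 $ i $ j\<bar> \<le> 4 * form_bound CARD('n) l * (mx i0 - mn i0)"
    by (intro mu_gap_ge A(1) B(2,3,4) form_bound_pos)
  then have "\<bar>B i0 $ i $ j\<bar> * e \<le> 4 * form_bound CARD('n) l * (mx i0 - mn i0) * e" using e by (intro mult_right_mono) auto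
  moreover have "4 * form_bound CARD('n) l * e = real (time_bound CARD('n) l)"
    by (simp add: form_bound_def time_bound_def e_def entry_bound_def power2_eq_square algebra_simps)
  then have "4 * form_bound CARD('n) l * (mx i0 - mn i0) * e = real (time_bound CARD('n) l) * (mx i0 - mn i0)"
    by (simp add: mult_ac flip: \<open>4 * form_bound CARD('n) l * e = real (time_bound CARD('n) l)\<close>)
  ultimately show "1 \<le> real (time_bound CARD('n) l) * (mx i0 - mn i0)" using abs_entry_le(3)[OF nz] unfolding e_def by linarith
qed

lemma time_bound_ge_1: "1 \<le> real (time_bound CARD('n) l)"
proof -
  have "1 \<le> time_bound CARD('n) l" by (simp add: time_bound_def Suc_le_eq)
  then show ?thesis by simp
qed

lemma data_bound_nonneg: "0 \<le> data_bound CARD('n) CARD('m) l"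
  using inverse_bound_pos by (simp add: data_bound_def)

lemma le_total_bound:
  "1 \<le> total_bound CARD('n) CARD('m) l" "real (time_bound CARD('n) l) \<le> total_bound CARD('n) CARD('m) l"
      "real CARD('m) * speed_bound CARD('n) l \<le> total_bound CARD('n) CARD('m) l"
      "speed_bound CARD('n) l \<le> total_bound CARD('n) CARD('m) l" "form_bound CARD('n) l \<le> total_bound CARD('n) CARD('m) l"
      "inverse_bound CARD('n) l \<le> total_bound CARD('n) CARD('m) l" "solution_bound CARD('n) CARD('m) l \<le> total_bound CARD('n) CARD('m) l"
proof -
  have s: "0 \<le> solution_bound CARD('n) CARD('m) l" using data_bound_nonneg speed_bound_pos by (simp add: solution_bound_def)
  have "1 \<le> real CARD('m)" by (simp add: Suc_le_eq)
  then have "1 * speed_bound CARD('n) l \<le> real CARD('m) * speed_bound CARD('n) l" using speed_bound_pos by (intro mult_right_mono) auto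
  then show "1 \<le> total_bound CARD('n) CARD('m) l" "real (time_bound CARD('n) l) \<le> total_bound CARD('n) CARD('m) l"
      "real CARD('m) * speed_bound CARD('n) l \<le> total_bound CARD('n) CARD('m) l"
      "speed_bound CARD('n) l \<le> total_bound CARD('n) CARD('m) l" "form_bound CARD('n) l \<le> total_bound CARD('n) CARD('m) l"
      "inverse_bound CARD('n) l \<le> total_bound CARD('n) CARD('m) l" "solution_bound CARD('n) CARD('m) l \<le> total_bound CARD('n) CARD('m) l"
    using s inverse_bound_pos form_bound_pos speed_bound_pos time_bound_ge_1 unfolding total_bound_def by linarith+
qed

lemma source_coeff_eq_0:
  assumes "l < k"
  shows "source_coeff A f k x = 0"
proof -
  have "Poly_Mapping.lookup e None \<noteq> k" if "e \<in> Poly_Mapping.keys (f j)" for j e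
    using f[OF that] assms by (metis not_le)
  then show ?thesis unfolding source_coeff_def by (intro sum.neutral ballI) simp
qed

lemma data_bdd:
  "poly_map_bdd (degree_bound CARD('m) l) (data_bound CARD('n) CARD('m) l) (space_field \<phi>)"
      "poly_map_bdd (degree_bound CARD('m) l - Suc k) (data_bound CARD('n) CARD('m) l) (source_coeff A f k)"
  "poly_map_bdd (degree_bound CARD('m) l) (data_bound CARD('n) CARD('m) l) (source_coeff A f k)"
proof -
  have l1: "1 \<le> l" using l by simp
  define c where "c = real CARD('n) * real ((l + 1) ^ CARD('m)) * (real l ^ (CARD('m) * l) * 2 ^ l)"
  have c: "0 \<le> c" by (simp add: c_def)
  have "1 * 1 \<le> (real l + 1) * (inverse_bound CARD('n) l + 1)"
    using inverse_bound_pos by (intro mult_mono) auto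
  then have "c * 1 \<le> c * ((real l + 1) * (inverse_bound CARD('n) l + 1))"
    using c by (intro mult_left_mono) auto
  also have "\<dots> = data_bound CARD('n) CARD('m) l" by (simp add: c_def data_bound_def algebra_simps)
  finally have cd: "c \<le> data_bound CARD('n) CARD('m) l" by simp
  have le: "Suc (CARD('m) * l) \<le> degree_bound CARD('m) l" by (simp add: degree_bound_def)
  have "poly_map_bdd (Suc (CARD('m) * l)) c (space_field \<phi>)"
    unfolding c_def by (rule space_field_bdd[OF \<phi> l1])
  then show "poly_map_bdd (degree_bound CARD('m) l) (data_bound CARD('n) CARD('m) l) (space_field \<phi>)"
    using poly_map_bdd_le[OF poly_map_bdd_mono[OF _ cd] data_bound_nonneg le] by blast
  define s where "s = real CARD('n) * real ((l + 1) ^ (CARD('m) + 1)) * (real l ^ (CARD('m) * l) * (2 ^ l * inverse_bound CARD('n) l))"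
  have sd: "s \<le> data_bound CARD('n) CARD('m) l"
    unfolding s_def data_bound_def by (intro mult_left_mono) auto
  have "poly_map_bdd (Suc (CARD('m) * l)) s (source_coeff A f k)"
    unfolding s_def using inverse_bound_pos by (intro source_coeff_bdd f l1 norm_inverse_le) auto
  then have *: "poly_map_bdd (Suc (CARD('m) * l)) (data_bound CARD('n) CARD('m) l) (source_coeff A f k)"
    by (rule poly_map_bdd_mono[OF _ sd])
  then show "poly_map_bdd (degree_bound CARD('m) l) (data_bound CARD('n) CARD('m) l) (source_coeff A f k)"
    by (rule poly_map_bdd_le[OF _ data_bound_nonneg le])
  show "poly_map_bdd (degree_bound CARD('m) l - Suc k) (data_bound CARD('n) CARD('m) l) (source_coeff A f k)"
  proof (cases "k \<le> l")
    case True
    then show ?thesis by (intro poly_map_bdd_le[OF * data_bound_nonneg]) (auto simp: degree_bound_def)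
  next
    case False
    then have "source_coeff A f k = (\<lambda>_. 0)" using source_coeff_eq_0 by auto
    then show ?thesis using poly_map_bdd_zero[OF data_bound_nonneg] by simp
  qed
qed

definition G where
  "G z = matrix_inv A *v spacetime_field f z"

lemma G_eq: "G z = time_poly (degree_bound CARD('m) l) (source_coeff A f) z"
  unfolding G_def
proof (rule time_poly_source_coeff[symmetric])
  fix j e assume "e \<in> Poly_Mapping.keys (f j)"
  then have "Poly_Mapping.lookup e None \<le> l" using f by blast
  then show "Poly_Mapping.lookup e None < degree_bound CARD('m) l" by (simp add: degree_bound_def)
qed

lemma solution_bound_ge:
  "(real CARD('m) + 1) * (real (degree_bound CARD('m) l))\<^sup>2 *
      real (time_bound CARD('n) l) ^ degree_bound CARD('m) l * data_bound CARD('n) CARD('m) l \<le> solution_bound CARD('n) CARD('m) l"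
  "real (degree_bound CARD('m) l) * real (time_bound CARD('n) l) ^ degree_bound CARD('m) l *
      data_bound CARD('n) CARD('m) l \<le> solution_bound CARD('n) CARD('m) l"
proof -
  have D: "1 \<le> real (degree_bound CARD('m) l)" by (simp add: degree_bound_def)
  have T: "0 \<le> real (time_bound CARD('n) l) ^ degree_bound CARD('m) l" by simp
  have "(real CARD('m) + 1) * (real (degree_bound CARD('m) l))\<^sup>2 *
      real (time_bound CARD('n) l) ^ degree_bound CARD('m) l * (1 * data_bound CARD('n) CARD('m) l) \<le>
      (real CARD('m) + 1) * real (degree_bound CARD('m) l) ^ 3 *
          real (time_bound CARD('n) l) ^ degree_bound CARD('m) l * ((real CARD('m) * speed_bound CARD('n) l +
          1) ^ degree_bound CARD('m) l * data_bound CARD('n) CARD('m) l)"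
    using D data_bound_nonneg speed_bound_pos
    by (intro mult_mono mult_right_mono one_le_power power_increasing) auto
  then show a: "(real CARD('m) + 1) * (real (degree_bound CARD('m) l))\<^sup>2 *
      real (time_bound CARD('n) l) ^ degree_bound CARD('m) l * data_bound CARD('n) CARD('m) l \<le> solution_bound CARD('n) CARD('m) l"
    by (simp add: solution_bound_def)
  have "real (degree_bound CARD('m) l) ^ 1 \<le> real (degree_bound CARD('m) l) ^ 2" using D by (intro power_increasing) auto
  then have "1 * real (degree_bound CARD('m) l) \<le> (real CARD('m) + 1) * (real (degree_bound CARD('m) l))\<^sup>2"
    using D by (intro mult_mono) auto
  then have "1 * real (degree_bound CARD('m) l) * real (time_bound CARD('n) l) ^ degree_bound CARD('m) l *
      data_bound CARD('n) CARD('m) l \<le> (real CARD('m) + 1) * (real (degree_bound CARD('m) l))\<^sup>2 *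
      real (time_bound CARD('n) l) ^ degree_bound CARD('m) l * data_bound CARD('n) CARD('m) l"
    using data_bound_nonneg by (intro mult_right_mono) auto
  then show "real (degree_bound CARD('m) l) * real (time_bound CARD('n) l) ^ degree_bound CARD('m) l *
      data_bound CARD('n) CARD('m) l \<le> solution_bound CARD('n) CARD('m) l" using a by simp
qed

lemma G_bounds:
  assumes "z \<in> {0..real (time_bound CARD('n) l)} \<times> unit_cube"
  shows "norm (G z) \<le> total_bound CARD('n) CARD('m) l"
      "z' \<in> {0..real (time_bound CARD('n) l)} \<times> unit_cube \<Longrightarrow> norm (G z - G z') \<le>
      total_bound CARD('n) CARD('m) l * norm (z - z')"
proof -
  have "norm (G z) \<le> real (degree_bound CARD('m) l) * real (time_bound CARD('n) l) ^ degree_bound CARD('m) l * data_bound CARD('n) CARD('m) l"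
    unfolding G_eq by (rule time_poly_norm_le[OF data_bdd(3) data_bound_nonneg time_bound_ge_1 assms])
  then show "norm (G z) \<le> total_bound CARD('n) CARD('m) l" using solution_bound_ge(2) le_total_bound(7) by linarith
  assume z': "z' \<in> {0..real (time_bound CARD('n) l)} \<times> unit_cube"
  have "norm (G z - G z') \<le> (real CARD('m) + 1) * (real (degree_bound CARD('m) l))\<^sup>2 *
      real (time_bound CARD('n) l) ^ degree_bound CARD('m) l * data_bound CARD('n) CARD('m) l * norm (z - z')"
    unfolding G_eq
    by (rule time_poly_lipschitz[OF data_bdd(3) data_bound_nonneg _ time_bound_ge_1 assms z'])
      (auto simp: degree_bound_def intro!: source_coeff_eq_0)
  also have "\<dots> \<le> total_bound CARD('n) CARD('m) l *
      norm (z - z')" using solution_bound_ge(1) le_total_bound(7) by (intro mult_right_mono) auto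
  finally show "norm (G z - G z') \<le> total_bound CARD('n) CARD('m) l * norm (z - z')" .
qed

lemma domain_eq: "domain_H A B = space_cone mx mn"
  by (simp add: domain_H_def space_cone_def)

lemma compact_domain: "compact (domain_H A B)"
proof -
  have "(unit_cube :: (real ^ 'm) set) = cbox (\<chi> i. 0) (\<chi> i. 1)" by (auto simp: unit_cube_def mem_box_cart)
  then have "compact (unit_cube :: (real ^ 'm) set)" by (metis compact_cbox)
  then have "compact ({0..real (time_bound CARD('n) l)} \<times> (unit_cube :: (real ^ 'm) set))"
    by (intro compact_Times compact_Icc)
  moreover have "domain_H A B = ({0..real (time_bound CARD('n) l)} \<times> unit_cube) \<inter> space_cone mx mn"
    using domain_subset unfolding domain_eq by blast
  ultimately show ?thesis by (metis closed_space_cone compact_Int_closed)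
qed

lemma upwind_cone_input:
  assumes PQ: "\<And>i. pos_semidef (P i)" "\<And>i. pos_semidef (Q i)" "\<And>i. B i = P i - Q i"
    "\<And>i x. energy (P i) x + energy (Q i) x \<le> speed_bound CARD('n) l * energy A x"
    and \<tau>: "0 < \<tau>" "\<tau> * 2 ^ N * (real CARD('m) * speed_bound CARD('n) l) \<le> 1"
  shows "upwind_cone A P Q N \<tau> (real CARD('m) * speed_bound CARD('n) l) mx mn"
proof
  fix x
  have "(\<Sum>i\<in>UNIV. energy (P i) x + energy (Q i) x) \<le> (\<Sum>i\<in>(UNIV :: 'm set). speed_bound CARD('n) l * energy A x)"
    by (intro sum_mono PQ(4))
  then show "(\<Sum>i\<in>UNIV. energy (P i) x + energy (Q i) x) \<le> real CARD('m) * speed_bound CARD('n) l * energy A x"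
    by simp
  fix i
  have e: "energy (P i) x - energy (Q i) x = energy (B i) x" by (simp add: PQ(3) energy_diff_matrix)
  show "energy (P i) x - energy (Q i) x \<le> mx i * energy A x"
    unfolding e by (rule energy_le_mu_max[OF A(1) B(2)])
  show "mn i * energy A x \<le> energy (P i) x - energy (Q i) x"
    unfolding e by (rule mu_min_energy_le[OF A(1) B(2)])
qed (use A PQ \<tau> B(3,4) speed_bound_pos in \<open>auto intro: less_imp_le\<close>)

text \<open>The difference to the smooth solution \<open>p\<close> has zero data; thus every
  classical solution on \<open>H\<close> inherits the explicit bounds of \<open>p\<close>.\<close>

lemma cauchy_solution_unique:
  fixes P Q :: "'m \<Rightarrow> 'n sqmat"
  assumes PQ: "\<And>i. pos_semidef (P i)" "\<And>i. pos_semidef (Q i)" "\<And>i. B i = P i - Q i"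
    "\<And>i x. energy (P i) x + energy (Q i) x \<le> speed_bound CARD('n) l * energy A x"
    and u: "cauchy_solution A B F \<psi> u"
    and dp: "\<And>z. (p has_derivative (\<lambda>w. fst w *\<^sub>R pt z + (\<Sum>i\<in>UNIV. snd w $ i *\<^sub>R px i z))) (at z)"
    and cont: "continuous_on (domain_H A B) pt" "\<And>i. continuous_on (domain_H A B) (px i)"
    and pde: "\<And>z. A *v pt z + (\<Sum>i\<in>UNIV. B i *v px i z) = F z"
    and p0: "\<And>x. p (0, x) = \<psi> x"
    and z: "z \<in> domain_H A B"
  shows "u z = p z"
proof -
  let ?H = "domain_H A B"
  obtain u' where u'': "\<forall>z\<in>?H. (u has_derivative u' z) (at z within ?H)"
    "\<forall>d. continuous_on ?H (\<lambda>z. u' z d)"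
    "\<forall>z\<in>?H. A *v u' z (1, 0) + (\<Sum>i\<in>UNIV. B i *v u' z (0, axis i 1)) = F z"
    using u unfolding cauchy_solution_def by (elim conjE exE)
  note u' = u''(1)[rule_format] u''(2)[rule_format] u''(3)[rule_format]
  have u0: "\<And>x. x \<in> unit_cube \<Longrightarrow> u (0, x) = \<psi> x"
    using u by (simp add: cauchy_solution_def)
  \<comment> \<open>A derivative in the sense of \<open>cauchy_solution\<close> is only a linear
    map; it is brought into the form with partial derivatives that the uniqueness lemma
    expects.\<close>
  have u'_eq: "u' z v = fst v *\<^sub>R u' z (1, 0) + (\<Sum>i\<in>UNIV. snd v $ i *\<^sub>R u' z (0, axis i 1))"
    if "z \<in> ?H" for z v
  proof -
    have lin: "linear (u' z)" using has_derivative_linear[OF u'(1)[OF that]] .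
    have "v = fst v *\<^sub>R (1, 0) + (\<Sum>i\<in>UNIV. snd v $ i *\<^sub>R (0, axis i 1))"
    proof (rule prod_eqI)
      show "fst v = fst (fst v *\<^sub>R (1, 0) + (\<Sum>i\<in>UNIV. snd v $ i *\<^sub>R (0, axis i 1)) :: real \<times> (real ^ 'm))"
        by (simp add: fst_sum)
      show "snd v = snd (fst v *\<^sub>R (1, 0) + (\<Sum>i\<in>UNIV. snd v $ i *\<^sub>R (0, axis i 1)) :: real \<times> (real ^ 'm))"
        by (auto simp: snd_sum vec_eq_iff axis_def if_distrib cong: if_cong)
    qed
    then have "u' z v = u' z (fst v *\<^sub>R (1, 0) + (\<Sum>i\<in>UNIV. snd v $ i *\<^sub>R (0, axis i 1)))" by simp
    also have "\<dots> = fst v *\<^sub>R u' z (1, 0) + (\<Sum>i\<in>UNIV. snd v $ i *\<^sub>R u' z (0, axis i 1))"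
      unfolding linear_add[OF lin] linear_sum[OF lin] linear_scale[OF lin] ..
    finally show ?thesis .
  qed
  have "u z - p z = 0"
  proof (rule zero_data_solution[where w = "\<lambda>z. u z - p z" and wt = "\<lambda>z. u' z (1, 0) - pt z"
        and wx = "\<lambda>i z. u' z (0, axis i 1) - px i z" and A = A and P = P and Q = Q and mx = mx and mn = mn
        and b = "real CARD('m) * speed_bound CARD('n) l" and R = "total_bound CARD('n) CARD('m) l",
        folded domain_eq])
    show "upwind_cone A P Q N \<tau> (real CARD('m) * speed_bound CARD('n) l) mx mn"
      if "0 < \<tau>" "\<tau> * 2 ^ N * (real CARD('m) * speed_bound CARD('n) l) \<le> 1" for N \<tau>
      by (rule upwind_cone_input[OF PQ that])
    show "compact ?H" by (rule compact_domain)
    show "((\<lambda>z. u z - p z) has_derivative (\<lambda>v. fst v *\<^sub>R (u' z (1, 0) - pt z) +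
        (\<Sum>i\<in>UNIV. snd v $ i *\<^sub>R (u' z (0, axis i 1) - px i z)))) (at z within ?H)" if "z \<in> ?H" for z
    proof -
      have "((\<lambda>z. u z - p z) has_derivative (\<lambda>v. u' z v - (fst v *\<^sub>R pt z + (\<Sum>i\<in>UNIV. snd v $ i *\<^sub>R px i z))))
          (at z within ?H)"
        by (intro has_derivative_diff u'(1)[OF that] has_derivative_at_withinI[OF dp])
      moreover have "u' z v - (fst v *\<^sub>R pt z + (\<Sum>i\<in>UNIV. snd v $ i *\<^sub>R px i z)) =
          fst v *\<^sub>R (u' z (1, 0) - pt z) + (\<Sum>i\<in>UNIV. snd v $ i *\<^sub>R (u' z (0, axis i 1) - px i z))" for v
        unfolding u'_eq[OF that, of v] by (simp add: scaleR_diff_right sum_subtractf)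
      ultimately show ?thesis by simp
    qed
    show "continuous_on ?H (\<lambda>z. u' z (1, 0) - pt z)" by (intro continuous_on_diff u'(2) cont)
    show "continuous_on ?H (\<lambda>z. u' z (0, axis i 1) - px i z)" for i by (intro continuous_on_diff u'(2) cont)
    show "A *v (u' z (1, 0) - pt z) + (\<Sum>i\<in>UNIV. (P i - Q i) *v (u' z (0, axis i 1) - px i z)) = 0"
      if "z \<in> ?H" for z
      using u'(3)[OF that] pde[of z]
      by (simp add: PQ(3)[symmetric] matrix_vector_mult_diff_distrib sum_subtractf algebra_simps)
    show "u (0, x) - p (0, x) = 0" if "(0, x) \<in> ?H" for x
      using that domain_subset u0 p0 by auto
    show "energy A y \<le> total_bound CARD('n) CARD('m) l * (norm y)\<^sup>2" for y
      using abs_energy_le(1)[of y] mult_right_mono[OF le_total_bound(5), of "(norm y)\<^sup>2"] by simp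
    show "(norm y)\<^sup>2 \<le> total_bound CARD('n) CARD('m) l * energy A y" for y
      using norm_le_energy_A[of y] mult_right_mono[OF le_total_bound(6), of "energy A y"]
        positive_definite_pos_semidef[OF A(1)] by (auto simp: pos_semidef_def intro: order_trans)
    show "0 < total_bound CARD('n) CARD('m) l" using le_total_bound(1) by linarith
    show "0 \<le> real CARD('m) * speed_bound CARD('n) l" using speed_bound_pos by simp
    show "0 \<le> mx i" "mn i \<le> 0" for i using B(3,4)[of i] by simp_all
    show "z \<in> ?H" by (rule z)
  qed
  then show ?thesis by simp
qed

lemma godunov_error:
  fixes a :: real
  assumes sm: "scheme_matrices A B \<mu> Tm"
    and u: "cauchy_solution A B (spacetime_field f) (space_field \<phi>) u"
    and a: "1 \<le> a" and r: "2 \<le> r" "(12 * CARD('m) + 1) * r \<le> N"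
    and X: "32400 * 4 ^ CARD('m) * (real CARD('m) + 1)\<^sup>2 * total_bound CARD('n) CARD('m) l ^ 10 * a\<^sup>2 \<le> 2 ^ r"
  shows "sL2_norm (domain_H A B) (\<lambda>z. u z - interpolate N (1 / 2 ^ (2 * N)) (time_bound CARD('n) l * 4 ^ N)
      (godunov A B \<mu> Tm (spacetime_field f) (space_field \<phi>) N (1 / 2 ^ (2 * N))) z) < ennreal (1 / a)"
proof -
  define K where "K = total_bound CARD('n) CARD('m) l"
  define T where "T = real (time_bound CARD('n) l)"
  define b where "b = real CARD('m) * speed_bound CARD('n) l"
  define \<tau> :: real where "\<tau> = 1 / 2 ^ (2 * N)"
  define L where "L = time_bound CARD('n) l * 4 ^ N"
  define U where "U = godunov A B \<mu> Tm (spacetime_field f) (space_field \<phi>) N \<tau>"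
  have bounds: "1 \<le> K" "T \<le> K" "b \<le> K" "speed_bound CARD('n) l \<le> K" "form_bound CARD('n) l \<le> K"
    "inverse_bound CARD('n) l \<le> K" "solution_bound CARD('n) CARD('m) l \<le> K"
    using le_total_bound unfolding K_def T_def b_def by blast+
  have T1: "1 \<le> T" using time_bound_ge_1 by (simp add: T_def)
  have \<tau>: "0 < \<tau>" "\<tau> = 1 / 2 ^ N * (1 / 2 ^ N)" by (simp_all add: \<tau>_def mult_2 power_add)
  have LT: "real L * \<tau> = T" by (simp add: L_def \<tau>_def T_def power_mult)
  obtain P Q where PQ: "\<And>i. pos_semidef (P i)" "\<And>i. pos_semidef (Q i)" "\<And>i. B i = P i - Q i"
    "\<And>i x. energy (P i) x + energy (Q i) x \<le> speed_bound CARD('n) l * energy A x"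
    and flux: "\<And>N U i j. B i *v face_value N \<mu> Tm U i j =
       P i *v U (j(i := wrap N (j i))) - Q i *v U (j(i := wrap N (j i + 1)))"
    using upwind_split[OF A(1) sm abs_energy_B_le] by blast
  have K2: "K \<le> 2 ^ N"
  proof -
    have a2: "1 \<le> a\<^sup>2" using a by (simp add: one_le_power)
    have m2: "1 \<le> (real CARD('m) + 1)\<^sup>2" by (simp add: one_le_power)
    have m4: "1 \<le> (4 :: real) ^ CARD('m)" by simp
    have "K ^ 1 \<le> K ^ 10" using bounds(1) by (intro power_increasing) auto
    then have "1 * 1 * 1 * K * 1 \<le> 32400 * 4 ^ CARD('m) * (real CARD('m) + 1)\<^sup>2 * K ^ 10 * a\<^sup>2"
      using bounds(1) a2 m2 by (intro mult_mono) auto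
    also have "\<dots> \<le> 2 ^ r" using X by (simp add: K_def)
    also have "\<dots> \<le> 2 ^ N"
    proof (rule power_increasing)
      have "1 * r \<le> (12 * CARD('m) + 1) * r" by (intro mult_le_mono) auto
      then show "r \<le> N" using r(2) by simp
    qed simp
    finally show ?thesis by simp
  qed
  \<comment> \<open>As \<open>\<tau> = h\<^sup>2\<close>, the Courant number is
    \<open>b / 2 ^ N\<close>, and \<open>2 ^ N\<close> exceeds every constant bounded by
    \<open>K\<close>.\<close>
  have cfl: "\<tau> * 2 ^ N * b \<le> 1"
    using bounds(3) K2 by (simp add: \<tau>(2) field_simps)
  have up: "upwind_cone A P Q N \<tau> b mx mn"
    unfolding b_def by (rule upwind_cone_input[OF PQ \<tau>(1) cfl[unfolded b_def]])
  have deg: "1 \<le> degree_bound CARD('m) l" by (simp add: degree_bound_def)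
  obtain p pt px where
    deriv: "\<And>z. (p has_derivative (\<lambda>w. fst w *\<^sub>R pt z + (\<Sum>i\<in>UNIV. snd w $ i *\<^sub>R px i z))) (at z)"
    and pde: "\<And>z. pt z + (\<Sum>i\<in>UNIV. (matrix_inv A ** B i) *v px i z) =
       time_poly (degree_bound CARD('m) l) (source_coeff A f) z"
    and p0: "\<And>x. p (0, x) = space_field \<phi> x"
    and p_le: "\<And>z. z \<in> {0..T} \<times> unit_cube \<Longrightarrow> norm (p z) \<le> solution_bound CARD('n) CARD('m) l"
    and p_lip: "\<And>z z'. z \<in> {0..T} \<times> unit_cube \<Longrightarrow> z' \<in> {0..T} \<times> unit_cube \<Longrightarrow>
       norm (p z - p z') \<le> solution_bound CARD('n) CARD('m) l * norm (z - z')"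
    and pt_lip: "\<And>z z'. z \<in> {0..T} \<times> unit_cube \<Longrightarrow> z' \<in> {0..T} \<times> unit_cube \<Longrightarrow>
       norm (pt z - pt z') \<le> solution_bound CARD('n) CARD('m) l * norm (z - z')"
    and px_lip: "\<And>i z z'. z \<in> {0..T} \<times> unit_cube \<Longrightarrow> z' \<in> {0..T} \<times> unit_cube \<Longrightarrow>
       norm (px i z - px i z') \<le> solution_bound CARD('n) CARD('m) l * norm (z - z')"
    by (rule polynomial_solution[OF norm_speed_matrix_le less_imp_le[OF speed_bound_pos] data_bdd(1,2)
          data_bound_nonneg time_bound_ge_1 deg, folded solution_bound_def T_def]) (rule that)
  have A_inv: "A *v (matrix_inv A *v x) = x" for x
    by (rule matrix_inv_vector(1)[OF positive_definite_invertible[OF A(1)]])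
  have pde': "A *v pt z + (\<Sum>i\<in>UNIV. B i *v px i z) = spacetime_field f z" for z
  proof -
    have "pt z + (\<Sum>i\<in>UNIV. (matrix_inv A ** B i) *v px i z) = G z" by (simp add: pde G_eq)
    then have "A *v (pt z + (\<Sum>i\<in>UNIV. (matrix_inv A ** B i) *v px i z)) = spacetime_field f z"
      by (simp add: G_def A_inv)
    then show ?thesis
      by (simp add: matrix_vector_right_distrib linear_sum[OF matrix_vector_mul_linear]
          matrix_vector_mul_assoc[symmetric] A_inv)
  qed
  have lipK: "x \<le> K * norm w" if "x \<le> solution_bound CARD('n) CARD('m) l * norm w" for x and w :: "real \<times> (real ^ 'm)"
    using that mult_right_mono[OF bounds(7) norm_ge_zero[of w]] by linarith
  interpret uc: upwind_cone A P Q N \<tau> b mx mn by (rule up)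
  interpret scheme_error A P Q N \<tau> b mx mn K T L p pt G px U
  proof
    show "1 \<le> K" "1 \<le> T" "T \<le> K" "real L * \<tau> = T" "b \<le> K" by (fact bounds T1 LT)+
    show "\<tau> \<le> 1 / 2 ^ N" unfolding \<tau>(2) by (simp add: divide_simps)
    show "energy A y \<le> K * (norm y)\<^sup>2" for y
      using abs_energy_le(1)[of y] mult_right_mono[OF bounds(5), of "(norm y)\<^sup>2"] by simp
    show "(norm y)\<^sup>2 \<le> K * energy A y" for y
      using norm_le_energy_A[of y] mult_right_mono[OF bounds(6) uc.energy_nonneg(1)] by (rule order_trans)
    show "(p has_derivative (\<lambda>w. fst w *\<^sub>R pt z + (\<Sum>i\<in>UNIV. snd w $ i *\<^sub>R px i z)))
        (at z within {0..T} \<times> unit_cube)" for z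
      by (rule has_derivative_at_withinI[OF deriv])
    show "A *v pt z + (\<Sum>i\<in>UNIV. (P i - Q i) *v px i z) = A *v G z" for z
      using pde'[of z] by (simp add: PQ(3)[symmetric] G_def A_inv)
    show "norm (p z) \<le> K" if "z \<in> {0..T} \<times> unit_cube" for z using p_le[OF that] bounds(7) by linarith
    show "norm (p z - p z') \<le> K * norm (z - z')" "norm (pt z - pt z') \<le> K * norm (z - z')"
      "norm (px i z - px i z') \<le> K * norm (z - z')"
      if "z \<in> {0..T} \<times> unit_cube" "z' \<in> {0..T} \<times> unit_cube" for i z z'
      by (rule lipK p_lip pt_lip px_lip that)+
    show "norm (G z) \<le> K" if "z \<in> {0..T} \<times> unit_cube" for z
      using G_bounds(1) that unfolding K_def T_def .
    show "norm (G z - G z') \<le> K * norm (z - z')"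
      if "z \<in> {0..T} \<times> unit_cube" "z' \<in> {0..T} \<times> unit_cube" for z z'
      using G_bounds(2) that unfolding K_def T_def .
    show "U 0 j = p (0, grid_point N j)" for j by (simp add: U_def p0)
    show "U (Suc k) j = uc.sweep (U k) j + \<tau> *\<^sub>R G (real k * \<tau>, grid_point N j)"
      if "j \<in> grid_indices N" for k j
      unfolding U_def G_def by (rule godunov_sweep[OF uc.upwind_axioms flux that])
  qed
  have cone_eq: "uc.cone = domain_H A B" by (simp add: uc.cone_def domain_eq space_cone_def)
  have sub: "domain_H A B \<subseteq> {0..T} \<times> unit_cube" using domain_subset by (simp add: T_def)
  have K0: "0 \<le> K" using bounds(1) by simp
  have lip_cont: "continuous_on (domain_H A B) g"
    if "\<And>z z'. z \<in> {0..T} \<times> unit_cube \<Longrightarrow> z' \<in> {0..T} \<times> unit_cube \<Longrightarrow> norm (g z - g z') \<le> K * norm (z - z')"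
    for g
  proof (rule lipschitz_on_continuous_on[where L = K], rule lipschitz_onI[OF _ K0])
    fix z z' assume "z \<in> domain_H A B" "z' \<in> domain_H A B"
    then show "dist (g z) (g z') \<le> K * dist z z'" using that sub unfolding dist_norm by blast
  qed
  have up_eq: "u z = p z" if "z \<in> domain_H A B" for z
  proof (rule cauchy_solution_unique[OF PQ u deriv _ _ pde' p0 that])
    show "continuous_on (domain_H A B) pt" by (intro lip_cont pt_lip)
    show "continuous_on (domain_H A B) (px i)" for i by (intro lip_cont px_lip)
  qed
  have "sL2_norm uc.cone (\<lambda>z. u z - interpolate N \<tau> L U z) < ennreal (1 / a)"
  proof (rule final_error[OF a r X[folded K_def]])
    show "mx i \<le> K" "- mn i \<le> K" for i using speeds_le[of i] bounds(4) by linarith+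
    show "\<tau> = h * h" by (simp add: h_def \<tau>(2))
    show "fst z \<le> T" if "z \<in> uc.cone" for z using that sub unfolding cone_eq by auto
    show "u z = p z" if "z \<in> uc.cone" for z using up_eq that by (simp add: cone_eq)
  qed
  then show ?thesis unfolding cone_eq \<tau>_def L_def U_def .
qed

end

theorem proposition4:
  shows "\<exists>(M :: tm) (p :: nat poly). turing_machine M \<and>
    (\<forall>(a :: int)
       (\<phi> :: 'n::{finite,linorder} \<Rightarrow> 'm::{finite,linorder} qpoly)
       (f :: 'n \<Rightarrow> 'm option qpoly)
       (A :: 'n sqmat)
       (B :: 'm \<Rightarrow> 'n sqmat).
      a \<ge> 1 \<and>
      algebraic_matrix A \<and> symmetric_matrix A \<and> positive_definite A \<and>
      (\<forall>i. algebraic_matrix (B i) \<and> symmetric_matrix (B i) \<and>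
           mu_min A (B i) < 0 \<and> 0 < mu_max A (B i)) \<longrightarrow>
      (\<exists>(N :: nat) (\<tau> :: rat) (T :: rat) (L :: nat).
         computes_within M (poly p (length (input_word a \<phi> f A B)))
           (input_word a \<phi> f A B) (output_word (1 / 2 ^ N) \<tau>) \<and>
         \<tau> > 0 \<and> T > 0 \<and> T = of_nat L * \<tau> \<and>
         domain_H A B \<subseteq> {0..real_of_rat T} \<times> unit_cube \<and>
         (\<forall>\<mu> Tm u.
            scheme_matrices A B \<mu> Tm \<longrightarrow>
            cauchy_solution A B (spacetime_field f) (space_field \<phi>) u \<longrightarrow>
            sL2_norm (domain_H A B)
              (\<lambda>z. u z - interpolate N (real_of_rat \<tau>) L
                 (godunov A B \<mu> Tm (spacetime_field f) (space_field \<phi>) N (real_of_rat \<tau>)) z)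
            < ennreal (1 / real_of_int a))))"
proof -
  \<comment> \<open>The exponent depends only on the two dimensions, so the machine and its time
    bound are fixed before any input.\<close>
  obtain k where k: "\<And>l N. 2 \<le> l \<Longrightarrow> N = (l + 1) ^ k - 1 \<Longrightarrow> \<exists>r. 2 \<le> r \<and> (12 * CARD('m) + 1) * r \<le> N \<and>
     32400 * 4 ^ CARD('m) * (real CARD('m) + 1)\<^sup>2 * total_bound CARD('n) CARD('m) l ^ 10 * (2 ^ l)\<^sup>2 \<le> 2 ^ r"
    using grid_exponent[of "CARD('m)" "CARD('n)"] by blast
  obtain M :: tm and p :: "nat poly" where M: "turing_machine M"
    "\<And>w. let N = (length w + 1) ^ k - 1 in computes_within M (poly p (length w)) w (output_word (1 / 2 ^ N) (1 / 2 ^ (2 * N)))"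
    using polynomial_time_grid[of k] by blast
  show ?thesis
  proof (intro exI[of _ M] exI[of _ p] conjI M(1) allI impI)
    fix a :: int and \<phi> :: "'n \<Rightarrow> 'm qpoly" and f :: "'n \<Rightarrow> 'm option qpoly" and A :: "'n sqmat" and B :: "'m \<Rightarrow> 'n sqmat"
    assume hyp: "a \<ge> 1 \<and> algebraic_matrix A \<and> symmetric_matrix A \<and> positive_definite A \<and>
      (\<forall>i. algebraic_matrix (B i) \<and> symmetric_matrix (B i) \<and> mu_min A (B i) < 0 \<and> 0 < mu_max A (B i))"
    define l where "l = length (input_word a \<phi> f A B)"
    note w = input_word_bounds[where a = a and \<phi> = \<phi> and f = f and A = A and B = B, folded l_def]
    interpret cauchy_input l \<phi> f A B
    proof
      show "2 \<le> l" by (rule w(1))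
      show "\<bar>Poly_Mapping.lookup (\<phi> j) e\<bar> \<le> 2 ^ l \<and> (\<forall>v. Poly_Mapping.lookup e v \<le> l)"
        if "e \<in> Poly_Mapping.keys (\<phi> j)" for j e
        by (rule code_qpoly_bounds[OF _ that w(3)]) (rule set_index_list)
      show "\<bar>Poly_Mapping.lookup (f j) e\<bar> \<le> 2 ^ l \<and> (\<forall>v. Poly_Mapping.lookup e v \<le> l)"
        if "e \<in> Poly_Mapping.keys (f j)" for j e
        by (rule code_qpoly_bounds[OF _ that w(4)]) (simp add: set_index_list UNIV_option_conv)
    qed (use hyp w(5,6) in auto)
    define N where "N = (l + 1) ^ k - 1"
    define T where "T = time_bound CARD('n) l"
    obtain r where r: "2 \<le> r" "(12 * CARD('m) + 1) * r \<le> N"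
      "32400 * 4 ^ CARD('m) * (real CARD('m) + 1)\<^sup>2 * total_bound CARD('n) CARD('m) l ^ 10 * (2 ^ l)\<^sup>2 \<le> 2 ^ r"
      using k[OF w(1) N_def] by blast
    have a: "1 \<le> real_of_int a" using hyp by simp
    have "real_of_int a \<le> 2 ^ l"
    proof -
      have "a \<le> 2 ^ l" using w(2) by linarith
      then have "real_of_int a \<le> real_of_int (2 ^ l)" by (simp only: of_int_le_iff)
      then show ?thesis by simp
    qed
    then have "(real_of_int a)\<^sup>2 \<le> (2 ^ l)\<^sup>2" using a by (intro power_mono) auto
    then have "32400 * 4 ^ CARD('m) * (real CARD('m) + 1)\<^sup>2 * total_bound CARD('n) CARD('m) l ^ 10 * (real_of_int a)\<^sup>2
        \<le> 32400 * 4 ^ CARD('m) * (real CARD('m) + 1)\<^sup>2 * total_bound CARD('n) CARD('m) l ^ 10 * (2 ^ l)\<^sup>2"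
      by (intro mult_left_mono) auto
    note X = order_trans[OF this r(3)]
    have T: "real (time_bound CARD('n) l) = real_of_rat (of_nat T)" by (simp add: T_def)
    have \<tau>: "real_of_rat (1 / 2 ^ (2 * N)) = 1 / 2 ^ (2 * N)" by (simp add: of_rat_divide of_rat_power)
    \<comment> \<open>The time step is \<open>1 / 4 ^ N\<close>, so an integer final time is reached
      after \<open>T * 4 ^ N\<close> steps.\<close>
    have LT: "of_nat T = of_nat (T * 4 ^ N) * (1 / 2 ^ (2 * N) :: rat)" by (simp add: power_mult)
    have cw: "computes_within M (poly p (length (input_word a \<phi> f A B)))
           (input_word a \<phi> f A B) (output_word (1 / 2 ^ N) (1 / 2 ^ (2 * N)))"
      using M(2)[of "input_word a \<phi> f A B"] unfolding N_def l_def Let_def .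
    have T0: "0 < (of_nat T :: rat)" using time_bound_ge_1 by (simp add: T_def)
    show "\<exists>(N :: nat) (\<tau> :: rat) (T :: rat) (L :: nat).
         computes_within M (poly p (length (input_word a \<phi> f A B)))
           (input_word a \<phi> f A B) (output_word (1 / 2 ^ N) \<tau>) \<and>
         \<tau> > 0 \<and> T > 0 \<and> T = of_nat L * \<tau> \<and>
         domain_H A B \<subseteq> {0..real_of_rat T} \<times> unit_cube \<and>
         (\<forall>\<mu> Tm u.
            scheme_matrices A B \<mu> Tm \<longrightarrow>
            cauchy_solution A B (spacetime_field f) (space_field \<phi>) u \<longrightarrow>
            sL2_norm (domain_H A B)
              (\<lambda>z. u z - interpolate N (real_of_rat \<tau>) L
                 (godunov A B \<mu> Tm (spacetime_field f) (space_field \<phi>) N (real_of_rat \<tau>)) z)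
            < ennreal (1 / real_of_int a))"
    proof (rule exI[of _ N], rule exI[of _ "1 / 2 ^ (2 * N)"], rule exI[of _ "of_nat T"], rule exI[of _ "T * 4 ^ N"],
        intro conjI allI impI cw T0 LT)
      show "domain_H A B \<subseteq> {0..real_of_rat (of_nat T)} \<times> unit_cube" using domain_subset by (simp add: T_def)
      show "sL2_norm (domain_H A B) (\<lambda>z. u z - interpolate N (real_of_rat (1 / 2 ^ (2 * N))) (T * 4 ^ N)
                 (godunov A B \<mu> Tm (spacetime_field f) (space_field \<phi>) N (real_of_rat (1 / 2 ^ (2 * N)))) z)
            < ennreal (1 / real_of_int a)"
        if "scheme_matrices A B \<mu> Tm" "cauchy_solution A B (spacetime_field f) (space_field \<phi>) u" for \<mu> Tm u
        unfolding \<tau> T_def by (rule godunov_error[OF that a r(1,2) X])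
    qed simp
  qed
qed

end
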